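(* Let $k$ be an infinite Brauer field and let $\underline{d}=(d_1,\ldots,d_r)$ be a multi-degree. There exists a constant $C(\underline{d})$ (depending only on $\underline{d}$ and $k$) such that for every finite-dimensional $k$-vector space $V$ and every tuple $\underline{f}=(f_1,\ldots,f_r)$ with $f_i$ a homogeneous polynomial of degree $d_i$ on $V$ satisfying $\operatorname{str}(\underline{f})>C(\underline{d})$, the set $Z(\underline{f})(k)$ of $k$-points is Zariski dense in $Z(\underline{f})$.
   Context: A field $k$ is a Brauer field if for every $d\ge 1$ there is a number $N_k(d)$ such that every equation $a_1x_1^d+\cdots+a_nx_n^d=0$ with $n>N_k(d)$ and $a_i\in k$ has a non-trivial solution in $k^n$. A multi-degree is a tuple $(d_1,\ldots,d_r)$ of integers with $d_1\ge\cdots\ge d_r\ge 1$. $Z(\underline{f})$ is the closed subvariety of $V$ defined by $f_1=\cdots=f_r=0$. Strength: for a homogeneous polynomial $f$ of degree $d>0$ on $V$ (an element of $\mathrm{Sym}^d(V^* )$), $\operatorname{str}(f)$ is the minimal $s\ge 0$ such that $f=g_1h_1+\cdots+g_sh_s$ with $g_i,h_i$ homogeneous polynomials on $V$ (over $k$) of degrees $<d$; if no such expression exists (only possible when $d=1$) then $\operatorname{str}(f)=\infty$. The strength of a tuple $\underline{f}$ is the minimum of the strengths of all nontrivial $k$-linear combinations of members of $\underline{f}$ having the same degree ($\infty$ for the empty tuple). *)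

theory Defs
  imports Main "HOL-Library.Poly_Mapping" "HOL-Library.Extended_Nat"
begin

text \<open>Polynomials over a field 'k in the variables x_0, x_1, ...:
  a finitely supported map from monomials (exponent vectors) to coefficients.
  A polynomial on V = k^n is one that only involves the variables x_0..x_{n-1}.\<close>

type_synonym 'k mpoly = "(nat \<Rightarrow>\<^sub>0 nat) \<Rightarrow>\<^sub>0 'k"

definition mdeg :: "(nat \<Rightarrow>\<^sub>0 nat) \<Rightarrow> nat" where
  "mdeg m = (\<Sum>i\<in>Poly_Mapping.keys m. Poly_Mapping.lookup m i)"

definition vars_in :: "nat \<Rightarrow> 'k::zero mpoly \<Rightarrow> bool" where
  "vars_in n p \<longleftrightarrow> (\<forall>m\<in>Poly_Mapping.keys p. \<forall>i\<in>Poly_Mapping.keys m. i < n)"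

text \<open>Homogeneous of degree d (the zero polynomial is homogeneous of every degree).\<close>
definition homogeneous :: "nat \<Rightarrow> 'k::zero mpoly \<Rightarrow> bool" where
  "homogeneous d p \<longleftrightarrow> (\<forall>m\<in>Poly_Mapping.keys p. mdeg m = d)"

definition const_mpoly :: "'k::zero \<Rightarrow> 'k mpoly" where
  "const_mpoly c = Poly_Mapping.single 0 c"

definition eval_mpoly :: "'k::comm_ring_1 mpoly \<Rightarrow> (nat \<Rightarrow> 'k) \<Rightarrow> 'k" where
  "eval_mpoly p x = (\<Sum>m\<in>Poly_Mapping.keys p. Poly_Mapping.lookup p m * (\<Prod>i\<in>Poly_Mapping.keys m. x i ^ Poly_Mapping.lookup m i))"

definition brauer_field :: "'k::field itself \<Rightarrow> bool" where
  "brauer_field _ \<longleftrightarrow> (\<forall>d\<ge>1. \<exists>N::nat. \<forall>n>N. \<forall>a::nat \<Rightarrow> 'k.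
      \<exists>x::nat \<Rightarrow> 'k. (\<exists>i<n. x i \<noteq> 0) \<and> (\<Sum>i<n. a i * x i ^ d) = 0)"

definition strength_decomp :: "nat \<Rightarrow> nat \<Rightarrow> 'k::comm_ring_1 mpoly \<Rightarrow> nat \<Rightarrow> bool" where
  "strength_decomp n d f s \<longleftrightarrow>
     (\<exists>(g::nat \<Rightarrow> 'k mpoly) (h::nat \<Rightarrow> 'k mpoly) (a::nat \<Rightarrow> nat) (b::nat \<Rightarrow> nat).
        (\<forall>i<s. a i < d \<and> b i < d \<and> homogeneous (a i) (g i) \<and> homogeneous (b i) (h i)
               \<and> vars_in n (g i) \<and> vars_in n (h i))
        \<and> f = (\<Sum>i<s. g i * h i))"

definition strength :: "nat \<Rightarrow> nat \<Rightarrow> 'k::comm_ring_1 mpoly \<Rightarrow> enat" where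
  "strength n d f = (if \<exists>s. strength_decomp n d f s
                     then enat (LEAST s. strength_decomp n d f s) else \<infinity>)"

definition tuple_strength :: "nat \<Rightarrow> nat list \<Rightarrow> 'k::field mpoly list \<Rightarrow> enat" where
  "tuple_strength n ds fs = Inf {strength n e (\<Sum>i\<in>{i. i < length ds \<and> ds!i = e}. const_mpoly (c i) * fs!i)
      | e c. \<exists>i<length ds. ds!i = e \<and> c i \<noteq> 0}"

definition multi_degree :: "nat list \<Rightarrow> bool" where
  "multi_degree ds \<longleftrightarrow> sorted_wrt (\<ge>) ds \<and> (\<forall>d\<in>set ds. d \<ge> 1)"

definition kpoints :: "nat \<Rightarrow> 'k::field mpoly list \<Rightarrow> (nat \<Rightarrow> 'k) set" where
  "kpoints n fs = {x. (\<forall>i\<ge>n. x i = 0) \<and> (\<forall>f\<in>set fs. eval_mpoly f x = 0)}"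

text \<open>Zariski density of the k-points in the k-variety Z(fs): every polynomial over k vanishing
  on Z(fs)(k) vanishes on Z(fs), i.e. lies in the radical of the ideal (f_1,...,f_r) of k[x_0..x_{n-1}].\<close>
definition kpoints_dense :: "nat \<Rightarrow> 'k::field mpoly list \<Rightarrow> bool" where
  "kpoints_dense n fs \<longleftrightarrow>
     (\<forall>g. vars_in n g \<longrightarrow> (\<forall>x\<in>kpoints n fs. eval_mpoly g x = 0) \<longrightarrow>
        (\<exists>m::nat. \<exists>q::nat \<Rightarrow> 'k mpoly. (\<forall>j<length fs. vars_in n (q j)) \<and>
            g ^ m = (\<Sum>j<length fs. q j * fs!j)))"

end

theory Submission
  imports Defs "HOL-Computational_Algebra.Polynomial" "HOL-Library.Function_Algebras"
begin

text \<open>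
  As \<open>k\<close> is infinite, forms may be treated as functions on \<open>k^n\<close>. Induction on \<open>d\<close> shows: for a sufficiently
  strong tuple of forms of degrees at most \<open>d\<close>, the ideal of every fibre \<open>f = c\<close> is prime and the fibre has Zariski
  dense rational points. The case \<open>c = 0\<close> is the theorem.

  Brauer's method of orthogonal blocks (diagonal equations, and forms of lower degree to annihilate polarizations)
  yields many pairs \<open>(x, w)\<close> along which the tuple is additive and a chosen \<open>f1\<close> of top degree takes the form
  \<open>f1(u + s x + t w) = f1(u) + c s^d + s^(d-1) t\<close>. Adjoin to the tuple few forms of lower degree, keeping it strong,
  that determine the polarizations in the directions \<open>w\<close>. A point of a generic fibre of the larger tuple without
  \<open>f1\<close> can be moved to one where \<open>f1\<close> is affine and nonconstant along some \<open>w'\<close> in the span of the \<open>w\<close>, while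
  nothing else in the tuple changes along \<open>w'\<close>. The equation for \<open>f1\<close> can then be solved linearly, which reduces
  the fibre to one for fewer forms of degree \<open>d\<close>.

  Existence of the blocks requires that the differential \<open>D_w f(x)\<close> of a strong form is strong. If \<open>d\<close> is nonzero
  in \<open>k\<close>, this is Euler's identity. If \<open>char k = p\<close> divides \<open>d\<close>, a weak differential vanishes on the zero set
  of few lower forms \<open>B\<close>; climbing from the span of a frame to the whole space one coordinate at a time gives
  \<open>f = \<Sum>i e_i c_i^p\<close> modulo \<open>(B)^2\<close>, and the sum is finite because the Brauer condition makes \<open>k\<close> finite over
  its \<open>p\<close>-th powers. Hence \<open>f\<close> is not strong.
\<close>

text \<open>Density alone does not pass through the induction. Lowering the number of forms leads
  from the zero fibre to fibres over other values, and a function nonzero modulo one ideal has to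
  stay nonzero modulo the ideal of a generic fibre of the enlarged tuple. Hence all fibres are
  treated at once, together with primality over \<open>k\<close>: any two functions outside the
  ideal are nonzero at a common rational point. Vanishing at the rational points then already means
  membership in the ideal, without radicals or an algebraic closure. Generic fibres are compared
  through top-degree components, where the ideal of every fibre degenerates to the ideal of the
  forms.

  The direction along which \<open>f1\<close> is solved has to be chosen before the point at which
  it is used; the adjoined lower forms take equal values at both points and so force equal slopes.

  Fibres and differentials need one simultaneous induction: \<open>strong_deriv d\<close> rests on
  \<open>dense_fibres\<close> below \<open>d\<close>, and \<open>dense_fibres d\<close> on
  \<open>strong_deriv\<close> up to \<open>d\<close>. Thresholds are functions of the number of
  forms, because regularization alters that number by an amount known only afterwards.\<close>

type_synonym 'k pfun = "(nat \<Rightarrow> 'k) \<Rightarrow> 'k"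

text \<open>The degree is stored with the form, since the zero function is homogeneous of every
  degree. Sets of such pairs can replace tuples because a strong tuple has no repeated entry
  (\<open>strong_family_inj\<close>).\<close>

type_synonym 'k dform = "nat \<times> 'k pfun"

section \<open>Polynomial functions and forms\<close>

lemma sum_apply: "(sum f A) x = (\<Sum>a\<in>A. f a x)"
  by (induction A rule: infinite_finite_induct) auto

lemma power_apply: "((f :: 'a \<Rightarrow> 'b::comm_ring_1) ^ m) x = f x ^ m"
  by (induction m) auto

definition scl :: "'k::field \<Rightarrow> ('a \<Rightarrow> 'k) \<Rightarrow> 'a \<Rightarrow> 'k" where
  "scl c f = (\<lambda>x. c * f x)"

lemma scl_apply [simp]: "scl c f x = c * f x"
  by (simp add: scl_def)

global_interpretation fs: vector_space "scl :: 'k::field \<Rightarrow> ('a \<Rightarrow> 'k) \<Rightarrow> 'a \<Rightarrow> 'k"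
  by unfold_locales (auto simp: fun_eq_iff algebra_simps)

text \<open>Points are functions on all of \<open>nat\<close>, but only the coordinates below
  \<open>n\<close> are seen. The inductive form makes substitution (\<open>polyf_comp\<close>,
  \<open>tpolyf_polyf_comp\<close>) an induction over the rules.\<close>

inductive polyf :: "nat \<Rightarrow> ('k::comm_ring_1) pfun \<Rightarrow> bool" for n where
  polyf_const: "polyf n (\<lambda>v. c)"
| polyf_var: "i < n \<Longrightarrow> polyf n (\<lambda>v. v i)"
| polyf_add: "polyf n f \<Longrightarrow> polyf n g \<Longrightarrow> polyf n (\<lambda>v. f v + g v)"
| polyf_mult: "polyf n f \<Longrightarrow> polyf n g \<Longrightarrow> polyf n (\<lambda>v. f v * g v)"

lemma polyf_plus: "polyf n f \<Longrightarrow> polyf n g \<Longrightarrow> polyf n (f + g)"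
  and polyf_times: "polyf n f \<Longrightarrow> polyf n g \<Longrightarrow> polyf n (f * g)"
  and polyf_0: "polyf n 0"
  and polyf_1: "polyf n 1"
  using polyf_add[of n f g] polyf_mult[of n f g] polyf_const[of n 0] polyf_const[of n 1]
  by (auto simp: plus_fun_def times_fun_def zero_fun_def one_fun_def)

lemma polyf_uminus: "polyf n f \<Longrightarrow> polyf n (\<lambda>v. - f v)"
  using polyf_mult[OF polyf_const[of n "-1"], of f] by simp

lemma polyf_minus: "polyf n f \<Longrightarrow> polyf n g \<Longrightarrow> polyf n (\<lambda>v. f v - g v)"
  using polyf_add[OF _ polyf_uminus, of n f g] by simp

lemma polyf_neg: "polyf n f \<Longrightarrow> polyf n (- f)"
  and polyf_diff: "polyf n f \<Longrightarrow> polyf n g \<Longrightarrow> polyf n (f - g)"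
  using polyf_uminus[of n f] polyf_minus[of n f g] by (auto simp: fun_Compl_def fun_diff_def)

lemma polyf_scl: "polyf n f \<Longrightarrow> polyf n (scl c f)"
  unfolding scl_def by (intro polyf_mult polyf_const)

lemma polyf_sum: "(\<And>a. a \<in> A \<Longrightarrow> polyf n (f a)) \<Longrightarrow> polyf n (\<lambda>v. \<Sum>a\<in>A. f a v)"
  by (induction A rule: infinite_finite_induct) (auto intro: polyf_const polyf_add)

lemma polyf_prod: "(\<And>a. a \<in> A \<Longrightarrow> polyf n (f a)) \<Longrightarrow> polyf n (\<lambda>v. \<Prod>a\<in>A. f a v)"
  by (induction A rule: infinite_finite_induct) (auto intro: polyf_const polyf_mult)

lemma polyf_Sum: "(\<And>a. a \<in> A \<Longrightarrow> polyf n (f a)) \<Longrightarrow> polyf n (\<Sum>a\<in>A. f a)"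
proof -
  assume "\<And>a. a \<in> A \<Longrightarrow> polyf n (f a)"
  moreover have "(\<Sum>a\<in>A. f a) = (\<lambda>v. \<Sum>a\<in>A. f a v)" by (simp add: fun_eq_iff sum_apply)
  ultimately show ?thesis using polyf_sum[of A n f] by simp
qed

lemma polyf_pow: "polyf n f \<Longrightarrow> polyf n (\<lambda>v. f v ^ m)"
  by (induction m) (auto intro: polyf_const polyf_mult)

lemma polyf_power: "polyf n f \<Longrightarrow> polyf n (f ^ m)"
  by (induction m) (auto intro: polyf_1 polyf_times)

lemmas pf_intros = polyf_const polyf_var polyf_add polyf_mult polyf_plus polyf_times polyf_0 polyf_1 polyf_uminus polyf_minus
  polyf_neg polyf_diff polyf_scl polyf_sum polyf_prod polyf_Sum polyf_pow polyf_power

lemma polyf_mono: "polyf m f \<Longrightarrow> m \<le> n \<Longrightarrow> polyf n f"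
  by (induction rule: polyf.induct) (auto intro: polyf.intros)

lemma polyf_comp: "polyf n f \<Longrightarrow> (\<And>i. i < n \<Longrightarrow> polyf m (\<lambda>v. L v i)) \<Longrightarrow> polyf m (\<lambda>v. f (L v))"
  by (induction rule: polyf.induct) (auto intro: polyf.intros)

lemma polyf_cong_coords: "polyf n f \<Longrightarrow> (\<And>i. i < n \<Longrightarrow> v i = w i) \<Longrightarrow> f v = f w"
  by (induction rule: polyf.induct) auto

text \<open>A polynomial in \<open>t\<close> whose coefficients are polynomial functions of
  \<open>v\<close>. The degree bound is uniform in \<open>v\<close>, so that the expansion in powers
  of \<open>t\<close> is one finite sum valid for all \<open>v\<close>.\<close>

definition tpolyf :: "nat \<Rightarrow> ((nat \<Rightarrow> 'k::comm_ring_1) \<Rightarrow> 'k \<Rightarrow> 'k) \<Rightarrow> bool" where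
  "tpolyf m F \<longleftrightarrow> (\<exists>P D. (\<forall>j. polyf m (\<lambda>v. coeff (P v) j)) \<and> (\<forall>v. degree (P v) \<le> D) \<and> (\<forall>v t. F v t = poly (P v) t))"

lemma tpolyf_base: "polyf m g \<Longrightarrow> tpolyf m (\<lambda>v t. g v)"
proof -
  assume g: "polyf m g"
  have "polyf m (\<lambda>v. coeff [:g v:] j)" for j
    by (cases j) (use g in \<open>auto intro: polyf_const\<close>)
  then show ?thesis unfolding tpolyf_def
    by (intro exI[of _ "\<lambda>v. [:g v:]"] exI[of _ 0]) auto
qed

lemma tpolyf_t: "tpolyf m (\<lambda>v t. t)"
  unfolding tpolyf_def
  by (rule exI[of _ "\<lambda>v. [:0, 1:]"], rule exI[of _ 1])
     (auto simp: coeff_pCons split: nat.splits intro: polyf_const)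

lemma tpolyf_add: assumes "tpolyf m F" "tpolyf m G" shows "tpolyf m (\<lambda>v t. F v t + G v t)"
proof -
  from assms obtain P D Q E where P: "\<And>j. polyf m (\<lambda>v. coeff (P v) j)" "\<And>v. degree (P v) \<le> D" "\<And>v t. F v t = poly (P v) t"
    and Q: "\<And>j. polyf m (\<lambda>v. coeff (Q v) j)" "\<And>v. degree (Q v) \<le> E" "\<And>v t. G v t = poly (Q v) t"
    unfolding tpolyf_def by metis
  show ?thesis unfolding tpolyf_def
    by (rule exI[of _ "\<lambda>v. P v + Q v"], rule exI[of _ "max D E"])
       (use P Q in \<open>auto intro!: polyf_add degree_add_le intro: order.trans[OF _ max.cobounded1] order.trans[OF _ max.cobounded2]\<close>)
qed

lemma tpolyf_mult: assumes "tpolyf m F" "tpolyf m G" shows "tpolyf m (\<lambda>v t. F v t * G v t)"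
proof -
  from assms obtain P D Q E where P: "\<And>j. polyf m (\<lambda>v. coeff (P v) j)" "\<And>v. degree (P v) \<le> D" "\<And>v t. F v t = poly (P v) t"
    and Q: "\<And>j. polyf m (\<lambda>v. coeff (Q v) j)" "\<And>v. degree (Q v) \<le> E" "\<And>v t. G v t = poly (Q v) t"
    unfolding tpolyf_def by metis
  have "degree (P v * Q v) \<le> D + E" for v
    by (rule order.trans[OF degree_mult_le]) (use P(2) Q(2) in \<open>auto intro: add_mono\<close>)
  then show ?thesis unfolding tpolyf_def
    by (intro exI[of _ "\<lambda>v. P v * Q v"] exI[of _ "D + E"])
       (use P Q in \<open>auto intro!: polyf_sum polyf_mult simp: coeff_mult\<close>)
qed

lemma tpolyf_polyf_comp: "polyf n f \<Longrightarrow> (\<And>i. i < n \<Longrightarrow> tpolyf m (\<lambda>v t. L v t i)) \<Longrightarrow> tpolyf m (\<lambda>v t. f (L v t))"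
  by (induction rule: polyf.induct) (auto intro: tpolyf_base polyf_const tpolyf_add tpolyf_mult)

text \<open>Only meaningful when \<open>F\<close> is given by a polynomial, which is then unique since the field is infinite.\<close>

definition tcoeff :: "('k::field \<Rightarrow> 'k) \<Rightarrow> nat \<Rightarrow> 'k" where
  "tcoeff F j = coeff (THE p. \<forall>t. poly p t = F t) j"

definition hcomp :: "nat \<Rightarrow> ('k::field) pfun \<Rightarrow> (nat \<Rightarrow> 'k) \<Rightarrow> 'k" where
  "hcomp j f = (\<lambda>v. tcoeff (\<lambda>t. f (scl t v)) j)"

text \<open>The Hasse derivative of order \<open>j\<close> in direction \<open>u\<close>. The
  coefficient of \<open>t^j\<close> carries no factor \<open>j!\<close>, so nothing is lost in
  positive characteristic.\<close>

definition hder :: "(nat \<Rightarrow> 'k::field) \<Rightarrow> nat \<Rightarrow> 'k pfun \<Rightarrow> (nat \<Rightarrow> 'k) \<Rightarrow> 'k" where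
  "hder u j f = (\<lambda>v. tcoeff (\<lambda>t. f (v + scl t u)) j)"

definition form :: "nat \<Rightarrow> nat \<Rightarrow> ('k::field) pfun \<Rightarrow> bool" where
  "form n d f \<longleftrightarrow> polyf n f \<and> (\<forall>c v. f (scl c v) = c ^ d * f v)"

lemma form_polyf: "form n d f \<Longrightarrow> polyf n f"
  by (simp add: form_def)

lemma form_scl: "form n d f \<Longrightarrow> f (scl c v) = c ^ d * f v"
  by (simp add: form_def)

section \<open>Homogeneous components and Hasse derivatives over an infinite field\<close>

locale infinite_field =
  fixes K :: "'k::field itself"
  assumes inf: "infinite (UNIV :: 'k set)"
begin

lemma poly_eq_by_values: "(\<And>t. poly p t = poly q t) \<Longrightarrow> p = (q :: 'k poly)"
proof -
  assume a: "\<And>t. poly p t = poly q t"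
  have "poly (p - q) t = 0" for t using a by simp
  then have "{t. poly (p - q) t = 0} = UNIV" by auto
  then have "p - q = 0" using poly_roots_finite[of "p - q"] inf by auto
  then show ?thesis by simp
qed

lemma poly_nonzero_avoid:
  assumes "(p :: 'k poly) \<noteq> 0" "finite A" shows "\<exists>t. t \<notin> A \<and> poly p t \<noteq> 0"
proof -
  have "finite ({t. poly p t = 0} \<union> A)" using assms poly_roots_finite by auto
  then obtain t where "t \<notin> {t. poly p t = 0} \<union> A" using inf ex_new_if_finite by blast
  then show ?thesis by auto
qed

lemma tcoeff_poly: "(\<And>t. F t = poly p t) \<Longrightarrow> tcoeff F j = coeff (p::'k poly) j"
proof -
  assume a: "\<And>t. F t = poly p t"
  have "(THE q. \<forall>t. poly q t = F t) = p"
    by (rule the_equality) (use a poly_eq_by_values in auto)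
  then show ?thesis by (simp add: tcoeff_def)
qed

lemma tcoeff_sum: assumes "\<And>t. F t = (\<Sum>j\<le>D. c j * t ^ j)" shows "tcoeff F j = (if j \<le> D then c j else (0::'k))"
proof -
  have "F t = poly (\<Sum>j\<le>D. monom (c j) j) t" for t
    by (simp add: assms poly_sum poly_monom)
  from tcoeff_poly[OF this] show ?thesis by (simp add: coeff_sum)
qed

lemma tpolyf_tcoeff: assumes "tpolyf m (F :: _ \<Rightarrow> 'k \<Rightarrow> 'k)"
  shows "polyf m (\<lambda>v. tcoeff (F v) j)"
    and "\<exists>D. (\<forall>v t. F v t = (\<Sum>j\<le>D. tcoeff (F v) j * t ^ j)) \<and> (\<forall>j>D. \<forall>v. tcoeff (F v) j = 0)"
proof -
  from assms obtain P D where P: "\<And>j. polyf m (\<lambda>v. coeff (P v) j)" "\<And>v. degree (P v) \<le> D" "\<And>v t. F v t = poly (P v) t"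
    unfolding tpolyf_def by metis
  have c: "tcoeff (F v) j = coeff (P v) j" for v j
    by (rule tcoeff_poly) (rule P(3))
  show "polyf m (\<lambda>v. tcoeff (F v) j)" by (simp add: c P(1))
  have "F v t = (\<Sum>j\<le>D. tcoeff (F v) j * t ^ j)" for v t
  proof -
    have "F v t = (\<Sum>j\<le>degree (P v). coeff (P v) j * t ^ j)" by (simp add: P(3) poly_altdef)
    also have "\<dots> = (\<Sum>j\<le>D. coeff (P v) j * t ^ j)"
      by (rule sum.mono_neutral_left) (use P(2) in \<open>auto simp: coeff_eq_0\<close>)
    finally show ?thesis by (simp add: c)
  qed
  moreover have "tcoeff (F v) j = 0" if "j > D" for v j
    using P(2)[of v] that by (simp add: c coeff_eq_0)
  ultimately show "\<exists>D. (\<forall>v t. F v t = (\<Sum>j\<le>D. tcoeff (F v) j * t ^ j)) \<and> (\<forall>j>D. \<forall>v. tcoeff (F v) j = 0)"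
    by blast
qed

lemma tpolyf_scl: "polyf n f \<Longrightarrow> tpolyf n (\<lambda>v t. f (scl t v))"
  by (rule tpolyf_polyf_comp) (auto intro!: tpolyf_mult tpolyf_t tpolyf_base polyf_var)

lemma polyf_hcomp: "polyf n f \<Longrightarrow> polyf n (hcomp j (f :: _ \<Rightarrow> 'k))"
  unfolding hcomp_def by (intro tpolyf_tcoeff(1) tpolyf_scl)

lemma hcomp_form: assumes "polyf n f" shows "form n j (hcomp j (f :: _ \<Rightarrow> 'k))"
proof -
  obtain D where D: "\<And>v t. f (scl t v) = (\<Sum>j\<le>D. hcomp j f v * t ^ j)" "\<And>j v. j > D \<Longrightarrow> hcomp j f v = 0"
    using tpolyf_tcoeff(2)[OF tpolyf_scl[OF assms]] unfolding hcomp_def by blast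
  have "hcomp j f (scl c v) = c ^ j * hcomp j f v" for c v
  proof -
    have "f (scl t (scl c v)) = (\<Sum>j\<le>D. (c ^ j * hcomp j f v) * t ^ j)" for t
    proof -
      have "scl t (scl c v) = scl (t * c) v" by auto
      then show ?thesis by (simp add: D(1) power_mult_distrib algebra_simps)
    qed
    from tcoeff_sum[OF this] have "hcomp j f (scl c v) = (if j \<le> D then c ^ j * hcomp j f v else 0)"
      unfolding hcomp_def .
    then show ?thesis using D(2)[of j v] by (cases "j \<le> D") auto
  qed
  then show ?thesis using polyf_hcomp[OF assms] by (simp add: form_def)
qed

lemma hcomp_expand: assumes "polyf n (f :: _ \<Rightarrow> 'k)"
  shows "\<exists>D. (\<forall>t v. f (scl t v) = (\<Sum>j\<le>D. hcomp j f v * t ^ j)) \<and> f = (\<Sum>j\<le>D. hcomp j f) \<and> (\<forall>j>D. hcomp j f = 0)"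
proof -
  obtain D where D: "\<And>v t. f (scl t v) = (\<Sum>j\<le>D. hcomp j f v * t ^ j)" "\<And>j v. j > D \<Longrightarrow> hcomp j f v = 0"
    using tpolyf_tcoeff(2)[OF tpolyf_scl[OF assms]] unfolding hcomp_def by blast
  have "f v = (\<Sum>j\<le>D. hcomp j f v)" for v
  proof -
    have "scl 1 v = v" by auto
    then show ?thesis using D(1)[of 1 v] by simp
  qed
  then show ?thesis using D by (intro exI[of _ D]) (auto simp: fun_eq_iff sum_apply)
qed

lemma hcomp_of_form: assumes "form n d (f :: _ \<Rightarrow> 'k)" shows "hcomp j f = (if j = d then f else 0)"
proof -
  have "f (scl t v) = poly (monom (f v) d) t" for t v
    using assms by (simp add: form_def poly_monom)
  then have "hcomp j f v = coeff (monom (f v) d) j" for v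
    unfolding hcomp_def by (rule tcoeff_poly)
  then show ?thesis by (auto simp: fun_eq_iff)
qed

lemma poly_rep: "polyf n (f :: _ \<Rightarrow> 'k) \<Longrightarrow> \<exists>p. \<forall>t. f (scl t v) = poly p t"
  using tpolyf_scl[of n f] unfolding tpolyf_def by metis

lemma hcomp_add: assumes "polyf n f" "polyf n g" shows "hcomp j (f + g) = hcomp j f + hcomp j (g :: _ \<Rightarrow> 'k)"
proof
  fix v
  obtain p q where p: "\<And>t. f (scl t v) = poly p t" and q: "\<And>t. g (scl t v) = poly q t"
    using poly_rep assms by metis
  have "(f + g) (scl t v) = poly (p + q) t" for t by (simp add: p q)
  then have "hcomp j (f + g) v = coeff (p + q) j" unfolding hcomp_def by (rule tcoeff_poly)
  moreover have "hcomp j f v = coeff p j" unfolding hcomp_def by (rule tcoeff_poly) (rule p)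
  moreover have "hcomp j g v = coeff q j" unfolding hcomp_def by (rule tcoeff_poly) (rule q)
  ultimately show "hcomp j (f + g) v = (hcomp j f + hcomp j g) v" by simp
qed

lemma hcomp_0: "hcomp j (0 :: _ \<Rightarrow> 'k) = 0"
  using hcomp_of_form[of 0 0 0 j] polyf_0[of 0] by (auto simp: form_def)

lemma hcomp_sum: "(\<And>a. a \<in> A \<Longrightarrow> polyf n (f a)) \<Longrightarrow> hcomp j (\<Sum>a\<in>A. f a) = (\<Sum>a\<in>A. hcomp j (f a :: _ \<Rightarrow> 'k))"
  by (induction A rule: infinite_finite_induct) (auto simp: hcomp_0 hcomp_add[of n] polyf_Sum)

lemma hcomp_mult_form: assumes "polyf n f" "form n e g"
  shows "hcomp j (f * g) = (if e \<le> j then hcomp (j - e) f * g else (0 :: _ \<Rightarrow> 'k))"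
proof
  fix v
  obtain p where p: "\<And>t. f (scl t v) = poly p t"
    using poly_rep assms by metis
  have "(f * g) (scl t v) = poly (p * monom (g v) e) t" for t
    using assms(2) by (simp add: p form_def poly_monom)
  then have "hcomp j (f * g) v = coeff (p * monom (g v) e) j" unfolding hcomp_def by (rule tcoeff_poly)
  moreover have "hcomp i f v = coeff p i" for i unfolding hcomp_def by (rule tcoeff_poly) (rule p)
  ultimately show "hcomp j (f * g) v = (if e \<le> j then hcomp (j - e) f * g else 0) v"
    by (simp add: mult.commute[of p] coeff_monom_mult)
qed

lemma hcomp_neg: "polyf n f \<Longrightarrow> hcomp j (- f) = - hcomp j (f :: _ \<Rightarrow> 'k)"
  using hcomp_add[of n f "- f" j] polyf_neg[of n f] by (simp add: hcomp_0 eq_neg_iff_add_eq_0 add.commute)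

lemma hcomp_diff: "polyf n f \<Longrightarrow> polyf n g \<Longrightarrow> hcomp j (f - g) = hcomp j f - hcomp j (g :: _ \<Rightarrow> 'k)"
  using hcomp_add[of n f "- g" j] hcomp_neg[of n g j] polyf_neg[of n g] by simp

lemma form_0: "form n d (0 :: _ \<Rightarrow> 'k)"
  by (simp add: form_def polyf_0)

lemma form_add: "form n d f \<Longrightarrow> form n d g \<Longrightarrow> form n d (f + (g :: _ \<Rightarrow> 'k))"
  by (auto simp: form_def polyf_plus algebra_simps)

lemma form_cmul: "form n d f \<Longrightarrow> form n d (scl c (f :: _ \<Rightarrow> 'k))"
  by (auto simp: form_def polyf_scl algebra_simps)

lemma form_sum: "(\<And>a. a \<in> A \<Longrightarrow> form n d (f a)) \<Longrightarrow> form n d (\<Sum>a\<in>A. (f a :: _ \<Rightarrow> 'k))"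
  by (induction A rule: infinite_finite_induct) (auto intro: form_0 form_add)

lemma form_mult: "form n d f \<Longrightarrow> form n e g \<Longrightarrow> form n (d + e) (f * (g :: _ \<Rightarrow> 'k))"
  by (auto simp: form_def polyf_times power_add algebra_simps)

lemma form_power: "form n d f \<Longrightarrow> form n (d * m) ((f :: _ \<Rightarrow> 'k) ^ m)"
  by (auto simp: form_def polyf_power power_apply power_mult_distrib power_mult)

lemma form_at_0: "form n d f \<Longrightarrow> d > 0 \<Longrightarrow> f (0 :: nat \<Rightarrow> 'k) = 0"
proof -
  assume a: "form n d f" "d > 0"
  have "scl 0 (0 :: nat \<Rightarrow> 'k) = 0" by auto
  then show ?thesis using form_scl[OF a(1), of 0 0] a(2) by (simp add: power_0_left)
qed

lemma form_deg0: "form n 0 f \<Longrightarrow> f v = f (0 :: nat \<Rightarrow> 'k)"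
proof -
  assume a: "form n 0 f"
  have "scl 0 v = (0 :: nat \<Rightarrow> 'k)" by auto
  then show ?thesis using form_scl[OF a, of 0 v] by simp
qed

text \<open>Restricted to the line through a nonzero of \<open>f\<close> and a nonzero of
  \<open>g\<close>, both become nonzero polynomials in one variable, and their product has a
  non-root. This is density and primality for the whole affine space, the start of all
  inductions.\<close>

lemma polyf_eq_0_near: assumes "polyf n f" "polyf n g" "f \<noteq> (0 :: _ \<Rightarrow> 'k)" "g \<noteq> 0" shows "\<exists>v. f v \<noteq> 0 \<and> g v \<noteq> 0"
proof -
  from assms(3,4) obtain a b where ab: "f a \<noteq> 0" "g b \<noteq> 0" by (auto simp: fun_eq_iff)
  define L where "L t = a + scl t (b - a)" for t
  have *: "\<exists>p. \<forall>t. h (L t) = poly p t" if "polyf n h" for h :: "'k pfun"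
  proof -
    have "tpolyf n (\<lambda>(v :: nat \<Rightarrow> 'k) t. h (L t))"
      by (rule tpolyf_polyf_comp[OF that]) (auto simp: L_def intro!: tpolyf_add tpolyf_mult tpolyf_t tpolyf_base polyf_const)
    then show ?thesis unfolding tpolyf_def by metis
  qed
  obtain p q where p: "\<And>t. f (L t) = poly p t" and q: "\<And>t. g (L t) = poly q t"
    using * assms by metis
  have "L 0 = a" "L 1 = b" by (auto simp: L_def)
  then have "p \<noteq> 0" "q \<noteq> 0" using p[of 0] q[of 1] ab by auto
  then have "p * q \<noteq> 0" by simp
  then obtain t where "poly (p * q) t \<noteq> 0" using poly_nonzero_avoid[of "p * q" "{}"] by auto
  then have "f (L t) \<noteq> 0 \<and> g (L t) \<noteq> 0" using p[of t] q[of t] by auto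
  then show ?thesis by blast
qed

lemma tpolyf_line: "polyf n f \<Longrightarrow> tpolyf n (\<lambda>v t. f (v + scl t u))"
  by (rule tpolyf_polyf_comp) (auto intro!: tpolyf_add tpolyf_mult tpolyf_t tpolyf_base polyf_var polyf_const)

lemma polyf_hder: "polyf n f \<Longrightarrow> polyf n (hder u j (f :: _ \<Rightarrow> 'k))"
  unfolding hder_def by (intro tpolyf_tcoeff(1) tpolyf_line)

lemma hder_expand0: assumes "polyf n (f :: _ \<Rightarrow> 'k)"
  shows "\<exists>D. (\<forall>t v. f (v + scl t u) = (\<Sum>j\<le>D. hder u j f v * t ^ j)) \<and> (\<forall>j>D. hder u j f = 0)"
proof -
  from tpolyf_tcoeff(2)[OF tpolyf_line[OF assms, of u]] obtain D where
    D: "\<And>v t. f (v + scl t u) = (\<Sum>j\<le>D. hder u j f v * t ^ j)" "\<And>j v. j > D \<Longrightarrow> hder u j f v = 0"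
    unfolding hder_def by blast
  show ?thesis using D(1) D(2) by (intro exI[of _ D]) (auto simp: fun_eq_iff)
qed

lemma hder_hom: assumes "form n d (f :: _ \<Rightarrow> 'k)"
  shows "hder (scl c u) j f (scl c v) = c ^ d * hder u j f v"
proof -
  obtain D where D: "\<And>t v. f (v + scl t u) = (\<Sum>j\<le>D. hder u j f v * t ^ j)" "\<And>j. j > D \<Longrightarrow> hder u j f = 0"
    using hder_expand0[OF form_polyf[OF assms], of u] by auto
  have "f (scl c v + scl t (scl c u)) = (\<Sum>j\<le>D. (c ^ d * hder u j f v) * t ^ j)" for t
  proof -
    have "scl c v + scl t (scl c u) = scl c (v + scl t u)" by (auto simp: algebra_simps)
    then have "f (scl c v + scl t (scl c u)) = c ^ d * f (v + scl t u)" using form_scl[OF assms] by simp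
    then show ?thesis by (simp add: D(1) sum_distrib_left algebra_simps)
  qed
  from tcoeff_sum[OF this, of j] have "hder (scl c u) j f (scl c v) = (if j \<le> D then c ^ d * hder u j f v else 0)"
    unfolding hder_def .
  then show ?thesis using D(2)[of j] by (cases "j \<le> D") auto
qed

lemma hder_scale_dir: assumes "polyf n (f :: _ \<Rightarrow> 'k)"
  shows "hder (scl c u) j f v = c ^ j * hder u j f v"
proof -
  obtain D where D: "\<And>t v. f (v + scl t u) = (\<Sum>j\<le>D. hder u j f v * t ^ j)" "\<And>j. j > D \<Longrightarrow> hder u j f = 0"
    using hder_expand0[OF assms, of u] by auto
  have "f (v + scl t (scl c u)) = (\<Sum>j\<le>D. (c ^ j * hder u j f v) * t ^ j)" for t
  proof -
    have "v + scl t (scl c u) = v + scl (t * c) u" by (auto simp: algebra_simps)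
    then show ?thesis by (simp add: D(1) power_mult_distrib algebra_simps)
  qed
  from tcoeff_sum[OF this, of j] have "hder (scl c u) j f v = (if j \<le> D then c ^ j * hder u j f v else 0)"
    unfolding hder_def .
  then show ?thesis using D(2)[of j] by (cases "j \<le> D") auto
qed

text \<open>Scaling point and direction together multiplies by \<open>c^d\<close>, scaling the
  direction alone by \<open>c^j\<close>. For \<open>c\<close> nonzero this gives the degree
  \<open>d - j\<close>; the case \<open>c = 0\<close> follows by comparing polynomials in
  \<open>c\<close> that agree off \<open>0\<close>.\<close>

lemma hder_form: assumes "form n d (f :: _ \<Rightarrow> 'k)"
  shows "j \<le> d \<Longrightarrow> form n (d - j) (hder u j f)" and "j > d \<Longrightarrow> hder u j f = 0"
proof -
  have eq: "c ^ j * hder u j f (scl c v) = c ^ d * hder u j f v" for c v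
    using hder_hom[OF assms, of c u j v] hder_scale_dir[OF form_polyf[OF assms], of c u j "scl c v"] by simp
  have polyf: "polyf n (hder u j f)" using assms by (intro polyf_hder form_polyf)
  {
    assume j: "j \<le> d"
    have nz: "hder u j f (scl c v) = c ^ (d - j) * hder u j f v" if "c \<noteq> 0" for c v
    proof -
      have "c ^ j * hder u j f (scl c v) = c ^ j * (c ^ (d - j) * hder u j f v)"
        using eq[of c v] j by (simp add: power_add[symmetric] mult.assoc[symmetric])
      then show ?thesis using that by simp
    qed
    have P: "hder u j f (scl c v) = c ^ (d - j) * hder u j f v" for c v
    proof -
      obtain p where p: "\<And>t. hder u j f (scl t v) = poly p t" using poly_rep[OF polyf] by metis
      define q where "q = p - monom (hder u j f v) (d - j)"
      have "poly q t = 0" if "t \<noteq> 0" for t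
        using that p[of t] nz[of t v] by (simp add: q_def poly_monom mult.commute)
      then have "q = 0" using poly_nonzero_avoid[of q "{0}"] by auto
      then show ?thesis using p[of c] by (simp add: q_def poly_monom mult.commute)
    qed
    then show "form n (d - j) (hder u j f)" using polyf by (simp add: form_def)
  }
  {
    assume j: "j > d"
    have "hder u j f v = 0" for v
    proof -
      obtain p where p: "\<And>t. hder u j f (scl t v) = poly p t" using poly_rep[OF polyf] by metis
      \<comment> \<open>For \<open>j > d\<close> the scaling relation says that
        \<open>t^(j-d) * p(t)\<close> equals a constant for all nonzero \<open>t\<close>, hence as
        polynomials; at \<open>t = 0\<close> the constant is seen to be \<open>0\<close>.\<close>
      define q where "q = monom 1 (j - d) * p - [:hder u j f v:]"
      have "poly q t = 0" if "t \<noteq> 0" for t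
      proof -
        have "t ^ d * (t ^ (j - d) * hder u j f (scl t v)) = t ^ d * hder u j f v"
          using eq[of t v] j by (simp add: power_add[symmetric] mult.assoc[symmetric])
        then show ?thesis using that p[of t] by (simp add: q_def poly_monom)
      qed
      then have "q = 0" using poly_nonzero_avoid[of q "{0}"] by auto
      then have "poly q 0 = 0" by simp
      then show ?thesis using j by (simp add: q_def poly_monom power_0_left)
    qed
    then show "hder u j f = 0" by auto
  }
qed

lemma hder_expand: assumes "form n d (f :: _ \<Rightarrow> 'k)"
  shows "f (v + scl t u) = (\<Sum>j\<le>d. hder u j f v * t ^ j)"
proof -
  obtain D where D: "\<And>t v. f (v + scl t u) = (\<Sum>j\<le>D. hder u j f v * t ^ j)" "\<And>j. j > D \<Longrightarrow> hder u j f = 0"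
    using hder_expand0[OF form_polyf[OF assms], of u] by auto
  have "(\<Sum>j\<le>D. hder u j f v * t ^ j) = (\<Sum>j\<le>max D d. hder u j f v * t ^ j)"
    by (rule sum.mono_neutral_left) (auto simp: D(2))
  also have "\<dots> = (\<Sum>j\<le>d. hder u j f v * t ^ j)"
    by (rule sum.mono_neutral_right) (auto simp: hder_form(2)[OF assms])
  finally show ?thesis by (simp add: D(1))
qed

lemma hder_0: assumes "polyf n (f :: _ \<Rightarrow> 'k)" shows "hder u 0 f = f"
proof
  fix v
  obtain D where D: "\<And>t v. f (v + scl t u) = (\<Sum>j\<le>D. hder u j f v * t ^ j)"
    using hder_expand0[OF assms, of u] by auto
  have "v + scl 0 u = v" by auto
  moreover have "(\<Sum>j\<le>D. hder u j f v * 0 ^ j) = hder u 0 f v"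
    by (simp add: power_0_left if_distrib[where f = "\<lambda>x. _ * x"] cong: if_cong)
  ultimately show "hder u 0 f v = f v" using D[of v 0] by simp
qed

end

section \<open>Ideals and strength\<close>

text \<open>The map goes from \<open>m\<close> to \<open>n\<close> variables. Coordinates from
  \<open>n\<close> on are left open, as polynomial functions in \<open>n\<close> variables do not
  see them.\<close>

definition linmap :: "nat \<Rightarrow> nat \<Rightarrow> ((nat \<Rightarrow> 'k::field) \<Rightarrow> nat \<Rightarrow> 'k) \<Rightarrow> bool" where
  "linmap n m L \<longleftrightarrow> (\<forall>i<n. form m 1 (\<lambda>z. L z i))"

definition ideal :: "nat \<Rightarrow> 'i set \<Rightarrow> ('i \<Rightarrow> (nat \<Rightarrow> 'k::field) \<Rightarrow> 'k) \<Rightarrow> 'k pfun set" where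
  "ideal n I g = {f. \<exists>q. (\<forall>i\<in>I. polyf n (q i)) \<and> f = (\<Sum>i\<in>I. q i * g i)}"

text \<open>Strength at most \<open>C\<close>, with the two factors of each product of positive and
  complementary degrees. In degree 1 no such product exists, so only \<open>0\<close> is
  low.\<close>

definition low :: "nat \<Rightarrow> nat \<Rightarrow> nat \<Rightarrow> ('k::field) pfun \<Rightarrow> bool" where
  "low n C e f \<longleftrightarrow> (\<exists>s g h a. s \<le> C \<and>
     (\<forall>i<s. 1 \<le> a i \<and> a i < e \<and> form n (a i) (g i) \<and> form n (e - a i) (h i)) \<and> f = (\<Sum>i<(s::nat). g i * h i))"

definition form_set :: "nat \<Rightarrow> nat \<Rightarrow> ('k::field) dform set \<Rightarrow> bool" where
  "form_set n d S \<longleftrightarrow> finite S \<and> (\<forall>x\<in>S. 1 \<le> fst x \<and> fst x \<le> d \<and> form n (fst x) (snd x))"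

text \<open>The strength of the tuple exceeds \<open>C\<close>, measured by
  \<open>low\<close>.\<close>

definition strong :: "nat \<Rightarrow> nat \<Rightarrow> ('k::field) dform set \<Rightarrow> bool" where
  "strong n C S \<longleftrightarrow> (\<forall>e u. (\<exists>x\<in>S. fst x = e \<and> u x \<noteq> 0) \<longrightarrow>
     \<not> low n C e (\<Sum>x\<in>{x\<in>S. fst x = e}. scl (u x) (snd x)))"

definition fibre_eq :: "(('k::field) dform \<Rightarrow> 'k) \<Rightarrow> 'k dform \<Rightarrow> (nat \<Rightarrow> 'k) \<Rightarrow> 'k" where
  "fibre_eq c x = (\<lambda>v. snd x v - c x)"

text \<open>The zero set of the \<open>g i\<close> has Zariski dense rational points, and its ideal is prime.\<close>

definition dense_prime :: "nat \<Rightarrow> 'i set \<Rightarrow> ('i \<Rightarrow> (nat \<Rightarrow> 'k::field) \<Rightarrow> 'k) \<Rightarrow> bool" where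
  "dense_prime n I g \<longleftrightarrow> (\<forall>a b. polyf n a \<longrightarrow> polyf n b \<longrightarrow> a \<notin> ideal n I g \<longrightarrow> b \<notin> ideal n I g \<longrightarrow>
     (\<exists>z. (\<forall>i\<in>I. g i z = 0) \<and> a z \<noteq> 0 \<and> b z \<noteq> 0))"

lemma ideal_zero: "0 \<in> ideal n I g"
  unfolding ideal_def by (auto intro!: exI[of _ "\<lambda>_. 0"] polyf_0)

lemma ideal_add: "f \<in> ideal n I g \<Longrightarrow> h \<in> ideal n I g \<Longrightarrow> f + h \<in> ideal n I g"
proof -
  assume "f \<in> ideal n I g" "h \<in> ideal n I g"
  then obtain q r where "\<forall>i\<in>I. polyf n (q i)" "f = (\<Sum>i\<in>I. q i * g i)" "\<forall>i\<in>I. polyf n (r i)" "h = (\<Sum>i\<in>I. r i * g i)"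
    unfolding ideal_def by blast
  then show ?thesis unfolding ideal_def
    by (auto intro!: exI[of _ "\<lambda>i. q i + r i"] polyf_plus simp: distrib_right sum.distrib)
qed

lemma ideal_mult: "polyf n h \<Longrightarrow> f \<in> ideal n I g \<Longrightarrow> h * f \<in> ideal n I g"
proof -
  assume h: "polyf n h" and "f \<in> ideal n I g"
  then obtain q where "\<forall>i\<in>I. polyf n (q i)" "f = (\<Sum>i\<in>I. q i * g i)"
    unfolding ideal_def by blast
  then show ?thesis unfolding ideal_def using h
    by (auto intro!: exI[of _ "\<lambda>i. h * q i"] polyf_times simp: sum_distrib_left mult.assoc)
qed

lemma ideal_mult2: "polyf n h \<Longrightarrow> f \<in> ideal n I g \<Longrightarrow> f * h \<in> ideal n I g"
  using ideal_mult[of n h f I g] by (simp add: mult.commute)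

lemma ideal_neg: "f \<in> ideal n I g \<Longrightarrow> - f \<in> ideal n I g"
  using ideal_mult[OF polyf_neg[OF polyf_1], of f n I g] by simp

lemma ideal_diff: "f \<in> ideal n I g \<Longrightarrow> h \<in> ideal n I g \<Longrightarrow> f - h \<in> ideal n I g"
  using ideal_add[OF _ ideal_neg, of f n I g h] by simp

lemma ideal_scl: "f \<in> ideal n I g \<Longrightarrow> scl c f \<in> ideal n I g"
proof -
  assume "f \<in> ideal n I g"
  moreover have "scl c f = (\<lambda>_. c) * f" by (simp add: fun_eq_iff)
  ultimately show ?thesis using ideal_mult[OF polyf_const, of f n I g c] by simp
qed

lemma ideal_sum: "(\<And>a. a \<in> A \<Longrightarrow> f a \<in> ideal n I g) \<Longrightarrow> (\<Sum>a\<in>A. f a) \<in> ideal n I g"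
  by (induction A rule: infinite_finite_induct) (auto intro: ideal_zero ideal_add)

lemma ideal_fibre_eq: "finite I \<Longrightarrow> i \<in> I \<Longrightarrow> g i \<in> ideal n I g"
  unfolding ideal_def
  by (auto intro!: exI[of _ "\<lambda>j. if j = i then 1 else 0"] polyf_1 polyf_0 simp: if_distrib[where f = "\<lambda>x. x * _"] cong: if_cong)

lemma ideal_subset: assumes "\<And>i. i \<in> I \<Longrightarrow> g i \<in> ideal n J h" shows "ideal n I g \<subseteq> ideal n J h"
proof
  fix f assume "f \<in> ideal n I g"
  then obtain q where "\<forall>i\<in>I. polyf n (q i)" "f = (\<Sum>i\<in>I. q i * g i)" unfolding ideal_def by blast
  then show "f \<in> ideal n J h" using assms by (auto intro!: ideal_sum ideal_mult)
qed

lemma ideal_mono: "finite J \<Longrightarrow> I \<subseteq> J \<Longrightarrow> ideal n I g \<subseteq> ideal n J g"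
  by (rule ideal_subset) (auto intro: ideal_fibre_eq)

lemma ideal_vanish: "f \<in> ideal n I g \<Longrightarrow> (\<And>i. i \<in> I \<Longrightarrow> g i z = 0) \<Longrightarrow> f z = 0"
  unfolding ideal_def by (auto simp: sum_apply)

lemma ideal_polyf: "f \<in> ideal n I g \<Longrightarrow> (\<And>i. i \<in> I \<Longrightarrow> polyf n (g i)) \<Longrightarrow> polyf n f"
  unfolding ideal_def by (auto intro!: polyf_Sum polyf_times)

lemma ideal_cong: "(\<And>i. i \<in> I \<Longrightarrow> g i = h i) \<Longrightarrow> ideal n I g = ideal n I h"
  unfolding ideal_def by (simp cong: sum.cong)

lemma ideal_insert: assumes "finite I" "j \<notin> I"
  shows "f \<in> ideal n (insert j I) g \<longleftrightarrow> (\<exists>h q. h \<in> ideal n I g \<and> polyf n q \<and> f = h + q * g j)"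
proof
  assume "f \<in> ideal n (insert j I) g"
  then obtain q where "\<forall>i\<in>insert j I. polyf n (q i)" "f = (\<Sum>i\<in>insert j I. q i * g i)" unfolding ideal_def by blast
  then show "\<exists>h q. h \<in> ideal n I g \<and> polyf n q \<and> f = h + q * g j"
    using assms by (intro exI[of _ "\<Sum>i\<in>I. q i * g i"] exI[of _ "q j"]) (auto simp: ideal_def add.commute)
next
  assume "\<exists>h q. h \<in> ideal n I g \<and> polyf n q \<and> f = h + q * g j"
  then obtain h q where h: "h \<in> ideal n I g" "polyf n q" "f = h + q * g j" by blast
  have "h \<in> ideal n (insert j I) g" using h(1) ideal_mono[of "insert j I" I n g] assms by auto
  then show "f \<in> ideal n (insert j I) g" using h assms by (auto intro!: ideal_add ideal_mult ideal_fibre_eq)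
qed

lemma low_mono: "low n C e f \<Longrightarrow> C \<le> D \<Longrightarrow> low n D e f"
  unfolding low_def by (elim exE conjE, intro exI conjI, erule (1) order.trans, assumption+)

lemma strong_mono: "strong n D S \<Longrightarrow> C \<le> D \<Longrightarrow> strong n C S"
  unfolding strong_def using low_mono by blast

lemma strong_subset: assumes "strong n C S" "T \<subseteq> S" "finite S" shows "strong n C T"
  unfolding strong_def
proof (intro allI impI)
  fix e and u :: "nat \<times> ((nat \<Rightarrow> 'a) \<Rightarrow> 'a) \<Rightarrow> 'a"
  assume "\<exists>x\<in>T. fst x = e \<and> u x \<noteq> 0"
  then obtain x where x: "x \<in> T" "fst x = e" "u x \<noteq> 0" by blast
  define w where "w = (\<lambda>x. if x \<in> T then u x else 0)"
  have "\<not> low n C e (\<Sum>x\<in>{x\<in>S. fst x = e}. scl (w x) (snd x))"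
  proof -
    have "x \<in> S" "w x \<noteq> 0" using x assms(2) by (auto simp: w_def)
    then show ?thesis using assms(1) x(2) unfolding strong_def by blast
  qed
  also have "(\<Sum>x\<in>{x\<in>S. fst x = e}. scl (w x) (snd x)) = (\<Sum>x\<in>{x\<in>T. fst x = e}. scl (u x) (snd x))"
    using assms(2,3) by (intro sum.mono_neutral_cong_right) (auto simp: w_def fun_eq_iff)
  finally show "\<not> low n C e (\<Sum>x\<in>{x\<in>T. fst x = e}. scl (u x) (snd x))" .
qed

lemma form_set_subset: "form_set n d S \<Longrightarrow> T \<subseteq> S \<Longrightarrow> form_set n d T"
  unfolding form_set_def by (auto intro: finite_subset)

lemma form_set_mono: "form_set n d S \<Longrightarrow> d \<le> e \<Longrightarrow> form_set n e S"
  unfolding form_set_def by auto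

lemma form_set_Un: "form_set n d S \<Longrightarrow> form_set n d T \<Longrightarrow> form_set n d (S \<union> T)"
  unfolding form_set_def by auto

lemma dense_prime_mem: "dense_prime n I g \<Longrightarrow> polyf n a \<Longrightarrow> (\<And>z. (\<And>i. i \<in> I \<Longrightarrow> g i z = 0) \<Longrightarrow> a z = 0) \<Longrightarrow> a \<in> ideal n I g"
  unfolding dense_prime_def by blast

lemma dense_prime_prime: "dense_prime n I g \<Longrightarrow> polyf n a \<Longrightarrow> polyf n b \<Longrightarrow> a * b \<in> ideal n I g \<Longrightarrow> a \<in> ideal n I g \<or> b \<in> ideal n I g"
proof (rule ccontr)
  assume *: "dense_prime n I g" "polyf n a" "polyf n b" "a * b \<in> ideal n I g" "\<not> (a \<in> ideal n I g \<or> b \<in> ideal n I g)"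
  then obtain z where "\<forall>i\<in>I. g i z = 0" "a z \<noteq> 0" "b z \<noteq> 0" unfolding dense_prime_def by blast
  then show False using ideal_vanish[OF *(4), of z] by auto
qed

lemma linmap_polyf: "linmap n m L \<Longrightarrow> polyf n f \<Longrightarrow> polyf m (\<lambda>z. f (L z))"
  by (rule polyf_comp) (auto simp: linmap_def form_def)

lemma linmap_form: assumes "linmap n m L" "form n d f" shows "form m d (\<lambda>z. f (L z))"
proof -
  have "f (L (scl c z)) = c ^ d * f (L z)" for c z
  proof -
    have "f (L (scl c z)) = f (scl c (L z))"
    proof (rule polyf_cong_coords[OF form_polyf[OF assms(2)]])
      fix i assume "i < n"
      then have "form m 1 (\<lambda>z. L z i)" using assms(1) by (simp add: linmap_def)
      from form_scl[OF this] show "L (scl c z) i = scl c (L z) i" by simp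
    qed
    then show ?thesis using form_scl[OF assms(2)] by simp
  qed
  then show ?thesis using linmap_polyf[OF assms(1) form_polyf[OF assms(2)]] by (simp add: form_def)
qed

lemma low_pull: assumes "linmap n m L" "low n C e f" shows "low m C e (\<lambda>z. f (L z))"
proof -
  obtain s g h a where "s \<le> C" and
    *: "\<forall>i<s. 1 \<le> a i \<and> a i < e \<and> form n (a i) (g i) \<and> form n (e - a i) (h i)" "f = (\<Sum>i<(s::nat). g i * h i)"
    using assms(2) unfolding low_def by blast
  then show ?thesis unfolding low_def
    using linmap_form[OF assms(1)]
    by (intro exI[of _ s] exI[of _ "\<lambda>i z. g i (L z)"] exI[of _ "\<lambda>i z. h i (L z)"] exI[of _ a])
       (auto simp: fun_eq_iff sum_apply)
qed

context infinite_field
begin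

text \<open>The degree \<open>e\<close> component of \<open>q i * g i\<close> is the component of
  degree \<open>e - d i\<close> of \<open>q i\<close>, times \<open>g i\<close>; so the coefficients
  may be replaced by single components.\<close>

lemma ideal_hom:
  assumes "f \<in> ideal n I g" "\<And>i. i \<in> I \<Longrightarrow> form n (d i) (g i)" "form n e (f :: _ \<Rightarrow> 'k)"
  shows "\<exists>q. (\<forall>i\<in>I. if d i \<le> e then form n (e - d i) (q i) else q i = 0) \<and> f = (\<Sum>i\<in>I. q i * g i)"
proof -
  obtain q where q: "\<forall>i\<in>I. polyf n (q i)" "f = (\<Sum>i\<in>I. q i * g i)" using assms(1) unfolding ideal_def by blast
  define r where "r = (\<lambda>i. if d i \<le> e then hcomp (e - d i) (q i) else 0)"
  have "f = hcomp e f" using hcomp_of_form[OF assms(3)] by simp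
  also have "\<dots> = (\<Sum>i\<in>I. hcomp e (q i * g i))"
    unfolding q(2) using q(1) form_polyf[OF assms(2)] by (intro hcomp_sum[of _ n]) (auto intro!: polyf_times)
  also have "\<dots> = (\<Sum>i\<in>I. r i * g i)"
    using q(1) assms(2) by (intro sum.cong) (auto simp: r_def hcomp_mult_form[OF _ assms(2)])
  finally have "f = (\<Sum>i\<in>I. r i * g i)" .
  moreover have "\<forall>i\<in>I. if d i \<le> e then form n (e - d i) (r i) else r i = 0"
    using q(1) by (auto simp: r_def intro: hcomp_form)
  ultimately show ?thesis by blast
qed

lemma ideal_hcomp:
  assumes "f \<in> ideal n I g" "\<And>i. i \<in> I \<Longrightarrow> form n (d i) (g i :: _ \<Rightarrow> 'k)"
  shows "hcomp e f \<in> ideal n I g"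
proof -
  obtain q where q: "\<forall>i\<in>I. polyf n (q i)" "f = (\<Sum>i\<in>I. q i * g i)" using assms(1) unfolding ideal_def by blast
  have "hcomp e f = (\<Sum>i\<in>I. hcomp e (q i * g i))"
    unfolding q(2) using q(1) form_polyf[OF assms(2)] by (intro hcomp_sum[of _ n]) (auto intro!: polyf_times)
  also have "\<dots> = (\<Sum>i\<in>I. (if d i \<le> e then hcomp (e - d i) (q i) else 0) * g i)"
    using q(1) assms(2) by (intro sum.cong) (auto simp: hcomp_mult_form[OF _ assms(2)])
  also have "\<dots> \<in> ideal n I g"
    unfolding ideal_def using q(1)
    by (intro CollectI exI[of _ "\<lambda>i. if d i \<le> e then hcomp (e - d i) (q i) else 0"]) (auto intro: polyf_hcomp polyf_0)
  finally show ?thesis .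
qed

lemma low_0: "low n C e (0 :: _ \<Rightarrow> 'k)"
  unfolding low_def by (rule exI[of _ 0]) auto

lemma low_add: assumes "low n C e f" "low n D e (g :: _ \<Rightarrow> 'k)" shows "low n (C + D) e (f + g)"
proof -
  obtain s g1 h1 a1 where 1: "s \<le> C" "\<forall>i<s. 1 \<le> a1 i \<and> a1 i < e \<and> form n (a1 i) (g1 i) \<and> form n (e - a1 i) (h1 i)"
    "f = (\<Sum>i<(s::nat). g1 i * h1 i)"
    using assms(1) unfolding low_def by blast
  obtain t g2 h2 a2 where 2: "t \<le> D" "\<forall>i<t. 1 \<le> a2 i \<and> a2 i < e \<and> form n (a2 i) (g2 i) \<and> form n (e - a2 i) (h2 i)"
    "g = (\<Sum>i<(t::nat). g2 i * h2 i)"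
    using assms(2) unfolding low_def by blast
  define g3 where "g3 = (\<lambda>i. if i < s then g1 i else g2 (i - s))"
  define h3 where "h3 = (\<lambda>i. if i < s then h1 i else h2 (i - s))"
  define a3 where "a3 = (\<lambda>i. if i < s then a1 i else a2 (i - s))"
  have "(\<Sum>i<s+t. g3 i * h3 i) = (\<Sum>i<s. g3 i * h3 i) + (\<Sum>i<t. g3 (s + i) * h3 (s + i))"
    by (induction t) (auto simp: add.assoc)
  also have "\<dots> = f + g" by (simp add: 1 2 g3_def h3_def)
  finally have "f + g = (\<Sum>i<s+t. g3 i * h3 i)" by simp
  moreover have "\<forall>i<s+t. 1 \<le> a3 i \<and> a3 i < e \<and> form n (a3 i) (g3 i) \<and> form n (e - a3 i) (h3 i)"
    using 1 2 by (auto simp: g3_def h3_def a3_def)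
  ultimately show ?thesis unfolding low_def using 1(1) 2(1)
    by (intro exI[of _ "s+t"] exI[of _ g3] exI[of _ h3] exI[of _ a3]) auto
qed

lemma low_single: assumes "form n a g" "form n b h" "1 \<le> a" "1 \<le> b" "a + b = e" shows "low n 1 e (g * (h :: _ \<Rightarrow> 'k))"
proof -
  have "e - a = b" using assms by auto
  then show ?thesis unfolding low_def using assms
  by (intro exI[of _ 1] exI[of _ "\<lambda>_. g"] exI[of _ "\<lambda>_. h"] exI[of _ "\<lambda>_. a"]) auto
qed

lemma low_sum: assumes "finite A" "\<And>a. a \<in> A \<Longrightarrow> low n 1 e (f a :: _ \<Rightarrow> 'k)" shows "low n (card A) e (\<Sum>a\<in>A. f a)"
  using assms
proof (induction A rule: finite_induct)
  case (insert x F)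
  then have "low n (1 + card F) e (f x + sum f F)" by (intro low_add) auto
  moreover have "sum f (insert x F) = f x + sum f F" using insert by (intro sum.insert)
  ultimately show ?case using insert by (metis card_insert_disjoint plus_1_eq_Suc)
qed (simp add: low_0)

lemma low_scl: assumes "low n C e (f :: _ \<Rightarrow> 'k)" shows "low n C e (scl c f)"
proof -
  obtain s g h a where "s \<le> C" and
    *: "\<forall>i<s. 1 \<le> a i \<and> a i < e \<and> form n (a i) (g i) \<and> form n (e - a i) (h i)" "f = (\<Sum>i<(s::nat). g i * h i)"
    using assms unfolding low_def by blast
  then show ?thesis unfolding low_def
    by (intro exI[of _ s] exI[of _ "\<lambda>i. scl c (g i)"] exI[of _ h] exI[of _ a])
       (auto simp: fun_eq_iff sum_apply sum_distrib_left mult.assoc intro: form_cmul)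
qed

lemma low_of_ideal:
  assumes "f \<in> ideal n I g" "finite I" "\<And>i. i \<in> I \<Longrightarrow> form n (d i) (g i) \<and> 1 \<le> d i \<and> d i < e" "form n e (f :: _ \<Rightarrow> 'k)"
  shows "low n (card I) e f"
proof -
  obtain q where q: "\<forall>i\<in>I. if d i \<le> e then form n (e - d i) (q i) else q i = 0" "f = (\<Sum>i\<in>I. q i * g i)"
    using ideal_hom[OF assms(1) _ assms(4), of d] assms(3) by blast
  show ?thesis unfolding q(2)
  proof (rule low_sum[OF assms(2)])
    fix i assume "i \<in> I"
    then show "low n 1 e (q i * g i)" using q(1) assms(3)[of i]
      by (intro low_single[of n "e - d i" _ "d i"]) auto
  qed
qed

text \<open>In a homogeneous relation expressing \<open>snd x\<close> by the others, the
  coefficients at members of the same degree are constants. Moved to the left they give a linear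
  combination with coefficient 1 at \<open>x\<close>; what remains is a sum of at most
  \<open>card S\<close> products of forms of positive degree. Strength at least
  \<open>card S\<close> forbids this.\<close>

lemma strong_notin:
  assumes "form_set n d S" "strong n C S" "x \<in> S" "card S \<le> C"
  shows "(snd x :: _ \<Rightarrow> 'k) \<notin> ideal n (S - {x}) snd"
proof
  assume a: "snd x \<in> ideal n (S - {x}) snd"
  define e where "e = fst x"
  have fin: "finite S" using assms(1) by (simp add: form_set_def)
  have "form n e (snd x)" using assms by (auto simp: form_set_def e_def)
  then obtain q where q: "\<forall>y\<in>S-{x}. if fst y \<le> e then form n (e - fst y) (q y) else q y = 0"
    "snd x = (\<Sum>y\<in>S-{x}. q y * snd y)"
    using ideal_hom[OF a, of fst e] assms(1) by (auto simp: form_set_def)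
  define u where "u = (\<lambda>y. if y = x then 1 else - q y 0)"
  have "(\<Sum>y\<in>{y\<in>S. fst y = e}. scl (u y) (snd y)) = snd x + (\<Sum>y\<in>{y\<in>S-{x}. fst y = e}. scl (u y) (snd y))"
  proof -
    have "{y\<in>S. fst y = e} = insert x {y\<in>S-{x}. fst y = e}" using assms(3) e_def by auto
    then show ?thesis using fin by (simp add: u_def)
  qed
  also have "(\<Sum>y\<in>{y\<in>S-{x}. fst y = e}. scl (u y) (snd y)) = - (\<Sum>y\<in>{y\<in>S-{x}. fst y = e}. q y * snd y)"
  proof -
    have "scl (u y) (snd y) = - (q y * snd y)" if "y \<in> S - {x}" "fst y = e" for y
    proof -
      have "form n 0 (q y)" using bspec[OF q(1) that(1)] that(2) by simp
      then have "q y = (\<lambda>_. q y 0)" using form_deg0 by blast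
      moreover have "scl (- c) (snd y) = - ((\<lambda>_. c) * snd y)" for c by (simp add: fun_eq_iff)
      moreover have "u y = - q y 0" using that by (auto simp: u_def)
      ultimately show ?thesis by metis
    qed
    then show ?thesis by (auto simp: sum_negf[symmetric] intro!: sum.cong)
  qed
  also have "snd x = (\<Sum>y\<in>{y\<in>S-{x}. fst y = e}. q y * snd y) + (\<Sum>y\<in>{y\<in>S-{x}. fst y \<noteq> e}. q y * snd y)"
    unfolding q(2)
    by (subst sum.union_disjoint[symmetric]) (use fin in \<open>auto intro!: sum.cong\<close>)
  also have "a + b + - a = b" for a b :: "'k pfun" by (rule ext) simp
  finally have eq: "(\<Sum>y\<in>{y\<in>S. fst y = e}. scl (u y) (snd y)) = (\<Sum>y\<in>{y\<in>S-{x}. fst y \<noteq> e}. q y * snd y)" .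
  have "low n (card {y\<in>S-{x}. fst y \<noteq> e}) e (\<Sum>y\<in>{y\<in>S-{x}. fst y \<noteq> e}. q y * snd y)"
  proof (rule low_sum)
    show "finite {y\<in>S-{x}. fst y \<noteq> e}" using fin by auto
    fix y assume "y \<in> {y\<in>S-{x}. fst y \<noteq> e}"
    then have y: "y \<in> S - {x}" "fst y \<noteq> e" by auto
    show "low n 1 e (q y * snd y)"
    proof (cases "fst y \<le> e")
      case True
      then show ?thesis using q(1) y assms(1) by (intro low_single[of n "e - fst y" _ "fst y"]) (auto simp: form_set_def)
    next
      case False
      then show ?thesis using q(1) y by (simp add: low_0)
    qed
  qed
  moreover have "card {y\<in>S-{x}. fst y \<noteq> e} \<le> C"
    using assms(4) card_mono[OF fin, of "{y\<in>S-{x}. fst y \<noteq> e}"] by auto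
  ultimately have "low n C e (\<Sum>y\<in>{y\<in>S. fst y = e}. scl (u y) (snd y))"
    unfolding eq using low_mono by blast
  moreover have "\<exists>y\<in>S. fst y = e \<and> u y \<noteq> 0" using assms(3) by (auto simp: u_def e_def intro!: bexI[of _ x])
  ultimately show False using assms(2) unfolding strong_def by blast
qed

lemma dense_prime_empty: "dense_prime n {} (g :: 'i \<Rightarrow> _ \<Rightarrow> 'k)"
  unfolding dense_prime_def ideal_def using polyf_eq_0_near by auto

lemma polyf_fibre_eq: "form_set n d S \<Longrightarrow> x \<in> S \<Longrightarrow> polyf n (fibre_eq c x)"
  unfolding form_set_def fibre_eq_def by (auto intro!: polyf_minus polyf_const dest: form_polyf)

lemma fibre_eq_0: "fibre_eq (\<lambda>_. 0) = snd"
  by (auto simp: fibre_eq_def fun_eq_iff)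

text \<open>The threshold depends on the number of forms and on the degree bound, but neither on
  \<open>n\<close> nor on the values \<open>c\<close>.\<close>

definition dense_fibres :: "nat \<Rightarrow> bool" where
  "dense_fibres d \<longleftrightarrow> (\<exists>C :: nat \<Rightarrow> nat. \<forall>N n S (c :: _ \<Rightarrow> 'k). card S \<le> N \<longrightarrow> form_set n d S \<longrightarrow> strong n (C N) S \<longrightarrow> dense_prime n S (fibre_eq c))"

lemma dense_fibres_0: "dense_fibres 0"
proof -
  have "S = {}" if "form_set n 0 S" for n and S :: "'k dform set" using that by (auto simp: form_set_def)
  then show ?thesis unfolding dense_fibres_def using dense_prime_empty by metis
qed

section \<open>Regularization of strong tuples\<close>

lemma tpolyf_bi: assumes "linmap n m X" "linmap n m W" "polyf n (f :: _ \<Rightarrow> 'k)"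
  shows "tpolyf m (\<lambda>z t. f (X z + scl t (W z)))"
proof (rule tpolyf_polyf_comp[OF assms(3)])
  fix i assume "i < n"
  then have "polyf m (\<lambda>z. X z i)" "polyf m (\<lambda>z. W z i)"
    using assms(1,2) form_polyf[of m 1 "\<lambda>z. X z i"] form_polyf[of m 1 "\<lambda>z. W z i"] by (auto simp: linmap_def)
  then have "tpolyf m (\<lambda>z t. X z i + t * W z i)" by (intro tpolyf_add tpolyf_mult tpolyf_t tpolyf_base)
  then show "tpolyf m (\<lambda>z t. (X z + scl t (W z)) i)" by simp
qed

text \<open>Scaling \<open>z\<close> scales the base point and the direction alike, so the degree is
  that of \<open>f\<close> whatever \<open>j\<close> is.\<close>

lemma form_bi: assumes "linmap n m X" "linmap n m W" "form n e (f :: _ \<Rightarrow> 'k)"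
  shows "form m e (\<lambda>z. hder (W z) j f (X z))"
proof -
  have p: "polyf m (\<lambda>z. hder (W z) j f (X z))"
    unfolding hder_def by (rule tpolyf_tcoeff(1)) (rule tpolyf_bi[OF assms(1,2) form_polyf[OF assms(3)]])
  have "hder (W (scl c z)) j f (X (scl c z)) = c ^ e * hder (W z) j f (X z)" for c z
  proof -
    have "f (X (scl c z) + scl t (W (scl c z))) = f (scl c (X z) + scl t (scl c (W z)))" for t
    proof (rule polyf_cong_coords[OF form_polyf[OF assms(3)]])
      fix i assume "i < n"
      then have "form m 1 (\<lambda>z. X z i)" "form m 1 (\<lambda>z. W z i)" using assms by (auto simp: linmap_def)
      from this[THEN form_scl] show "(X (scl c z) + scl t (W (scl c z))) i = (scl c (X z) + scl t (scl c (W z))) i" by simp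
    qed
    then have "hder (W (scl c z)) j f (X (scl c z)) = hder (scl c (W z)) j f (scl c (X z))"
      unfolding hder_def by simp
    then show ?thesis using hder_hom[OF assms(3)] by simp
  qed
  then show ?thesis using p by (simp add: form_def)
qed

lemma hder_biexp: assumes "form n e (f :: _ \<Rightarrow> 'k)"
  shows "f (scl s x + scl t w) = (\<Sum>j\<le>e. s ^ (e - j) * t ^ j * hder w j f x)"
proof -
  have "scl s x + scl t w = scl s x + scl 1 (scl t w)" by auto
  then have "f (scl s x + scl t w) = (\<Sum>j\<le>e. hder (scl t w) j f (scl s x))"
    using hder_expand[OF assms, of "scl s x" 1 "scl t w"] by simp
  also have "\<dots> = (\<Sum>j\<le>e. s ^ (e - j) * t ^ j * hder w j f x)"
  proof (rule sum.cong)
    fix j assume "j \<in> {..e}"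
    then have "form n (e - j) (hder w j f)" using hder_form(1)[OF assms] by simp
    from form_scl[OF this] show "hder (scl t w) j f (scl s x) = s ^ (e - j) * t ^ j * hder w j f x"
      using hder_scale_dir[OF form_polyf[OF assms]] by simp
  qed simp
  finally show ?thesis .
qed

lemma hder_shift: assumes "form n e (f :: _ \<Rightarrow> 'k)" shows "f (v + z) = (\<Sum>a\<le>e. hder v a f z)"
  using hder_expand[OF assms, of z 1 v] by (simp add: add.commute scl_def)

lemma diff_shift: "x1 = a1 + t \<Longrightarrow> x2 = a2 + t \<Longrightarrow> a1 - b1 = a2 - b2 \<Longrightarrow> x1 - b1 = x2 - (b2 :: 'b::ab_group_add)"
proof -
  assume 1: "x1 = a1 + t" and 2: "x2 = a2 + t" and 3: "a1 - b1 = a2 - b2"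
  have "x1 - b1 = (a1 - b1) + t" using 1 by simp
  also have "\<dots> = (a2 - b2) + t" using 3 by simp
  also have "\<dots> = x2 - b2" using 2 by simp
  finally show ?thesis .
qed

text \<open>The values of \<open>\<Psi>\<close> at \<open>v\<close> determine the increment of
  \<open>f\<close> at \<open>v\<close> along every vector of the span of \<open>U\<close>. Split off
  one \<open>a\<close> in \<open>U\<close> and write \<open>u = u' + k a\<close>: in the expansion
  along \<open>a\<close>, the increment of \<open>f\<close> along \<open>u'\<close> is settled by
  induction on the number of vectors, and each derivative of \<open>f\<close> at
  \<open>v + u'\<close> by its value at \<open>v\<close> together with its own increment along
  \<open>u'\<close>.\<close>

lemma polarize:
  "\<exists>B. \<forall>n U f. finite U \<longrightarrow> card U \<le> m \<longrightarrow> form n e (f :: _ \<Rightarrow> 'k) \<longrightarrow>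
    (\<exists>\<Psi>. form_set n (e - 1) \<Psi> \<and> card \<Psi> \<le> B \<and>
      (\<forall>u\<in>fs.span U. \<forall>v w. (\<forall>\<psi>\<in>\<Psi>. snd \<psi> v = snd \<psi> w) \<longrightarrow> f (v + u) - f v = f (w + u) - f w))"
proof (induction m arbitrary: e)
  case 0
  have *: "f (v + u) - f v = f (w + u) - f w" if "u \<in> fs.span U" "finite U" "card U \<le> 0" for u v w :: "nat \<Rightarrow> 'k" and U and f :: "'k pfun"
  proof -
    have "U = {}" using that by simp
    then have "u = 0" using that(1) by (simp only: fs.span_empty singleton_iff)
    then show ?thesis by (metis add.right_neutral diff_self)
  qed
  have wf0: "form_set n (e - 1) {}" for n by (simp add: form_set_def)
  show ?case
  proof (intro exI[of _ "0::nat"] allI impI)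
    fix n and U :: "(nat \<Rightarrow> 'k) set" and f :: "'k pfun"
    assume U: "finite U" "card U \<le> 0" "form n e f"
    show "\<exists>\<Psi>. form_set n (e - 1) \<Psi> \<and> card \<Psi> \<le> 0 \<and>
      (\<forall>u\<in>fs.span U. \<forall>v w. (\<forall>\<psi>\<in>\<Psi>. snd \<psi> v = snd \<psi> w) \<longrightarrow> f (v + u) - f v = f (w + u) - f w)"
      by (rule exI[of _ "{}"], intro conjI ballI allI impI wf0 *[OF _ U(1,2)]) auto
  qed
next
  case (Suc m)
  define P where "P = (\<lambda>e n (U :: (nat \<Rightarrow> 'k) set) (f :: (nat \<Rightarrow> 'k) \<Rightarrow> 'k) \<Psi> B. form_set n (e - 1) \<Psi> \<and> card \<Psi> \<le> B \<and>
      (\<forall>u\<in>fs.span U. \<forall>v w. (\<forall>\<psi>\<in>\<Psi>. snd \<psi> v = snd \<psi> w) \<longrightarrow> f (v + u) - f v = f (w + u) - f w))"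
  define R where "R = (\<lambda>e B. \<forall>n U f. finite U \<longrightarrow> card U \<le> m \<longrightarrow> form n e f \<longrightarrow> (\<exists>\<Psi>. P e n U f \<Psi> B))"
  from Suc have "\<exists>B. R e B" for e
    unfolding R_def P_def by blast
  then obtain B0 where "\<And>e. R e (B0 e)" by metis
  then obtain B where B: "\<And>e n U f. finite U \<Longrightarrow> card U \<le> m \<Longrightarrow> form n e f \<Longrightarrow> \<exists>\<Psi>. P e n U f \<Psi> (B e)"
    unfolding R_def by blast
  \<comment> \<open>Polarizations of \<open>f\<close> itself, and for each \<open>0 < j < e\<close>
    the derivative of order \<open>j\<close> with its polarizations. The derivative of order
    \<open>e\<close> is constant and contributes nothing.\<close>
  define BB where "BB = B e + (\<Sum>j\<in>{1..<e}. 1 + B (e - j))"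
  show ?case
  proof (intro exI[of _ BB] allI impI)
    fix n and U :: "(nat \<Rightarrow> 'k) set" and f :: "'k pfun"
    assume U: "finite U" "card U \<le> Suc m" and f: "form n e f"
    show "\<exists>\<Psi>. form_set n (e - 1) \<Psi> \<and> card \<Psi> \<le> BB \<and>
      (\<forall>u\<in>fs.span U. \<forall>v w. (\<forall>\<psi>\<in>\<Psi>. snd \<psi> v = snd \<psi> w) \<longrightarrow> f (v + u) - f v = f (w + u) - f w)"
    proof (cases "U = {}")
      case True
      have s: "f (v + u) - f v = f (w + u) - f w" if "u \<in> fs.span U" for u v w
      proof -
        have "u = 0" using that unfolding True by (simp only: fs.span_empty singleton_iff)
        then show ?thesis by (metis add.right_neutral diff_self)
      qed
      show ?thesis by (rule exI[of _ "{}"], intro conjI ballI allI impI s) (auto simp: form_set_def)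
    next
      case False
      then obtain a where a: "a \<in> U" by auto
      define U' where "U' = U - {a}"
      have U': "finite U'" "card U' \<le> m" "U = insert a U'" using U a by (auto simp: U'_def)
      have hj: "form n (e - j) (hder a j f)" if "j \<le> e" for j using hder_form(1)[OF f that] .
      obtain \<Psi>0 where P0: "P e n U' f \<Psi>0 (B e)" using B[OF U'(1,2) f] by blast
      have "\<forall>j. \<exists>\<Psi>. j \<le> e \<longrightarrow> P (e - j) n U' (hder a j f) \<Psi> (B (e - j))"
        using B[OF U'(1,2) hj] by blast
      then obtain \<Psi>j where Pj: "\<And>j. j \<le> e \<Longrightarrow> P (e - j) n U' (hder a j f) (\<Psi>j j) (B (e - j))" by metis
      define \<Psi> where "\<Psi> = \<Psi>0 \<union> (\<Union>j\<in>{1..<e}. insert (e - j, hder a j f) (\<Psi>j j))"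
      have fin: "finite \<Psi>0" "j \<le> e \<Longrightarrow> finite (\<Psi>j j)" for j using P0 Pj[of j] by (auto simp: P_def form_set_def)
      have "card \<Psi> \<le> card \<Psi>0 + card (\<Union>j\<in>{1..<e}. insert (e - j, hder a j f) (\<Psi>j j))"
        unfolding \<Psi>_def by (rule card_Un_le)
      also have "\<dots> \<le> BB" unfolding BB_def
      proof (rule add_mono)
        show "card \<Psi>0 \<le> B e" using P0 by (simp add: P_def)
        have "card (\<Union>j\<in>{1..<e}. insert (e - j, hder a j f) (\<Psi>j j)) \<le> (\<Sum>j\<in>{1..<e}. card (insert (e - j, hder a j f) (\<Psi>j j)))"
          by (rule card_UN_le) simp
        also have "\<dots> \<le> (\<Sum>j\<in>{1..<e}. 1 + B (e - j))"
        proof (rule sum_mono)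
          fix j assume "j \<in> {1..<e}"
          then have "card (\<Psi>j j) \<le> B (e - j)" using Pj[of j] by (simp add: P_def)
          then show "card (insert (e - j, hder a j f) (\<Psi>j j)) \<le> 1 + B (e - j)"
            using card_insert_le_m1[of "Suc (B (e - j))" "\<Psi>j j" "(e - j, hder a j f)"] by simp
        qed
        finally show "card (\<Union>j\<in>{1..<e}. insert (e - j, hder a j f) (\<Psi>j j)) \<le> (\<Sum>j\<in>{1..<e}. 1 + B (e - j))" .
      qed
      finally have card: "card \<Psi> \<le> BB" .
      have form_set: "form_set n (e - 1) \<Psi>" unfolding form_set_def
      proof (intro conjI ballI)
        show "finite \<Psi>" using fin by (auto simp: \<Psi>_def)
        fix x assume "x \<in> \<Psi>"
        then consider "x \<in> \<Psi>0" | j where "1 \<le> j" "j < e" "x = (e - j, hder a j f)" | j where "1 \<le> j" "j < e" "x \<in> \<Psi>j j"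
          by (auto simp: \<Psi>_def)
        then have "1 \<le> fst x \<and> fst x \<le> e - 1 \<and> form n (fst x) (snd x)"
        proof cases
          case 1 then show ?thesis using P0 by (auto simp: P_def form_set_def)
        next
          case 2 then show ?thesis using hj[of j] by auto
        next
          case 3 then show ?thesis using Pj[of j] by (fastforce simp: P_def form_set_def)
        qed
        then show "1 \<le> fst x" "fst x \<le> e - 1" "form n (fst x) (snd x)" by auto
      qed
      have "f (v + u) - f v = f (w + u) - f w" if u: "u \<in> fs.span U" and ag: "\<forall>\<psi>\<in>\<Psi>. snd \<psi> v = snd \<psi> w" for u v w
      proof -
        obtain k where k: "u - scl k a \<in> fs.span U'" using u unfolding U'(3) fs.span_breakdown_eq by blast
        define u' where "u' = u - scl k a"
        have sh: "f (y + u) = f (y + u') + (\<Sum>j\<in>{1..e}. hder a j f (y + u') * k ^ j)" for y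
        proof -
          have "y + u = (y + u') + scl k a" by (auto simp: u'_def)
          then have "f (y + u) = (\<Sum>j\<le>e. hder a j f (y + u') * k ^ j)" using hder_expand[OF f] by metis
          also have "{..e} = insert 0 {1..e}" by auto
          also have "(\<Sum>j\<in>insert 0 {1..e}. hder a j f (y + u') * k ^ j) = f (y + u') + (\<Sum>j\<in>{1..e}. hder a j f (y + u') * k ^ j)"
            using hder_0[OF form_polyf[OF f], of a] by (subst sum.insert) auto
          finally show ?thesis .
        qed
        have 0: "f (v + u') - f v = f (w + u') - f w"
          using P0 k ag unfolding P_def u'_def \<Psi>_def by blast
        have j: "hder a j f (v + u') = hder a j f (w + u')" if "j \<in> {1..e}" for j
        proof (cases "j = e")
          case True
          then have "form n 0 (hder a j f)" using hj[of j] by simp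
          then show ?thesis using form_deg0[of n "hder a j f" "v + u'"] form_deg0[of n "hder a j f" "w + u'"] by simp
        next
          case False
          with that have je: "j \<in> {1..<e}" by auto
          then have "(e - j, hder a j f) \<in> \<Psi>" unfolding \<Psi>_def by blast
          then have "hder a j f v = hder a j f w" using ag by fastforce
          have "\<Psi>j j \<subseteq> \<Psi>" unfolding \<Psi>_def using je by blast
          then have "\<forall>\<psi>\<in>\<Psi>j j. snd \<psi> v = snd \<psi> w" using ag by blast
          then have "hder a j f (v + u') - hder a j f v = hder a j f (w + u') - hder a j f w"
            using Pj[of j] je k unfolding P_def u'_def by simp
          then show ?thesis using \<open>hder a j f v = hder a j f w\<close> by (metis diff_add_cancel)
        qed
        have "(\<Sum>j\<in>{1..e}. hder a j f (v + u') * k ^ j) = (\<Sum>j\<in>{1..e}. hder a j f (w + u') * k ^ j)"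
          by (rule sum.cong) (auto simp: j)
        then show ?thesis using diff_shift[OF sh[of v] _ 0] sh[of w] by (simp only:)
      qed
      then show ?thesis using form_set card by blast
    qed
  qed
qed

text \<open>Only values are compared, no polynomial expression of \<open>f\<close> is demanded.
  Members of \<open>S\<close> of degree above \<open>d\<close> may differ at the two points; this is
  what later leaves the forms of top degree free.\<close>

definition determined :: "nat \<Rightarrow> 'k dform set \<Rightarrow> 'k pfun \<Rightarrow> bool" where
  "determined d S f \<longleftrightarrow> (\<forall>v w. (\<forall>x\<in>S. fst x \<le> d \<longrightarrow> snd x v = snd x w) \<longrightarrow> f v = f w)"

lemma determined_mono: "determined d S f \<Longrightarrow> d \<le> e \<Longrightarrow> S \<subseteq> T \<Longrightarrow> determined e T f"
  unfolding determined_def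
proof (intro allI impI)
  fix v w
  assume *: "\<forall>v w. (\<forall>x\<in>S. fst x \<le> d \<longrightarrow> snd x v = snd x w) \<longrightarrow> f v = f w" "d \<le> e" "S \<subseteq> T"
    "\<forall>x\<in>T. fst x \<le> e \<longrightarrow> snd x v = snd x w"
  then have "\<forall>x\<in>S. fst x \<le> d \<longrightarrow> snd x v = snd x w" using order.trans by blast
  then show "f v = f w" using *(1) by blast
qed

text \<open>\<open>Kf\<close> prescribes the strength of the outcome in terms of its number of
  forms, which is not known beforehand. The given \<open>F\<close> is kept, whatever its degrees;
  only the auxiliary forms \<open>\<Phi>\<close> are exchanged for others.\<close>

definition regularizes :: "(nat \<Rightarrow> nat) \<Rightarrow> nat \<Rightarrow> nat \<Rightarrow> nat \<Rightarrow> nat \<Rightarrow> nat \<Rightarrow> bool" where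
  "regularizes Kf d m N C B \<longleftrightarrow> (\<forall>n D F \<Phi>. form_set n D F \<longrightarrow> card F \<le> m \<longrightarrow> strong n C F \<longrightarrow> form_set n d \<Phi> \<longrightarrow> card \<Phi> \<le> N \<longrightarrow>
    (\<exists>Q. form_set n d Q \<and> card Q \<le> B \<and> strong n (Kf (card (F \<union> Q))) (F \<union> Q) \<and> (\<forall>\<phi>\<in>\<Phi>. determined d (F \<union> Q) (snd \<phi>))))"

definition regularizes_top :: "(nat \<Rightarrow> nat) \<Rightarrow> nat \<Rightarrow> nat \<Rightarrow> nat \<Rightarrow> nat \<Rightarrow> nat \<Rightarrow> nat \<Rightarrow> bool" where
  "regularizes_top Kf d m r N C B \<longleftrightarrow> (\<forall>n D F \<Phi>t \<Phi>. form_set n D F \<longrightarrow> card F \<le> m \<longrightarrow> strong n C F \<longrightarrow> form_set n d \<Phi> \<longrightarrow> card \<Phi> \<le> N \<longrightarrow>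
    form_set n (Suc d) \<Phi>t \<longrightarrow> (\<forall>x\<in>\<Phi>t. fst x = Suc d) \<longrightarrow> card \<Phi>t \<le> r \<longrightarrow>
    (\<exists>Q. form_set n (Suc d) Q \<and> card Q \<le> B \<and> strong n (Kf (card (F \<union> Q))) (F \<union> Q) \<and> (\<forall>\<phi>\<in>\<Phi>t \<union> \<Phi>. determined (Suc d) (F \<union> Q) (snd \<phi>))))"

text \<open>If \<open>F\<close> stays strong together with \<open>\<Phi>t\<close>, then
  \<open>\<Phi>t\<close> is kept and only lower forms remain to be treated. Otherwise some linear
  combination is low; as \<open>F\<close> is strong, it involves a member \<open>y\<close> of
  \<open>\<Phi>t\<close>, and \<open>y\<close> is determined by the other forms and the factors of
  the decomposition. Exchanging \<open>y\<close> for these factors lowers the number of forms of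
  degree \<open>Suc d\<close>.\<close>

lemma regularize_top:
  assumes regularize: "\<And>m N. \<exists>C B. regularizes Kf d m N C B"
  shows "\<exists>C B. regularizes_top Kf d m r N C B"
proof (induction r arbitrary: N)
  case 0
  obtain C B where R: "regularizes Kf d m N C B" using regularize by blast
  note CB = R[unfolded regularizes_def, rule_format]
  show ?case unfolding regularizes_top_def
  proof (rule exI[of _ C], rule exI[of _ B], intro allI impI)
    fix n D and F \<Phi> \<Phi>t :: "'k dform set"
    assume a: "form_set n D F" "card F \<le> m" "strong n C F" "form_set n d \<Phi>" "card \<Phi> \<le> N" "form_set n (Suc d) \<Phi>t" "card \<Phi>t \<le> 0"
    then have "\<Phi>t = {}" by (auto simp: form_set_def)
    from CB[OF a(1-5)] obtain Q where Q: "form_set n d Q" "card Q \<le> B" "strong n (Kf (card (F \<union> Q))) (F \<union> Q)" "\<And>\<phi>. \<phi> \<in> \<Phi> \<Longrightarrow> determined d (F \<union> Q) (snd \<phi>)"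
      by blast
    have "form_set n (Suc d) Q" using Q(1) form_set_mono by (metis le_Suc_eq order_refl)
    moreover have "determined (Suc d) (F \<union> Q) (snd \<phi>)" if "\<phi> \<in> \<Phi>t \<union> \<Phi>" for \<phi>
      using Q(4)[of \<phi>] that \<open>\<Phi>t = {}\<close> by (auto intro: determined_mono)
    ultimately show "\<exists>Q. form_set n (Suc d) Q \<and> card Q \<le> B \<and> strong n (Kf (card (F \<union> Q))) (F \<union> Q) \<and> (\<forall>\<phi>\<in>\<Phi>t \<union> \<Phi>. determined (Suc d) (F \<union> Q) (snd \<phi>))"
      using Q(2,3) by blast
  qed
next
  case (Suc r)
  obtain C1 B1 where R1: "regularizes Kf d (m + Suc r) N C1 B1" using regularize by blast
  note CB1 = R1[unfolded regularizes_def, rule_format]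
  \<comment> \<open>\<open>C1\<close> is fixed before the induction hypothesis is applied: if
    strength \<open>C1\<close> fails, at most \<open>2 * C1\<close> factors of lower degree are
    added.\<close>
  obtain C2 B2 where R2: "regularizes_top Kf d m r (N + 2 * C1) C2 B2" using Suc by blast
  note CB2 = R2[unfolded regularizes_top_def, rule_format]
  show ?case unfolding regularizes_top_def
  proof (rule exI[of _ "max C1 C2"], rule exI[of _ "max (Suc r + B1) B2"], intro allI impI)
    fix n D and F \<Phi> \<Phi>t :: "'k dform set"
    assume a: "form_set n D F" "card F \<le> m" "strong n (max C1 C2) F" "form_set n d \<Phi>" "card \<Phi> \<le> N" "form_set n (Suc d) \<Phi>t"
      "\<forall>x\<in>\<Phi>t. fst x = Suc d" "card \<Phi>t \<le> Suc r"
    have fin: "finite F" "finite \<Phi>" "finite \<Phi>t" using a by (auto simp: form_set_def)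
    show "\<exists>Q. form_set n (Suc d) Q \<and> card Q \<le> max (Suc r + B1) B2 \<and> strong n (Kf (card (F \<union> Q))) (F \<union> Q) \<and> (\<forall>\<phi>\<in>\<Phi>t \<union> \<Phi>. determined (Suc d) (F \<union> Q) (snd \<phi>))"
    proof (cases "strong n C1 (F \<union> \<Phi>t)")
      case True
      have w: "form_set n (max D (Suc d)) (F \<union> \<Phi>t)" using a by (intro form_set_Un) (auto elim: form_set_mono)
      have c: "card (F \<union> \<Phi>t) \<le> m + Suc r" using card_Un_le[of F \<Phi>t] a by linarith
      obtain Q where Q: "form_set n d Q" "card Q \<le> B1" "strong n (Kf (card ((F \<union> \<Phi>t) \<union> Q))) ((F \<union> \<Phi>t) \<union> Q)"
        "\<And>\<phi>. \<phi> \<in> \<Phi> \<Longrightarrow> determined d ((F \<union> \<Phi>t) \<union> Q) (snd \<phi>)"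
        using CB1[OF w c True a(4,5)] by blast
      have "form_set n (Suc d) (\<Phi>t \<union> Q)" using Q(1) a(6) by (intro form_set_Un) (auto elim: form_set_mono)
      moreover have "card (\<Phi>t \<union> Q) \<le> max (Suc r + B1) B2" using card_Un_le[of \<Phi>t Q] Q(2) a(8) by linarith
      moreover have "strong n (Kf (card (F \<union> (\<Phi>t \<union> Q)))) (F \<union> (\<Phi>t \<union> Q))" using Q(3) by (simp add: Un_assoc)
      moreover have "determined (Suc d) (F \<union> (\<Phi>t \<union> Q)) (snd \<phi>)" if "\<phi> \<in> \<Phi>t \<union> \<Phi>" for \<phi>
      proof (cases "\<phi> \<in> \<Phi>t")
        case True
        then show ?thesis using a(7) unfolding determined_def by auto
      next
        case False
        then have "determined d ((F \<union> \<Phi>t) \<union> Q) (snd \<phi>)" using Q(4) that by auto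
        then show ?thesis by (rule determined_mono) auto
      qed
      ultimately show ?thesis by (intro exI[of _ "\<Phi>t \<union> Q"]) blast
    next
      case False
      then obtain e u x where x: "x \<in> F \<union> \<Phi>t" "fst x = e" "u x \<noteq> 0"
        and lo: "low n C1 e (\<Sum>x\<in>{x\<in>F \<union> \<Phi>t. fst x = e}. scl (u x) (snd x))"
        unfolding strong_def by blast
      have "\<exists>y\<in>\<Phi>t - F. fst y = e \<and> u y \<noteq> 0"
      proof (rule ccontr)
        assume no: "\<not> ?thesis"
        have "(\<Sum>x\<in>{x\<in>F \<union> \<Phi>t. fst x = e}. scl (u x) (snd x)) = (\<Sum>x\<in>{x\<in>F. fst x = e}. scl (u x) (snd x))"
          using fin no by (intro sum.mono_neutral_right) (auto simp: fun_eq_iff)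
        then have lo': "low n C1 e (\<Sum>x\<in>{x\<in>F. fst x = e}. scl (u x) (snd x))" using lo by (simp only:)
        have xF: "x \<in> F" using x no by auto
        have "strong n C1 F" using a(3) by (rule strong_mono) simp
        from this[unfolded strong_def, rule_format, of e u] show False using lo' xF x(2,3) by blast
      qed
      then obtain y where y: "y \<in> \<Phi>t" "y \<notin> F" "fst y = e" "u y \<noteq> 0" by blast
      have e: "e = Suc d" using a(7) y by auto
      obtain s g h al where "s \<le> C1" and
        gh: "\<forall>i<s. 1 \<le> al i \<and> al i < e \<and> form n (al i) (g i) \<and> form n (e - al i) (h i)"
        "(\<Sum>x\<in>{x\<in>F \<union> \<Phi>t. fst x = e}. scl (u x) (snd x)) = (\<Sum>i<(s::nat). g i * h i)"
        using lo unfolding low_def by blast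
      define G where "G = (\<lambda>i. (al i, g i)) ` {..<s} \<union> (\<lambda>i. (e - al i, h i)) ` {..<s}"
      have "card G \<le> s + s" unfolding G_def
        by (rule order.trans[OF card_Un_le]) (intro add_mono card_image_le[THEN order.trans], auto)
      then have cG: "card (\<Phi> \<union> G) \<le> N + 2 * C1" using card_Un_le[of \<Phi> G] a(5) \<open>s \<le> C1\<close> by linarith
      have "form_set n d G" unfolding form_set_def
      proof (intro conjI ballI)
        show "finite G" by (auto simp: G_def)
        fix x assume "x \<in> G"
        then obtain i where i: "i < s" "x = (al i, g i) \<or> x = (e - al i, h i)" by (auto simp: G_def)
        have "1 \<le> al i" "al i < Suc d" "form n (al i) (g i)" "form n (e - al i) (h i)" using gh(1) i(1) e by auto
        then show "1 \<le> fst x" "fst x \<le> d" "form n (fst x) (snd x)" using i(2) e by auto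
      qed
      then have w: "form_set n d (\<Phi> \<union> G)" using a(4) by (intro form_set_Un)
      have s2: "strong n C2 F" using a(3) by (rule strong_mono) simp
      have wt: "form_set n (Suc d) (\<Phi>t - {y})" using a(6) by (rule form_set_subset) auto
      have ct: "card (\<Phi>t - {y}) \<le> r" using a(8) y(1) fin by simp
      have dt: "fst x = Suc d" if "x \<in> \<Phi>t - {y}" for x using a(7) that by auto
      obtain Q where Q: "form_set n (Suc d) Q" "card Q \<le> B2" "strong n (Kf (card (F \<union> Q))) (F \<union> Q)"
        "\<And>\<phi>. \<phi> \<in> (\<Phi>t - {y}) \<union> (\<Phi> \<union> G) \<Longrightarrow> determined (Suc d) (F \<union> Q) (snd \<phi>)"
        using CB2[OF a(1,2) s2 w cG wt dt ct] by blast
      have "determined (Suc d) (F \<union> Q) (snd y)"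
        unfolding determined_def
      proof (intro allI impI)
        fix v w assume ag: "\<forall>x\<in>F \<union> Q. fst x \<le> Suc d \<longrightarrow> snd x v = snd x w"
        have ph: "snd \<phi> v = snd \<phi> w" if "\<phi> \<in> (\<Phi>t - {y}) \<union> (\<Phi> \<union> G)" for \<phi>
          using Q(4)[OF that] ag unfolding determined_def by blast
        have gi: "g i v = g i w" "h i v = h i w" if "i < s" for i
          using ph[of "(al i, g i)"] ph[of "(e - al i, h i)"] that by (auto simp: G_def)
        have "{x\<in>F \<union> \<Phi>t. fst x = e} = insert y {x\<in>F \<union> \<Phi>t. fst x = e \<and> x \<noteq> y}" using y by auto
        then have H: "(\<Sum>x\<in>{x\<in>F \<union> \<Phi>t. fst x = e}. scl (u x) (snd x)) z
          = u y * snd y z + (\<Sum>x\<in>{x\<in>F \<union> \<Phi>t. fst x = e \<and> x \<noteq> y}. u x * snd x z)" for z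
          using fin by (simp add: sum_apply)
        have "(\<Sum>i<s. g i z * h i z) = u y * snd y z + (\<Sum>x\<in>{x\<in>F \<union> \<Phi>t. fst x = e \<and> x \<noteq> y}. u x * snd x z)" for z
          using H[of z] unfolding gh(2) by (simp only: sum_apply times_fun_apply)
        then have key: "u y * snd y z = (\<Sum>i<s. g i z * h i z) - (\<Sum>x\<in>{x\<in>F \<union> \<Phi>t. fst x = e \<and> x \<noteq> y}. u x * snd x z)" for z
          by simp
        have "u y * snd y v = u y * snd y w"
          unfolding key
        proof (intro arg_cong2[where f = minus] sum.cong refl)
          fix x assume "x \<in> {x\<in>F \<union> \<Phi>t. fst x = e \<and> x \<noteq> y}"
          then show "u x * snd x v = u x * snd x w" using ph[of x] ag e by auto
        qed (use gi in auto)
        then show "snd y v = snd y w" using y(4) by simp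
      qed
      then have "\<forall>\<phi>\<in>\<Phi>t \<union> \<Phi>. determined (Suc d) (F \<union> Q) (snd \<phi>)" using Q(4) by blast
      then show ?thesis using Q(1-3) by (metis max.coboundedI2)
    qed
  qed
qed

lemma regularize: "\<exists>C B. regularizes Kf d m N C B"
proof (induction d arbitrary: m N)
  case 0
  show ?case unfolding regularizes_def
  \<comment> \<open>No form has degree between 1 and 0, so \<open>F\<close> is unchanged; the sum
    dominates \<open>Kf (card F)\<close> for every possible cardinality.\<close>
  proof (rule exI[of _ "\<Sum>j\<le>m. Kf j"], rule exI[of _ 0], intro allI impI)
    fix n D and F \<Phi> :: "'k dform set"
    assume a: "card F \<le> m" "strong n (\<Sum>j\<le>m. Kf j) F" "form_set n 0 \<Phi>"
    have "Kf (card F) \<le> (\<Sum>j\<le>m. Kf j)" using a(1) by (intro member_le_sum) auto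
    then have "strong n (Kf (card F)) F" using strong_mono a(2) by blast
    moreover have "\<Phi> = {}" using a(3) by (auto simp: form_set_def)
    ultimately show "\<exists>Q. form_set n 0 Q \<and> card Q \<le> 0 \<and> strong n (Kf (card (F \<union> Q))) (F \<union> Q) \<and> (\<forall>\<phi>\<in>\<Phi>. determined 0 (F \<union> Q) (snd \<phi>))"
      by (intro exI[of _ "{}"]) (auto simp: form_set_def)
  qed
next
  case (Suc d)
  obtain C B where R: "regularizes_top Kf d m N N C B" using regularize_top[OF Suc] by blast
  note CB = R[unfolded regularizes_top_def, rule_format]
  show ?case unfolding regularizes_def
  proof (rule exI[of _ C], rule exI[of _ B], intro allI impI)
    fix n D and F \<Phi> :: "'k dform set"
    assume a: "form_set n D F" "card F \<le> m" "strong n C F" "form_set n (Suc d) \<Phi>" "card \<Phi> \<le> N"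
    define \<Phi>t where "\<Phi>t = {x\<in>\<Phi>. fst x = Suc d}"
    define \<Phi>l where "\<Phi>l = {x\<in>\<Phi>. fst x \<noteq> Suc d}"
    have fin: "finite \<Phi>" using a by (simp add: form_set_def)
    have u: "\<Phi> = \<Phi>t \<union> \<Phi>l" by (auto simp: \<Phi>t_def \<Phi>l_def)
    have l: "form_set n d \<Phi>l" using a(4) by (fastforce simp: form_set_def \<Phi>l_def)
    have t: "form_set n (Suc d) \<Phi>t" using a(4) by (rule form_set_subset) (auto simp: \<Phi>t_def)
    have c: "card \<Phi>t \<le> N" "card \<Phi>l \<le> N"
      using a(5) card_mono[OF fin, of \<Phi>t] card_mono[OF fin, of \<Phi>l] by (auto simp: \<Phi>t_def \<Phi>l_def)
    have e: "fst x = Suc d" if "x \<in> \<Phi>t" for x using that by (simp add: \<Phi>t_def)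
    show "\<exists>Q. form_set n (Suc d) Q \<and> card Q \<le> B \<and> strong n (Kf (card (F \<union> Q))) (F \<union> Q) \<and> (\<forall>\<phi>\<in>\<Phi>. determined (Suc d) (F \<union> Q) (snd \<phi>))"
      using CB[OF a(1-3) l c(2) t e c(1)] unfolding u by blast
  qed
qed

section \<open>Rational points on the common zeros of few lower forms\<close>

lemma dense_fibres_card: assumes "dense_fibres d"
  shows "\<exists>C. \<forall>n S (c :: _ \<Rightarrow> 'k). form_set n d S \<longrightarrow> strong n (C (card S)) S \<longrightarrow> dense_prime n S (fibre_eq c)"
proof -
  obtain C where "\<And>N n S (c :: _ \<Rightarrow> 'k). card S \<le> N \<Longrightarrow> form_set n d S \<Longrightarrow> strong n (C N) S \<Longrightarrow> dense_prime n S (fibre_eq c)"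
    using assms unfolding dense_fibres_def by blast
  then show ?thesis by (intro exI[of _ C]) blast
qed

text \<open>Regularization with empty \<open>F\<close>. All forms vanish at the origin, so where
  \<open>Q\<close> vanishes every form determined by \<open>Q\<close> takes its value at the origin,
  which is \<open>0\<close>.\<close>

lemma strong_common_zeros:
  "\<exists>B. \<forall>n \<Phi>. form_set n d \<Phi> \<longrightarrow> card \<Phi> \<le> N \<longrightarrow> (\<exists>Q. form_set n d Q \<and> card Q \<le> B \<and> strong n (Kf (card Q)) Q \<and>
    (\<forall>z. (\<forall>x\<in>Q. snd x z = (0::'k)) \<longrightarrow> (\<forall>\<phi>\<in>\<Phi>. snd \<phi> z = 0)))"
proof -
  obtain C' B where R: "regularizes Kf d 0 N C' B" using regularize by blast
  note CB = R[unfolded regularizes_def, rule_format]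
  show ?thesis
  proof (intro exI[of _ B] allI impI)
    fix n and \<Phi> :: "'k dform set"
    assume a: "form_set n d \<Phi>" "card \<Phi> \<le> N"
    have e: "form_set n d {}" "card {} \<le> 0" "strong n C' {}" by (auto simp: form_set_def strong_def)
    obtain Q where Q: "form_set n d Q" "card Q \<le> B" "strong n (Kf (card Q)) Q" "\<And>\<phi>. \<phi> \<in> \<Phi> \<Longrightarrow> determined d Q (snd \<phi>)"
      using CB[OF e a] unfolding Un_empty_left by blast
    have "snd \<phi> z = 0" if "\<forall>x\<in>Q. snd x z = 0" "\<phi> \<in> \<Phi>" for z \<phi>
    proof -
      have "snd x 0 = 0" if "x \<in> Q" for x using Q(1) that form_at_0[of n "fst x" "snd x"] by (auto simp: form_set_def)
      then have "snd \<phi> z = snd \<phi> 0" using Q(4)[OF that(2)] that(1) unfolding determined_def by metis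
      also have "\<dots> = 0" using a(1) that(2) form_at_0[of n "fst \<phi>" "snd \<phi>"] by (auto simp: form_set_def)
      finally show ?thesis .
    qed
    then show "\<exists>Q. form_set n d Q \<and> card Q \<le> B \<and> strong n (Kf (card Q)) Q \<and> (\<forall>z. (\<forall>x\<in>Q. snd x z = (0::'k)) \<longrightarrow> (\<forall>\<phi>\<in>\<Phi>. snd \<phi> z = 0))"
      using Q by blast
  qed
qed

lemma dense_common_zeros: assumes "dense_fibres d"
  shows "\<exists>B. \<forall>n \<Phi>. form_set n d \<Phi> \<longrightarrow> card \<Phi> \<le> N \<longrightarrow> (\<exists>Q. form_set n d Q \<and> card Q \<le> B \<and> dense_prime n Q snd \<and>
    (\<forall>z. (\<forall>x\<in>Q. snd x z = (0::'k)) \<longrightarrow> (\<forall>\<phi>\<in>\<Phi>. snd \<phi> z = 0)))"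
proof -
  obtain C where C: "\<And>n S (c :: _ \<Rightarrow> 'k). form_set n d S \<Longrightarrow> strong n (C (card S)) S \<Longrightarrow> dense_prime n S (fibre_eq c)"
    using dense_fibres_card[OF assms] by blast
  have dense_prime: "dense_prime n Q snd" if "form_set n d Q" "strong n (C (card Q)) Q" for n and Q :: "'k dform set"
    using C[OF that, of "\<lambda>_. 0"] by (simp add: fibre_eq_0)
  show ?thesis using strong_common_zeros[of d N C] dense_prime by meson
qed

text \<open>If \<open>g\<close> vanished at all common zeros of \<open>\<Phi>\<close>, it would
  vanish at those of the strong set \<open>Q\<close> and hence lie in its ideal. All members of
  \<open>Q\<close> have degree below \<open>e\<close>, so homogeneous coefficients would exhibit
  \<open>g\<close> as low, with at most \<open>B\<close> products.\<close>

lemma nonvanishing_point: assumes "dense_fibres d"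
  shows "\<exists>B. \<forall>n \<Phi> g e. form_set n d \<Phi> \<longrightarrow> card \<Phi> \<le> N \<longrightarrow> d < e \<longrightarrow> form n e g \<longrightarrow> \<not> low n B e (g :: _ \<Rightarrow> 'k) \<longrightarrow>
    (\<exists>z. (\<forall>\<phi>\<in>\<Phi>. snd \<phi> z = 0) \<and> g z \<noteq> 0)"
proof -
  obtain B where B: "\<And>n \<Phi>. form_set n d \<Phi> \<Longrightarrow> card \<Phi> \<le> N \<Longrightarrow> (\<exists>Q. form_set n d Q \<and> card Q \<le> B \<and> dense_prime n Q snd \<and>
    (\<forall>z. (\<forall>x\<in>Q. snd x z = (0::'k)) \<longrightarrow> (\<forall>\<phi>\<in>\<Phi>. snd \<phi> z = 0)))"
    using dense_common_zeros[OF assms] by blast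
  show ?thesis
  proof (intro exI[of _ B] allI impI)
    fix n e and g :: "'k pfun" and \<Phi> :: "'k dform set"
    assume a: "form_set n d \<Phi>" "card \<Phi> \<le> N" "d < e" "form n e g" "\<not> low n B e g"
    obtain Q where Q: "form_set n d Q" "card Q \<le> B" "dense_prime n Q snd" "\<And>z. (\<forall>x\<in>Q. snd x z = (0::'k)) \<Longrightarrow> (\<forall>\<phi>\<in>\<Phi>. snd \<phi> z = 0)"
      using B[OF a(1,2)] by metis
    have "g \<notin> ideal n Q snd"
    proof
      assume "g \<in> ideal n Q snd"
      from low_of_ideal[OF this, of fst e] have "low n (card Q) e g" using Q(1) a by (fastforce simp: form_set_def)
      then show False using a(5) Q(2) low_mono by blast
    qed
    then show "\<exists>z. (\<forall>\<phi>\<in>\<Phi>. snd \<phi> z = 0) \<and> g z \<noteq> 0"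
      using dense_prime_mem[OF Q(3) form_polyf[OF a(4)]] Q(4) by blast
  qed
qed

definition coordfun :: "nat \<Rightarrow> (nat \<Rightarrow> 'k) \<Rightarrow> 'k" where "coordfun i = (\<lambda>v. v i)"

lemma polyf_coordfun: "i < n \<Longrightarrow> polyf n (coordfun i)"
  unfolding coordfun_def by (rule polyf_var)

lemma inj_coordfun: "inj_on coordfun I"
proof
  fix i j assume "coordfun i = coordfun j"
  from fun_cong[OF this, of "\<lambda>l. if l = i then 1 else 0"] show "i = j" by (auto simp: coordfun_def split: if_splits)
qed

lemma independent_coords: assumes "finite J" shows "fs.independent (coordfun ` J)"
  using assms
proof (induction J rule: finite_induct)
  case empty
  show ?case unfolding image_empty by (rule fs.independent_empty)
next
  case (insert i J)
  define W where "W = {f :: (nat \<Rightarrow> 'k) \<Rightarrow> 'k. f (\<lambda>l. if l = i then 1 else 0) = 0}"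
  have "fs.subspace W" unfolding fs.subspace_def W_def by auto
  moreover have "coordfun ` J \<subseteq> W" using insert(2) by (auto simp: W_def coordfun_def)
  ultimately have "fs.span (coordfun ` J) \<subseteq> W" by (intro fs.span_minimal)
  moreover have "coordfun i \<notin> W" by (simp add: W_def coordfun_def)
  ultimately have "coordfun i \<notin> fs.span (coordfun ` J)" by blast
  then show ?case unfolding image_insert using fs.independent_insertI insert(3) by blast
qed

text \<open>If all coordinates in \<open>I\<close> vanished at the common zeros, each would lie in
  the ideal of \<open>Q\<close> and, being of degree 1, in the linear span of \<open>Q\<close>.
  Coordinates are linearly independent, so \<open>I\<close> would have at most \<open>card Q\<close>
  elements.\<close>

lemma nonzero_coordinate_point: assumes "dense_fibres d"
  shows "\<exists>B. \<forall>n \<Phi> I. form_set n d \<Phi> \<longrightarrow> card \<Phi> \<le> N \<longrightarrow> I \<subseteq> {..<n} \<longrightarrow> card I > B \<longrightarrow>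
    (\<exists>z. (\<forall>\<phi>\<in>\<Phi>. snd \<phi> z = (0::'k)) \<and> (\<exists>i\<in>I. z i \<noteq> 0))"
proof -
  obtain B where B: "\<And>n \<Phi>. form_set n d \<Phi> \<Longrightarrow> card \<Phi> \<le> N \<Longrightarrow> (\<exists>Q. form_set n d Q \<and> card Q \<le> B \<and> dense_prime n Q snd \<and>
    (\<forall>z. (\<forall>x\<in>Q. snd x z = (0::'k)) \<longrightarrow> (\<forall>\<phi>\<in>\<Phi>. snd \<phi> z = 0)))"
    using dense_common_zeros[OF assms] by blast
  show ?thesis
  proof (intro exI[of _ B] allI impI)
    fix n I and \<Phi> :: "'k dform set"
    assume a: "form_set n d \<Phi>" "card \<Phi> \<le> N" "I \<subseteq> {..<n}" "card I > B"
    obtain Q where Q: "form_set n d Q" "card Q \<le> B" "dense_prime n Q snd" "\<And>z. (\<forall>x\<in>Q. snd x z = (0::'k)) \<Longrightarrow> (\<forall>\<phi>\<in>\<Phi>. snd \<phi> z = 0)"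
      using B[OF a(1,2)] by metis
    show "\<exists>z. (\<forall>\<phi>\<in>\<Phi>. snd \<phi> z = 0) \<and> (\<exists>i\<in>I. z i \<noteq> 0)"
    proof (rule ccontr)
      assume no: "\<not> ?thesis"
      have "coordfun i \<in> fs.span (snd ` Q)" if "i \<in> I" for i
      proof -
        have i: "i < n" using that a(3) by auto
        have z0: "coordfun i z = 0" if "\<And>x. x \<in> Q \<Longrightarrow> snd x z = 0" for z
        proof -
          have "\<forall>\<phi>\<in>\<Phi>. snd \<phi> z = 0" using Q(4) that by blast
          then show ?thesis using no \<open>i \<in> I\<close> by (auto simp: coordfun_def)
        qed
        have "coordfun i \<in> ideal n Q snd"
          by (rule dense_prime_mem[OF Q(3) polyf_coordfun[OF i] z0])
        then have mem: "coordfun i \<in> ideal n Q snd" .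
        have h1: "form n 1 (coordfun i)" using i polyf_coordfun[OF i] by (simp add: form_def) (simp add: coordfun_def)
        have hx: "form n (fst x) (snd x)" if "x \<in> Q" for x using Q(1) that by (simp add: form_set_def)
        obtain q where q: "\<forall>x\<in>Q. if fst x \<le> 1 then form n (1 - fst x) (q x) else q x = 0" "coordfun i = (\<Sum>x\<in>Q. q x * snd x)"
          using ideal_hom[OF mem hx h1] by blast
        have "q x * snd x = scl (q x 0) (snd x)" if "x \<in> Q" for x
        proof -
          have "fst x \<ge> 1" using Q(1) that by (auto simp: form_set_def)
          then have "q x v = q x 0" for v
            using bspec[OF q(1) that] form_deg0[of n "q x" v] by (cases "fst x \<le> 1") auto
          then have "q x = (\<lambda>_. q x 0)" by blast
          moreover have "(\<lambda>_. c) * snd x = scl c (snd x)" for c by (simp add: fun_eq_iff)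
          ultimately show ?thesis by metis
        qed
        then have "coordfun i = (\<Sum>x\<in>Q. scl (q x 0) (snd x))" unfolding q(2) by (intro sum.cong) auto
        also have "\<dots> \<in> fs.span (snd ` Q)" by (intro fs.span_sum fs.span_scale fs.span_base) auto
        finally show ?thesis .
      qed
      then have "coordfun ` I \<subseteq> fs.span (snd ` Q)" by auto
      then have "card (coordfun ` I) \<le> card (snd ` Q)"
        using fs.independent_span_bound[OF _ independent_coords] Q(1) finite_subset[OF a(3)] by (auto simp: form_set_def)
      also have "\<dots> \<le> B" using card_image_le[of Q snd] Q(1,2) by (auto simp: form_set_def)
      finally show False using a(4) card_image[OF inj_coordfun, of I] by simp
    qed
  qed
qed

section \<open>Differentials of forms and strength\<close>

definition unit_vec :: "nat \<Rightarrow> nat \<Rightarrow> 'k" where "unit_vec i = (\<lambda>l. if l = i then 1 else 0)"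

text \<open>The differential \<open>(x, w) \<mapsto> D_w f(x)\<close> is a form in \<open>2 n\<close> variables, \<open>w\<close> being the last \<open>n\<close> of them.\<close>

definition strong_deriv :: "nat \<Rightarrow> bool" where
  "strong_deriv d \<longleftrightarrow> (\<forall>c. \<exists>C. \<forall>n f. form n d f \<longrightarrow> \<not> low n C d (f :: _ \<Rightarrow> 'k) \<longrightarrow>
     \<not> low (2 * n) c d (\<lambda>z. hder (\<lambda>i. z (i + n)) 1 f z))"

lemma hder_1_cong: assumes "\<And>t. f (v + scl t u) = g (w + scl t y)" shows "hder u j f v = hder y j (g :: (nat \<Rightarrow> 'k) \<Rightarrow> 'k) w"
  unfolding hder_def using assms by simp

lemma hder_mult_1: assumes "polyf n f" "polyf n (g :: _ \<Rightarrow> 'k)"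
  shows "hder u 1 (f * g) v = f v * hder u 1 g v + hder u 1 f v * g v"
proof -
  obtain p where p: "\<And>t. f (v + scl t u) = poly p t" using tpolyf_line[OF assms(1), of u] unfolding tpolyf_def by metis
  obtain q where q: "\<And>t. g (v + scl t u) = poly q t" using tpolyf_line[OF assms(2), of u] unfolding tpolyf_def by metis
  have "v + scl 0 u = v" by auto
  then have 0: "coeff p 0 = f v" "coeff q 0 = g v" using p[of 0] q[of 0] by (simp_all add: poly_0_coeff_0)
  have "(f * g) (v + scl t u) = poly (p * q) t" for t using p q by simp
  then have "hder u 1 (f * g) v = coeff (p * q) 1" unfolding hder_def by (rule tcoeff_poly)
  moreover have "hder u 1 f v = coeff p 1" "hder u 1 g v = coeff q 1" unfolding hder_def using p q by (auto intro: tcoeff_poly)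
  moreover have "coeff (p * q) 1 = coeff p 0 * coeff q 1 + coeff p 1 * coeff q 0"
    by (simp add: coeff_mult)
  ultimately show ?thesis using 0 by simp
qed

lemma hder_add_1: assumes "polyf n f" "polyf n (g :: _ \<Rightarrow> 'k)"
  shows "hder u j (f + g) v = hder u j f v + hder u j g v"
proof -
  obtain p where p: "\<And>t. f (v + scl t u) = poly p t" using tpolyf_line[OF assms(1), of u] unfolding tpolyf_def by metis
  obtain q where q: "\<And>t. g (v + scl t u) = poly q t" using tpolyf_line[OF assms(2), of u] unfolding tpolyf_def by metis
  have "(f + g) (v + scl t u) = poly (p + q) t" for t using p q by simp
  then have "hder u j (f + g) v = coeff (p + q) j" unfolding hder_def by (rule tcoeff_poly)
  moreover have "hder u j f v = coeff p j" "hder u j g v = coeff q j" unfolding hder_def using p q by (auto intro: tcoeff_poly)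
  ultimately show ?thesis by simp
qed

lemma hder_const: "hder u j (\<lambda>v. c) v = (if j = 0 then c else (0 :: 'k))"
proof -
  have "hder u j (\<lambda>v. c) v = coeff [:c:] j" unfolding hder_def by (rule tcoeff_poly) simp
  then show ?thesis by (auto simp: coeff_pCons split: nat.splits)
qed

lemma hder_sum_1: assumes "\<And>a. a \<in> A \<Longrightarrow> polyf n (f a :: _ \<Rightarrow> 'k)"
  shows "hder u j (\<Sum>a\<in>A. f a) v = (\<Sum>a\<in>A. hder u j (f a) v)"
  using assms
proof (induction A rule: infinite_finite_induct)
  case (insert x F)
  have "hder u j (f x + sum f F) v = hder u j (f x) v + hder u j (sum f F) v"
    by (rule hder_add_1[of n]) (use insert in \<open>auto intro: polyf_Sum\<close>)
  moreover have "hder u j (sum f F) v = (\<Sum>a\<in>F. hder u j (f a) v)" using insert by blast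
  ultimately show ?case unfolding sum.insert[OF insert(1,2)] by (simp only:)
qed (use hder_const[of u j 0 v] in \<open>auto simp: zero_fun_def\<close>)

lemma hder_scl_1: assumes "polyf n (f :: _ \<Rightarrow> 'k)" shows "hder u j (scl c f) v = c * hder u j f v"
proof -
  obtain p where p: "\<And>t. f (v + scl t u) = poly p t" using tpolyf_line[OF assms(1), of u] unfolding tpolyf_def by metis
  have "(scl c f) (v + scl t u) = poly (smult c p) t" for t using p by simp
  then have "hder u j (scl c f) v = coeff (smult c p) j" unfolding hder_def by (rule tcoeff_poly)
  moreover have "hder u j f v = coeff p j" unfolding hder_def using p by (auto intro: tcoeff_poly)
  ultimately show ?thesis by simp
qed

lemma hder_1_linear: assumes "\<And>t. f (v + scl t u) = f v + t * c" shows "hder u 1 f v = (c :: 'k)"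
proof -
  have "hder u 1 f v = coeff [:f v, c:] 1" unfolding hder_def by (rule tcoeff_poly) (simp add: assms mult.commute)
  then show ?thesis by simp
qed

text \<open>A sum of products of two factors lies in the square of the ideal of all factors, so it
  vanishes to second order where they vanish.\<close>

lemma low_zero_locus: assumes "low n C e (F :: _ \<Rightarrow> 'k)"
  shows "\<exists>\<Phi>. form_set n (e - 1) \<Phi> \<and> card \<Phi> \<le> 2 * C \<and>
    (\<forall>z. (\<forall>\<phi>\<in>\<Phi>. snd \<phi> z = 0) \<longrightarrow> F z = 0 \<and> (\<forall>u. hder u 1 F z = 0))"
proof -
  obtain s g h al where s: "s \<le> C" and
    gh: "\<forall>i<s. 1 \<le> al i \<and> al i < e \<and> form n (al i) (g i) \<and> form n (e - al i) (h i)" "F = (\<Sum>i<(s::nat). g i * h i)"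
    using assms unfolding low_def by blast
  define G where "G = (\<lambda>i. (al i, g i)) ` {..<s} \<union> (\<lambda>i. (e - al i, h i)) ` {..<s}"
  have "card G \<le> s + s" unfolding G_def
    by (rule order.trans[OF card_Un_le]) (intro add_mono card_image_le[THEN order.trans], auto)
  then have c: "card G \<le> 2 * C" using s by simp
  have w: "form_set n (e - 1) G" unfolding form_set_def
  proof (intro conjI ballI)
    show "finite G" by (auto simp: G_def)
    fix x assume "x \<in> G"
    then obtain i where i: "i < s" "x = (al i, g i) \<or> x = (e - al i, h i)" by (auto simp: G_def)
    have "1 \<le> al i" "al i < e" "form n (al i) (g i)" "form n (e - al i) (h i)" using gh(1) i(1) by auto
    then show "1 \<le> fst x" "fst x \<le> e - 1" "form n (fst x) (snd x)" using i(2) by auto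
  qed
  have z: "F z = 0 \<and> (\<forall>u. hder u 1 F z = 0)" if "\<forall>\<phi>\<in>G. snd \<phi> z = 0" for z
  proof -
    have 0: "g i z = 0" "h i z = 0" if "i < s" for i
    proof -
      have "(al i, g i) \<in> G" "(e - al i, h i) \<in> G" using that by (auto simp: G_def)
      then show "g i z = 0" "h i z = 0" using \<open>\<forall>\<phi>\<in>G. snd \<phi> z = 0\<close> by fastforce+
    qed
    have p: "polyf n (g i)" "polyf n (h i)" if "i < s" for i using gh(1) that form_polyf by blast+
    have "hder u 1 F z = 0" for u
    proof -
      have "hder u 1 F z = (\<Sum>i<s. hder u 1 (g i * h i) z)" unfolding gh(2)
        by (rule hder_sum_1[of _ n]) (use p in \<open>auto intro: polyf_times\<close>)
      also have "\<dots> = 0"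
      proof (intro sum.neutral ballI)
        fix i assume "i \<in> {..<s}"
        then show "hder u 1 (g i * h i) z = 0" using hder_mult_1[OF p, of i i u z] 0[of i] by simp
      qed
      finally show ?thesis .
    qed
    moreover have "F z = 0" unfolding gh(2) by (simp add: sum_apply 0)
    ultimately show ?thesis by blast
  qed
  show ?thesis using c w z by blast
qed

text \<open>The model is a sum of \<open>z^(e-1) t\<close> over many pairs of variables. If
  \<open>F\<close> were low, its differential would vanish at the common zeros of at most
  \<open>2 * C\<close> forms of degree below \<open>e\<close>; as the derivative in direction
  \<open>\<tau> i\<close> is \<open>u * z i ^ (e - 1)\<close>, all coordinates in \<open>I\<close>
  would vanish there, which \<open>nonzero_coordinate_point\<close> excludes for large
  \<open>I\<close>.\<close>

lemma hyperbolic_not_low: assumes "dense_fibres (e - 1)"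
  shows "\<exists>M. \<forall>n I \<tau> u F. I \<subseteq> {..<n} \<longrightarrow> card I > M \<longrightarrow> u \<noteq> (0::'k) \<longrightarrow>
    (\<forall>i\<in>I. \<forall>z t. F (z + scl t (unit_vec (\<tau> i))) = F z + t * (u * z i ^ (e - 1))) \<longrightarrow> \<not> low n C e (F :: _ \<Rightarrow> 'k)"
proof -
  obtain B where B: "\<And>n \<Phi> I. form_set n (e - 1) \<Phi> \<Longrightarrow> card \<Phi> \<le> 2 * C \<Longrightarrow> I \<subseteq> {..<n} \<Longrightarrow> card I > B \<Longrightarrow>
    (\<exists>z. (\<forall>\<phi>\<in>\<Phi>. snd \<phi> z = (0::'k)) \<and> (\<exists>i\<in>I. z i \<noteq> 0))" using nonzero_coordinate_point[OF assms] by blast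
  show ?thesis
  proof (rule exI[of _ B], intro allI impI notI)
    fix n I and \<tau> :: "nat \<Rightarrow> nat" and u :: 'k and F :: "'k pfun"
    assume a: "I \<subseteq> {..<n}" "card I > B" "u \<noteq> 0"
      "\<forall>i\<in>I. \<forall>z t. F (z + scl t (unit_vec (\<tau> i))) = F z + t * (u * z i ^ (e - 1))" "low n C e F"
    obtain \<Phi> where P: "form_set n (e - 1) \<Phi>" "card \<Phi> \<le> 2 * C" "\<And>z. (\<forall>\<phi>\<in>\<Phi>. snd \<phi> z = 0) \<Longrightarrow> (\<forall>u. hder u 1 F z = 0)"
      using low_zero_locus[OF a(5)] by blast
    obtain z i where z: "\<forall>\<phi>\<in>\<Phi>. snd \<phi> z = 0" "i \<in> I" "z i \<noteq> 0" using B[OF P(1,2) a(1,2)] by blast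
    have "hder (unit_vec (\<tau> i)) 1 F z = u * z i ^ (e - 1)" by (rule hder_1_linear) (use a(4) z in blast)
    then show False using P(3)[OF z(1)] a(3) z(3) by simp
  qed
qed

text \<open>On the diagonal \<open>w = x\<close> the differential becomes \<open>d\<close> times
  \<open>f\<close>, and restriction along a linear map preserves \<open>low\<close> with the same
  bound; so \<open>C = c\<close> works.\<close>

lemma strong_deriv_if_nonzero_degree: assumes "of_nat d \<noteq> (0::'k)" shows "strong_deriv d"
  unfolding strong_deriv_def
proof (intro allI, rule_tac x = c in exI, intro allI impI notI)
  fix c n and f :: "'k pfun"
  assume f: "form n d f" "\<not> low n c d f" and l: "low (2 * n) c d (\<lambda>z. hder (\<lambda>i. z (i + n)) 1 f z)"
  define L where "L = (\<lambda>(z :: nat \<Rightarrow> 'k) i. if i < n then z i else z (i - n))"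
  have "polyf n (\<lambda>z :: nat \<Rightarrow> 'k. L z i)" if "i < 2 * n" for i
    proof (cases "i < n")
    case True
    then show ?thesis using polyf_var[of i n] by (simp add: L_def)
  next
    case False
    then have "i - n < n" using that by auto
    then show ?thesis using polyf_var[of "i - n" n] False by (simp add: L_def)
  qed
  then have lm: "linmap (2 * n) n L" unfolding linmap_def form_def by (auto simp: L_def)
  have "hder (\<lambda>i. L z (i + n)) 1 f (L z) = of_nat d * f z" for z
  proof -
    have "hder (\<lambda>i. L z (i + n)) 1 f (L z) = hder z 1 f z"
      by (rule hder_1_cong, rule polyf_cong_coords[OF form_polyf[OF f(1)]]) (simp add: L_def)
    also have "\<dots> = coeff ([:1, 1:] ^ d * [:f z:]) 1" unfolding hder_def
    proof (rule tcoeff_poly)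
      fix t
      have "z + scl t z = scl (1 + t) z" by (auto simp: algebra_simps)
      then show "f (z + scl t z) = poly ([:1, 1:] ^ d * [:f z:]) t" using form_scl[OF f(1)] by simp
    qed
    also have "\<dots> = of_nat d * f z"
    proof -
      have "coeff ([:1, 1::'k:] ^ d) 1 = of_nat d \<and> coeff ([:1, 1::'k:] ^ d) 0 = 1" by (induction d) auto
      then show ?thesis by (simp add: mult.commute)
    qed
    finally show ?thesis .
  qed
  then have "low n c d (\<lambda>z. of_nat d * f z)" using low_pull[OF lm l] by simp
  from low_scl[OF this, of "inverse (of_nat d)"] have "low n c d (\<lambda>z. inverse (of_nat d) * (of_nat d * f z))" unfolding scl_def .
  moreover have "inverse (of_nat d) * (of_nat d * f z) = f z" for z using assms by simp
  ultimately have "low n c d f" by (simp only:)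
  then show False using f(2) by simp
qed

section \<open>Blocks in Brauer's method\<close>

text \<open>Orthogonality in Brauer's sense for a plane instead of a vector: there are no mixed
  terms between the span of \<open>U\<close> and the plane, and members of degree other than
  \<open>e\<close> do not notice the plane.\<close>

definition orth_pair :: "'k dform set \<Rightarrow> nat \<Rightarrow> (nat \<Rightarrow> 'k) set \<Rightarrow> (nat \<Rightarrow> 'k) \<Rightarrow> (nat \<Rightarrow> 'k) \<Rightarrow> bool" where
  "orth_pair S e U x w \<longleftrightarrow> (\<forall>y\<in>S. \<forall>u\<in>fs.span U. \<forall>s t. snd y (u + (scl s x + scl t w)) =
     snd y u + (if fst y = e then snd y (scl s x + scl t w) else 0))"

text \<open>The values \<open>G y j\<close> are the coefficients of \<open>s^(e-j) t^j\<close> in \<open>snd y (s x + t w)\<close>.\<close>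

definition available :: "'k dform set \<Rightarrow> nat \<Rightarrow> nat \<Rightarrow> (('k dform \<Rightarrow> nat \<Rightarrow> 'k) \<Rightarrow> bool) \<Rightarrow> bool" where
  "available S e m Q \<longleftrightarrow> (\<forall>U. finite U \<longrightarrow> card U \<le> m \<longrightarrow> (\<exists>x w. orth_pair S e U x w \<and> Q (\<lambda>y j. hder w j (snd y) x)))"

text \<open>The second pair is orthogonal to \<open>U\<close> and to the first pair, so adding
  multiples keeps orthogonality to \<open>U\<close> and produces no mixed terms between the two
  pairs.\<close>

lemma orth_pair_comb:
  assumes "orth_pair S e U x w" "orth_pair S e U' x' w'" "U \<subseteq> fs.span U'" "x \<in> fs.span U'" "w \<in> fs.span U'"
  shows "orth_pair S e U (scl s x + scl s' x') (scl t w + scl t' w')"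
    and "y \<in> S \<Longrightarrow> fst y = e \<Longrightarrow> snd y (scl a (scl s x + scl s' x') + scl b (scl t w + scl t' w')) =
      snd y (scl (a * s) x + scl (b * t) w) + snd y (scl (a * s') x' + scl (b * t') w')"
proof -
  have eq: "u + (scl a (scl s x + scl s' x') + scl b (scl t w + scl t' w')) =
    (u + (scl (a * s) x + scl (b * t) w)) + (scl (a * s') x' + scl (b * t') w')" for u :: "nat \<Rightarrow> 'k" and a b
    by (rule ext) (simp add: algebra_simps)
  have eq0: "scl a (scl s x + scl s' x') + scl b (scl t w + scl t' w') =
    (scl (a * s) x + scl (b * t) w) + (scl (a * s') x' + scl (b * t') w')" for a b
    by (rule ext) (simp add: algebra_simps)
  have in2: "scl a x + scl b w \<in> fs.span U'" for a b using assms(4,5) by (intro fs.span_add fs.span_scale)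
  have sub: "u \<in> fs.span U'" if "u \<in> fs.span U" for u
    using fs.span_minimal[OF assms(3) fs.subspace_span] that by blast
  show 2: "snd y (scl a (scl s x + scl s' x') + scl b (scl t w + scl t' w')) =
      snd y (scl (a * s) x + scl (b * t) w) + snd y (scl (a * s') x' + scl (b * t') w')" if "y \<in> S" "fst y = e" for a b y
    using assms(2)[unfolded orth_pair_def, rule_format, OF that(1) in2, of "a * s" "b * t" "a * s'" "b * t'"] that(2)
    unfolding eq0 by simp
  show "orth_pair S e U (scl s x + scl s' x') (scl t w + scl t' w')"
    unfolding orth_pair_def
  proof (intro ballI allI)
    fix y u a b assume y: "y \<in> S" and u: "u \<in> fs.span U"
    have "u + (scl (a * s) x + scl (b * t) w) \<in> fs.span U'" by (rule fs.span_add[OF sub[OF u] in2])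
    from assms(2)[unfolded orth_pair_def, rule_format, OF y this, of "a * s'" "b * t'"]
      assms(1)[unfolded orth_pair_def, rule_format, OF y u, of "a * s" "b * t"]
    show "snd y (u + (scl a (scl s x + scl s' x') + scl b (scl t w + scl t' w'))) = snd y u +
       (if fst y = e then snd y (scl a (scl s x + scl s' x') + scl b (scl t w + scl t' w')) else 0)"
      unfolding eq using 2[OF y, of a b] by (cases "fst y = e") (simp_all only: if_True if_False add.assoc add_0_right refl)
  qed
qed

lemma orth_pair_comb_hder:
  assumes "orth_pair S e U' x' w'" "x \<in> fs.span U'" "w \<in> fs.span U'" "form_set n d S" "y \<in> S" "fst y = e" "j \<le> e"
  shows "hder (scl t w + scl t' w') j (snd y) (scl s x + scl s' x') =
     s ^ (e - j) * t ^ j * hder w j (snd y) x + s' ^ (e - j) * t' ^ j * hder w' j (snd y) x'"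
proof -
  have o: "orth_pair S e {} 0 0"
    unfolding orth_pair_def fs.span_empty
  proof (intro ballI allI)
    fix y u s t assume "y \<in> S" "u \<in> {0 :: nat \<Rightarrow> 'k}"
    have "snd y 0 = 0" using form_at_0[of n "fst y" "snd y"] assms(4) \<open>y \<in> S\<close> by (auto simp: form_set_def)
    moreover have "scl s 0 + scl t 0 = (0 :: nat \<Rightarrow> 'k)" by (rule ext) simp
    moreover have "u = 0" using \<open>u \<in> {0}\<close> by (simp only: singleton_iff)
    ultimately show "snd y (u + (scl s 0 + scl t 0)) = snd y u + (if fst y = e then snd y (scl s 0 + scl t 0) else 0)"
      by (simp only: add_0_right if_cancel)
  qed
  have h: "form n e (snd y)" using assms(4-6) by (auto simp: form_set_def)
  have E: "snd y ((scl s x + scl s' x') + scl b (scl t w + scl t' w')) =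
    (\<Sum>j\<le>e. (s ^ (e - j) * t ^ j * hder w j (snd y) x + s' ^ (e - j) * t' ^ j * hder w' j (snd y) x') * b ^ j)" for b
  proof -
    have z: "scl s x + scl s' x' + scl b (scl t w + scl t' w') = 0 + ((scl s x + scl (b * t) w) + (scl s' x' + scl (b * t') w'))"
      by (rule ext) (simp add: algebra_simps)
    have "scl s x + scl (b * t) w \<in> fs.span U'" using assms(2,3) by (intro fs.span_add fs.span_scale)
    from assms(1)[unfolded orth_pair_def, rule_format, OF assms(5) this, of s' "b * t'"]
    have "snd y (scl s x + scl s' x' + scl b (scl t w + scl t' w')) = snd y (scl s x + scl (b * t) w) + snd y (scl s' x' + scl (b * t') w')"
      unfolding z assms(6) by (simp only: if_True add_0_left refl)
    also have "\<dots> = (\<Sum>j\<le>e. s ^ (e - j) * (b * t) ^ j * hder w j (snd y) x) + (\<Sum>j\<le>e. s' ^ (e - j) * (b * t') ^ j * hder w' j (snd y) x')"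
      by (simp only: hder_biexp[OF h])
    also have "\<dots> = (\<Sum>j\<le>e. (s ^ (e - j) * t ^ j * hder w j (snd y) x + s' ^ (e - j) * t' ^ j * hder w' j (snd y) x') * b ^ j)"
      unfolding sum.distrib[symmetric] by (rule sum.cong) (auto simp: power_mult_distrib algebra_simps)
    finally show ?thesis .
  qed
  from tcoeff_sum[OF E, of j] show ?thesis unfolding hder_def[of "scl t w + scl t' w'"] using assms(7) by simp
qed

lemma available_mono: "available S e m Q \<Longrightarrow> m' \<le> m \<Longrightarrow> (\<And>G. Q G \<Longrightarrow> Q' G) \<Longrightarrow> available S e m' Q'"
  unfolding available_def by (meson order.trans)

text \<open>The second pair is chosen after the first and orthogonal to it, which costs two more
  vectors; its property \<open>Q2\<close> may depend on the coefficients of the first. The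
  coefficients of the combination are then weighted sums of those of the two pairs.\<close>

lemma available_comb:
  assumes "form_set n d S" "available S e m Q1" "\<And>G. Q1 G \<Longrightarrow> available S e (m + 2) (Q2 G)"
    "\<And>G G'. Q1 G \<Longrightarrow> Q2 G G' \<Longrightarrow> \<exists>s t s' t'. \<forall>H. (\<forall>y\<in>S. fst y = e \<longrightarrow> (\<forall>j\<le>e. H y j = s ^ (e - j) * t ^ j * G y j + s' ^ (e - j) * t' ^ j * G' y j)) \<longrightarrow> Q3 H"
  shows "available S e m Q3"
  unfolding available_def
proof (intro allI impI)
  fix U :: "(nat \<Rightarrow> 'k) set" assume U: "finite U" "card U \<le> m"
  obtain x w where x: "orth_pair S e U x w" "Q1 (\<lambda>y j. hder w j (snd y) x)" using assms(2) U unfolding available_def by blast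
  define U' where "U' = insert x (insert w U)"
  have "card U' \<le> Suc (Suc m)" unfolding U'_def
    using card_insert_le_m1[of "Suc (Suc m)" "insert w U" x] card_insert_le_m1[of "Suc m" U w] U(2) by simp
  then have U': "finite U'" "card U' \<le> m + 2" using U(1) by (auto simp: U'_def)
  obtain x' w' where x': "orth_pair S e U' x' w'" "Q2 (\<lambda>y j. hder w j (snd y) x) (\<lambda>y j. hder w' j (snd y) x')"
    using assms(3)[OF x(2)] U' unfolding available_def by blast
  have sp: "U \<subseteq> fs.span U'" "x \<in> fs.span U'" "w \<in> fs.span U'" using fs.span_superset[of U'] by (auto simp: U'_def)
  obtain s t s' t' where H: "\<And>H. (\<forall>y\<in>S. fst y = e \<longrightarrow> (\<forall>j\<le>e. H y j = s ^ (e - j) * t ^ j * hder w j (snd y) x + s' ^ (e - j) * t' ^ j * hder w' j (snd y) x')) \<Longrightarrow> Q3 H"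
    using assms(4)[OF x(2) x'(2)] by blast
  have "Q3 (\<lambda>y j. hder (scl t w + scl t' w') j (snd y) (scl s x + scl s' x'))"
    by (rule H) (intro ballI impI allI orth_pair_comb_hder[OF x'(1) sp(2,3) assms(1)])
  then show "\<exists>x w. orth_pair S e U x w \<and> Q3 (\<lambda>y j. hder w j (snd y) x)"
    using orth_pair_comb(1)[OF x(1) x'(1) sp, of s s' t t'] by blast
qed

text \<open>The weights \<open>\<sigma>\<close> of the first vectors and \<open>\<tau>\<close> of
  the second ones are independent; the substitution that removes coefficients needs both.\<close>

definition block_family :: "'k dform set \<Rightarrow> nat \<Rightarrow> nat \<Rightarrow> (nat \<Rightarrow> 'k) set \<Rightarrow>
    (('k dform \<Rightarrow> nat \<Rightarrow> 'k) \<Rightarrow> bool) \<Rightarrow> (nat \<Rightarrow> nat \<Rightarrow> 'k) \<Rightarrow> (nat \<Rightarrow> nat \<Rightarrow> 'k) \<Rightarrow> bool" where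
  "block_family S e N U Q x w \<longleftrightarrow> (\<forall>i<(N::nat). Q (\<lambda>y j. hder (w i) j (snd y) (x i))) \<and>
    (\<forall>\<sigma> \<tau>. orth_pair S e U (\<Sum>i<N. scl (\<sigma> i) (x i)) (\<Sum>i<N. scl (\<tau> i) (w i)) \<and>
      (\<forall>y\<in>S. fst y = e \<longrightarrow> (\<forall>j\<le>e. hder (\<Sum>i<N. scl (\<tau> i) (w i)) j (snd y) (\<Sum>i<N. scl (\<sigma> i) (x i)) =
         (\<Sum>i<N. \<sigma> i ^ (e - j) * \<tau> i ^ j * hder (w i) j (snd y) (x i)))))"

lemma block_familyD: assumes "block_family S e N U Q x w"
  shows "i < N \<Longrightarrow> Q (\<lambda>y j. hder (w i) j (snd y) (x i))"
    "orth_pair S e U (\<Sum>i<N. scl (\<sigma> i) (x i)) (\<Sum>i<N. scl (\<tau> i) (w i))"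
    "y\<in>S \<Longrightarrow> fst y = e \<Longrightarrow> j\<le>e \<Longrightarrow> hder (\<Sum>i<N. scl (\<tau> i) (w i)) j (snd y) (\<Sum>i<N. scl (\<sigma> i) (x i)) =
         (\<Sum>i<N. \<sigma> i ^ (e - j) * \<tau> i ^ j * hder (w i) j (snd y) (x i))"
proof -
  note 1 = assms[unfolded block_family_def, THEN conjunct1, rule_format]
  note 2 = assms[unfolded block_family_def, THEN conjunct2, THEN spec, THEN spec]
  show "i < N \<Longrightarrow> Q (\<lambda>y j. hder (w i) j (snd y) (x i))" by (rule 1)
  show "orth_pair S e U (\<Sum>i<N. scl (\<sigma> i) (x i)) (\<Sum>i<N. scl (\<tau> i) (w i))" by (rule 2[THEN conjunct1])
  show "y\<in>S \<Longrightarrow> fst y = e \<Longrightarrow> j\<le>e \<Longrightarrow> hder (\<Sum>i<N. scl (\<tau> i) (w i)) j (snd y) (\<Sum>i<N. scl (\<sigma> i) (x i)) =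
         (\<Sum>i<N. \<sigma> i ^ (e - j) * \<tau> i ^ j * hder (w i) j (snd y) (x i))"
    by (rule 2[THEN conjunct2, rule_format])
qed

lemma available_family:
  assumes "form_set n d S" "1 \<le> e" "available S e (m + 2 * N) Q" "finite U" "card U \<le> m"
  shows "\<exists>x w. block_family S e N U Q x w"
  using assms(3)
proof (induction N)
  case 0
  have s0: "snd y 0 = 0" if "y \<in> S" for y using form_at_0[of n "fst y" "snd y"] assms(1) that by (auto simp: form_set_def)
  have z: "scl s 0 + scl t 0 = (0 :: nat \<Rightarrow> 'k)" for s t by (rule ext) simp
  have o: "orth_pair S e U 0 0" unfolding orth_pair_def
  proof (intro ballI allI)
    fix y and u :: "nat \<Rightarrow> 'k" and s t assume "y \<in> S"
    show "snd y (u + (scl s 0 + scl t 0)) = snd y u + (if fst y = e then snd y (scl s 0 + scl t 0) else 0)"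
      using s0[OF \<open>y \<in> S\<close>] by (simp only: z add_0_right if_cancel)
  qed
  have "hder 0 j (snd y) 0 = 0" if "y \<in> S" for y j
  proof -
    have "0 + scl t 0 = (0 :: nat \<Rightarrow> 'k)" for t by (rule ext) simp
    then have "snd y (0 + scl t 0) = poly 0 t" for t using s0[OF that] by (simp only: poly_0)
    then have "hder 0 j (snd y) 0 = coeff 0 j" unfolding hder_def by (rule tcoeff_poly)
    then show ?thesis by simp
  qed
  then show ?case using o
    unfolding block_family_def by (intro exI[of _ "\<lambda>_. 0"] conjI allI ballI impI) (simp_all only: lessThan_0 sum.empty not_less_zero)
next
  case (Suc N)
  have "available S e (m + 2 * N) Q" using Suc.prems by (rule available_mono) auto
  from Suc.IH[OF this] obtain x w where "block_family S e N U Q x w" by blast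
  note xw = block_familyD[OF this]
  define U' where "U' = U \<union> (x ` {..<N} \<union> w ` {..<N})"
  have fin: "finite U'" using assms(4) by (auto simp: U'_def)
  have "card U' \<le> card U + (card (x ` {..<N}) + card (w ` {..<N}))"
    unfolding U'_def by (intro order.trans[OF card_Un_le] add_mono card_Un_le order_refl)
  also have "\<dots> \<le> m + (N + N)" using assms(5) card_image_le[of "{..<N}" x] card_image_le[of "{..<N}" w] by simp
  finally have "card U' \<le> m + 2 * Suc N" by simp
  then obtain x' w' where x': "orth_pair S e U' x' w'" "Q (\<lambda>y j. hder w' j (snd y) x')"
    using Suc.prems fin unfolding available_def by blast
  define X where "X = (\<lambda>i. if i < N then x i else x')"
  define W where "W = (\<lambda>i. if i < N then w i else w')"
  have base: "a \<in> fs.span U'" if "a \<in> U'" for a using fs.span_superset[of U'] that by blast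
  have sp1: "U \<subseteq> fs.span U'" using base by (auto simp: U'_def)
  have sp2: "(\<Sum>i<N. scl (\<sigma> i) (x i)) \<in> fs.span U'" "(\<Sum>i<N. scl (\<sigma> i) (w i)) \<in> fs.span U'" for \<sigma>
    by (rule fs.span_sum, rule fs.span_scale, rule base, simp add: U'_def)+
  have sum_eq: "(\<Sum>i<Suc N. scl (\<sigma> i) (X i)) = scl 1 (\<Sum>i<N. scl (\<sigma> i) (x i)) + scl (\<sigma> N) x'"
     "(\<Sum>i<Suc N. scl (\<sigma> i) (W i)) = scl 1 (\<Sum>i<N. scl (\<sigma> i) (w i)) + scl (\<sigma> N) w'" for \<sigma>
  proof -
    have one: "scl 1 a = a" for a :: "nat \<Rightarrow> 'k" by (rule ext) simp
    have "(\<Sum>i<N. scl (\<sigma> i) (X i)) = (\<Sum>i<N. scl (\<sigma> i) (x i))" "(\<Sum>i<N. scl (\<sigma> i) (W i)) = (\<Sum>i<N. scl (\<sigma> i) (w i))"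
      by (rule sum.cong, auto simp: X_def W_def)+
    then show "(\<Sum>i<Suc N. scl (\<sigma> i) (X i)) = scl 1 (\<Sum>i<N. scl (\<sigma> i) (x i)) + scl (\<sigma> N) x'"
     "(\<Sum>i<Suc N. scl (\<sigma> i) (W i)) = scl 1 (\<Sum>i<N. scl (\<sigma> i) (w i)) + scl (\<sigma> N) w'"
      unfolding one sum.lessThan_Suc by (simp_all only: X_def W_def less_irrefl if_False)
  qed
  show ?case unfolding block_family_def
  proof (rule exI[of _ X], rule exI[of _ W], intro conjI allI impI ballI)
    fix i assume "i < Suc N"
    then show "Q (\<lambda>y j. hder (W i) j (snd y) (X i))" using xw(1)[of i] x'(2) by (cases "i < N") (simp_all only: X_def W_def if_True if_False)
  next
    fix \<sigma> \<tau>
    show "orth_pair S e U (\<Sum>i<Suc N. scl (\<sigma> i) (X i)) (\<Sum>i<Suc N. scl (\<tau> i) (W i))"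
      unfolding sum_eq by (rule orth_pair_comb(1)[OF xw(2) x'(1) sp1 sp2])
    fix y j assume y: "y \<in> S" "fst y = e" "j \<le> e"
    have "hder (\<Sum>i<Suc N. scl (\<tau> i) (W i)) j (snd y) (\<Sum>i<Suc N. scl (\<sigma> i) (X i)) =
      1 ^ (e - j) * 1 ^ j * (\<Sum>i<N. \<sigma> i ^ (e - j) * \<tau> i ^ j * hder (w i) j (snd y) (x i)) + \<sigma> N ^ (e - j) * \<tau> N ^ j * hder w' j (snd y) x'"
      unfolding sum_eq orth_pair_comb_hder[OF x'(1) sp2 assms(1) y] xw(3)[OF y] ..
    also have "\<dots> = (\<Sum>i<Suc N. \<sigma> i ^ (e - j) * \<tau> i ^ j * hder (W i) j (snd y) (X i))"
      unfolding sum.lessThan_Suc power_one mult_1_left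
      by (intro arg_cong2[where f = plus] sum.cong refl) (simp_all only: X_def W_def lessThan_iff if_True less_irrefl if_False)
    finally show "hder (\<Sum>i<Suc N. scl (\<tau> i) (W i)) j (snd y) (\<Sum>i<Suc N. scl (\<sigma> i) (X i)) =
        (\<Sum>i<Suc N. \<sigma> i ^ (e - j) * \<tau> i ^ j * hder (W i) j (snd y) (X i))" .
  qed
qed

lemma avoid_root: assumes "A \<noteq> (0::'k)" "0 < m" shows "\<exists>r. r \<noteq> 0 \<and> A * r ^ m + B \<noteq> 0"
proof -
  define p where "p = monom A m + [:B:]"
  have "coeff p m = A" using assms(2) by (auto simp: p_def coeff_pCons split: nat.splits)
  then have "p \<noteq> 0" using assms(1) by auto
  then obtain t where "t \<notin> {0}" "poly p t \<noteq> 0" using poly_nonzero_avoid[of p "{0}"] by blast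
  then show ?thesis by (auto simp: p_def poly_monom)
qed

definition diag_solv :: "nat \<Rightarrow> nat \<Rightarrow> bool" where
  "diag_solv e N \<longleftrightarrow> (\<forall>a :: nat \<Rightarrow> 'k. \<exists>l :: nat \<Rightarrow> 'k. (\<exists>i<N. l i \<noteq> 0) \<and> (\<Sum>i<N. a i * l i ^ e) = 0)"

text \<open>Substituting \<open>\<sigma> i = l i \<rho>^j0\<close> and \<open>\<tau> i = l i \<rho>^-(e-j0)\<close> keeps the coefficient of
  \<open>\<sigma>^(e-j0) \<tau>^j0\<close> but rescales that of \<open>\<sigma>^(e-1) \<tau>\<close>, which therefore can be kept nonzero.\<close>

lemma available_kill:
  assumes "form_set n e S" "1 \<le> e" "diag_solv e N" "y0 \<in> S" "fst y0 = e" "2 \<le> j0" "j0 \<le> e"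
    "Zs \<subseteq> {y\<in>S. fst y = e} \<times> {..e}"
    "available S e (m + 2 * N) (\<lambda>G. (\<forall>z\<in>Zs. G (fst z) (snd z) = 0) \<and> (\<Sum>y\<in>{y\<in>S. fst y = e}. u y * G y 1) \<noteq> 0)"
  shows "available S e m (\<lambda>G. (\<forall>z\<in>insert (y0, j0) Zs. G (fst z) (snd z) = 0) \<and> (\<Sum>y\<in>{y\<in>S. fst y = e}. u y * G y 1) \<noteq> 0)"
  unfolding available_def
proof (intro allI impI)
  fix U :: "(nat \<Rightarrow> 'k) set" assume U: "finite U" "card U \<le> m"
  define T where "T = {y\<in>S. fst y = e}"
  obtain x w where "block_family S e N U (\<lambda>G. (\<forall>z\<in>Zs. G (fst z) (snd z) = 0) \<and> (\<Sum>y\<in>{y\<in>S. fst y = e}. u y * G y 1) \<noteq> 0) x w"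
    using available_family[OF assms(1,2,9) U] by blast
  note xw = block_familyD[OF this, folded T_def]
  define G where "G = (\<lambda>i (y :: 'k dform) j. hder (w i) j (snd y) (x i))"
  \<comment> \<open>A diagonal equation of degree \<open>e\<close> in the coefficients to be
    removed; its nontrivial solution comes from the Brauer condition.\<close>
  obtain l i1 where l: "i1 < N" "l i1 \<noteq> 0" "(\<Sum>i<N. G i y0 j0 * l i ^ e) = 0"
    using assms(3)[unfolded diag_solv_def, rule_format, of "\<lambda>i. G i y0 j0"] by (elim exE conjE)
  \<comment> \<open>\<open>H i\<close> is the share of the pair \<open>i\<close> in the quantity
    that has to stay nonzero, before rescaling. Only the pair \<open>i1\<close> is rescaled; the
    quantity then depends on \<open>r\<close> through a power with exponent
    \<open>e * (j0 - 1)\<close>, positive as \<open>j0\<close> is at least 2, so some nonzero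
    \<open>r\<close> avoids the value \<open>0\<close>.\<close>
  define H where "H = (\<lambda>i. l i ^ e * (\<Sum>y\<in>T. u y * G i y 1))"
  have "H i1 \<noteq> 0" using xw(1)[OF l(1)] l(2) by (simp add: H_def G_def)
  moreover have "0 < e * (j0 - 1)" using assms(2,6) by simp
  ultimately obtain r where r: "r \<noteq> 0" "H i1 * r ^ (e * (j0 - 1)) + (\<Sum>i\<in>{..<N}-{i1}. H i) \<noteq> 0" using avoid_root by blast
  define rr where "rr = (\<lambda>i. if i = i1 then r else 1)"
  have rr: "rr i \<noteq> 0" for i using r(1) by (simp add: rr_def)
  define \<sigma> where "\<sigma> = (\<lambda>i. l i * rr i ^ j0)"
  define \<tau> where "\<tau> = (\<lambda>i. l i * inverse (rr i) ^ (e - j0))"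
  have A: "\<sigma> i ^ (e - j0) * \<tau> i ^ j0 = l i ^ e" for i
  proof -
    have "\<sigma> i ^ (e - j0) * \<tau> i ^ j0 = (l i ^ (e - j0) * l i ^ j0) * ((rr i ^ (j0 * (e - j0))) * inverse (rr i) ^ ((e - j0) * j0))"
      by (simp add: \<sigma>_def \<tau>_def power_mult_distrib power_mult)
    also have "l i ^ (e - j0) * l i ^ j0 = l i ^ e" using assms(7) by (simp add: power_add[symmetric])
    also have "rr i ^ (j0 * (e - j0)) * inverse (rr i) ^ ((e - j0) * j0) = 1"
      using rr[of i] by (simp add: mult.commute power_inverse)
    finally show ?thesis by simp
  qed
  have B: "\<sigma> i ^ (e - 1) * \<tau> i ^ 1 = l i ^ e * rr i ^ (e * (j0 - 1))" for i
  proof -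
    have ex: "j0 * (e - 1) = e * (j0 - 1) + (e - j0)"
    proof -
      obtain a b where "j0 = Suc (Suc a)" "e = j0 + b" using assms(6,7) by (metis add_2_eq_Suc le_Suc_ex)
      then show ?thesis by (simp add: algebra_simps)
    qed
    have "\<sigma> i ^ (e - 1) * \<tau> i ^ 1 = (l i ^ (e - 1) * l i) * (rr i ^ (j0 * (e - 1)) * inverse (rr i) ^ (e - j0))"
      by (simp add: \<sigma>_def \<tau>_def power_mult_distrib power_mult)
    also have "l i ^ (e - 1) * l i = l i ^ e" using assms(2) by (metis Suc_diff_le diff_Suc_1 One_nat_def power_Suc2)
    also have "rr i ^ (j0 * (e - 1)) * inverse (rr i) ^ (e - j0) = rr i ^ (e * (j0 - 1))"
      unfolding ex using rr[of i] by (simp add: power_add power_inverse)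
    finally show ?thesis .
  qed
  let ?X = "\<Sum>i<N. scl (\<sigma> i) (x i)" and ?W = "\<Sum>i<N. scl (\<tau> i) (w i)"
  have 1: "hder ?W (snd z) (snd (fst z)) ?X = 0" if "z \<in> insert (y0, j0) Zs" for z
  proof (cases "z = (y0, j0)")
    case True
    have "hder ?W j0 (snd y0) ?X = (\<Sum>i<N. G i y0 j0 * l i ^ e)"
      unfolding xw(3)[OF assms(4,5,7)] A by (rule sum.cong) (simp_all add: G_def)
    then show ?thesis using l(3) True by simp
  next
    case False
    then have z: "z \<in> Zs" using that by simp
    then have "fst z \<in> S" "fst (fst z) = e" "snd z \<le> e" using assms(8) by auto
    from xw(3)[OF this] show ?thesis using xw(1) z by simp
  qed
  have "(\<Sum>y\<in>T. u y * hder ?W 1 (snd y) ?X) = (\<Sum>y\<in>T. u y * (\<Sum>i<N. l i ^ e * rr i ^ (e * (j0 - 1)) * G i y 1))"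
  proof (rule sum.cong[OF refl])
    fix y assume "y \<in> T"
    then have y: "y \<in> S" "fst y = e" by (auto simp: T_def)
    show "u y * hder ?W 1 (snd y) ?X = u y * (\<Sum>i<N. l i ^ e * rr i ^ (e * (j0 - 1)) * G i y 1)"
      unfolding xw(3)[OF y assms(2)] B G_def ..
  qed
  also have "\<dots> = (\<Sum>i<N. rr i ^ (e * (j0 - 1)) * H i)"
    unfolding H_def sum_distrib_left by (subst sum.swap) (intro sum.cong refl, simp only: ac_simps)
  also have "\<dots> = rr i1 ^ (e * (j0 - 1)) * H i1 + (\<Sum>i\<in>{..<N}-{i1}. rr i ^ (e * (j0 - 1)) * H i)"
    using l(1) by (subst sum.remove[of _ i1]) auto
  also have "(\<Sum>i\<in>{..<N}-{i1}. rr i ^ (e * (j0 - 1)) * H i) = (\<Sum>i\<in>{..<N}-{i1}. H i)"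
    by (rule sum.cong) (auto simp: rr_def)
  also have "rr i1 ^ (e * (j0 - 1)) * H i1 + (\<Sum>i\<in>{..<N}-{i1}. H i) = H i1 * r ^ (e * (j0 - 1)) + (\<Sum>i\<in>{..<N}-{i1}. H i)"
    by (simp add: rr_def)
  finally have 2: "(\<Sum>y\<in>T. u y * hder ?W 1 (snd y) ?X) \<noteq> 0" using r(2) by (simp only: not_False_eq_True)
  show "\<exists>x w. orth_pair S e U x w \<and> (\<forall>z\<in>insert (y0, j0) Zs. hder w (snd z) (snd (fst z)) x = 0) \<and> (\<Sum>y\<in>{y\<in>S. fst y = e}. u y * hder w 1 (snd y) x) \<noteq> 0"
    using xw(2)[of \<sigma> \<tau>] 1 2 unfolding T_def by blast
qed

text \<open>Each removed coefficient consumes \<open>N\<close> mutually orthogonal pairs, that is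
  \<open>2 * N\<close> vectors.\<close>

lemma available_kill_all:
  assumes "form_set n e S" "1 \<le> e" "diag_solv e N" "finite Zs" "Zs \<subseteq> {y\<in>S. fst y = e} \<times> {2..e}"
    "available S e (m + 2 * N * card Zs) (\<lambda>G. (\<Sum>y\<in>{y\<in>S. fst y = e}. u y * G y 1) \<noteq> 0)"
  shows "available S e m (\<lambda>G. (\<forall>z\<in>Zs. G (fst z) (snd z) = 0) \<and> (\<Sum>y\<in>{y\<in>S. fst y = e}. u y * G y 1) \<noteq> 0)"
  using assms(4-)
proof (induction Zs arbitrary: m rule: finite_induct)
  case empty
  show ?case by (rule available_mono[OF empty(2)]) auto
next
  case (insert z Zs)
  obtain y0 j0 where z: "z = (y0, j0)" by fastforce
  have y0: "y0 \<in> S" "fst y0 = e" "2 \<le> j0" "j0 \<le> e" using insert.prems(1) unfolding z by auto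
  have sub: "Zs \<subseteq> {y\<in>S. fst y = e} \<times> {2..e}" "Zs \<subseteq> {y\<in>S. fst y = e} \<times> {..e}" using insert.prems(1) by auto
  have "m + 2 * N + 2 * N * card Zs = m + 2 * N * card (insert z Zs)" using insert.hyps by simp
  then have "available S e (m + 2 * N + 2 * N * card Zs) (\<lambda>G. (\<Sum>y\<in>{y\<in>S. fst y = e}. u y * G y 1) \<noteq> 0)"
    using insert.prems(2) by (simp only:)
  from insert.IH[OF sub(1) this] show ?case unfolding z by (rule available_kill[OF assms(1-3) y0 sub(2)])
qed

text \<open>Gaussian elimination on the linear coefficients. To remove the one at \<open>l\<close>,
  a pair with nonzero coefficient at \<open>l\<close> is combined with a later pair. The
  coefficients of order at least 2 in \<open>Zs\<close> vanish for both pairs, so they vanish for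
  every combination.\<close>

lemma available_reduce:
  assumes "form_set n e S" "1 \<le> e" "finite J" "J \<subseteq> {y\<in>S. fst y = e}" "Zs \<subseteq> {y\<in>S. fst y = e} \<times> {2..e}"
    "\<And>m' u. m' \<le> m + 2 * card J \<Longrightarrow> (\<exists>y\<in>S. fst y = e \<and> u y \<noteq> 0) \<Longrightarrow>
      available S e m' (\<lambda>G. (\<forall>z\<in>Zs. G (fst z) (snd z) = 0) \<and> (\<Sum>y\<in>{y\<in>S. fst y = e}. u y * G y 1) \<noteq> 0)"
    "\<exists>y\<in>S. fst y = e \<and> y \<notin> J \<and> u y \<noteq> 0"
  shows "available S e m (\<lambda>G. ((\<forall>z\<in>Zs. G (fst z) (snd z) = 0) \<and> (\<forall>y\<in>J. G y 1 = 0)) \<and> (\<Sum>y\<in>{y\<in>S. fst y = e}. u y * G y 1) \<noteq> 0)"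
  using assms(3,4,6,7)
proof (induction J arbitrary: m u rule: finite_induct)
  case empty
  have "available S e m (\<lambda>G. (\<forall>z\<in>Zs. G (fst z) (snd z) = 0) \<and> (\<Sum>y\<in>{y\<in>S. fst y = e}. u y * G y 1) \<noteq> 0)"
    by (rule empty.prems(2)) (use empty.prems(3) in auto)
  then show ?case by (rule available_mono) auto
next
  case (insert l J)
  define T where "T = {y\<in>S. fst y = e}"
  have fT: "finite T" using assms(1) by (auto simp: T_def form_set_def)
  have l: "l \<in> T" "l \<in> S" "fst l = e" "l \<notin> J" "J \<subseteq> T" using insert by (auto simp: T_def)
  define R where "R = (\<lambda>G :: 'k dform \<Rightarrow> nat \<Rightarrow> 'k. (\<forall>z\<in>Zs. G (fst z) (snd z) = 0) \<and> (\<forall>y\<in>J. G y 1 = 0))"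
  have IH: "available S e m' (\<lambda>G. R G \<and> (\<Sum>y\<in>T. u y * G y 1) \<noteq> 0)" if "m' \<le> m + 2" "\<exists>y\<in>S. fst y = e \<and> y \<notin> J \<and> u y \<noteq> 0" for m' u
    unfolding R_def T_def
  proof (rule insert.IH[OF _ _ that(2)])
    show "J \<subseteq> {y\<in>S. fst y = e}" using l(5) by (simp add: T_def)
    fix m'' and u' :: "'k dform \<Rightarrow> 'k"
    assume a: "m'' \<le> m' + 2 * card J" "\<exists>y\<in>S. fst y = e \<and> u' y \<noteq> 0"
    have "m'' \<le> m + 2 * card (insert l J)" using a(1) that(1) insert.hyps by simp
    from insert.prems(2)[OF this a(2)]
    show "available S e m'' (\<lambda>G. (\<forall>z\<in>Zs. G (fst z) (snd z) = 0) \<and> (\<Sum>y\<in>{y\<in>S. fst y = e}. u' y * G y 1) \<noteq> 0)" .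
  qed
  define dl where "dl = (\<lambda>y. if y = l then 1 else (0::'k))"
  have dl: "(\<Sum>y\<in>T. dl y * g y) = g l" for g :: "_ \<Rightarrow> 'k"
    using fT l(1) by (simp add: dl_def if_distrib[where f = "\<lambda>x. x * _"] cong: if_cong)
  have A: "available S e m (\<lambda>G. R G \<and> G l 1 \<noteq> 0)"
    using IH[of m dl] l unfolding dl by (auto simp: dl_def)
  obtain y1 where y1: "y1 \<in> S" "fst y1 = e" "y1 \<notin> J" "y1 \<noteq> l" "u y1 \<noteq> 0" using insert.prems(3) by auto
  have fin: "available S e m (\<lambda>G. (R G \<and> G l 1 = 0) \<and> (\<Sum>y\<in>T. u y * G y 1) \<noteq> 0)"
  proof (rule available_comb[OF assms(1) A])
    fix G assume "R G \<and> G l 1 \<noteq> 0"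
    \<comment> \<open>With this \<open>\<kappa>\<close> the functional
      \<open>u - \<kappa> * dl\<close> vanishes on the coefficients \<open>G\<close> of the first
      pair. Its value on the second pair is thus unaffected by the correction, and once the
      coefficient at \<open>l\<close> is \<open>0\<close> it agrees with the value of
      \<open>u\<close>.\<close>
    define \<kappa> where "\<kappa> = (\<Sum>y\<in>T. u y * G y 1) / G l 1"
    have "available S e (m + 2) (\<lambda>G'. R G' \<and> (\<Sum>y\<in>T. (u y - \<kappa> * dl y) * G' y 1) \<noteq> 0)"
      by (rule IH) (use y1 in \<open>auto simp: dl_def\<close>)
    then show "available S e (m + 2) (\<lambda>G'. R G' \<and> (\<Sum>y\<in>T. (u y - (\<Sum>y\<in>T. u y * G y 1) / G l 1 * dl y) * G' y 1) \<noteq> 0)"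
      by (simp only: \<kappa>_def)
  next
    fix G G' assume G: "R G \<and> G l 1 \<noteq> 0" and G': "R G' \<and> (\<Sum>y\<in>T. (u y - (\<Sum>y\<in>T. u y * G y 1) / G l 1 * dl y) * G' y 1) \<noteq> 0"
    define c where "c = G' l 1 / G l 1"
    have sm: "(\<Sum>y\<in>T. (u y - (\<Sum>y\<in>T. u y * G y 1) / G l 1 * dl y) * G' y 1) = (\<Sum>y\<in>T. u y * G' y 1) - (\<Sum>y\<in>T. u y * G y 1) / G l 1 * G' l 1"
      unfolding left_diff_distrib sum_subtractf mult.assoc sum_distrib_left[symmetric] dl ..
    show "\<exists>s t s' t'. \<forall>H. (\<forall>y\<in>S. fst y = e \<longrightarrow> (\<forall>j\<le>e. H y j = s ^ (e - j) * t ^ j * G y j + s' ^ (e - j) * t' ^ j * G' y j)) \<longrightarrow>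
      (R H \<and> H l 1 = 0) \<and> (\<Sum>y\<in>T. u y * H y 1) \<noteq> 0"
    proof (rule exI[of _ 1], rule exI[of _ "- c"], rule exI[of _ 1], rule exI[of _ 1], intro allI impI)
      fix H assume H: "\<forall>y\<in>S. fst y = e \<longrightarrow> (\<forall>j\<le>e. H y j = 1 ^ (e - j) * (- c) ^ j * G y j + 1 ^ (e - j) * 1 ^ j * G' y j)"
      have H': "H y j = (- c) ^ j * G y j + G' y j" if "y \<in> T" "j \<le> e" for y j using H that by (auto simp: T_def)
      have H1: "H y 1 = - c * G y 1 + G' y 1" if "y \<in> T" for y using H'[OF that assms(2)] by simp
      have r1: "H (fst z) (snd z) = 0" if "z \<in> Zs" for z
      proof -
        have "fst z \<in> T" "snd z \<le> e" using assms(5) that by (auto simp: T_def)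
        from H'[OF this] show ?thesis using G G' that by (simp add: R_def)
      qed
      have r2: "H y 1 = 0" if "y \<in> J" for y
      proof -
        have "y \<in> T" using l(5) that by auto
        from H1[OF this] show ?thesis using G G' that by (simp add: R_def)
      qed
      have r3: "H l 1 = 0" using H1[OF l(1)] G by (simp add: c_def)
      have "(\<Sum>y\<in>T. u y * H y 1) = (\<Sum>y\<in>T. u y * G' y 1) - c * (\<Sum>y\<in>T. u y * G y 1)"
        unfolding sum_distrib_left sum_subtractf[symmetric]
      proof (rule sum.cong[OF refl])
        fix y assume "y \<in> T"
        from H1[OF this] show "u y * H y 1 = u y * G' y 1 - c * (u y * G y 1)" by (simp only:) (simp add: algebra_simps)
      qed
      also have "\<dots> \<noteq> 0" using G' unfolding sm c_def by (simp add: mult.commute)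
      finally show "(R H \<and> H l 1 = 0) \<and> (\<Sum>y\<in>T. u y * H y 1) \<noteq> 0" using r1 r2 r3 by (simp add: R_def)
    qed
  qed
  show ?case by (rule available_mono[OF fin]) (auto simp: R_def T_def)
qed

text \<open>The pair is found as one point \<open>(x, w)\<close> of the doubled space. Orthogonality
  holds if all coefficients in \<open>s\<close> and \<open>t\<close> of the polarizing forms, and of
  the members of degree below \<open>e\<close>, vanish there; these are boundedly many forms of
  degree below \<open>e\<close>. The condition to be kept is that \<open>D_w F(x)\<close> is nonzero
  for the combination \<open>F\<close> given by \<open>u\<close>; as \<open>F\<close> is strong, its
  differential is not low, and \<open>nonvanishing_point\<close> applies.\<close>

lemma available_strong_deriv:
  assumes "dense_fibres (e - 1)" "strong_deriv e" "1 \<le> e"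
  shows "\<exists>C. \<forall>n S u. form_set n e S \<longrightarrow> card S \<le> R \<longrightarrow> strong n C S \<longrightarrow> (\<exists>y\<in>S. fst y = e \<and> u y \<noteq> 0) \<longrightarrow>
    available S e m (\<lambda>G. (\<Sum>y\<in>{y\<in>S. fst y = e}. u y * G y 1) \<noteq> 0)"
proof -
  define P where "P = (\<lambda>e' B. \<forall>n U f. finite U \<longrightarrow> card U \<le> m \<longrightarrow> form n e' (f :: _ \<Rightarrow> 'k) \<longrightarrow>
    (\<exists>\<Psi>. form_set n (e' - 1) \<Psi> \<and> card \<Psi> \<le> B \<and>
      (\<forall>u\<in>fs.span U. \<forall>v w. (\<forall>\<psi>\<in>\<Psi>. snd \<psi> v = snd \<psi> w) \<longrightarrow> f (v + u) - f v = f (w + u) - f w)))"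
  have "\<exists>B. P e' B" for e' unfolding P_def by (rule polarize)
  then obtain Bp where Bp: "\<And>e'. P e' (Bp e')" by metis
  define Bm where "Bm = (\<Sum>e'\<le>e. Bp e')"
  \<comment> \<open>At most \<open>R\<close> members, for each of them its polarizations and
    possibly the member itself, and \<open>e + 1\<close> coefficients in \<open>s\<close> and
    \<open>t\<close> for each of these forms.\<close>
  define N where "N = R * (Bm + 1) * (e + 1)"
  obtain B where nonvanishing_point: "\<And>n \<Phi> g e'. form_set n (e - 1) \<Phi> \<Longrightarrow> card \<Phi> \<le> N \<Longrightarrow> e - 1 < e' \<Longrightarrow> form n e' g \<Longrightarrow> \<not> low n B e' (g :: _ \<Rightarrow> 'k) \<Longrightarrow>
    (\<exists>z. (\<forall>\<phi>\<in>\<Phi>. snd \<phi> z = 0) \<and> g z \<noteq> 0)" using nonvanishing_point[OF assms(1)] by blast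
  obtain C where C: "\<And>n f. form n e f \<Longrightarrow> \<not> low n C e (f :: _ \<Rightarrow> 'k) \<Longrightarrow> \<not> low (2 * n) B e (\<lambda>z. hder (\<lambda>i. z (i + n)) 1 f z)"
    using assms(2) unfolding strong_deriv_def by blast
  show ?thesis
  proof (rule exI[of _ C], intro allI impI)
    fix n u and S :: "'k dform set"
    assume a: "form_set n e S" "card S \<le> R" "strong n C S" "\<exists>y\<in>S. fst y = e \<and> u y \<noteq> (0::'k)"
    define T where "T = {y\<in>S. fst y = e}"
    define F where "F = (\<Sum>y\<in>T. scl (u y) (snd y))"
    have nl: "\<not> low n C e F" using a(3,4) unfolding strong_def F_def T_def by blast
    have hT: "form n e (snd y)" if "y \<in> T" for y using a(1) that by (auto simp: form_set_def T_def)
    have hS: "form n (fst y) (snd y)" if "y \<in> S" for y using a(1) that by (auto simp: form_set_def)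
    have hF: "form n e F" unfolding F_def by (rule form_sum, rule form_cmul, rule hT)
    define W where "W = (\<lambda>(z :: nat \<Rightarrow> 'k) i. z (i + n))"
    have lX: "linmap n (2 * n) (\<lambda>z. z)" unfolding linmap_def form_def by (auto intro: polyf_var)
    have lW: "linmap n (2 * n) W" unfolding linmap_def form_def W_def by (auto intro!: polyf_var)
    have nl2: "\<not> low (2 * n) B e (\<lambda>z. hder (W z) 1 F z)" using C[OF hF nl] unfolding W_def .
    show "available S e m (\<lambda>G. (\<Sum>y\<in>{y\<in>S. fst y = e}. u y * G y 1) \<noteq> 0)"
      unfolding available_def
    proof (intro allI impI)
      fix U :: "(nat \<Rightarrow> 'k) set" assume U: "finite U" "card U \<le> m"
      have "\<forall>y. \<exists>\<Psi>. y \<in> S \<longrightarrow> form_set n (fst y - 1) \<Psi> \<and> card \<Psi> \<le> Bp (fst y) \<and>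
        (\<forall>u\<in>fs.span U. \<forall>v w. (\<forall>\<psi>\<in>\<Psi>. snd \<psi> v = snd \<psi> w) \<longrightarrow> snd y (v + u) - snd y v = snd y (w + u) - snd y w)"
        using Bp[unfolded P_def, rule_format, OF U hS] by blast
      then obtain \<Psi>0 where P0: "\<And>y. y \<in> S \<Longrightarrow> form_set n (fst y - 1) (\<Psi>0 y)" "\<And>y. y \<in> S \<Longrightarrow> card (\<Psi>0 y) \<le> Bp (fst y)"
        "\<And>y u v w. y \<in> S \<Longrightarrow> u\<in>fs.span U \<Longrightarrow> (\<forall>\<psi>\<in>\<Psi>0 y. snd \<psi> v = snd \<psi> w) \<Longrightarrow> snd y (v + u) - snd y v = snd y (w + u) - snd y w"
        by metis
      define \<Psi> where "\<Psi> = (\<lambda>y. \<Psi>0 y \<union> (if fst y < e then {y} else {}))"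
      have PsiS: "form_set n (e - 1) (\<Psi> y) \<and> card (\<Psi> y) \<le> Bm + 1" if y: "y \<in> S" for y
      proof
        have le: "1 \<le> fst y" "fst y \<le> e" using a(1) y by (auto simp: form_set_def)
        have "form_set n (e - 1) (\<Psi>0 y)" by (rule form_set_mono[OF P0(1)[OF y]]) (use le in auto)
        moreover have "form_set n (e - 1) (if fst y < e then {y} else {})" using le hS[OF y] by (auto simp: form_set_def)
        ultimately show "form_set n (e - 1) (\<Psi> y)" unfolding \<Psi>_def by (rule form_set_Un)
        have "Bp (fst y) \<le> Bm" unfolding Bm_def using le by (intro member_le_sum) auto
        then have "card (\<Psi>0 y) \<le> Bm" using P0(2)[OF y] by simp
        then show "card (\<Psi> y) \<le> Bm + 1" unfolding \<Psi>_def
          using card_Un_le[of "\<Psi>0 y" "if fst y < e then {y} else {}"] by (cases "fst y < e") auto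
      qed
      have finS: "finite S" using a(1) by (simp add: form_set_def)
      define Q where "Q = (\<Union>y\<in>S. \<Psi> y)"
      have Qw: "form_set n (e - 1) Q" using PsiS finS unfolding Q_def form_set_def by blast
      have "card Q \<le> (\<Sum>y\<in>S. card (\<Psi> y))" unfolding Q_def by (rule card_UN_le[OF finS])
      also have "\<dots> \<le> (\<Sum>y\<in>S. Bm + 1)" using PsiS by (intro sum_mono) blast
      also have "\<dots> = card S * (Bm + 1)" by simp
      also have "\<dots> \<le> R * (Bm + 1)" by (rule mult_le_mono1[OF a(2)])
      finally have Qc: "card Q \<le> R * (Bm + 1)" .
      define \<Phi> where "\<Phi> = (\<lambda>(\<psi>, i). (fst \<psi>, \<lambda>z. hder (W z) i (snd \<psi>) z)) ` (Q \<times> {..e})"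
      have finQ: "finite Q" using Qw by (simp add: form_set_def)
      have "card \<Phi> \<le> card (Q \<times> {..e})" unfolding \<Phi>_def by (rule card_image_le) (use finQ in simp)
      also have "\<dots> \<le> N" unfolding N_def card_cartesian_product card_atMost using mult_le_mono1[OF Qc, of "e + 1"] by (simp only: Suc_eq_plus1)
      finally have cP: "card \<Phi> \<le> N" .
      have wP: "form_set (2 * n) (e - 1) \<Phi>" unfolding form_set_def
      proof (intro conjI ballI)
        show "finite \<Phi>" unfolding \<Phi>_def using finQ by simp
        fix x assume "x \<in> \<Phi>"
        then obtain \<psi> i where x: "\<psi> \<in> Q" "x = (fst \<psi>, \<lambda>z. hder (W z) i (snd \<psi>) z)" unfolding \<Phi>_def by auto
        have q: "1 \<le> fst \<psi>" "fst \<psi> \<le> e - 1" "form n (fst \<psi>) (snd \<psi>)" using Qw x(1) by (auto simp: form_set_def)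
        from form_bi[OF lX lW q(3)] q show "1 \<le> fst x" "fst x \<le> e - 1" "form (2 * n) (fst x) (snd x)" unfolding x(2) by simp_all
      qed
      have "e - 1 < e" using assms(3) by simp
      obtain z where z: "\<forall>\<phi>\<in>\<Phi>. snd \<phi> z = 0" "hder (W z) 1 F z \<noteq> 0"
        using nonvanishing_point[OF wP cP \<open>e - 1 < e\<close> form_bi[OF lX lW hF] nl2] by blast
      have Qz: "snd \<psi> (scl s z + scl t (W z)) = 0" if q: "\<psi> \<in> Q" for \<psi> s t
      proof -
        have q': "fst \<psi> \<le> e - 1" "form n (fst \<psi>) (snd \<psi>)" using Qw q by (auto simp: form_set_def)
        have "hder (W z) i (snd \<psi>) z = 0" if "i \<le> fst \<psi>" for i
        proof -
          have "(fst \<psi>, \<lambda>z. hder (W z) i (snd \<psi>) z) \<in> \<Phi>" unfolding \<Phi>_def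
            by (rule image_eqI[of _ _ "(\<psi>, i)"]) (use q q' that in auto)
          then show ?thesis using z(1) by fastforce
        qed
        then show ?thesis unfolding hder_biexp[OF q'(2)] by (intro sum.neutral) auto
      qed
      have o: "orth_pair S e U z (W z)" unfolding orth_pair_def
      proof (intro ballI allI)
        fix y u s t assume y: "y \<in> S" and u: "u \<in> fs.span U"
        define v where "v = scl s z + scl t (W z)"
        have "snd \<psi> v = snd \<psi> 0" if "\<psi> \<in> \<Psi>0 y" for \<psi>
        proof -
          have "\<psi> \<in> Q" using that y by (auto simp: Q_def \<Psi>_def)
          moreover have "snd \<psi> 0 = 0" using form_at_0[of n "fst \<psi>" "snd \<psi>"] P0(1)[OF y] that by (auto simp: form_set_def)
          ultimately show ?thesis using Qz[of \<psi> s t] by (simp add: v_def)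
        qed
        then have "snd y (v + u) - snd y v = snd y (0 + u) - snd y 0" using P0(3)[OF y u] by blast
        moreover have "snd y 0 = 0" using form_at_0[OF hS[OF y]] a(1) y by (auto simp: form_set_def)
        ultimately have 1: "snd y (u + v) = snd y u + snd y v" by (simp add: add.commute diff_eq_eq)
        show "snd y (u + (scl s z + scl t (W z))) = snd y u + (if fst y = e then snd y (scl s z + scl t (W z)) else 0)"
        proof (cases "fst y = e")
          case True
          then show ?thesis using 1 unfolding v_def by simp
        next
          case False
          then have "fst y < e" using a(1) y by (fastforce simp: form_set_def)
          then have "y \<in> Q" using y by (auto simp: Q_def \<Psi>_def)
          then show ?thesis using 1 Qz[of y s t] False unfolding v_def by simp
        qed
      qed
      have "hder (W z) 1 F z = (\<Sum>y\<in>T. hder (W z) 1 (scl (u y) (snd y)) z)" unfolding F_def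
        by (rule hder_sum_1[of _ n]) (rule polyf_scl[OF form_polyf[OF hT]])
      also have "\<dots> = (\<Sum>y\<in>T. u y * hder (W z) 1 (snd y) z)"
        by (rule sum.cong[OF refl], rule hder_scl_1[OF form_polyf[OF hT]])
      finally show "\<exists>x w. orth_pair S e U x w \<and> (\<Sum>y\<in>{y\<in>S. fst y = e}. u y * hder w 1 (snd y) x) \<noteq> 0"
        using o z(2) unfolding T_def by (rule_tac exI[of _ z], rule_tac exI[of _ "W z"]) (simp only: not_False_eq_True simp_thms)
    qed
  qed
qed

definition block :: "'k dform set \<Rightarrow> nat \<Rightarrow> 'k dform \<Rightarrow> (nat \<Rightarrow> 'k) set \<Rightarrow> (nat \<Rightarrow> 'k) \<Rightarrow> (nat \<Rightarrow> 'k) \<Rightarrow> bool" where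
  "block S e f1 U x w \<longleftrightarrow> (\<forall>y\<in>S. \<forall>u\<in>fs.span U. \<forall>s t. snd y (u + (scl s x + scl t w)) =
     snd y u + (if fst y = e then s ^ e * snd y x else 0) + (if y = f1 then s ^ (e - 1) * t else 0))"

text \<open>The order of the eliminations matters: coefficients of order at least 2 are removed
  while an arbitrary combination of linear ones is kept, since the elimination of the linear
  coefficients at members other than \<open>f1\<close> uses several such combinations. Rescaling
  \<open>w\<close> finally turns the remaining linear coefficient of \<open>f1\<close> into
  1.\<close>

lemma block_exists:
  assumes "dense_fibres (e - 1)" "strong_deriv e" "1 \<le> e" "diag_solv e N"
  shows "\<exists>C. \<forall>n S f1 U. form_set n e S \<longrightarrow> card S \<le> R \<longrightarrow> strong n C S \<longrightarrow> f1 \<in> S \<longrightarrow> fst f1 = e \<longrightarrow> finite U \<longrightarrow> card U \<le> m \<longrightarrow>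
    (\<exists>x w. block S e f1 U x w)"
proof -
  \<comment> \<open>Two vectors for each of at most \<open>R\<close> linear eliminations, and
    \<open>2 * N\<close> for each of at most \<open>R * e\<close> removed higher
    coefficients.\<close>
  define M where "M = m + 2 * R + 2 * N * (R * e)"
  obtain C where C: "\<And>n S u. form_set n e S \<Longrightarrow> card S \<le> R \<Longrightarrow> strong n C S \<Longrightarrow> (\<exists>y\<in>S. fst y = e \<and> u y \<noteq> (0::'k)) \<Longrightarrow>
    available S e M (\<lambda>G. (\<Sum>y\<in>{y\<in>S. fst y = e}. u y * G y 1) \<noteq> 0)" using available_strong_deriv[OF assms(1-3), of R M] by blast
  show ?thesis
  proof (rule exI[of _ C], intro allI impI)
    fix n and S :: "'k dform set" and f1 and U :: "(nat \<Rightarrow> 'k) set"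
    assume a: "form_set n e S" "card S \<le> R" "strong n C S" "f1 \<in> S" "fst f1 = e" "finite U" "card U \<le> m"
    define T where "T = {y\<in>S. fst y = e}"
    have finS: "finite S" using a(1) by (simp add: form_set_def)
    have fT: "finite T" "T \<subseteq> S" using finS by (auto simp: T_def)
    define Zs where "Zs = T \<times> {2..e}"
    define J where "J = T - {f1}"
    have fin: "finite Zs" "finite J" using fT by (auto simp: Zs_def J_def)
    have cT: "card T \<le> R" using card_mono[OF finS fT(2)] a(2) by simp
    have "card J \<le> card T" unfolding J_def by (rule card_mono) (use fT in auto)
    then have cJ: "card J \<le> R" using cT by simp
    have "card Zs = card T * (e - 1)" by (simp add: Zs_def card_cartesian_product)
    also have "\<dots> \<le> R * e" using cT by (intro mult_le_mono) auto
    finally have cZ: "2 * N * card Zs \<le> 2 * N * (R * e)" by simp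
    have sub: "J \<subseteq> {y\<in>S. fst y = e}" "Zs \<subseteq> {y\<in>S. fst y = e} \<times> {2..e}" by (auto simp: J_def Zs_def T_def)
    have 1: "available S e m' (\<lambda>G. (\<forall>z\<in>Zs. G (fst z) (snd z) = 0) \<and> (\<Sum>y\<in>{y\<in>S. fst y = e}. u y * G y 1) \<noteq> 0)"
      if "m' \<le> m + 2 * card J" "\<exists>y\<in>S. fst y = e \<and> u y \<noteq> 0" for m' u
    proof (rule available_kill_all[OF a(1) assms(3,4) fin(1) sub(2)])
      have "m' + 2 * N * card Zs \<le> M" using that(1) cJ cZ unfolding M_def by linarith
      then show "available S e (m' + 2 * N * card Zs) (\<lambda>G. (\<Sum>y\<in>{y\<in>S. fst y = e}. u y * G y 1) \<noteq> 0)"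
        by (rule available_mono[OF C[OF a(1-3) that(2)]])
    qed
    define u where "u = (\<lambda>y. if y = f1 then 1 else (0::'k))"
    have ex: "\<exists>y\<in>S. fst y = e \<and> y \<notin> J \<and> u y \<noteq> 0" using a(4,5) by (auto simp: u_def J_def intro!: bexI[of _ f1])
    have "available S e m (\<lambda>G. ((\<forall>z\<in>Zs. G (fst z) (snd z) = 0) \<and> (\<forall>y\<in>J. G y 1 = 0)) \<and> (\<Sum>y\<in>{y\<in>S. fst y = e}. u y * G y 1) \<noteq> 0)"
      by (rule available_reduce[OF a(1) assms(3) fin(2) sub 1 ex])
    from this[unfolded available_def, rule_format, OF a(6,7)]
    obtain x w where xw0: "orth_pair S e U x w" "\<forall>z\<in>Zs. hder w (snd z) (snd (fst z)) x = 0" "\<forall>y\<in>J. hder w 1 (snd y) x = 0"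
      "(\<Sum>y\<in>T. u y * hder w 1 (snd y) x) \<noteq> 0" unfolding T_def by (elim exE conjE)
    note xw = xw0(1) bspec[OF xw0(2)] bspec[OF xw0(3)] xw0(4)
    have f1: "f1 \<in> T" using a(4,5) by (simp add: T_def)
    have "(\<Sum>y\<in>T. u y * hder w 1 (snd y) x) = hder w 1 (snd f1) x"
      using fT(1) f1 by (simp add: u_def if_distrib[where f = "\<lambda>x. x * _"] cong: if_cong)
    then have c: "hder w 1 (snd f1) x \<noteq> 0" using xw(4) by simp
    define c where "c = hder w 1 (snd f1) x"
    have "block S e f1 U x (scl (inverse c) w)"
      unfolding block_def
    proof (intro ballI allI)
      fix y v s t assume y: "y \<in> S" and v: "v \<in> fs.span U"
      have tt: "scl t (scl (inverse c) w) = scl (t * inverse c) w" by (rule ext) simp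
      have o: "snd y (v + (scl s x + scl (t * inverse c) w)) = snd y v + (if fst y = e then snd y (scl s x + scl (t * inverse c) w) else 0)"
        using xw(1) y v unfolding orth_pair_def by blast
      show "snd y (v + (scl s x + scl t (scl (inverse c) w))) =
         snd y v + (if fst y = e then s ^ e * snd y x else 0) + (if y = f1 then s ^ (e - 1) * t else 0)"
      proof (cases "fst y = e")
        case True
        then have yT: "y \<in> T" using y by (simp add: T_def)
        have h: "form n e (snd y)" using a(1) y True by (auto simp: form_set_def)
        have "snd y (scl s x + scl (t * inverse c) w) = (\<Sum>j\<le>e. s ^ (e - j) * (t * inverse c) ^ j * hder w j (snd y) x)"
          by (rule hder_biexp[OF h])
        also have "\<dots> = (\<Sum>j\<in>{0,1}. s ^ (e - j) * (t * inverse c) ^ j * hder w j (snd y) x)"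
        proof (rule sum.mono_neutral_right)
          show "{0, 1} \<subseteq> {..e}" using assms(3) by auto
          show "\<forall>j\<in>{..e} - {0, 1}. s ^ (e - j) * (t * inverse c) ^ j * hder w j (snd y) x = 0"
          proof
            fix j assume "j \<in> {..e} - {0,1}"
            then have "(y, j) \<in> Zs" using yT by (auto simp: Zs_def)
            from xw(2)[OF this] show "s ^ (e - j) * (t * inverse c) ^ j * hder w j (snd y) x = 0" by simp
          qed
        qed simp
        also have "\<dots> = s ^ e * snd y x + s ^ (e - 1) * (t * inverse c) * hder w 1 (snd y) x"
          using hder_0[OF form_polyf[OF h], of w] by simp
        also have "s ^ (e - 1) * (t * inverse c) * hder w 1 (snd y) x = (if y = f1 then s ^ (e - 1) * t else 0)"
        proof (cases "y = f1")
          case True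
          then show ?thesis using c by (simp add: c_def)
        next
          case False
          then show ?thesis using xw(3)[of y] yT by (simp add: J_def)
        qed
        finally have fin: "snd y (scl s x + scl (t * inverse c) w) = s ^ e * snd y x + (if y = f1 then s ^ (e - 1) * t else 0)" .
        show ?thesis unfolding tt o by (simp only: True if_True refl fin add.assoc)
      next
        case False
        then show ?thesis unfolding tt o using a(5) by auto
      qed
    qed
    then show "\<exists>x w. block S e f1 U x w" by blast
  qed
qed

section \<open>Strong families and frames\<close>

text \<open>The indexed variant of \<open>strong\<close>, for families such as restrictions in which
  coincidences are not excluded beforehand; strength itself excludes them.\<close>

definition strong_family :: "nat \<Rightarrow> nat \<Rightarrow> 'i set \<Rightarrow> ('i \<Rightarrow> nat) \<Rightarrow> ('i \<Rightarrow> (nat \<Rightarrow> 'k) \<Rightarrow> 'k) \<Rightarrow> bool" where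
  "strong_family n C I d g \<longleftrightarrow> (\<forall>e u. (\<exists>i\<in>I. d i = e \<and> u i \<noteq> 0) \<longrightarrow> \<not> low n C e (\<Sum>i\<in>{i\<in>I. d i = e}. scl (u i) (g i)))"

lemma strong_family_mono: "strong_family n D I d g \<Longrightarrow> C \<le> D \<Longrightarrow> strong_family n C I d g"
  unfolding strong_family_def using low_mono by blast

lemma strong_familyD: assumes "strong_family n C I d g" "i \<in> I" "d i = e" "u i \<noteq> 0"
  shows "\<not> low n C e (\<Sum>i\<in>{i\<in>I. d i = e}. scl (u i) (g i))"
proof -
  have "\<exists>i\<in>I. d i = e \<and> u i \<noteq> 0" using assms(2-4) by blast
  then show ?thesis by (rule assms(1)[unfolded strong_family_def, rule_format])
qed

lemma strong_family_inj: assumes "strong_family n C I d g" "finite I" shows "inj_on (\<lambda>i. (d i, g i)) I"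
proof
  fix i j assume ij: "i \<in> I" "j \<in> I" "(d i, g i) = (d j, g j)"
  show "i = j"
  proof (rule ccontr)
    assume ne: "i \<noteq> j"
    define u where "u = (\<lambda>l. if l = i then 1 else if l = j then - 1 else (0::'k))"
    have "(\<Sum>l\<in>{l\<in>I. d l = d i}. scl (u l) (g l)) = (\<Sum>l\<in>{i,j}. scl (u l) (g l))"
      using ij assms(2) by (intro sum.mono_neutral_cong_right) (auto simp: u_def fun_eq_iff)
    also have "\<dots> = scl 1 (g i) + scl (- 1) (g i)" using ne ij by (simp add: u_def)
    also have "\<dots> = 0" by (rule ext) simp
    finally have "low n C (d i) (\<Sum>l\<in>{l\<in>I. d l = d i}. scl (u l) (g l))" by (simp only: low_0)
    moreover have "u i \<noteq> 0" by (simp add: u_def)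
    ultimately show False using strong_familyD[OF assms(1) ij(1) refl] by blast
  qed
qed

lemma strong_family_set: assumes "strong_family n C I d g" "finite I" shows "strong n C ((\<lambda>i. (d i, g i)) ` I)"
  unfolding strong_def
proof (intro allI impI)
  fix e and u :: "'k dform \<Rightarrow> 'k"
  let ?h = "\<lambda>i. (d i, g i)"
  assume "\<exists>x\<in>?h ` I. fst x = e \<and> u x \<noteq> 0"
  then obtain i where "i \<in> I" "d i = e" "u (?h i) \<noteq> 0" by auto
  then have nl: "\<not> low n C e (\<Sum>i\<in>{i\<in>I. d i = e}. scl (u (?h i)) (g i))"
    by (rule strong_familyD[OF assms(1), of _ e "\<lambda>i. u (?h i)"])
  have "{x\<in>?h ` I. fst x = e} = ?h ` {i\<in>I. d i = e}" by auto
  moreover have "inj_on ?h {i\<in>I. d i = e}" using strong_family_inj[OF assms] by (rule inj_on_subset) auto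
  ultimately have "(\<Sum>x\<in>{x\<in>?h ` I. fst x = e}. scl (u x) (snd x)) = (\<Sum>i\<in>{i\<in>I. d i = e}. scl (u (?h i)) (g i))"
    by (simp only: sum.reindex comp_def snd_conv)
  from nl[folded this] show "\<not> low n C e (\<Sum>x\<in>{x\<in>?h ` I. fst x = e}. scl (u x) (snd x))" .
qed

lemma ideal_reindex: assumes "inj_on h I" shows "ideal n (h ` I) g = ideal n I (\<lambda>i. g (h i))"
proof (intro set_eqI iffI)
  fix f assume "f \<in> ideal n (h ` I) g"
  then obtain q where q: "\<forall>i\<in>h ` I. polyf n (q i)" "f = (\<Sum>i\<in>h ` I. q i * g i)" unfolding ideal_def by blast
  then show "f \<in> ideal n I (\<lambda>i. g (h i))" unfolding ideal_def
    by (intro CollectI exI[of _ "\<lambda>i. q (h i)"]) (simp add: sum.reindex[OF assms])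
next
  fix f assume "f \<in> ideal n I (\<lambda>i. g (h i))"
  then obtain q where q: "\<forall>i\<in>I. polyf n (q i)" "f = (\<Sum>i\<in>I. q i * g (h i))" unfolding ideal_def by blast
  have "(\<Sum>i\<in>h ` I. q (inv_into I h i) * g i) = (\<Sum>i\<in>I. q i * g (h i))"
    unfolding sum.reindex[OF assms] by (rule sum.cong) (auto simp: inv_into_f_f[OF assms])
  then show "f \<in> ideal n (h ` I) g" unfolding ideal_def
    by (intro CollectI exI[of _ "\<lambda>i. q (inv_into I h i)"]) (use q in \<open>auto simp: inv_into_f_f[OF assms]\<close>)
qed

definition form_family :: "nat \<Rightarrow> nat \<Rightarrow> 'i set \<Rightarrow> ('i \<Rightarrow> nat) \<Rightarrow> ('i \<Rightarrow> (nat \<Rightarrow> 'k) \<Rightarrow> 'k) \<Rightarrow> bool" where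
  "form_family n D I d g \<longleftrightarrow> finite I \<and> (\<forall>i\<in>I. 1 \<le> d i \<and> d i \<le> D \<and> form n (d i) (g i))"

lemma dense_fibres_family: assumes "dense_fibres D"
  shows "\<exists>C. \<forall>n (I :: 'i set) d g. form_family n D I d g \<longrightarrow> card I \<le> R \<longrightarrow> strong_family n C I d g \<longrightarrow>
    (\<forall>J\<subseteq>I. dense_prime n J g) \<and> (\<forall>i\<in>I. g i \<notin> ideal n (I - {i}) g)"
proof -
  obtain C where C: "\<And>N n S (c :: _ \<Rightarrow> 'k). card S \<le> N \<Longrightarrow> form_set n D S \<Longrightarrow> strong n (C N) S \<Longrightarrow> dense_prime n S (fibre_eq c)"
    using assms unfolding dense_fibres_def by blast
  show ?thesis
  \<comment> \<open>The first summand is for the fibres, the second for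
    \<open>strong_notin\<close>.\<close>
  proof (rule exI[of _ "C R + R"], intro allI impI conjI ballI)
    fix n and I :: "'i set" and d g
    assume a: "form_family n D I d g" "card I \<le> R" "strong_family n (C R + R) I d g"
    have fin: "finite I" using a(1) by (simp add: form_family_def)
    let ?h = "\<lambda>i. (d i, g i)"
    have inj: "inj_on ?h I" by (rule strong_family_inj[OF a(3) fin])
    have st: "strong n (C R + R) (?h ` I)" by (rule strong_family_set[OF a(3) fin])
    have w: "form_set n D (?h ` I)" using a(1) by (auto simp: form_set_def form_family_def)
    have c: "card (?h ` I) \<le> R" using a(2) card_image[OF inj] by simp
    {
      fix J assume J: "J \<subseteq> I"
      have sub: "?h ` J \<subseteq> ?h ` I" using J by auto
      have cJ: "card (?h ` J) \<le> R" using card_mono[OF _ sub] fin c by simp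
      have "strong n (C R) (?h ` I)" by (rule strong_mono[OF st]) simp
      then have "strong n (C R) (?h ` J)" by (rule strong_subset) (use sub fin in auto)
      then have dense_prime: "dense_prime n (?h ` J) snd" using C[OF cJ form_set_subset[OF w sub], of "\<lambda>_. 0"] by (simp only: fibre_eq_0)
      have "inj_on ?h J" using inj J by (rule inj_on_subset)
      from ideal_reindex[OF this, of n snd] have "ideal n (?h ` J) snd = ideal n J g" by simp
      then show "dense_prime n J g" using dense_prime unfolding dense_prime_def by simp
    }
    fix i assume i: "i \<in> I"
    have "snd (?h i) \<notin> ideal n (?h ` I - {?h i}) snd"
      by (rule strong_notin[OF w st]) (use i c in auto)
    moreover have "?h ` I - {?h i} = ?h ` (I - {i})" using inj i by (auto simp: inj_on_def)
    moreover have "ideal n (?h ` (I - {i})) snd = ideal n (I - {i}) g"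
      using ideal_reindex[of ?h "I - {i}" n snd] inj_on_subset[OF inj, of "I - {i}"] by auto
    ultimately show "g i \<notin> ideal n (I - {i}) g" by simp
  qed
qed

section \<open>Linear independence of the differentials along the zero set\<close>

definition trunc :: "nat \<Rightarrow> (nat \<Rightarrow> 'k) \<Rightarrow> nat \<Rightarrow> 'k" where "trunc n v = (\<lambda>i. if i < n then v i else 0)"

lemma linmap_trunc: "linmap N n (trunc n)"
  unfolding linmap_def form_def
proof (intro allI impI conjI)
  fix i
  show "polyf n (\<lambda>z. trunc n z i)" by (cases "i < n") (auto simp: trunc_def intro: polyf_var polyf_const)
qed (simp add: trunc_def)

lemma polyf_trunc: "polyf N f \<Longrightarrow> polyf n (\<lambda>v. f (trunc n v))"
  by (rule linmap_polyf[OF linmap_trunc])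

lemma trunc_polyf: "polyf n f \<Longrightarrow> f (trunc n v) = f v"
  by (rule polyf_cong_coords) (auto simp: trunc_def)

lemma ideal_pull: assumes "f \<in> ideal N I g" "linmap N n L"
  shows "(\<lambda>v. f (L v)) \<in> ideal n I (\<lambda>i v. g i (L v))"
proof -
  obtain q where q: "\<forall>i\<in>I. polyf N (q i)" "f = (\<Sum>i\<in>I. q i * g i)" using assms(1) unfolding ideal_def by blast
  then show ?thesis unfolding ideal_def
    by (intro CollectI exI[of _ "\<lambda>i v. q i (L v)"] conjI ballI linmap_polyf[OF assms(2)]) (auto simp: fun_eq_iff sum_apply)
qed

text \<open>The forms \<open>g i\<close> in \<open>x\<close> together with their differentials in
  \<open>(x, w)\<close> are a strong family in \<open>2 * n\<close> variables. If
  \<open>q i0\<close> were outside the ideal, there would be a rational point where every member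
  except the differential of \<open>g i0\<close> vanishes, while this differential and
  \<open>q i0\<close> do not. The relation at that point reduces to their product, a
  contradiction.\<close>

lemma jacobian_independence: assumes "dense_fibres D" "\<And>e. 1 \<le> e \<Longrightarrow> e \<le> D \<Longrightarrow> strong_deriv e"
  shows "\<exists>C. \<forall>n (I :: 'i set) d g q. form_family n D I d g \<longrightarrow> card I \<le> R \<longrightarrow> strong_family n C I d g \<longrightarrow> (\<forall>i\<in>I. polyf n (q i)) \<longrightarrow>
    (\<forall>x. (\<forall>i\<in>I. g i x = 0) \<longrightarrow> (\<forall>w. (\<Sum>i\<in>I. q i x * hder w 1 (g i) x) = 0)) \<longrightarrow> (\<forall>i\<in>I. q i \<in> ideal n I g)"
proof -
  obtain C' where C': "\<And>n (I :: ('i + 'i) set) d g. form_family n D I d g \<Longrightarrow> card I \<le> 2 * R \<Longrightarrow> strong_family n C' I d g \<Longrightarrow>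
    (\<forall>J\<subseteq>I. dense_prime n J g) \<and> (\<forall>i\<in>I. g i \<notin> ideal n (I - {i}) g)" using dense_fibres_family[OF assms(1)] by blast
  define P where "P = (\<lambda>e C. \<forall>n f. form n e f \<longrightarrow> \<not> low n C e (f :: _ \<Rightarrow> 'k) \<longrightarrow>
     \<not> low (2 * n) C' e (\<lambda>z. hder (\<lambda>i. z (i + n)) 1 f z))"
  have "\<exists>C. P e C" if "1 \<le> e" "e \<le> D" for e
    using assms(2)[OF that, unfolded strong_deriv_def, THEN spec, of C'] unfolding P_def .
  then obtain Ce where "\<And>e. 1 \<le> e \<Longrightarrow> e \<le> D \<Longrightarrow> P e (Ce e)" by metis
  note Ce = this[unfolded P_def, rule_format]
  define C where "C = C' + (\<Sum>e\<le>D. Ce e)"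
  show ?thesis
  proof (rule exI[of _ C], intro allI impI ballI)
    fix n and I :: "'i set" and d g and q :: "'i \<Rightarrow> (nat \<Rightarrow> 'k) \<Rightarrow> 'k" and i0
    assume a: "form_family n D I d g" "card I \<le> R" "strong_family n C I d g" "\<forall>i\<in>I. polyf n (q i)"
      "\<forall>x. (\<forall>i\<in>I. g i x = 0) \<longrightarrow> (\<forall>w. (\<Sum>i\<in>I. q i x * hder w 1 (g i) x) = 0)" and i0: "i0 \<in> I"
    have fin: "finite I" and gf: "\<And>i. i \<in> I \<Longrightarrow> 1 \<le> d i" "\<And>i. i \<in> I \<Longrightarrow> d i \<le> D" "\<And>i. i \<in> I \<Longrightarrow> form n (d i) (g i)"
      using a(1) by (auto simp: form_family_def)
    define W where "W = (\<lambda>(z :: nat \<Rightarrow> 'k) i. z (i + n))"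
    have lX: "linmap n (2 * n) (\<lambda>z. z)" unfolding linmap_def form_def by (auto intro: polyf_var)
    have lW: "linmap n (2 * n) W" unfolding linmap_def form_def W_def by (auto intro!: polyf_var)
    define T where "T = Inl ` I \<union> (Inr ` I :: ('i + 'i) set)"
    define dT where "dT = (\<lambda>t :: 'i + 'i. case t of Inl i \<Rightarrow> d i | Inr i \<Rightarrow> d i)"
    define gT where "gT = (\<lambda>t :: 'i + 'i. case t of Inl i \<Rightarrow> g i | Inr i \<Rightarrow> (\<lambda>z. hder (W z) 1 (g i) z))"
    have fT: "form_family (2 * n) D T dT gT" unfolding form_family_def
    proof (intro conjI ballI)
      show "finite T" using fin by (simp add: T_def)
      fix t assume "t \<in> T"
      then obtain i where i: "i \<in> I" "t = Inl i \<or> t = Inr i" by (auto simp: T_def)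
      have "form (2 * n) (d i) (g i)" using gf(3)[OF i(1)] polyf_mono[of n "g i" "2 * n"] by (simp add: form_def)
      moreover have "form (2 * n) (d i) (\<lambda>z. hder (W z) 1 (g i) z)" by (rule form_bi[OF lX lW gf(3)[OF i(1)]])
      ultimately show "1 \<le> dT t" "dT t \<le> D" "form (2 * n) (dT t) (gT t)" using gf(1,2)[OF i(1)] i(2) by (auto simp: dT_def gT_def)
    qed
    have cT: "card T \<le> 2 * R"
      using card_Un_le[of "Inl ` I" "Inr ` I :: ('i+'i) set"] card_image_le[OF fin, of "Inl :: 'i \<Rightarrow> 'i + 'i"] card_image_le[OF fin, of "Inr :: 'i \<Rightarrow> 'i + 'i"] a(2)
      unfolding T_def by linarith
    have sT: "strong_family (2 * n) C' T dT gT" unfolding strong_family_def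
    proof (intro allI impI notI)
      fix e and u :: "'i + 'i \<Rightarrow> 'k" assume ex: "\<exists>i\<in>T. dT i = e \<and> u i \<noteq> 0"
        and l: "low (2 * n) C' e (\<Sum>i\<in>{i\<in>T. dT i = e}. scl (u i) (gT i))"
      define J where "J = {i\<in>I. d i = e}"
      have finJ: "finite J" using fin by (simp add: J_def)
      have TJ: "{i\<in>T. dT i = e} = Inl ` J \<union> Inr ` J" by (auto simp: T_def dT_def J_def)
      have eq: "(\<Sum>i\<in>{i\<in>T. dT i = e}. scl (u i) (gT i)) z = (\<Sum>i\<in>J. u (Inl i) * g i z) + (\<Sum>i\<in>J. u (Inr i) * hder (W z) 1 (g i) z)" for z
      proof -
        have "(\<Sum>i\<in>{i\<in>T. dT i = e}. scl (u i) (gT i)) z = (\<Sum>t\<in>Inl ` J \<union> Inr ` J. u t * gT t z)"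
          unfolding TJ sum_apply scl_apply ..
        also have "\<dots> = (\<Sum>t\<in>Inl ` J. u t * gT t z) + (\<Sum>t\<in>Inr ` J. u t * gT t z)"
          by (rule sum.union_disjoint) (use finJ in auto)
        finally show ?thesis by (simp add: sum.reindex gT_def)
      qed
      \<comment> \<open>If some \<open>g i\<close> occurs in the combination, restriction to
        \<open>w = 0\<close> removes all differentials and leaves a combination of the
        \<open>g i\<close>. Otherwise the combination is the differential of one strong
        form.\<close>
      show False
      proof (cases "\<exists>i\<in>J. u (Inl i) \<noteq> 0")
        case True
        have lr: "linmap (2 * n) n (trunc n)" by (rule linmap_trunc)
        have "(\<Sum>i\<in>{i\<in>T. dT i = e}. scl (u i) (gT i)) (trunc n z) = (\<Sum>i\<in>J. scl (u (Inl i)) (g i)) z" for z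
        proof -
          have W0: "W (trunc n z) = 0" by (rule ext) (simp add: W_def trunc_def)
          have "hder 0 1 (g i) (trunc n z) = 0" if "i \<in> J" for i
          proof (rule hder_1_linear)
            fix t
            have "trunc n z + scl t 0 = trunc n z" by (rule ext) simp
            then show "g i (trunc n z + scl t 0) = g i (trunc n z) + t * 0" by simp
          qed
          then have "(\<Sum>i\<in>J. u (Inr i) * hder (W (trunc n z)) 1 (g i) (trunc n z)) = 0" unfolding W0 by (intro sum.neutral) auto
          moreover have "g i (trunc n z) = g i z" if "i \<in> J" for i by (rule trunc_polyf[OF form_polyf[OF gf(3)]]) (use that in \<open>simp add: J_def\<close>)
          ultimately show ?thesis unfolding eq by (simp add: sum_apply)
        qed
        then have "low n C' e (\<Sum>i\<in>J. scl (u (Inl i)) (g i))" using low_pull[OF lr l] by (simp only:)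
        then have "low n C e (\<Sum>i\<in>J. scl (u (Inl i)) (g i))" by (rule low_mono) (simp add: C_def)
        moreover obtain i where "i \<in> I" "d i = e" "u (Inl i) \<noteq> 0" using True by (auto simp: J_def)
        ultimately show False using strong_familyD[OF a(3), of i e "\<lambda>i. u (Inl i)"] unfolding J_def by blast
      next
        case False
        then obtain i1 where i1: "i1 \<in> J" "u (Inr i1) \<noteq> 0" using ex by (auto simp: T_def dT_def J_def)
        then have e: "1 \<le> e" "e \<le> D" using gf(1,2)[of i1] by (auto simp: J_def)
        define f where "f = (\<Sum>i\<in>J. scl (u (Inr i)) (g i))"
        have hJ: "form n e (g i)" if "i \<in> J" for i using gf(3)[of i] that by (simp add: J_def)
        have form: "form n e f" unfolding f_def by (rule form_sum, rule form_cmul, rule hJ)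
        have "\<not> low n C e f" using strong_familyD[OF a(3), of i1 e "\<lambda>i. u (Inr i)"] i1 unfolding J_def f_def by blast
        moreover have "Ce e \<le> C" unfolding C_def by (rule trans_le_add2, rule member_le_sum) (use e in auto)
        ultimately have "\<not> low n (Ce e) e f" using low_mono by blast
        from Ce[OF e form this] have "\<not> low (2 * n) C' e (\<lambda>z. hder (W z) 1 f z)" unfolding W_def .
        moreover have "(\<Sum>i\<in>{i\<in>T. dT i = e}. scl (u i) (gT i)) z = hder (W z) 1 f z" for z
        proof -
          have "hder (W z) 1 f z = (\<Sum>i\<in>J. hder (W z) 1 (scl (u (Inr i)) (g i)) z)" unfolding f_def
            by (rule hder_sum_1[of _ n]) (rule polyf_scl[OF form_polyf[OF hJ]])
          also have "\<dots> = (\<Sum>i\<in>J. u (Inr i) * hder (W z) 1 (g i) z)"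
            by (rule sum.cong[OF refl], rule hder_scl_1[OF form_polyf[OF hJ]])
          finally show ?thesis unfolding eq using False by simp
        qed
        then have "(\<Sum>i\<in>{i\<in>T. dT i = e}. scl (u i) (gT i)) = (\<lambda>z. hder (W z) 1 f z)" by blast
        ultimately show False using l by simp
      qed
    qed
    show "q i0 \<in> ideal n I g"
    proof (rule ccontr)
      assume q0: "q i0 \<notin> ideal n I g"
      define T0 where "T0 = T - {Inr i0}"
      have dense_prime: "dense_prime (2 * n) T0 gT" and nin: "gT (Inr i0) \<notin> ideal (2 * n) T0 gT"
        using C'[OF fT cT sT] i0 unfolding T0_def by (auto simp: T_def)
      have pq: "polyf (2 * n) (q i0)" using a(4) i0 polyf_mono[of n "q i0" "2 * n"] by simp
      have pg: "polyf (2 * n) (gT (Inr i0))" using fT i0 form_polyf unfolding form_family_def T_def by blast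
      have nin2: "q i0 \<notin> ideal (2 * n) T0 gT"
      proof
        assume "q i0 \<in> ideal (2 * n) T0 gT"
        from ideal_pull[OF this linmap_trunc, of n] obtain r where r: "\<forall>t\<in>T0. polyf n (r t)" "(\<lambda>v. q i0 (trunc n v)) = (\<Sum>t\<in>T0. r t * (\<lambda>v. gT t (trunc n v)))"
          unfolding ideal_def by blast
        have gt: "(\<lambda>v. gT t (trunc n v)) \<in> ideal n I g" if "t \<in> T0" for t
        proof (cases t)
          case (Inl i)
          then have i: "i \<in> I" using that by (auto simp: T0_def T_def)
          have "gT t (trunc n v) = g i v" for v using Inl trunc_polyf[OF form_polyf[OF gf(3)[OF i]]] by (simp add: gT_def)
          then have "(\<lambda>v. gT t (trunc n v)) = g i" by blast
          then show ?thesis using ideal_fibre_eq[OF fin i, of g n] by simp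
        next
          case (Inr i)
          have "gT t (trunc n v) = 0" for v
          proof -
            have W0: "W (trunc n v) = 0" by (rule ext) (simp add: W_def trunc_def)
            have "hder 0 1 (g i) (trunc n v) = 0"
            proof (rule hder_1_linear)
              fix t
              have "trunc n v + scl t 0 = trunc n v" by (rule ext) simp
              then show "g i (trunc n v + scl t 0) = g i (trunc n v) + t * 0" by simp
            qed
            then show ?thesis unfolding Inr gT_def sum.case W0 .
          qed
          then have "(\<lambda>v. gT t (trunc n v)) = 0" by (simp add: fun_eq_iff)
          then show ?thesis using ideal_zero[of n I g] by simp
        qed
        have "(\<lambda>v. q i0 (trunc n v)) \<in> ideal n I g" unfolding r(2) by (rule ideal_sum, rule ideal_mult) (use r(1) gt in auto)
        moreover have "(\<lambda>v. q i0 (trunc n v)) = q i0" using trunc_polyf a(4) i0 by blast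
        ultimately show False using q0 by simp
      qed
      obtain z where z: "\<forall>i\<in>T0. gT i z = 0" "q i0 z \<noteq> 0" "gT (Inr i0) z \<noteq> 0"
        using dense_prime pq pg nin2 nin unfolding dense_prime_def by blast
      have "\<forall>i\<in>I. g i z = 0"
      proof
        fix i assume "i \<in> I"
        then have "Inl i \<in> T0" by (auto simp: T0_def T_def)
        then show "g i z = 0" using z(1) by (force simp: gT_def)
      qed
      then have "(\<Sum>i\<in>I. q i z * hder (W z) 1 (g i) z) = 0" using a(5) by blast
      moreover have "(\<Sum>i\<in>I. q i z * hder (W z) 1 (g i) z) = (\<Sum>i\<in>{i0}. q i z * hder (W z) 1 (g i) z)"
      proof (rule sum.mono_neutral_right[OF fin])
        show "\<forall>i\<in>I - {i0}. q i z * hder (W z) 1 (g i) z = 0"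
        proof
          fix i assume "i \<in> I - {i0}"
          then have "Inr i \<in> T0" by (auto simp: T0_def T_def)
          then have "hder (W z) 1 (g i) z = 0" using z(1) by (force simp: gT_def)
          then show "q i z * hder (W z) 1 (g i) z = 0" by simp
        qed
      qed (use i0 in auto)
      ultimately show False using z(2,3) by (simp add: gT_def)
    qed
  qed
qed

text \<open>The block \<open>i\<close> is orthogonal to all earlier ones, but only with respect to
  members of degree at most that of \<open>b i\<close>; members of higher degree are unrestricted on
  it.\<close>

definition frame :: "'k dform set \<Rightarrow> (nat \<Rightarrow> 'k dform) \<Rightarrow> nat \<Rightarrow> (nat \<Rightarrow> nat \<Rightarrow> 'k) \<Rightarrow> (nat \<Rightarrow> nat \<Rightarrow> 'k) \<Rightarrow> bool" where
  "frame S b k x w \<longleftrightarrow> (\<forall>i<k. block {y\<in>S. fst y \<le> fst (b i)} (fst (b i)) (b i) (x ` {..<i} \<union> w ` {..<i}) (x i) (w i))"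

lemma frame_ex:
  assumes "\<And>e. e < D \<Longrightarrow> dense_fibres e" "\<And>e. 1 \<le> e \<Longrightarrow> e \<le> D \<Longrightarrow> strong_deriv e" "\<And>e. 1 \<le> e \<Longrightarrow> \<exists>N. diag_solv e N"
  shows "\<exists>C. \<forall>n S b. form_set n D S \<longrightarrow> card S \<le> R \<longrightarrow> strong n C S \<longrightarrow> (\<forall>i<k. b i \<in> S) \<longrightarrow> (\<exists>x w. frame S b k x w)"
proof -
  define P where "P = (\<lambda>e C. \<forall>n S f1 U. form_set n e S \<longrightarrow> card S \<le> R \<longrightarrow> strong n C S \<longrightarrow> f1 \<in> S \<longrightarrow> fst f1 = e \<longrightarrow> finite U \<longrightarrow> card U \<le> 2 * k \<longrightarrow>
    (\<exists>x w. block S e f1 U x w))"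
  have "\<exists>C. P e C" if "1 \<le> e" "e \<le> D" for e
  proof -
    obtain N where N: "diag_solv e N" using assms(3) \<open>1 \<le> e\<close> by blast
    have "dense_fibres (e - 1)" "strong_deriv e" using that assms(1)[of "e - 1"] assms(2)[of e] by auto
    from block_exists[OF this that(1) N, of R "2 * k"] show ?thesis unfolding P_def .
  qed
  then obtain C where "\<And>e. 1 \<le> e \<Longrightarrow> e \<le> D \<Longrightarrow> P e (C e)" by metis
  note C = this[unfolded P_def, rule_format]
  show ?thesis
  proof (rule exI[of _ "\<Sum>e\<le>D. C e"], intro allI impI)
    fix n b and S :: "'k dform set"
    assume a: "form_set n D S" "card S \<le> R" "strong n (\<Sum>e\<le>D. C e) S" "\<forall>i<k. b i \<in> S"
    have fin: "finite S" using a(1) by (simp add: form_set_def)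
    have "\<exists>x w. frame S b j x w" if "j \<le> k" for j
      using that
    proof (induction j)
      case 0
      show ?case by (simp add: frame_def)
    next
      case (Suc j)
      then obtain x w where xw: "frame S b j x w" by auto
      define e where "e = fst (b j)"
      define S' where "S' = {y\<in>S. fst y \<le> e}"
      define U where "U = x ` {..<j} \<union> w ` {..<j}"
      have bj: "b j \<in> S" "b j \<in> S'" using a(4) Suc.prems by (auto simp: S'_def e_def)
      then have e: "1 \<le> e" "e \<le> D" using a(1) by (auto simp: form_set_def e_def)
      have sub: "S' \<subseteq> S" by (auto simp: S'_def)
      have "form_set n e S'" using a(1) by (auto simp: form_set_def S'_def)
      moreover have "card S' \<le> R" using card_mono[OF fin sub] a(2) by simp
      moreover have "C e \<le> (\<Sum>e\<le>D. C e)" by (rule member_le_sum) (use e in auto)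
      then have "strong n (C e) S" using a(3) strong_mono by blast
      then have "strong n (C e) S'" by (rule strong_subset[OF _ sub fin])
      moreover have "card U \<le> 2 * k"
        using card_Un_le[of "x ` {..<j}" "w ` {..<j}"] card_image_le[of "{..<j}" x] card_image_le[of "{..<j}" w] Suc.prems
        unfolding U_def by simp
      moreover have "finite U" by (simp add: U_def)
      ultimately obtain x' w' where n: "block S' e (b j) U x' w'" using C[OF e _ _ _ bj(2)] e_def by blast
      define X where "X = (\<lambda>i. if i = j then x' else x i)"
      define W where "W = (\<lambda>i. if i = j then w' else w i)"
      have im: "X ` {..<i} = x ` {..<i}" "W ` {..<i} = w ` {..<i}" if "i \<le> j" for i
        using that by (auto simp: X_def W_def intro!: image_cong)
      have "frame S b (Suc j) X W" unfolding frame_def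
      proof (intro allI impI)
        fix i assume "i < Suc j"
        show "block {y\<in>S. fst y \<le> fst (b i)} (fst (b i)) (b i) (X ` {..<i} \<union> W ` {..<i}) (X i) (W i)"
        proof (cases "i = j")
          case True
          then show ?thesis using n im[of i] unfolding U_def S'_def e_def by (simp add: X_def W_def)
        next
          case False
          then have "i < j" using \<open>i < Suc j\<close> by simp
          then show ?thesis using xw im[of i] False unfolding frame_def by (simp add: X_def W_def)
        qed
      qed
      then show ?case by blast
    qed
    then show "\<exists>x w. frame S b k x w" by blast
  qed
qed

definition frame_map :: "(nat \<Rightarrow> nat \<Rightarrow> 'k) \<Rightarrow> (nat \<Rightarrow> nat \<Rightarrow> 'k) \<Rightarrow> nat \<Rightarrow> (nat \<Rightarrow> 'k) \<Rightarrow> nat \<Rightarrow> 'k" where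
  "frame_map x w k s = (\<Sum>i<k. scl (s (2 * i)) (x i) + scl (s (2 * i + 1)) (w i))"

lemma frame_map_span: "frame_map x w k s \<in> fs.span (x ` {..<k} \<union> w ` {..<k})"
  unfolding frame_map_def
  by (rule fs.span_sum, rule fs.span_add; rule fs.span_scale, rule fs.span_base, simp)

lemma frame_map_Suc: "frame_map x w (Suc k) s = frame_map x w k s + (scl (s (2 * k)) (x k) + scl (s (2 * k + 1)) (w k))"
  unfolding frame_map_def sum.lessThan_Suc ..

lemma linmap_frame_map: assumes "2 * k \<le> m" shows "linmap n m (frame_map x w k)"
  unfolding linmap_def form_def
proof (intro allI impI conjI)
  fix i
  have *: "frame_map x w k z i = (\<Sum>j<k. z (2 * j) * x j i + z (2 * j + 1) * w j i)" for z
    unfolding frame_map_def sum_apply plus_fun_apply scl_apply ..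
  show "polyf m (\<lambda>z. frame_map x w k z i)" unfolding *
    by (rule polyf_sum, rule polyf_add; rule polyf_mult, rule polyf_var, use assms in simp, rule polyf_const)
  fix c z
  show "frame_map x w k (scl c z) i = c ^ 1 * frame_map x w k z i" unfolding * by (simp add: sum_distrib_left algebra_simps)
qed

lemma frame_map_cong: "(\<And>i. i < 2 * k \<Longrightarrow> s i = s' i) \<Longrightarrow> frame_map x w k s = frame_map x w k s'"
  unfolding frame_map_def by (rule sum.cong) auto

text \<open>As the degrees of the \<open>b i\<close> do not decrease, \<open>y\<close> takes part in
  the block \<open>i\<close> and in all later ones. These are orthogonal to what precedes them, so
  the change made in block \<open>i\<close> persists unaltered.\<close>

lemma frame_shift:
  assumes "frame S b k x w" "\<And>i j. i \<le> j \<Longrightarrow> j < k \<Longrightarrow> fst (b i) \<le> fst (b j)" "i < k" "y \<in> S" "fst y \<le> fst (b i)"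
  shows "snd y (frame_map x w k (s + scl t (unit_vec (2 * i + 1)))) = snd y (frame_map x w k s) + (if y = b i then s (2 * i) ^ (fst (b i) - 1) * t else 0)"
proof -
  let ?s = "s + scl t (unit_vec (2 * i + 1))"
  let ?d = "if y = b i then s (2 * i) ^ (fst (b i) - 1) * t else 0"
  have bl: "snd y (u + (scl a (x j) + scl c (w j))) =
     snd y u + (if fst y = fst (b j) then a ^ fst (b j) * snd y (x j) else 0) + (if y = b j then a ^ (fst (b j) - 1) * c else 0)"
    if "i \<le> j" "j < k" "u \<in> fs.span (x ` {..<j} \<union> w ` {..<j})" for j u a c
  proof -
    have "block {y\<in>S. fst y \<le> fst (b j)} (fst (b j)) (b j) (x ` {..<j} \<union> w ` {..<j}) (x j) (w j)" using assms(1) that(2) by (simp add: frame_def)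
    moreover have "y \<in> {y\<in>S. fst y \<le> fst (b j)}" using assms(4,5) assms(2)[OF that(1,2)] by simp
    ultimately show ?thesis using that(3) unfolding block_def by blast
  qed
  have "snd y (frame_map x w j ?s) = snd y (frame_map x w j s) + ?d" if "Suc i \<le> j" "j \<le> k" for j
    using that
  proof (induction j rule: dec_induct)
    case base
    have c: "frame_map x w i ?s = frame_map x w i s" by (rule frame_map_cong) (simp add: unit_vec_def)
    show ?case unfolding frame_map_Suc bl[OF order_refl assms(3) frame_map_span] c by (simp add: unit_vec_def algebra_simps)
  next
    case (step j)
    have ij: "i \<le> j" "j < k" using step by auto
    have "snd y (frame_map x w j ?s) = snd y (frame_map x w j s) + ?d" by (rule step.IH) (use ij in simp)
    moreover have "?s (2 * j) = s (2 * j)" "?s (2 * j + 1) = s (2 * j + 1)" using step(1) by (auto simp: unit_vec_def)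
    ultimately show ?case unfolding frame_map_Suc bl[OF ij frame_map_span] by (simp only: ac_simps)
  qed
  from this[of k] assms(3) show ?thesis by simp
qed

section \<open>Forms whose differential vanishes, in positive characteristic\<close>

lemma hder_mult_l: "polyf n f \<Longrightarrow> polyf n g \<Longrightarrow> hder u 1 (\<lambda>v. f v * g v) v = f v * hder u 1 g v + hder u 1 f v * (g v :: 'k)"
  using hder_mult_1[of n f g u v] by (simp add: times_fun_def)

lemma hder_add_l: "polyf n f \<Longrightarrow> polyf n g \<Longrightarrow> hder u j (\<lambda>v. f v + g v) v = hder u j f v + (hder u j g v :: 'k)"
  using hder_add_1[of n f g u j v] by (simp add: plus_fun_def)

lemma hder_sum_l: assumes "\<And>a. a \<in> A \<Longrightarrow> polyf n (f a)"
  shows "hder u j (\<lambda>v. \<Sum>a\<in>A. f a v) v = (\<Sum>a\<in>A. hder u j (f a) v :: 'k)"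
proof -
  have "(\<lambda>v. \<Sum>a\<in>A. f a v) = (\<Sum>a\<in>A. f a)" by (rule ext) (simp add: sum_apply)
  then show ?thesis using hder_sum_1[of A n f u j v] assms by simp
qed

lemma hder_pow: "polyf n f \<Longrightarrow> hder u 1 (\<lambda>v. f v ^ m) v = of_nat m * f v ^ (m - 1) * (hder u 1 f v :: 'k)"
proof (induction m)
  case 0
  show ?case using hder_const[of u 1 1 v] by simp
next
  case (Suc m)
  have "hder u 1 (\<lambda>v. f v * f v ^ m) v = f v * (of_nat m * f v ^ (m - 1) * hder u 1 f v) + hder u 1 f v * f v ^ m"
    using hder_mult_l[OF Suc.prems polyf_pow[OF Suc.prems], of u m v] Suc by simp
  moreover have "f v * (of_nat m * f v ^ (m - 1) * hder u 1 f v) = of_nat m * f v ^ m * hder u 1 f v"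
    by (cases m) (auto simp: algebra_simps)
  ultimately show ?case by (simp add: algebra_simps)
qed

lemma hder_coord: "hder u 1 (\<lambda>v. v i) v = (u i :: 'k)"
  by (rule hder_1_linear) simp

lemma hder_comp_trunc: "hder u j (\<lambda>v. f (trunc n v)) v = hder (trunc n u) j f (trunc n v)"
proof (rule hder_1_cong)
  fix t
  have "trunc n (v + scl t u) = trunc n v + scl t (trunc n u)" by (rule ext) (simp add: trunc_def)
  then show "f (trunc n (v + scl t u)) = f (trunc n v + scl t (trunc n u))" by simp
qed

lemma coord_expand: assumes "polyf (Suc N) (f :: _ \<Rightarrow> 'k)"
  shows "\<exists>D h. (\<forall>j. polyf N (h j)) \<and> (\<forall>v. f v = (\<Sum>j\<le>D. h j v * v N ^ j)) \<and> h 0 = (\<lambda>v. f (trunc N v))"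
proof -
  obtain D where D: "\<And>t v. f (v + scl t (unit_vec N)) = (\<Sum>j\<le>D. hder (unit_vec N) j f v * t ^ j)"
    using hder_expand0[OF assms, of "unit_vec N"] by blast
  define h where "h = (\<lambda>j v. hder (unit_vec N) j f (trunc N v))"
  have "f v = (\<Sum>j\<le>D. h j v * v N ^ j)" for v
  proof -
    have "f v = f (trunc N v + scl (v N) (unit_vec N))"
      by (rule polyf_cong_coords[OF assms]) (auto simp: trunc_def unit_vec_def less_Suc_eq)
    then show ?thesis unfolding D h_def .
  qed
  moreover have "polyf N (h j)" for j unfolding h_def by (rule polyf_trunc[OF polyf_hder[OF assms]])
  moreover have "h 0 = (\<lambda>v. f (trunc N v))" unfolding h_def hder_0[OF assms] ..
  ultimately show ?thesis by blast
qed

lemma coord_dvd: assumes "polyf (Suc N) (f :: _ \<Rightarrow> 'k)" "\<And>v. f (trunc N v) = 0"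
  shows "\<exists>a. polyf (Suc N) a \<and> (\<forall>v. f v = v N * a v)"
proof -
  obtain D h where h: "\<And>j. polyf N (h j)" "\<And>v. f v = (\<Sum>j\<le>D. h j v * v N ^ j)" "h 0 = (\<lambda>v. f (trunc N v))"
    using coord_expand[OF assms(1)] by blast
  define a where "a = (\<lambda>v. \<Sum>j<D. h (Suc j) v * v N ^ j)"
  have "polyf (Suc N) a" unfolding a_def
    by (intro polyf_sum polyf_mult polyf_pow polyf_var polyf_mono[OF h(1)]) simp_all
  moreover have "f v = v N * a v" for v
  proof -
    have "f v = h 0 v + (\<Sum>j<D. h (Suc j) v * v N ^ Suc j)" unfolding h(2) sum.atMost_shift by simp
    also have "h 0 v = 0" unfolding h(3) by (rule assms(2))
    finally show ?thesis by (simp add: a_def sum_distrib_left algebra_simps)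
  qed
  ultimately show ?thesis by blast
qed

text \<open>Only the differential of \<open>f\<close> is constrained at the zeros, not its value; in
  characteristic \<open>p\<close> every \<open>p\<close>-th power has this property.\<close>

definition deriv_vanish :: "'i set \<Rightarrow> ('i \<Rightarrow> (nat \<Rightarrow> 'k) \<Rightarrow> 'k) \<Rightarrow> 'k pfun \<Rightarrow> bool" where
  "deriv_vanish I g f \<longleftrightarrow> (\<forall>x. (\<forall>i\<in>I. g i x = 0) \<longrightarrow> (\<forall>w. hder w 1 f x = 0))"

definition ideal_sq :: "nat \<Rightarrow> 'i set \<Rightarrow> ('i \<Rightarrow> (nat \<Rightarrow> 'k) \<Rightarrow> 'k) \<Rightarrow> 'k pfun set" where
  "ideal_sq n I g = {f. \<exists>r. (\<forall>i\<in>I. r i \<in> ideal n I g) \<and> f = (\<Sum>i\<in>I. r i * g i)}"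

lemma ideal_sq_0: "0 \<in> ideal_sq n I g"
  unfolding ideal_sq_def by (intro CollectI exI[of _ "\<lambda>_. 0"]) (auto simp: ideal_zero)

lemma ideal_sq_add: assumes "f \<in> ideal_sq n I g" "h \<in> ideal_sq n I g" shows "f + h \<in> ideal_sq n I g"
proof -
  obtain r s where "\<forall>i\<in>I. r i \<in> ideal n I g" "f = (\<Sum>i\<in>I. r i * g i)" "\<forall>i\<in>I. s i \<in> ideal n I g" "h = (\<Sum>i\<in>I. s i * g i)"
    using assms unfolding ideal_sq_def by blast
  then show ?thesis unfolding ideal_sq_def
    by (intro CollectI exI[of _ "\<lambda>i. r i + s i"]) (auto intro: ideal_add simp: distrib_right sum.distrib)
qed

lemma ideal_sq_mult: assumes "f \<in> ideal_sq n I g" "polyf n h" shows "h * f \<in> ideal_sq n I g"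
proof -
  obtain r where "\<forall>i\<in>I. r i \<in> ideal n I g" "f = (\<Sum>i\<in>I. r i * g i)"
    using assms unfolding ideal_sq_def by blast
  then show ?thesis unfolding ideal_sq_def
    by (intro CollectI exI[of _ "\<lambda>i. h * r i"]) (auto intro: ideal_mult assms(2) simp: sum_distrib_left mult.assoc)
qed

lemma ideal_sq_sum: "(\<And>a. a \<in> A \<Longrightarrow> f a \<in> ideal_sq n I g) \<Longrightarrow> (\<Sum>a\<in>A. f a) \<in> ideal_sq n I g"
  by (induction A rule: infinite_finite_induct) (auto intro: ideal_sq_0 ideal_sq_add)

lemma ideal_sq_ideal: assumes "f \<in> ideal_sq n I g" "finite I" "\<And>i. i \<in> I \<Longrightarrow> polyf n (g i)" shows "f \<in> ideal n I g"
proof -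
  obtain r where r: "\<forall>i\<in>I. r i \<in> ideal n I g" "f = (\<Sum>i\<in>I. r i * g i)"
    using assms unfolding ideal_sq_def by blast
  show ?thesis unfolding r(2) by (rule ideal_sum, rule ideal_mult2) (use r(1) assms(3) in auto)
qed

lemma ideal_sq_deriv_vanish: assumes "f \<in> ideal_sq n I g" "\<And>i. i \<in> I \<Longrightarrow> polyf n (g i)" shows "deriv_vanish I g f"
  unfolding deriv_vanish_def
proof (intro allI impI)
  fix x w assume x: "\<forall>i\<in>I. g i x = 0"
  obtain r where r: "\<forall>i\<in>I. r i \<in> ideal n I g" "f = (\<Sum>i\<in>I. r i * g i)"
    using assms unfolding ideal_sq_def by blast
  have pr: "polyf n (r i)" if "i \<in> I" for i using ideal_polyf[of "r i" n I g] r(1) assms(2) that by blast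
  have "hder w 1 f x = (\<Sum>i\<in>I. hder w 1 (r i * g i) x)" unfolding r(2)
    by (rule hder_sum_1[of _ n]) (intro polyf_times pr assms(2))
  also have "\<dots> = 0"
  proof (intro sum.neutral ballI)
    fix i assume i: "i \<in> I"
    have "r i x = 0" using ideal_vanish[of "r i" n I g x] r(1) i x by blast
    then show "hder w 1 (r i * g i) x = 0" using hder_mult_1[OF pr[OF i] assms(2)[OF i], of w x] x i by simp
  qed
  finally show "hder w 1 f x = 0" .
qed

lemma ideal_sq_hcomp: assumes "f \<in> ideal_sq n I g" "\<And>i. i \<in> I \<Longrightarrow> form n (d i) (g i)" shows "hcomp e f \<in> ideal_sq n I g"
proof -
  obtain r where r: "\<forall>i\<in>I. r i \<in> ideal n I g" "f = (\<Sum>i\<in>I. r i * g i)"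
    using assms unfolding ideal_sq_def by blast
  have pr: "polyf n (r i)" if "i \<in> I" for i using ideal_polyf[of "r i" n I g] r(1) form_polyf[OF assms(2)] that by blast
  have "hcomp e f = (\<Sum>i\<in>I. hcomp e (r i * g i))" unfolding r(2)
    by (rule hcomp_sum[of _ n]) (intro polyf_times pr form_polyf[OF assms(2)])
  also have "\<dots> = (\<Sum>i\<in>I. (if d i \<le> e then hcomp (e - d i) (r i) else 0) * g i)"
  proof (rule sum.cong[OF refl])
    fix i assume i: "i \<in> I"
    show "hcomp e (r i * g i) = (if d i \<le> e then hcomp (e - d i) (r i) else 0) * g i"
      unfolding hcomp_mult_form[OF pr[OF i] assms(2)[OF i]] by simp
  qed
  finally have eq: "hcomp e f = (\<Sum>i\<in>I. (if d i \<le> e then hcomp (e - d i) (r i) else 0) * g i)" .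
  have m: "(if d i \<le> e then hcomp (e - d i) (r i) else 0) \<in> ideal n I g" if "i \<in> I" for i
  proof (cases "d i \<le> e")
    case True
    have "hcomp (e - d i) (r i) \<in> ideal n I g" by (rule ideal_hcomp[of _ n I g d]) (use r(1) that assms(2) in blast)+
    then show ?thesis using True by (simp only: if_True)
  next
    case False
    then show ?thesis using ideal_zero[of n I g] by (simp only: if_False)
  qed
  show ?thesis unfolding ideal_sq_def
    by (rule CollectI, rule exI[of _ "\<lambda>i. if d i \<le> e then hcomp (e - d i) (r i) else 0"], intro conjI ballI m eq)
qed

text \<open>Vanishing at the rational zeros is membership in the ideal, so primality removes one
  factor \<open>l\<close> at a time.\<close>

lemma dense_prime_cancel: assumes "dense_prime n I g" "polyf n l" "l \<notin> ideal n I g" "polyf n u" "\<And>x. (\<forall>i\<in>I. g i x = 0) \<Longrightarrow> l x ^ m * u x = (0::'k)"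
  shows "\<And>x. (\<forall>i\<in>I. g i x = 0) \<Longrightarrow> u x = 0"
  using assms(5)
proof (induction m)
  case (Suc m)
  have "l * (\<lambda>x. l x ^ m * u x) \<in> ideal n I g"
  proof (rule dense_prime_mem[OF assms(1)])
    show "polyf n (l * (\<lambda>x. l x ^ m * u x))" using assms(2,4) by (intro polyf_times polyf_mult polyf_pow)
    show "(l * (\<lambda>x. l x ^ m * u x)) z = 0" if "\<And>i. i \<in> I \<Longrightarrow> g i z = 0" for z
      using Suc(3)[of z] that by (simp add: mult.assoc)
  qed
  moreover have "polyf n (\<lambda>x. l x ^ m * u x)" using assms(2,4) by (intro polyf_mult polyf_pow)
  ultimately have "(\<lambda>x. l x ^ m * u x) \<in> ideal n I g" using dense_prime_prime[OF assms(1,2)] assms(3) by blast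
  then have "l x ^ m * u x = 0" if "\<forall>i\<in>I. g i x = 0" for x using ideal_vanish[of "\<lambda>x. l x ^ m * u x" n I g x] that by blast
  then show ?case using Suc(1,2) by blast
qed auto

end

section \<open>Combinations of p-th powers over a field with a finite p-basis\<close>

locale frobenius = infinite_field K for K :: "'k::field itself" +
  fixes p q :: nat and eb :: "nat \<Rightarrow> 'k"
  assumes p_prime: "prime p" and p_char: "p = CHAR('k)"
    and p_basis: "\<And>a. \<exists>c. a = (\<Sum>b<q. eb b * c b ^ p)"
    and p_indep: "\<And>c b. (\<Sum>b<q. eb b * c b ^ p) = 0 \<Longrightarrow> b < q \<Longrightarrow> c b = 0"
begin

lemma prime_char: "prime CHAR('k)"
  using p_prime p_char by simp

lemma of_nat_p [simp]: "of_nat p = (0::'k)"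
  by (simp add: p_char)

lemma p_pos: "p \<ge> 2" "p > 0"
  using p_prime prime_ge_2_nat prime_gt_0_nat by auto

lemma of_nat_nz: "1 \<le> i \<Longrightarrow> i < p \<Longrightarrow> of_nat i \<noteq> (0::'k)"
  unfolding of_nat_eq_0_iff_char_dvd p_char[symmetric] by (auto dest: dvd_imp_le)

lemma frobenius_add: "(x + y) ^ p = x ^ p + (y::'k) ^ p"
  by (rule freshmans_dream[OF prime_char p_char])

lemma frobenius_sum: "(\<Sum>a\<in>A. f a :: 'k) ^ p = (\<Sum>a\<in>A. f a ^ p)"
  by (rule freshmans_dream_sum[OF prime_char p_char])

text \<open>For a basis \<open>eb\<close> of \<open>k\<close> over its \<open>p\<close>-th powers: the polynomials all of whose derivatives vanish.\<close>

definition pth_comb :: "nat \<Rightarrow> 'k pfun \<Rightarrow> bool" where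
  "pth_comb n f \<longleftrightarrow> (\<exists>c. (\<forall>b<q. polyf n (c b)) \<and> f = (\<lambda>v. \<Sum>b<q. eb b * c b v ^ p))"

lemma pth_comb_polyf: "pth_comb n f \<Longrightarrow> polyf n f"
  unfolding pth_comb_def by (auto intro!: polyf_sum polyf_mult polyf_const polyf_pow)

lemma pth_comb_mono: "pth_comb n f \<Longrightarrow> n \<le> m \<Longrightarrow> pth_comb m f"
  unfolding pth_comb_def by (metis polyf_mono)

lemma pth_comb_add: assumes "pth_comb n f" "pth_comb n g" shows "pth_comb n (\<lambda>v. f v + g v)"
proof -
  obtain c d where c: "\<forall>b<q. polyf n (c b)" "f = (\<lambda>v. \<Sum>b<q. eb b * c b v ^ p)" and d: "\<forall>b<q. polyf n (d b)" "g = (\<lambda>v. \<Sum>b<q. eb b * d b v ^ p)"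
    using assms unfolding pth_comb_def by blast
  show ?thesis unfolding pth_comb_def
    by (rule exI[of _ "\<lambda>b v. c b v + d b v"]) (use c d in \<open>auto intro: polyf_add simp: frobenius_add algebra_simps sum.distrib\<close>)
qed

lemma pth_comb_mult: assumes "pth_comb n f" "polyf n g" shows "pth_comb n (\<lambda>v. g v ^ p * f v)"
proof -
  obtain c where c: "\<forall>b<q. polyf n (c b)" "f = (\<lambda>v. \<Sum>b<q. eb b * c b v ^ p)"
    using assms unfolding pth_comb_def by blast
  show ?thesis unfolding pth_comb_def
    by (rule exI[of _ "\<lambda>b v. g v * c b v"]) (use c assms(2) in \<open>auto intro: polyf_mult simp: power_mult_distrib sum_distrib_left algebra_simps\<close>)
qed

lemma pth_comb_const: "pth_comb n (\<lambda>v. a)"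
proof -
  obtain c where "a = (\<Sum>b<q. eb b * c b ^ p)" using p_basis by blast
  then show ?thesis unfolding pth_comb_def by (intro exI[of _ "\<lambda>b v. c b"]) (auto intro: polyf_const)
qed

lemma pth_comb_sum: "(\<And>a. a \<in> A \<Longrightarrow> pth_comb n (f a)) \<Longrightarrow> pth_comb n (\<lambda>v. \<Sum>a\<in>A. f a v)"
  by (induction A rule: infinite_finite_induct) (auto intro: pth_comb_const pth_comb_add)

lemma pth_comb_hder: assumes "pth_comb n f" shows "hder w 1 f v = 0"
proof -
  obtain c where c: "\<forall>b<q. polyf n (c b)" "f = (\<lambda>v. \<Sum>b<q. eb b * c b v ^ p)"
    using assms unfolding pth_comb_def by blast
  have "hder w 1 f v = (\<Sum>b<q. hder w 1 (\<lambda>v. eb b * c b v ^ p) v)" unfolding c(2)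
    by (rule hder_sum_l[of _ n]) (use c(1) in \<open>auto intro!: polyf_mult polyf_const polyf_pow\<close>)
  also have "\<dots> = 0"
  proof (intro sum.neutral ballI)
    fix b assume "b \<in> {..<q}"
    then have pb: "polyf n (c b)" using c(1) by simp
    show "hder w 1 (\<lambda>v. eb b * c b v ^ p) v = 0"
      using hder_mult_l[OF polyf_const[of n "eb b"] polyf_pow[OF pb, of p], of w v] hder_pow[OF pb, of w p v] hder_const[of w 1 "eb b" v] by simp
  qed
  finally show ?thesis .
qed

text \<open>Frobenius is additive, so the degree \<open>e\<close> component of a \<open>p\<close>-th
  power is the \<open>p\<close>-th power of the component of degree \<open>e div p\<close> if
  \<open>p\<close> divides \<open>e\<close>, and \<open>0\<close> otherwise.\<close>

lemma pth_comb_hcomp: assumes "pth_comb n f"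
  shows "\<exists>c. (\<forall>b<q. form n (e div p) (c b)) \<and> hcomp e f = (\<lambda>v. if p dvd e then \<Sum>b<q. eb b * c b v ^ p else 0)"
proof -
  obtain c where c: "\<forall>b<q. polyf n (c b)" "f = (\<lambda>v. \<Sum>b<q. eb b * c b v ^ p)"
    using assms unfolding pth_comb_def by blast
  have "\<forall>b. \<exists>D. b < q \<longrightarrow> (\<forall>t v. c b (scl t v) = (\<Sum>j\<le>D. hcomp j (c b) v * t ^ j)) \<and> (\<forall>j>D. hcomp j (c b) = 0)"
    using c(1) hcomp_expand by blast
  then obtain D where D: "\<And>b t v. b < q \<Longrightarrow> c b (scl t v) = (\<Sum>j\<le>D b. hcomp j (c b) v * t ^ j)" "\<And>b j. b < q \<Longrightarrow> j > D b \<Longrightarrow> hcomp j (c b) = 0"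
    by metis
  define E where "E = (\<Sum>b<q. D b) + e"
  have DE: "c b (scl t v) = (\<Sum>j\<le>E. hcomp j (c b) v * t ^ j)" if "b < q" for b t v
    unfolding D(1)[OF that]
  proof (rule sum.mono_neutral_left)
    have "D b \<le> (\<Sum>b<q. D b)" using that by (intro member_le_sum) auto
    then show "{..D b} \<subseteq> {..E}" by (auto simp: E_def)
    show "\<forall>i\<in>{..E} - {..D b}. hcomp i (c b) v * t ^ i = 0" using D(2)[OF that] by auto
  qed simp
  define P where "P = (\<lambda>v. \<Sum>j\<le>E. monom (\<Sum>b<q. eb b * hcomp j (c b) v ^ p) (j * p))"
  have "f (scl t v) = poly (P v) t" for t v
  proof -
    have "f (scl t v) = (\<Sum>b<q. eb b * (\<Sum>j\<le>E. hcomp j (c b) v ^ p * t ^ (j * p)))"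
      unfolding c(2) by (rule sum.cong) (auto simp: DE frobenius_sum power_mult_distrib power_mult)
    also have "\<dots> = (\<Sum>j\<le>E. (\<Sum>b<q. eb b * hcomp j (c b) v ^ p) * t ^ (j * p))"
      unfolding sum_distrib_left sum_distrib_right by (subst sum.swap) (simp add: mult.assoc)
    finally show ?thesis by (simp add: P_def poly_sum poly_monom)
  qed
  then have "hcomp e f v = coeff (P v) e" for v unfolding hcomp_def by (rule tcoeff_poly)
  moreover have "coeff (P v) e = (if p dvd e then \<Sum>b<q. eb b * hcomp (e div p) (c b) v ^ p else 0)" for v
  proof (cases "p dvd e")
    case True
    have "coeff (P v) e = (\<Sum>j\<le>E. if j = e div p then \<Sum>b<q. eb b * hcomp j (c b) v ^ p else 0)"
      unfolding P_def coeff_sum coeff_monom by (rule sum.cong) (use True p_pos in auto)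
    moreover have "e div p \<le> E" unfolding E_def using div_le_dividend[of e p] by linarith
    ultimately show ?thesis using True by simp
  next
    case False
    then have "coeff (P v) e = 0" unfolding P_def coeff_sum coeff_monom by (intro sum.neutral) auto
    then show ?thesis using False by simp
  qed
  ultimately have "hcomp e f = (\<lambda>v. if p dvd e then \<Sum>b<q. eb b * hcomp (e div p) (c b) v ^ p else 0)" by (simp add: fun_eq_iff)
  moreover have "\<forall>b<q. form n (e div p) (hcomp (e div p) (c b))" using c(1) hcomp_form by blast
  ultimately show ?thesis by (intro exI[of _ "\<lambda>b. hcomp (e div p) (c b)"] conjI)
qed

lemma pth_comb_hcomp_pth_comb: assumes "pth_comb n f" shows "pth_comb n (hcomp e f)"
proof -
  obtain c where c: "\<forall>b<q. form n (e div p) (c b)" "hcomp e f = (\<lambda>v. if p dvd e then \<Sum>b<q. eb b * c b v ^ p else 0)"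
    using pth_comb_hcomp[OF assms] by blast
  show ?thesis
  proof (cases "p dvd e")
    case True
    then show ?thesis unfolding c(2) pth_comb_def by (intro exI[of _ c]) (use c(1) form_polyf in auto)
  next
    case False
    then show ?thesis unfolding c(2) using pth_comb_const[of n 0] by simp
  qed
qed

text \<open>Expand in powers of the last variable. Derivatives in the other directions show that
  every coefficient has zero differential, so induction applies to it; the derivative in the last
  direction removes all exponents not divisible by \<open>p\<close>.\<close>

lemma pd0_pth_comb: "polyf n f \<Longrightarrow> (\<And>w v. hder w 1 f v = 0) \<Longrightarrow> pth_comb n f"
proof (induction n arbitrary: f)
  case 0
  have "f v = f 0" for v by (rule polyf_cong_coords[OF 0(1)]) simp
  then have "f = (\<lambda>v. f 0)" by blast
  then show ?case using pth_comb_const[of 0 "f 0"] by simp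
next
  case (Suc n)
  obtain D h where h: "\<And>j. polyf n (h j)" "\<And>v. f v = (\<Sum>j\<le>D. h j v * v n ^ j)"
    using coord_expand[OF Suc.prems(1)] by blast
  have hS: "polyf (Suc n) (h j)" for j using h(1) by (rule polyf_mono) simp
  have hcomp: "h j (trunc n v) = h j v" for j v by (rule trunc_polyf[OF h(1)])
  have fe: "f = (\<lambda>v. \<Sum>j\<le>D. h j v * v n ^ j)" using h(2) by blast
  \<comment> \<open>Coefficients that do not involve the last variable are recovered by letting this
    variable run through the infinite field.\<close>
  have cf: "(\<forall>v. (\<Sum>j\<le>D. g j v * v n ^ j) = 0) \<Longrightarrow> (\<And>j v t. g j (v + scl t (unit_vec n)) = g j v) \<Longrightarrow> j \<le> D \<Longrightarrow> g j v = 0"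
    for g :: "nat \<Rightarrow> (nat \<Rightarrow> 'k) \<Rightarrow> 'k" and j v
  proof -
    assume a: "\<forall>v. (\<Sum>j\<le>D. g j v * v n ^ j) = 0" "\<And>j v t. g j (v + scl t (unit_vec n)) = g j v" "j \<le> D"
    define P where "P = (\<Sum>j\<le>D. monom (g j v) j)"
    have "poly P t = 0" for t
    proof -
      let ?z = "v + scl (t - v n) (unit_vec n)"
      have "?z n = t" by (simp add: unit_vec_def)
      then show ?thesis using a(1)[rule_format, of ?z] by (simp add: a(2) P_def poly_sum poly_monom)
    qed
    then have "P = 0" using poly_eq_by_values[of P 0] by simp
    then have "coeff P j = 0" by simp
    then show "g j v = 0" using a(3) by (simp add: P_def coeff_sum)
  qed
  have hinv: "h j (v + scl t (unit_vec n)) = h j v" for j v t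
    by (rule polyf_cong_coords[OF h(1)]) (simp add: unit_vec_def)
  have hdh: "hder w 1 (h j) v = 0" if "j \<le> D" for w j v
  proof -
    have "hder (trunc n w) 1 f v = (\<Sum>j\<le>D. hder (trunc n w) 1 (h j) v * v n ^ j)" for v
    proof -
      have "hder (trunc n w) 1 f v = (\<Sum>j\<le>D. hder (trunc n w) 1 (\<lambda>v. h j v * v n ^ j) v)" unfolding fe
        by (rule hder_sum_l[of _ "Suc n"]) (intro polyf_mult polyf_pow polyf_var hS, simp)
      also have "\<dots> = (\<Sum>j\<le>D. hder (trunc n w) 1 (h j) v * v n ^ j)"
      proof (rule sum.cong[OF refl])
        fix j
        have c: "polyf (Suc n) (\<lambda>v :: nat \<Rightarrow> 'k. v n)" by (rule polyf_var) simp
        show "hder (trunc n w) 1 (\<lambda>v. h j v * v n ^ j) v = hder (trunc n w) 1 (h j) v * v n ^ j"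
          using hder_mult_l[OF hS polyf_pow[OF c], of "trunc n w" j j v] hder_pow[OF c, of "trunc n w" j v] hder_coord[of "trunc n w" n v] by (simp add: trunc_def)
      qed
      finally show ?thesis .
    qed
    then have "\<forall>v. (\<Sum>j\<le>D. hder (trunc n w) 1 (h j) v * v n ^ j) = 0" using Suc.prems(2) by simp
    moreover have "hder (trunc n w) 1 (h j) (v + scl t (unit_vec n)) = hder (trunc n w) 1 (h j) v" for j v t
      by (rule hder_1_cong, rule polyf_cong_coords[OF h(1)]) (simp add: unit_vec_def)
    ultimately have "hder (trunc n w) 1 (h j) v = 0" using cf[of "\<lambda>j. hder (trunc n w) 1 (h j)" j v] that by blast
    moreover have "hder (trunc n w) 1 (h j) v = hder w 1 (h j) v"
      by (rule hder_1_cong, rule polyf_cong_coords[OF h(1)]) (simp add: trunc_def)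
    ultimately show ?thesis by simp
  qed
  have h0: "h j v = 0" if j: "j \<le> D" "\<not> p dvd j" for j v
  proof -
    have "hder (unit_vec n) 1 f v = (\<Sum>j\<le>D. h j v * (of_nat j * v n ^ (j - 1)))" for v
    proof -
      have "hder (unit_vec n) 1 f v = (\<Sum>j\<le>D. hder (unit_vec n) 1 (\<lambda>v. h j v * v n ^ j) v)" unfolding fe
        by (rule hder_sum_l[of _ "Suc n"]) (intro polyf_mult polyf_pow polyf_var hS, simp)
      also have "\<dots> = (\<Sum>j\<le>D. h j v * (of_nat j * v n ^ (j - 1)))"
      proof (rule sum.cong[OF refl])
        fix j assume "j \<in> {..D}"
        have c: "polyf (Suc n) (\<lambda>v :: nat \<Rightarrow> 'k. v n)" by (rule polyf_var) simp
        have z: "hder (unit_vec n) 1 (h j) v = 0" by (rule hder_1_linear) (simp add: hinv)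
        have e1: "hder (unit_vec n) 1 (\<lambda>v. v n ^ j) v = of_nat j * v n ^ (j - 1)"
          using hder_pow[OF c, of "unit_vec n" j v] hder_coord[of "unit_vec n" n v] by (simp add: unit_vec_def)
        show "hder (unit_vec n) 1 (\<lambda>v. h j v * v n ^ j) v = h j v * (of_nat j * v n ^ (j - 1))"
          using hder_mult_l[OF hS polyf_pow[OF c], of "unit_vec n" j j v] unfolding z e1 by simp
      qed
      finally show ?thesis .
    qed
    then have "\<forall>v. (\<Sum>j\<le>D. h j v * (of_nat j * v n ^ (j - 1))) = 0" using Suc.prems(2) by simp
    then have "\<forall>v. (\<Sum>j\<le>D. (of_nat j * h j v) * v n ^ j) = 0"
    proof (intro allI)
      fix v assume "\<forall>v. (\<Sum>j\<le>D. h j v * (of_nat j * v n ^ (j - 1))) = 0"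
      then have "v n * (\<Sum>j\<le>D. h j v * (of_nat j * v n ^ (j - 1))) = 0" by simp
      moreover have "v n * (h j v * (of_nat j * v n ^ (j - 1))) = (of_nat j * h j v) * v n ^ j" for j
        by (cases j) auto
      ultimately show "(\<Sum>j\<le>D. (of_nat j * h j v) * v n ^ j) = 0" unfolding sum_distrib_left by (simp only:)
    qed
    then have "of_nat j * h j v = 0" using cf[of "\<lambda>j v. of_nat j * h j v" j v] hinv that by simp
    moreover have "of_nat j \<noteq> (0::'k)" using j(2) unfolding of_nat_eq_0_iff_char_dvd p_char .
    ultimately show ?thesis by simp
  qed
  have "pth_comb (Suc n) (\<lambda>v. h j v * v n ^ j)" if "j \<le> D" for j
  proof (cases "p dvd j")
    case True
    then obtain i where i: "j = i * p" by (metis dvd_def mult.commute)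
    have "pth_comb n (h j)" using Suc.IH[OF h(1)] hdh[OF that] by blast
    then have "pth_comb (Suc n) (h j)" by (rule pth_comb_mono) simp
    from pth_comb_mult[OF this, of "\<lambda>v. v n ^ i"] have "pth_comb (Suc n) (\<lambda>v. (v n ^ i) ^ p * h j v)" by (simp add: polyf_pow polyf_var)
    then show ?thesis by (simp add: i power_mult mult.commute)
  next
    case False
    then have "(\<lambda>v. h j v * v n ^ j) = (\<lambda>v. 0)" using h0[OF that] by simp
    then show ?thesis using pth_comb_const[of "Suc n" 0] by simp
  qed
  then show ?case unfolding fe by (intro pth_comb_sum) auto
qed

end

section \<open>Adding one coordinate at a time\<close>

context infinite_field
begin

text \<open>The tuple restricted to the first \<open>N\<close> coordinates; the induction adds coordinates one at a time.\<close>

definition trunc_family :: "('i \<Rightarrow> (nat \<Rightarrow> 'k) \<Rightarrow> 'k) \<Rightarrow> nat \<Rightarrow> 'i \<Rightarrow> (nat \<Rightarrow> 'k) \<Rightarrow> 'k" where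
  "trunc_family B N i = (\<lambda>v. B i (trunc N v))"

text \<open>The differentials of the \<open>g i\<close> are linearly independent over the coordinate
  ring of the zero set.\<close>

definition jacobian_indep :: "nat \<Rightarrow> 'i set \<Rightarrow> ('i \<Rightarrow> (nat \<Rightarrow> 'k) \<Rightarrow> 'k) \<Rightarrow> bool" where
  "jacobian_indep n I g \<longleftrightarrow> (\<forall>r. (\<forall>i\<in>I. polyf n (r i)) \<longrightarrow> (\<forall>x. (\<forall>i\<in>I. g i x = 0) \<longrightarrow> (\<forall>w. (\<Sum>i\<in>I. r i x * hder w 1 (g i) x) = 0)) \<longrightarrow>
     (\<forall>i\<in>I. r i \<in> ideal n I g))"

lemma trunc_family_form: "form M d (B i) \<Longrightarrow> form n d (trunc_family B n i :: _ \<Rightarrow> 'k)"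
  unfolding trunc_family_def by (rule linmap_form[OF linmap_trunc])

lemma trunc_trunc: "trunc n (trunc m v) = trunc (min n m) v"
  by (rule ext) (simp add: trunc_def)

text \<open>The coefficients are taken over without dependence on the new variable; the error
  vanishes on the hyperplane \<open>v N = 0\<close> and is therefore divisible by
  \<open>v N\<close>.\<close>

lemma ideal_lift:
  assumes "finite I" "\<And>i. i \<in> I \<Longrightarrow> polyf M (B i)" "polyf (Suc N) f" "(\<lambda>v. f (trunc N v)) \<in> ideal N I (trunc_family B N)"
  shows "\<exists>r a. (\<forall>i\<in>I. polyf N (r i)) \<and> polyf (Suc N) a \<and> (\<forall>v. f v = (\<Sum>i\<in>I. r i v * trunc_family B (Suc N) i v) + v N * a v)"
proof -
  obtain r where r: "\<forall>i\<in>I. polyf N (r i)" "(\<lambda>v. f (trunc N v)) = (\<Sum>i\<in>I. r i * trunc_family B N i)" using assms(4) unfolding ideal_def by blast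
  define h where "h = (\<lambda>v. f v - (\<Sum>i\<in>I. r i v * trunc_family B (Suc N) i v))"
  have pr: "polyf (Suc N) (r i)" if "i \<in> I" for i using r(1) that polyf_mono[of N "r i" "Suc N"] by simp
  have pB: "polyf (Suc N) (trunc_family B (Suc N) i)" if "i \<in> I" for i unfolding trunc_family_def by (rule polyf_trunc[OF assms(2)[OF that]])
  have "polyf (Suc N) h" unfolding h_def by (intro polyf_minus assms(3) polyf_sum polyf_mult pr pB)
  moreover have "h (trunc N v) = 0" for v
  proof -
    have "f (trunc N v) = (\<Sum>i\<in>I. r i v * trunc_family B N i v)" using fun_cong[OF r(2), of v] by (simp add: sum_apply)
    also have "\<dots> = (\<Sum>i\<in>I. r i (trunc N v) * trunc_family B (Suc N) i (trunc N v))"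
    proof (rule sum.cong[OF refl])
      fix i assume "i \<in> I"
      then have "r i (trunc N v) = r i v" using r(1) trunc_polyf by blast
      moreover have "trunc_family B (Suc N) i (trunc N v) = trunc_family B N i v" by (simp add: trunc_family_def trunc_trunc)
      ultimately show "r i v * trunc_family B N i v = r i (trunc N v) * trunc_family B (Suc N) i (trunc N v)" by simp
    qed
    finally show ?thesis by (simp add: h_def)
  qed
  ultimately obtain a where a: "polyf (Suc N) a" "\<And>v. h v = v N * a v" using coord_dvd by blast
  have "f v = (\<Sum>i\<in>I. r i v * trunc_family B (Suc N) i v) + v N * a v" for v using a(2)[of v] by (simp add: h_def algebra_simps)
  then show ?thesis using r(1) a(1) by blast
qed

end

context frobenius
begin

text \<open>Combinations of \<open>p\<close>-th powers and elements of the square of the ideal have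
  vanishing differential on the zero set; the property says that sums of the two are all such
  functions.\<close>

definition frobenius_reduces :: "nat \<Rightarrow> 'i set \<Rightarrow> ('i \<Rightarrow> (nat \<Rightarrow> 'k) \<Rightarrow> 'k) \<Rightarrow> bool" where
  "frobenius_reduces n I g \<longleftrightarrow> (\<forall>a. polyf n a \<longrightarrow> deriv_vanish I g a \<longrightarrow> (\<exists>P Q. pth_comb n P \<and> Q \<in> ideal_sq n I g \<and> (\<forall>v. a v = P v + Q v)))"

text \<open>Write \<open>a = P + Q + v N ^ i * b\<close> and raise \<open>i\<close>. For
  \<open>0 < i < p\<close>, differentiation shows that \<open>b\<close> restricted to
  \<open>v N = 0\<close> lies in the ideal of \<open>N\<close> variables, and by independence of the
  differentials so do its coefficients; hence \<open>b\<close> is an element of the square of the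
  ideal plus a multiple of \<open>v N\<close>. At \<open>i = p\<close> the factor
  \<open>v N ^ p\<close> behaves as a constant, \<open>b\<close> inherits the hypothesis on
  \<open>a\<close>, and the process starts again with \<open>b\<close>.\<close>

lemma climb_step:
  fixes I :: "'i set"
  assumes fin: "finite I" and B: "\<And>i. i \<in> I \<Longrightarrow> form M (d i) (B i)"
    and PDN: "dense_prime N I (trunc_family B N)" and PDS: "dense_prime (Suc N) I (trunc_family B (Suc N))" and J: "jacobian_indep N I (trunc_family B N)"
    and l: "coordfun N \<notin> ideal (Suc N) I (trunc_family B (Suc N))" and C: "frobenius_reduces N I (trunc_family B N)"
  shows "frobenius_reduces (Suc N) I (trunc_family B (Suc N))"
proof -
  define G where "G = trunc_family B (Suc N)"
  define H where "H = trunc_family B N"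
  have hG: "form (Suc N) (d i) (G i)" if "i \<in> I" for i unfolding G_def using trunc_family_form[of M "d i" B i "Suc N"] B[OF that] by blast
  have pG: "polyf (Suc N) (G i)" if "i \<in> I" for i using form_polyf[OF hG[OF that]] .
  have pB: "polyf M (B i)" if "i \<in> I" for i using form_polyf[OF B[OF that]] .
  have GH: "G i (trunc N v) = H i v" for i v by (simp add: G_def H_def trunc_family_def trunc_trunc)
  have pl: "polyf (Suc N) (\<lambda>v. v N)" by (rule polyf_var) simp
  have crdl: "coordfun N = (\<lambda>v. v N)" by (simp add: coordfun_def)
  have cancel: "u x = 0" if "polyf (Suc N) u" "\<And>x. (\<forall>i\<in>I. G i x = 0) \<Longrightarrow> x N ^ m * u x = 0" "\<forall>i\<in>I. G i x = 0" for u m x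
    by (rule dense_prime_cancel[OF PDS[folded G_def] pl l[folded G_def, unfolded crdl] that(1) _ that(3), of m]) (rule that(2))
  define dec where "dec = (\<lambda>i a. \<exists>P Q b. pth_comb (Suc N) P \<and> Q \<in> ideal_sq (Suc N) I G \<and> polyf (Suc N) b \<and> (\<forall>v. a v = P v + Q v + v N ^ i * b v))"
  have idl2_pf: "polyf (Suc N) Q" if "Q \<in> ideal_sq (Suc N) I G" for Q
    using ideal_polyf[OF ideal_sq_ideal[OF that fin pG]] pG by blast
  have Dl: "of_nat i * x N ^ (i - 1) * w N * b x + x N ^ i * hder w 1 b x = 0"
    if a: "deriv_vanish I G a" "pth_comb (Suc N) P" "Q \<in> ideal_sq (Suc N) I G" "polyf (Suc N) b" "\<And>v. a v = P v + Q v + v N ^ i * b v" "\<forall>i\<in>I. G i x = 0" for a P Q b i x w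
  proof -
    have ae: "a = (\<lambda>v. (P v + Q v) + v N ^ i * b v)" using a(5) by blast
    have pP: "polyf (Suc N) P" "polyf (Suc N) Q" using pth_comb_polyf[OF a(2)] idl2_pf[OF a(3)] by auto
    have "hder w 1 a x = 0" using a(1,6) unfolding deriv_vanish_def by blast
    moreover have "hder w 1 a x = hder w 1 (\<lambda>v. P v + Q v) x + hder w 1 (\<lambda>v. v N ^ i * b v) x"
      unfolding ae by (rule hder_add_l[OF polyf_add[OF pP] polyf_mult[OF polyf_pow[OF pl] a(4)]])
    moreover have "hder w 1 (\<lambda>v. P v + Q v) x = hder w 1 P x + hder w 1 Q x" by (rule hder_add_l[OF pP])
    moreover have "hder w 1 P x = 0" by (rule pth_comb_hder[OF a(2)])
    moreover have "hder w 1 Q x = 0" using ideal_sq_deriv_vanish[OF a(3) pG] a(6) unfolding deriv_vanish_def by blast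
    moreover have "hder w 1 (\<lambda>v. v N ^ i * b v) x = x N ^ i * hder w 1 b x + of_nat i * x N ^ (i - 1) * w N * b x"
      using hder_mult_l[OF polyf_pow[OF pl, of i] a(4), of w x] hder_pow[OF pl, of w i x] hder_coord[of w N x] by simp
    ultimately show ?thesis by (simp add: add.commute)
  qed
  have Y1: "dec 1 a" if a: "polyf (Suc N) a" "deriv_vanish I G a" for a
  proof -
    have "deriv_vanish I H (\<lambda>v. a (trunc N v))"
      unfolding deriv_vanish_def
    proof (intro allI impI)
      fix x w assume "\<forall>i\<in>I. H i x = 0"
      then have "\<forall>i\<in>I. G i (trunc N x) = 0" using GH by simp
      then show "hder w 1 (\<lambda>v. a (trunc N v)) x = 0" using a(2) unfolding deriv_vanish_def hder_comp_trunc by blast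
    qed
    then obtain P Q where PQ: "pth_comb N P" "Q \<in> ideal_sq N I H" "\<And>v. a (trunc N v) = P v + Q v"
      using C polyf_trunc[OF a(1)] unfolding frobenius_reduces_def H_def by blast
    obtain r where r: "\<forall>i\<in>I. r i \<in> ideal N I H" "Q = (\<Sum>i\<in>I. r i * H i)" using PQ(2) unfolding ideal_sq_def by blast
    have "\<forall>i. \<exists>s. i \<in> I \<longrightarrow> (\<forall>j\<in>I. polyf N (s j)) \<and> r i = (\<Sum>j\<in>I. s j * H j)" using r(1) unfolding ideal_def by blast
    then obtain s where s: "\<And>i j. i \<in> I \<Longrightarrow> j \<in> I \<Longrightarrow> polyf N (s i j)" "\<And>i. i \<in> I \<Longrightarrow> r i = (\<Sum>j\<in>I. s i j * H j)" by metis
    define Q' where "Q' = (\<Sum>i\<in>I. (\<Sum>j\<in>I. s i j * G j) * G i)"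
    have ps: "polyf (Suc N) (s i j)" if "i \<in> I" "j \<in> I" for i j using polyf_mono[OF s(1)[OF that]] by simp
    have Q': "Q' \<in> ideal_sq (Suc N) I G" unfolding ideal_sq_def Q'_def
      by (rule CollectI, rule exI[of _ "\<lambda>i. \<Sum>j\<in>I. s i j * G j"], intro conjI ballI ideal_sum ideal_mult ps ideal_fibre_eq fin refl)
    have P': "pth_comb (Suc N) P" by (rule pth_comb_mono[OF PQ(1)]) simp
    define h where "h = (\<lambda>v. a v - (P v + Q' v))"
    have ph: "polyf (Suc N) h" unfolding h_def by (intro polyf_minus a(1) polyf_add pth_comb_polyf[OF P'] idl2_pf[OF Q'])
    have "h (trunc N v) = 0" for v
    proof -
      have "Q' (trunc N v) = Q v"
      proof -
        have "Q' (trunc N v) = (\<Sum>i\<in>I. (\<Sum>j\<in>I. s i j (trunc N v) * H j v) * H i v)" by (simp add: Q'_def sum_apply GH)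
        also have "\<dots> = (\<Sum>i\<in>I. (\<Sum>j\<in>I. s i j v * H j v) * H i v)"
          by (intro sum.cong arg_cong2[where f = times] refl) (simp add: trunc_polyf[OF s(1)])
        also have "\<dots> = (\<Sum>i\<in>I. r i v * H i v)" by (intro sum.cong refl) (simp add: s(2) sum_apply)
        also have "\<dots> = Q v" by (simp add: r(2) sum_apply)
        finally show ?thesis .
      qed
      moreover have "P (trunc N v) = P v" by (rule trunc_polyf[OF pth_comb_polyf[OF PQ(1)]])
      ultimately show ?thesis using PQ(3)[of v] by (simp add: h_def)
    qed
    then obtain b where b: "polyf (Suc N) b" "\<And>v. h v = v N * b v" using coord_dvd[OF ph] by blast
    have "a v = P v + Q' v + v N ^ 1 * b v" for v using b(2)[of v] by (simp add: h_def algebra_simps)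
    then show ?thesis unfolding dec_def using P' Q' b(1) by blast
  qed
  have Ystep: "dec (Suc i) a" if th: "deriv_vanish I G a" "dec i a" "1 \<le> i" "i < p" for a i
  proof -
    obtain P Q b where d: "pth_comb (Suc N) P" "Q \<in> ideal_sq (Suc N) I G" "polyf (Suc N) b" "\<And>v. a v = P v + Q v + v N ^ i * b v"
      using th(2) unfolding dec_def by blast
    note Dl = Dl[OF th(1) d]
    \<comment> \<open>The derivative in the new direction is \<open>v N ^ (i - 1)\<close> times
      \<open>u\<close>. The power cancels because the new coordinate is not in the prime ideal, and
      at \<open>v N = 0\<close> there remains \<open>of_nat i * b\<close>, where
      \<open>of_nat i\<close> is invertible as \<open>i < p\<close>.\<close>
    have b0: "b (trunc N x) = 0" if "\<forall>i\<in>I. H i x = 0" for x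
    proof -
      define u where "u = (\<lambda>x. of_nat i * b x + x N * hder (unit_vec N) 1 b x)"
      have pu: "polyf (Suc N) u" unfolding u_def by (intro polyf_add polyf_mult polyf_const pl d(3) polyf_hder)
      have "u (trunc N x) = 0"
      proof (rule cancel[OF pu, of "i - 1"])
        show "\<forall>i\<in>I. G i (trunc N x) = 0" using that GH by simp
        fix y assume y: "\<forall>i\<in>I. G i y = 0"
        have "y N ^ i = y N ^ (i - 1) * y N" using \<open>1 \<le> i\<close> by (metis Suc_diff_le diff_Suc_1 One_nat_def power_Suc2)
        then show "y N ^ (i - 1) * u y = 0" using Dl[OF y, of "unit_vec N"] by (simp add: u_def unit_vec_def algebra_simps)
      qed
      then show ?thesis using of_nat_nz[OF \<open>1 \<le> i\<close> \<open>i < p\<close>] by (simp add: u_def trunc_def)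
    qed
    have "(\<lambda>v. b (trunc N v)) \<in> ideal N I H"
      by (rule dense_prime_mem[OF PDN[folded H_def] polyf_trunc[OF d(3)]]) (use b0 in blast)
    from ideal_lift[OF fin pB d(3) this[unfolded H_def], folded G_def] obtain r b' where
      r: "\<And>j. j \<in> I \<Longrightarrow> polyf N (r j)" "polyf (Suc N) b'" "\<And>v. b v = (\<Sum>j\<in>I. r j v * G j v) + v N * b' v" by blast
    have pr: "polyf (Suc N) (r j)" if "j \<in> I" for j using polyf_mono[OF r(1)[OF that]] by simp
    have be: "b = (\<lambda>v. (\<Sum>j\<in>I. r j v * G j v) + v N * b' v)" using r(3) by blast
    \<comment> \<open>Derivatives in the old directions: \<open>v N ^ i\<close> cancels, and at a
      zero with \<open>v N = 0\<close> only the terms with differentials of the \<open>H j\<close>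
      survive.\<close>
    have "(\<Sum>j\<in>I. r j x * hder w 1 (H j) x) = 0" if x: "\<forall>i\<in>I. H i x = 0" for x w
    proof -
      let ?x = "trunc N x" and ?w = "trunc N w"
      have xG: "\<forall>i\<in>I. G i ?x = 0" using x GH by simp
      have wN: "?w N = 0" "?x N = 0" by (simp_all add: trunc_def)
      have "hder ?w 1 b ?x = 0"
      proof (rule cancel[OF polyf_hder[OF d(3)] _ xG, of i])
        fix y assume y: "\<forall>i\<in>I. G i y = 0"
        show "y N ^ i * hder ?w 1 b y = 0" using Dl[OF y, of ?w] wN by simp
      qed
      moreover have "hder ?w 1 b ?x = hder ?w 1 (\<lambda>v. \<Sum>j\<in>I. r j v * G j v) ?x + hder ?w 1 (\<lambda>v. v N * b' v) ?x"
        unfolding be by (rule hder_add_l[OF polyf_sum polyf_mult[OF pl r(2)]]) (intro polyf_mult pr pG)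
      moreover have "hder ?w 1 (\<lambda>v. v N * b' v) ?x = 0"
        using hder_mult_l[OF pl r(2), of ?w ?x] hder_coord[of ?w N ?x] wN by simp
      moreover have "hder ?w 1 (\<lambda>v. \<Sum>j\<in>I. r j v * G j v) ?x = (\<Sum>j\<in>I. hder ?w 1 (\<lambda>v. r j v * G j v) ?x)"
        by (rule hder_sum_l[of _ "Suc N"]) (intro polyf_mult pr pG)
      moreover have "\<dots> = (\<Sum>j\<in>I. r j x * hder w 1 (H j) x)"
      proof (rule sum.cong[OF refl])
        fix j assume j: "j \<in> I"
        have "r j ?x = r j x" by (rule trunc_polyf[OF r(1)[OF j]])
        moreover have "hder w 1 (H j) x = hder ?w 1 (G j) ?x"
        proof -
          have "H j = (\<lambda>v. G j (trunc N v))" using GH by simp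
          then show ?thesis using hder_comp_trunc[of w 1 "G j" N x] by simp
        qed
        ultimately show "hder ?w 1 (\<lambda>v. r j v * G j v) ?x = r j x * hder w 1 (H j) x"
          using hder_mult_l[OF pr[OF j] pG[OF j], of ?w ?x] xG j by simp
      qed
      ultimately show ?thesis by simp
    qed
    then have rI: "r j \<in> ideal N I H" if "j \<in> I" for j using J[unfolded jacobian_indep_def, folded H_def, rule_format, of r] r(1) that by blast
    have "\<forall>j. \<exists>s c. j \<in> I \<longrightarrow> (\<forall>k\<in>I. polyf N (s k)) \<and> polyf (Suc N) c \<and> (\<forall>v. r j v = (\<Sum>k\<in>I. s k v * G k v) + v N * c v)"
    proof
      fix j
      show "\<exists>s c. j \<in> I \<longrightarrow> (\<forall>k\<in>I. polyf N (s k)) \<and> polyf (Suc N) c \<and> (\<forall>v. r j v = (\<Sum>k\<in>I. s k v * G k v) + v N * c v)"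
      proof (cases "j \<in> I")
        case True
        have "(\<lambda>v. r j (trunc N v)) = r j" using trunc_polyf[OF r(1)[OF True]] by blast
        then have "(\<lambda>v. r j (trunc N v)) \<in> ideal N I (trunc_family B N)" using rI[OF True] unfolding H_def by simp
        from ideal_lift[OF fin pB pr[OF True] this, folded G_def] show ?thesis by blast
      qed auto
    qed
    then obtain s c where s: "\<And>j k. j \<in> I \<Longrightarrow> k \<in> I \<Longrightarrow> polyf N (s j k)" "\<And>j. j \<in> I \<Longrightarrow> polyf (Suc N) (c j)"
      "\<And>j v. j \<in> I \<Longrightarrow> r j v = (\<Sum>k\<in>I. s j k v * G k v) + v N * c j v" by metis
    have ps: "polyf (Suc N) (s j k)" if "j \<in> I" "k \<in> I" for j k using polyf_mono[OF s(1)[OF that]] by simp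
    define Q0 where "Q0 = (\<Sum>j\<in>I. (\<Sum>k\<in>I. s j k * G k) * G j)"
    have Q0: "Q0 \<in> ideal_sq (Suc N) I G" unfolding ideal_sq_def Q0_def
      by (rule CollectI, rule exI[of _ "\<lambda>i. \<Sum>j\<in>I. s i j * G j"], intro conjI ballI ideal_sum ideal_mult ps ideal_fibre_eq fin refl)
    define b'' where "b'' = (\<lambda>v. (\<Sum>j\<in>I. c j v * G j v) + b' v)"
    have pb'': "polyf (Suc N) b''" unfolding b''_def by (intro polyf_add polyf_sum polyf_mult s(2) pG r(2))
    have bv: "b v = Q0 v + v N * b'' v" for v
    proof -
      have "(\<Sum>j\<in>I. r j v * G j v) = (\<Sum>j\<in>I. (\<Sum>k\<in>I. s j k v * G k v) * G j v + v N * (c j v * G j v))"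
        by (rule sum.cong[OF refl]) (simp add: s(3) distrib_right mult.assoc)
      also have "\<dots> = Q0 v + v N * (\<Sum>j\<in>I. c j v * G j v)"
        by (simp add: sum.distrib sum_distrib_left Q0_def sum_apply)
      finally show ?thesis unfolding r(3) b''_def by (simp add: algebra_simps)
    qed
    have "(\<lambda>v. v N ^ i) * Q0 \<in> ideal_sq (Suc N) I G" by (rule ideal_sq_mult[OF Q0 polyf_pow[OF pl]])
    then have "Q + (\<lambda>v. v N ^ i) * Q0 \<in> ideal_sq (Suc N) I G" using d(2) by (rule ideal_sq_add[rotated])
    moreover have "a v = P v + (Q + (\<lambda>v. v N ^ i) * Q0) v + v N ^ Suc i * b'' v" for v
      unfolding d(4) bv by (simp add: algebra_simps)
    ultimately show ?thesis unfolding dec_def using d(1) pb'' by blast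
  qed
  have Y: "dec i a" if "polyf (Suc N) a" "deriv_vanish I G a" "1 \<le> i" "i \<le> p" for a i
    using that(3,4)
  proof (induction i rule: dec_induct)
    case base
    show ?case by (rule Y1[OF that(1,2)])
  next
    case (step i)
    then show ?case using Ystep[OF that(2), of i] by simp
  qed
  have X: "dec k a" if "polyf (Suc N) a" "deriv_vanish I G a" for k a
    using that
  proof (induction k arbitrary: a rule: less_induct)
    case (less k)
    have z2: "(0 :: (nat \<Rightarrow> 'k) \<Rightarrow> 'k) \<in> ideal_sq (Suc N) I G" by (rule ideal_sq_0)
    consider "k = 0" | "1 \<le> k" "k \<le> p" | "k > p" by linarith
    then show ?case
    proof cases
      case 1
      then show ?thesis unfolding dec_def
        by (intro exI[of _ "\<lambda>v. 0"] exI[of _ 0] exI[of _ a]) (use pth_comb_const less(2) z2 in auto)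
    next
      case 2
      then show ?thesis using Y less(2,3) by blast
    next
      case 3
      have "dec p a" using Y[OF less(2,3)] p_pos by simp
      then obtain P Q b where d: "pth_comb (Suc N) P" "Q \<in> ideal_sq (Suc N) I G" "polyf (Suc N) b" "\<And>v. a v = P v + Q v + v N ^ p * b v"
        unfolding dec_def by blast
      have "deriv_vanish I G b" unfolding deriv_vanish_def
      proof (intro allI impI)
        fix x w assume x: "\<forall>i\<in>I. G i x = 0"
        show "hder w 1 b x = 0"
        proof (rule cancel[OF polyf_hder[OF d(3)] _ x, of p])
          fix y assume "\<forall>i\<in>I. G i y = 0"
          from Dl[OF less(3) d this, of w] show "y N ^ p * hder w 1 b y = 0" by simp
        qed
      qed
      moreover have "k - p < k" using 3 p_pos by simp
      ultimately have "dec (k - p) b" using less(1) d(3) by blast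
      then obtain P' Q' b' where d': "pth_comb (Suc N) P'" "Q' \<in> ideal_sq (Suc N) I G" "polyf (Suc N) b'" "\<And>v. b v = P' v + Q' v + v N ^ (k - p) * b' v"
        unfolding dec_def by blast
      have "pth_comb (Suc N) (\<lambda>v. P v + v N ^ p * P' v)" by (rule pth_comb_add[OF d(1) pth_comb_mult[OF d'(1) pl]])
      moreover have "Q + (\<lambda>v. v N ^ p) * Q' \<in> ideal_sq (Suc N) I G" by (rule ideal_sq_add[OF d(2) ideal_sq_mult[OF d'(2) polyf_pow[OF pl]]])
      moreover have "a v = (P v + v N ^ p * P' v) + (Q + (\<lambda>v. v N ^ p) * Q') v + v N ^ k * b' v" for v
      proof -
        have "v N ^ k = v N ^ p * v N ^ (k - p)" using 3 by (simp add: power_add[symmetric])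
        then show ?thesis unfolding d(4) d'(4) by (simp add: algebra_simps)
      qed
      ultimately show ?thesis unfolding dec_def using d'(3) by blast
    qed
  qed
  show ?thesis unfolding frobenius_reduces_def G_def[symmetric]
  proof (intro allI impI)
    fix a assume a: "polyf (Suc N) a" "deriv_vanish I G a"
    obtain D where D: "a = (\<Sum>j\<le>D. hcomp j a)" using hcomp_expand[OF a(1)] by blast
    \<comment> \<open>\<open>D\<close> bounds the degree of \<open>a\<close>, so the components of
      degree at most \<open>D\<close> give all of \<open>a\<close> and do not see the remainder,
      which is divisible by \<open>v N ^ Suc D\<close>.\<close>
    obtain P Q b where d: "pth_comb (Suc N) P" "Q \<in> ideal_sq (Suc N) I G" "polyf (Suc N) b" "\<And>v. a v = P v + Q v + v N ^ (Suc D) * b v"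
      using X[OF a, of "Suc D"] unfolding dec_def by blast
    have ae: "a = (P + Q) + b * (\<lambda>v. v N ^ Suc D)" by (rule ext) (simp add: d(4))
    have hl: "form (Suc N) (Suc D) (\<lambda>v :: nat \<Rightarrow> 'k. v N ^ Suc D)" unfolding form_def using polyf_pow[OF pl, of "Suc D"] by (simp add: power_mult_distrib)
    have hj: "hcomp j a = hcomp j P + hcomp j Q" if "j \<le> D" for j
    proof -
      have "hcomp j a = hcomp j (P + Q) + hcomp j (b * (\<lambda>v. v N ^ Suc D))"
        unfolding ae by (rule hcomp_add[of "Suc N"]) (intro polyf_plus polyf_times pth_comb_polyf[OF d(1)] idl2_pf[OF d(2)] d(3) form_polyf[OF hl])+
      also have "hcomp j (b * (\<lambda>v. v N ^ Suc D)) = 0" unfolding hcomp_mult_form[OF d(3) hl] using that by simp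
      also have "hcomp j (P + Q) = hcomp j P + hcomp j Q" by (rule hcomp_add[OF pth_comb_polyf[OF d(1)] idl2_pf[OF d(2)]])
      finally show ?thesis by (simp only: add_0_right)
    qed
    have "pth_comb (Suc N) (\<lambda>v. \<Sum>j\<le>D. hcomp j P v)" by (rule pth_comb_sum) (rule pth_comb_hcomp_pth_comb[OF d(1)])
    moreover have "(\<Sum>j\<le>D. hcomp j Q) \<in> ideal_sq (Suc N) I G" by (rule ideal_sq_sum) (rule ideal_sq_hcomp[where d = d, OF d(2) hG])
    moreover have "a v = (\<Sum>j\<le>D. hcomp j P v) + (\<Sum>j\<le>D. hcomp j Q) v" for v
    proof -
      have "a v = (\<Sum>j\<le>D. hcomp j a v)" using fun_cong[OF D, of v] by (simp only: sum_apply)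
      also have "\<dots> = (\<Sum>j\<le>D. hcomp j P v + hcomp j Q v)" by (rule sum.cong) (simp_all add: hj)
      finally show ?thesis by (simp add: sum.distrib sum_apply)
    qed
    ultimately show "\<exists>P Q. pth_comb (Suc N) P \<and> Q \<in> ideal_sq (Suc N) I G \<and> (\<forall>v. a v = P v + Q v)" by blast
  qed
qed

end

section \<open>The start of the climb: the span of a frame\<close>

context infinite_field
begin

lemma unit_vec_sum: assumes "finite A" "inj_on ta A"
  shows "(\<Sum>j\<in>A. scl (c (ta j)) (unit_vec (ta j))) i = (if i \<in> ta ` A then c i else (0::'k))"
proof -
  have "(\<Sum>j\<in>A. scl (c (ta j)) (unit_vec (ta j))) i = (\<Sum>l\<in>ta ` A. c l * unit_vec l i)"
    unfolding sum.reindex[OF assms(2)] sum_apply by simp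
  also have "\<dots> = (\<Sum>l\<in>ta ` A. if i = l then c l else 0)" by (rule sum.cong) (auto simp: unit_vec_def)
  finally show ?thesis using assms(1) by simp
qed

end

context frobenius
begin

text \<open>The equations are triangular: \<open>g i\<close> does not involve the coordinates
  \<open>ta j\<close> with \<open>j > i\<close>, and is affine in \<open>ta i\<close> with slope a
  power of the coordinate \<open>sg i\<close>. Where the product \<open>pi\<close> of the
  coordinates \<open>sg j\<close> is nonzero, the zero set is a graph over the coordinates other
  than the \<open>ta j\<close>. After multiplication by a power of \<open>pi\<close>, the function
  \<open>a\<close> descends to this base, where a vanishing differential makes it a combination of
  \<open>p\<close>-th powers; \<open>pi\<close> is divided out again with \<open>dv\<close> and the
  independence of \<open>eb\<close> over the \<open>p\<close>-th powers.\<close>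

lemma base_claim:
  fixes g :: "nat \<Rightarrow> (nat \<Rightarrow> 'k) \<Rightarrow> 'k" and e sg ta :: "nat \<Rightarrow> nat"
  assumes g: "\<And>i. i < R \<Longrightarrow> polyf m (g i)" and sg: "\<And>j. j < R \<Longrightarrow> sg j < m" and ta: "\<And>j. j < R \<Longrightarrow> ta j < m"
    and ne: "\<And>i j. i < R \<Longrightarrow> j < R \<Longrightarrow> sg i \<noteq> ta j" and inj: "inj_on ta {..<R}"
    and sh: "\<And>i j s t. j < R \<Longrightarrow> i \<le> j \<Longrightarrow> g i (s + scl t (unit_vec (ta j))) = g i s + (if i = j then t * s (sg j) ^ (e j - 1) else 0)"
    and dense_prime: "dense_prime m {..<R} g" and J: "jacobian_indep m {..<R} g" and nin: "\<And>j. j < R \<Longrightarrow> coordfun (sg j) \<notin> ideal m {..<R} g"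
    and dv: "\<And>j u. j < R \<Longrightarrow> polyf m u \<Longrightarrow> (\<And>x. \<forall>i<R. g i x = 0 \<Longrightarrow> x (sg j) = 0 \<Longrightarrow> u x = 0) \<Longrightarrow>
      \<exists>c. polyf m c \<and> (\<forall>x. (\<forall>i<R. g i x = 0) \<longrightarrow> u x = x (sg j) * c x)"
  shows "frobenius_reduces m {..<R} g"
proof -
  define Z where "Z = {x. \<forall>i<R. g i x = 0}"
  have ZI: "x \<in> Z \<longleftrightarrow> (\<forall>i\<in>{..<R}. g i x = 0)" for x by (auto simp: Z_def)
  have ps: "polyf m (\<lambda>x :: nat \<Rightarrow> 'k. x (sg j))" if "j < R" for j by (rule polyf_var[OF sg[OF that]])
  have cancel1: "u x = 0" if "j < R" "polyf m u" "\<And>x. x \<in> Z \<Longrightarrow> x (sg j) ^ n * u x = 0" "x \<in> Z" for j u n x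
    by (rule dense_prime_cancel[OF dense_prime ps[OF that(1)] nin[OF that(1), unfolded coordfun_def] that(2) that(3)[unfolded ZI] that(4)[unfolded ZI]])
  have cancel: "\<forall>x\<in>Z. u x = 0" if "A \<subseteq> {..<R}" "polyf m u" "\<And>x. x \<in> Z \<Longrightarrow> (\<Prod>j\<in>A. x (sg j)) ^ n * u x = 0" for A u n
  proof -
    have "finite A" using that(1) finite_subset by blast
    then show ?thesis using that
    proof (induction A arbitrary: u rule: finite_induct)
      case (insert j A)
      have j: "j < R" "A \<subseteq> {..<R}" using insert.prems(1) by auto
      have "polyf m (\<lambda>x. x (sg j) ^ n * u x)" by (intro polyf_mult polyf_pow ps j(1) insert.prems(2))
      moreover have "(\<Prod>j\<in>A. x (sg j)) ^ n * (x (sg j) ^ n * u x) = 0" if "x \<in> Z" for x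
        using insert.prems(3)[OF that] insert.hyps by (simp add: power_mult_distrib ac_simps)
      ultimately have "\<forall>x\<in>Z. x (sg j) ^ n * u x = 0" by (rule insert.IH[OF j(2)])
      then show ?case using cancel1[OF j(1) insert.prems(2)] by blast
    qed auto
  qed
  \<comment> \<open>Functions on the base of the graph, that is, without any coordinate
    \<open>ta j\<close>.\<close>
  define R0 where "R0 = (\<lambda>f :: (nat \<Rightarrow> 'k) \<Rightarrow> 'k. \<forall>j<R. \<forall>s t. f (s + scl t (unit_vec (ta j))) = f s)"
  have R0s: "R0 (\<lambda>x. x (sg j))" if "j < R" for j using ne[OF that] by (auto simp: R0_def unit_vec_def)
  have R0sum: "a (s + (\<Sum>j\<in>A. scl (c j) (unit_vec (ta j)))) = a s" if "R0 a" "A \<subseteq> {..<R}" for a s A c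
  proof -
    have "finite A" using that(2) finite_subset by blast
    then show ?thesis using that(2)
    proof (induction A rule: finite_induct)
      case empty
      show ?case unfolding sum.empty add_0_right ..
    next
      case (insert j A)
      have "s + (\<Sum>j\<in>insert j A. scl (c j) (unit_vec (ta j))) = (s + (\<Sum>j\<in>A. scl (c j) (unit_vec (ta j)))) + scl (c j) (unit_vec (ta j))"
        unfolding sum.insert[OF insert(1,2)] by (simp only: ac_simps)
      moreover have "a ((s + (\<Sum>j\<in>A. scl (c j) (unit_vec (ta j)))) + scl (c j) (unit_vec (ta j))) = a (s + (\<Sum>j\<in>A. scl (c j) (unit_vec (ta j))))"
        using that(1) insert.prems unfolding R0_def by blast
      ultimately show ?case using insert.IH insert.prems by (simp only: insert_subset)
    qed
  qed
  define pi where "pi = (\<lambda>x :: nat \<Rightarrow> 'k. \<Prod>j<R. x (sg j))"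
  have ppi: "polyf m pi" unfolding pi_def by (rule polyf_prod, rule ps) simp
  have R0pi: "R0 pi" using ne by (simp add: R0_def pi_def unit_vec_def)
  \<comment> \<open>On the zero set, a power of \<open>pi\<close> times the function is a function
    on the base.\<close>
  define Red where "Red = (\<lambda>f. \<exists>n a. polyf m a \<and> R0 a \<and> (\<forall>s\<in>Z. pi s ^ n * f s = a s))"
  have Red_add: "Red (\<lambda>s. f s + h s)" and Red_mult: "Red (\<lambda>s. f s * h s)" if fh: "Red f" "Red h" for f h
  proof -
    obtain n a n' b where a: "polyf m a" "R0 a" "\<And>s. s\<in>Z \<Longrightarrow> pi s ^ n * f s = a s" and b: "polyf m b" "R0 b" "\<And>s. s\<in>Z \<Longrightarrow> pi s ^ n' * h s = b s"
      using fh unfolding Red_def by blast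
    have "pi s ^ (n + n') * (f s + h s) = pi s ^ n' * a s + pi s ^ n * b s" if "s \<in> Z" for s
      unfolding a(3)[OF that, symmetric] b(3)[OF that, symmetric] by (simp add: power_add algebra_simps)
    moreover have "R0 (\<lambda>s. pi s ^ n' * a s + pi s ^ n * b s)" using R0pi a(2) b(2) by (simp add: R0_def)
    ultimately show "Red (\<lambda>s. f s + h s)" unfolding Red_def
      by (intro exI[of _ "n + n'"] exI[of _ "\<lambda>s. pi s ^ n' * a s + pi s ^ n * b s"]) (use a b ppi in \<open>auto intro!: polyf_add polyf_mult polyf_pow\<close>)
    have "pi s ^ (n + n') * (f s * h s) = a s * b s" if "s \<in> Z" for s
      unfolding a(3)[OF that, symmetric] b(3)[OF that, symmetric] by (simp add: power_add algebra_simps)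
    moreover have "R0 (\<lambda>s. a s * b s)" using a(2) b(2) by (simp add: R0_def)
    ultimately show "Red (\<lambda>s. f s * h s)" unfolding Red_def
      by (intro exI[of _ "n + n'"] exI[of _ "\<lambda>s. a s * b s"]) (use a b in \<open>auto intro!: polyf_mult\<close>)
  qed
  have Red0: "Red f" if "polyf m f" "R0 f" for f unfolding Red_def
    by (intro exI[of _ "0::nat"] exI[of _ f]) (use that in simp)
  have Red_comp: "polyf m f \<Longrightarrow> (\<And>i. i < m \<Longrightarrow> Red (\<lambda>s. L s i)) \<Longrightarrow> Red (\<lambda>s. f (L s))" for f L
  proof (induction rule: polyf.induct)
    case (polyf_const c)
    show ?case by (rule Red0[OF polyf.polyf_const]) (simp add: R0_def)
  qed (auto intro: Red_add Red_mult)
  have gsum: "g i (s + (\<Sum>j\<in>A. scl (c j) (unit_vec (ta j)))) = g i s" if "A \<subseteq> {i<..<R}" for i A s c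
  proof -
    have "finite A" using that finite_subset by blast
    then show ?thesis using that
    proof (induction A rule: finite_induct)
      case empty
      show ?case unfolding sum.empty add_0_right ..
    next
      case (insert j A)
      have "s + (\<Sum>j\<in>insert j A. scl (c j) (unit_vec (ta j))) = (s + (\<Sum>j\<in>A. scl (c j) (unit_vec (ta j)))) + scl (c j) (unit_vec (ta j))"
        unfolding sum.insert[OF insert(1,2)] by (simp only: ac_simps)
      moreover have ji: "j < R" "i \<le> j" "i \<noteq> j" using insert.prems by auto
      have "g i ((s + (\<Sum>j\<in>A. scl (c j) (unit_vec (ta j)))) + scl (c j) (unit_vec (ta j))) = g i (s + (\<Sum>j\<in>A. scl (c j) (unit_vec (ta j))))"
        using sh[OF ji(1,2), of "s + (\<Sum>j\<in>A. scl (c j) (unit_vec (ta j)))" "c j"] unfolding if_not_P[OF ji(3)] add_0_right .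
      ultimately show ?case using insert.IH insert.prems by (simp only: insert_subset)
    qed
  qed
  have Redta: "Red (\<lambda>s. s (ta j))" if "j < R" for j
    using that
  proof (induction j rule: less_induct)
    case (less j)
    \<comment> \<open>\<open>zj\<close> sets the coordinates \<open>ta i\<close> with
      \<open>i \<ge> j\<close> to \<open>0\<close>. As \<open>g j\<close> ignores those beyond
      \<open>j\<close> and is affine in \<open>ta j\<close>, the equation \<open>g j = 0\<close>
      expresses \<open>s (ta j)\<close> through \<open>zj s\<close>, with a power of
      \<open>s (sg j)\<close> as denominator; the coordinates entering \<open>zj s\<close> are
      reducible by induction.\<close>
    define zj where "zj = (\<lambda>s :: nat \<Rightarrow> 'k. \<lambda>i. if i \<in> ta ` {j..<R} then 0 else s i)"
    have sz: "s = (zj s + (\<Sum>j'\<in>{j<..<R}. scl (s (ta j')) (unit_vec (ta j')))) + scl (s (ta j)) (unit_vec (ta j))" for s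
    proof (rule ext)
      fix i
      have "inj_on ta {j..<R}" by (rule inj_on_subset[OF inj]) auto
      then have "(\<Sum>j'\<in>{j..<R}. scl (s (ta j')) (unit_vec (ta j'))) i = (if i \<in> ta ` {j..<R} then s i else 0)" by (intro unit_vec_sum) auto
      moreover have "{j..<R} = insert j {j<..<R}" using less.prems by auto
      then have "(\<Sum>j'\<in>{j..<R}. scl (s (ta j')) (unit_vec (ta j'))) = scl (s (ta j)) (unit_vec (ta j)) + (\<Sum>j'\<in>{j<..<R}. scl (s (ta j')) (unit_vec (ta j')))"
        by (simp only: sum.insert finite_greaterThanLessThan greaterThanLessThan_iff less_irrefl simp_thms)
      ultimately have 1: "(scl (s (ta j)) (unit_vec (ta j)) + (\<Sum>j'\<in>{j<..<R}. scl (s (ta j')) (unit_vec (ta j')))) i = (if i \<in> ta ` {j..<R} then s i else 0)"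
        by (simp only:)
      have 2: "s i = (if i \<in> ta ` {j..<R} then s i else 0) + zj s i" by (simp add: zj_def)
      show "s i = ((zj s + (\<Sum>j'\<in>{j<..<R}. scl (s (ta j')) (unit_vec (ta j')))) + scl (s (ta j)) (unit_vec (ta j))) i"
        unfolding 2[folded 1] plus_fun_apply by (simp only: ac_simps)
    qed
    have gj: "g j s = g j (zj s) + s (ta j) * s (sg j) ^ (e j - 1)" for s
    proof -
      have "g j s = g j (zj s + (\<Sum>j'\<in>{j<..<R}. scl (s (ta j')) (unit_vec (ta j')))) + s (ta j) * (zj s + (\<Sum>j'\<in>{j<..<R}. scl (s (ta j')) (unit_vec (ta j')))) (sg j) ^ (e j - 1)"
        using trans[OF arg_cong[of _ _ "g j", OF sz[of s]] sh[OF less.prems order_refl, of "zj s + (\<Sum>j'\<in>{j<..<R}. scl (s (ta j')) (unit_vec (ta j')))" "s (ta j)"]]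
        unfolding if_P[OF refl] .
      moreover have "g j (zj s + (\<Sum>j'\<in>{j<..<R}. scl (s (ta j')) (unit_vec (ta j')))) = g j (zj s)" by (rule gsum[OF order_refl])
      moreover have "(zj s + (\<Sum>j'\<in>{j<..<R}. scl (s (ta j')) (unit_vec (ta j')))) (sg j) = s (sg j)"
      proof -
        have "(zj s + (\<Sum>j'\<in>{j<..<R}. scl (s (ta j')) (unit_vec (ta j')))) (sg j) = zj s (sg j)"
          by (rule R0sum[OF R0s[OF less.prems], of "{j<..<R}"]) auto
        moreover have "sg j \<notin> ta ` {j..<R}" using ne[OF less.prems] by (metis atLeastLessThan_iff imageE)
        ultimately show ?thesis by (simp add: zj_def)
      qed
      ultimately show ?thesis by simp
    qed
    have "Red (\<lambda>s. zj s i)" if i: "i < m" for i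
    proof -
      consider "i \<in> ta ` {j..<R}" | j' where "j' < j" "i = ta j'" | "i \<notin> ta ` {..<R}"
      proof (cases "i \<in> ta ` {..<R}")
        case True
        then obtain j' where "j' < R" "i = ta j'" by auto
        then show thesis using that(1,2) by (cases "j' < j") auto
      qed (rule that(3))
      then show ?thesis
      proof cases
        case 1
        have "Red (\<lambda>s. 0)" by (rule Red0[OF polyf_const]) (simp add: R0_def)
        then show ?thesis using 1 by (simp add: zj_def)
      next
        case 2
        have "i \<notin> ta ` {j..<R}"
        proof
          assume "i \<in> ta ` {j..<R}"
          then obtain j'' where "j \<le> j''" "j'' < R" "ta j' = ta j''" using 2 by auto
          then show False using inj_onD[OF inj, of j' j''] 2 less.prems by auto
        qed
        then show ?thesis using less.IH[OF 2(1)] 2 less.prems by (simp add: zj_def)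
      next
        case 3
        have "Red (\<lambda>s. s i)" by (rule Red0[OF polyf_var[OF i]]) (use 3 in \<open>auto simp: R0_def unit_vec_def\<close>)
        moreover have "i \<notin> ta ` {j..<R}" using 3 by auto
        ultimately show ?thesis by (simp add: zj_def)
      qed
    qed
    then have "Red (\<lambda>s. g j (zj s))" by (rule Red_comp[OF g[OF less.prems], of zj])
    then obtain n a where a: "polyf m a" "R0 a" "\<And>s. s \<in> Z \<Longrightarrow> pi s ^ n * g j (zj s) = a s"
      unfolding Red_def by blast
    define b where "b = (\<lambda>s :: nat \<Rightarrow> 'k. - ((\<Prod>i\<in>{..<R}-{j}. s (sg i)) ^ (e j - 1) * a s))"
    have "pi s ^ (n + (e j - 1)) * s (ta j) = b s" if s: "s \<in> Z" for s
    proof -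
      have "s (ta j) * s (sg j) ^ (e j - 1) = - g j (zj s)" using gj[of s] s less.prems by (simp add: Z_def eq_neg_iff_add_eq_0 add.commute)
      moreover have pe: "pi s = s (sg j) * (\<Prod>i\<in>{..<R}-{j}. s (sg i))" unfolding pi_def using less.prems by (intro prod.remove) auto
      have "pi s ^ (n + (e j - 1)) * s (ta j) = pi s ^ n * (\<Prod>i\<in>{..<R}-{j}. s (sg i)) ^ (e j - 1) * (s (ta j) * s (sg j) ^ (e j - 1))"
        unfolding power_add by (subst (2) pe) (simp add: power_mult_distrib)
      ultimately show ?thesis using a(3)[OF s] by (simp add: b_def ac_simps)
    qed
    moreover have "polyf m b" unfolding b_def by (intro polyf_uminus polyf_mult polyf_pow polyf_prod ps a(1)) simp
    moreover have "R0 b" using a(2) ne by (simp add: R0_def b_def unit_vec_def)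
    ultimately show ?case unfolding Red_def by blast
  qed
  have Red_all: "Red f" if "polyf m f" for f
  proof (rule Red_comp[OF that, of "\<lambda>s. s"])
    fix i assume i: "i < m"
    show "Red (\<lambda>s. s i)"
    proof (cases "i \<in> ta ` {..<R}")
      case True
      then show ?thesis using Redta by auto
    next
      case False
      show ?thesis by (rule Red0[OF polyf_var[OF i]]) (use False in \<open>auto simp: R0_def unit_vec_def\<close>)
    qed
  qed
  \<comment> \<open>Where \<open>pi\<close> is nonzero, the equations can be solved for the
    \<open>ta j\<close> in increasing order of \<open>j\<close>, since every slope is nonzero and
    later shifts do not disturb earlier equations.\<close>
  have solve: "\<exists>c. s + (\<Sum>j<R. scl (c j) (unit_vec (ta j))) \<in> Z" if s: "pi s \<noteq> 0" for s
  proof -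
    have "\<exists>c. \<forall>i<k. g i (s + (\<Sum>j<k. scl (c j) (unit_vec (ta j)))) = 0" if "k \<le> R" for k
      using that
    proof (induction k)
      case (Suc k)
      have "k \<le> R" using Suc.prems by simp
      from Suc.IH[OF this] obtain c where c: "\<And>i. i < k \<Longrightarrow> g i (s + (\<Sum>j<k. scl (c j) (unit_vec (ta j)))) = 0" by blast
      define s' where "s' = s + (\<Sum>j<k. scl (c j) (unit_vec (ta j)))"
      have k: "k < R" using Suc.prems by simp
      have "s' (sg k) = s (sg k)" unfolding s'_def by (rule R0sum[OF R0s[OF k], of "{..<k}"]) (use k in auto)
      moreover have "s (sg k) \<noteq> 0" using s k by (auto simp: pi_def)
      ultimately have nz: "s' (sg k) \<noteq> 0" by simp
      define c' where "c' = c(k := - g k s' / s' (sg k) ^ (e k - 1))"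
      have "(\<Sum>j<k. scl (c' j) (unit_vec (ta j))) = (\<Sum>j<k. scl (c j) (unit_vec (ta j)))" by (rule sum.cong) (auto simp: c'_def)
      then have eq: "s + (\<Sum>j<Suc k. scl (c' j) (unit_vec (ta j))) = s' + scl (c' k) (unit_vec (ta k))"
        unfolding s'_def sum.lessThan_Suc by (simp only: ac_simps)
      have "g i (s' + scl (c' k) (unit_vec (ta k))) = 0" if "i < Suc k" for i
      proof (cases "i = k")
        case True
        then show ?thesis using sh[OF k, of i s' "c' k"] nz by (simp add: c'_def)
      next
        case False
        then show ?thesis using sh[OF k, of i s' "c' k"] c[of i] that by (simp add: s'_def[symmetric])
      qed
      then show ?case unfolding eq[symmetric] by blast
    qed simp
    from this[of R] show ?thesis by (auto simp: Z_def)
  qed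
  define Qp where "Qp = (\<lambda>f. \<exists>c. (\<forall>b<q. polyf m (c b)) \<and> (\<forall>x\<in>Z. f x = (\<Sum>b<q. eb b * c b x ^ p)))"
  \<comment> \<open>On the part of the zero set with \<open>x (sg j) = 0\<close> the combination of
    the \<open>c b x ^ p\<close> vanishes, so each \<open>c b\<close> vanishes there by independence
    of \<open>eb\<close>; \<open>dv\<close> then divides every \<open>c b\<close> by the coordinate
    \<open>sg j\<close>, which divides the sum by its \<open>p\<close>-th power.\<close>
  have desc1: "Qp f" if j: "j < R" and f: "polyf m f" and Q: "Qp (\<lambda>x. x (sg j) ^ p * f x)" for j f
  proof -
    obtain c where c: "\<And>b. b < q \<Longrightarrow> polyf m (c b)" "\<And>x. x \<in> Z \<Longrightarrow> x (sg j) ^ p * f x = (\<Sum>b<q. eb b * c b x ^ p)"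
      using Q unfolding Qp_def by blast
    have "\<exists>c'. polyf m c' \<and> (\<forall>x. (\<forall>i<R. g i x = 0) \<longrightarrow> c b x = x (sg j) * c' x)" if "b < q" for b
    proof (rule dv[OF j c(1)[OF that]])
      fix x assume x: "\<forall>i<R. g i x = 0" "x (sg j) = 0"
      then have "(\<Sum>b<q. eb b * c b x ^ p) = 0" using c(2)[of x] p_pos by (simp add: Z_def power_0_left)
      then show "c b x = 0" using p_indep[of "\<lambda>b. c b x" b] that by simp
    qed
    then have "\<forall>b. \<exists>c'. b < q \<longrightarrow> polyf m c' \<and> (\<forall>x\<in>Z. c b x = x (sg j) * c' x)" unfolding Z_def by blast
    then obtain c' where c': "\<And>b. b < q \<Longrightarrow> polyf m (c' b)" "\<And>b x. b < q \<Longrightarrow> x \<in> Z \<Longrightarrow> c b x = x (sg j) * c' b x" by metis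
    define u where "u = (\<lambda>x. f x - (\<Sum>b<q. eb b * c' b x ^ p))"
    have pu: "polyf m u" unfolding u_def by (intro polyf_minus f polyf_sum polyf_mult polyf_const polyf_pow c'(1)) simp
    have "u x = 0" if "x \<in> Z" for x
    proof (rule cancel1[OF j pu _ that, of p])
      fix y assume y: "y \<in> Z"
      have "(\<Sum>b<q. eb b * c b y ^ p) = y (sg j) ^ p * (\<Sum>b<q. eb b * c' b y ^ p)"
        unfolding sum_distrib_left by (rule sum.cong) (simp_all add: c'(2)[OF _ y] power_mult_distrib ac_simps)
      then show "y (sg j) ^ p * u y = 0" using c(2)[OF y] by (simp add: u_def right_diff_distrib)
    qed
    then show ?thesis unfolding Qp_def using c'(1) by (intro exI[of _ c']) (simp add: u_def)
  qed
  have descn: "Qp f" if "j < R" "polyf m f" "Qp (\<lambda>x. x (sg j) ^ (n * p) * f x)" for j f n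
    using that(2,3)
  proof (induction n arbitrary: f)
    case (Suc n)
    have "Qp (\<lambda>x. x (sg j) ^ (n * p) * (x (sg j) ^ p * f x))" using Suc.prems(2) by (simp add: power_add ac_simps)
    then have "Qp (\<lambda>x. x (sg j) ^ p * f x)" by (rule Suc.IH[rotated]) (intro polyf_mult polyf_pow ps that(1) Suc.prems(1))
    then show ?case by (rule desc1[OF that(1) Suc.prems(1)])
  qed simp
  have desc: "Qp f" if "A \<subseteq> {..<R}" "polyf m f" "Qp (\<lambda>x. (\<Prod>j\<in>A. x (sg j)) ^ (n * p) * f x)" for A f n
  proof -
    have "finite A" using that(1) finite_subset by blast
    then show ?thesis using that
    proof (induction A arbitrary: f rule: finite_induct)
      case (insert j A)
      have j: "j < R" "A \<subseteq> {..<R}" using insert.prems(1) by auto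
      have "Qp (\<lambda>x. (\<Prod>j\<in>A. x (sg j)) ^ (n * p) * (x (sg j) ^ (n * p) * f x))"
        using insert.prems(3) insert.hyps by (simp add: power_mult_distrib ac_simps)
      then have "Qp (\<lambda>x. x (sg j) ^ (n * p) * f x)" by (rule insert.IH[OF j(2), rotated]) (intro polyf_mult polyf_pow ps j(1) insert.prems(2))
      then show ?case by (rule descn[OF j(1) insert.prems(2)])
    qed simp
  qed
  show ?thesis unfolding frobenius_reduces_def
  proof (intro allI impI)
    fix a assume a: "polyf m a" "deriv_vanish {..<R} g a"
    obtain n at0 where at0: "polyf m at0" "R0 at0" "\<And>s. s \<in> Z \<Longrightarrow> pi s ^ n * a s = at0 s" using Red_all[OF a(1)] unfolding Red_def by blast
    \<comment> \<open>The additional factor raises the power of \<open>pi\<close> to the exponent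
      \<open>n * p\<close>, whose differential is \<open>0\<close>; so on the zero set the
      differential of \<open>pi^(n * p) * a\<close> still vanishes.\<close>
    define atl where "atl = (\<lambda>s. pi s ^ (n * (p - 1)) * at0 s)"
    have atl: "polyf m atl" "R0 atl" "\<And>s. s \<in> Z \<Longrightarrow> pi s ^ (n * p) * a s = atl s"
    proof -
      show "polyf m atl" unfolding atl_def by (intro polyf_mult polyf_pow ppi at0(1))
      show "R0 atl" using R0pi at0(2) by (simp add: R0_def atl_def)
      have np: "n * p = n * (p - 1) + n" using p_pos by (cases p) auto
      show "pi s ^ (n * p) * a s = atl s" if "s \<in> Z" for s
        unfolding atl_def at0(3)[OF that, symmetric] np power_add by (simp add: ac_simps)
    qed
    define h where "h = (\<lambda>s. pi s ^ (n * p) * a s - atl s)"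
    have pp: "polyf m (\<lambda>s. pi s ^ (n * p) * a s)" by (intro polyf_mult polyf_pow ppi a(1))
    have ph: "polyf m h" unfolding h_def by (rule polyf_minus[OF pp atl(1)])
    have "h \<in> ideal m {..<R} g"
    proof (rule dense_prime_mem[OF dense_prime ph])
      fix z assume "\<And>i. i \<in> {..<R} \<Longrightarrow> g i z = 0"
      then show "h z = 0" using atl(3)[of z] by (simp add: h_def Z_def)
    qed
    then obtain r where r: "\<And>i. i < R \<Longrightarrow> polyf m (r i)" "h = (\<Sum>i<R. r i * g i)" unfolding ideal_def by blast
    have hdh: "hder w 1 h x = (\<Sum>i<R. r i x * hder w 1 (g i) x)" if x: "x \<in> Z" for x w
    proof -
      have "hder w 1 h x = (\<Sum>i<R. hder w 1 (r i * g i) x)" unfolding r(2) by (rule hder_sum_1[of _ m]) (simp add: polyf_times r(1) g)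
      also have "\<dots> = (\<Sum>i<R. r i x * hder w 1 (g i) x)"
      proof (rule sum.cong[OF refl])
        fix i assume "i \<in> {..<R}"
        then have i: "i < R" by simp
        show "hder w 1 (r i * g i) x = r i x * hder w 1 (g i) x"
          using hder_mult_1[OF r(1)[OF i] g[OF i], of w x] x i by (simp add: Z_def)
      qed
      finally show ?thesis .
    qed
    have hdh2: "hder w 1 atl x = - hder w 1 h x" if x: "x \<in> Z" for x w
    proof -
      have "hder w 1 a x = 0" using a(2) x unfolding deriv_vanish_def Z_def by auto
      moreover have "hder w 1 (\<lambda>s. pi s ^ (n * p)) x = 0" using hder_pow[OF ppi, of w "n * p" x] by simp
      ultimately have "hder w 1 (\<lambda>s. pi s ^ (n * p) * a s) x = 0" using hder_mult_l[OF polyf_pow[OF ppi] a(1), of w "n * p" x] by simp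
      moreover have "hder w 1 (\<lambda>s. h s + atl s) x = hder w 1 h x + hder w 1 atl x" by (rule hder_add_l[OF ph atl(1)])
      moreover have "(\<lambda>s. h s + atl s) = (\<lambda>s. pi s ^ (n * p) * a s)" by (simp add: h_def)
      ultimately show ?thesis by (simp add: eq_neg_iff_add_eq_0 add.commute)
    qed
    \<comment> \<open>Downward induction on \<open>j\<close>. The derivative in direction
      \<open>ta j\<close> annihilates \<open>atl\<close> and all \<open>g i\<close> with
      \<open>i < j\<close>, the \<open>r i\<close> with \<open>i > j\<close> are already
      \<open>0\<close> on \<open>Z\<close>, and the remaining term is \<open>r j\<close> times the
      slope.\<close>
    have rz: "\<forall>x\<in>Z. r j x = 0" if "j < R" for j
      using that
    proof (induction "R - j" arbitrary: j rule: less_induct)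
      case less
      have "r j x = 0" if x: "x \<in> Z" for x
      proof (rule cancel1[OF less.prems r(1)[OF less.prems] _ x, of "e j - 1"])
        fix y assume y: "y \<in> Z"
        have "hder (unit_vec (ta j)) 1 atl y = 0" by (rule hder_1_linear) (use atl(2) less.prems in \<open>simp add: R0_def\<close>)
        then have "(\<Sum>i<R. r i y * hder (unit_vec (ta j)) 1 (g i) y) = 0" using hdh[OF y] hdh2[OF y, of "unit_vec (ta j)"] by simp
        moreover have "(\<Sum>i<R. r i y * hder (unit_vec (ta j)) 1 (g i) y) = (\<Sum>i\<in>{j}. r i y * hder (unit_vec (ta j)) 1 (g i) y)"
        proof (rule sum.mono_neutral_right)
          show "\<forall>i\<in>{..<R} - {j}. r i y * hder (unit_vec (ta j)) 1 (g i) y = 0"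
          proof
            fix i assume i: "i \<in> {..<R} - {j}"
            show "r i y * hder (unit_vec (ta j)) 1 (g i) y = 0"
            proof (cases "i < j")
              case True
              have "hder (unit_vec (ta j)) 1 (g i) y = 0" by (rule hder_1_linear) (use sh[OF less.prems, of i] True in simp)
              then show ?thesis by simp
            next
              case False
              then have "R - i < R - j" "i < R" using i by auto
              then show ?thesis using less.hyps y by simp
            qed
          qed
        qed (use less.prems in auto)
        moreover have "hder (unit_vec (ta j)) 1 (g j) y = y (sg j) ^ (e j - 1)" by (rule hder_1_linear) (use sh[OF less.prems, of j] in simp)
        ultimately show "y (sg j) ^ (e j - 1) * r j y = 0" by (simp add: mult.commute)
      qed
      then show ?case by blast
    qed
    have at0': "hder w 1 atl x = 0" if "x \<in> Z" for x w using hdh2[OF that] hdh[OF that] rz that by simp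
    \<comment> \<open>A nonzero derivative would be nonzero somewhere with \<open>pi\<close>
      nonzero. Moving such a point into \<open>Z\<close> changes only coordinates
      \<open>ta j\<close>, on which \<open>atl\<close> and its derivatives do not depend.\<close>
    have "hder w 1 atl s = 0" for w s
    proof (rule ccontr)
      assume nz: "hder w 1 atl s \<noteq> 0"
      have pih: "polyf m (hder w 1 atl)" by (rule polyf_hder[OF atl(1)])
      have "pi (\<lambda>_. 1) \<noteq> 0" by (simp add: pi_def)
      then have "pi \<noteq> 0" by (metis zero_fun_apply)
      moreover have "hder w 1 atl \<noteq> 0" using nz by (metis zero_fun_apply)
      ultimately obtain s' where s': "hder w 1 atl s' \<noteq> 0" "pi s' \<noteq> 0" using polyf_eq_0_near[OF pih ppi] by blast
      obtain c where c: "s' + (\<Sum>j<R. scl (c j) (unit_vec (ta j))) \<in> Z" using solve[OF s'(2)] by blast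
      have "hder w 1 atl (s' + (\<Sum>j<R. scl (c j) (unit_vec (ta j)))) = hder w 1 atl s'"
      proof (rule hder_1_cong)
        fix t
        have "s' + (\<Sum>j<R. scl (c j) (unit_vec (ta j))) + scl t w = (s' + scl t w) + (\<Sum>j<R. scl (c j) (unit_vec (ta j)))" by (simp only: ac_simps)
        then show "atl (s' + (\<Sum>j<R. scl (c j) (unit_vec (ta j))) + scl t w) = atl (s' + scl t w)" by (simp only: R0sum[OF atl(2) order_refl])
      qed
      then show False using at0'[OF c] s'(1) by simp
    qed
    then have "pth_comb m atl" by (intro pd0_pth_comb[OF atl(1)])
    then obtain c where "\<forall>b<q. polyf m (c b)" "atl = (\<lambda>v. \<Sum>b<q. eb b * c b v ^ p)" unfolding pth_comb_def by blast
    then have "Qp (\<lambda>s. pi s ^ (n * p) * a s)" unfolding Qp_def using atl(3) by metis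
    then have "Qp a" unfolding pi_def using desc[of "{..<R}" a n] a(1) by blast
    then obtain c where c: "\<forall>b<q. polyf m (c b)" "\<And>x. x \<in> Z \<Longrightarrow> a x = (\<Sum>b<q. eb b * c b x ^ p)" unfolding Qp_def by blast
    define P where "P = (\<lambda>x. \<Sum>b<q. eb b * c b x ^ p)"
    have P: "pth_comb m P" unfolding pth_comb_def P_def using c(1) by blast
    define Q where "Q = a - P"
    have pQ: "polyf m Q" unfolding Q_def by (rule polyf_diff[OF a(1) pth_comb_polyf[OF P]])
    have "Q \<in> ideal m {..<R} g"
    proof (rule dense_prime_mem[OF dense_prime pQ])
      fix z assume "\<And>i. i \<in> {..<R} \<Longrightarrow> g i z = 0"
      then show "Q z = 0" using c(2)[of z] by (simp add: Q_def P_def Z_def)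
    qed
    then obtain s where s: "\<And>i. i < R \<Longrightarrow> polyf m (s i)" "Q = (\<Sum>i<R. s i * g i)" unfolding ideal_def by blast
    \<comment> \<open>\<open>Q\<close> lies in the ideal and has vanishing differential on the zero
      set; this puts its coefficients into the ideal, hence \<open>Q\<close> into the
      square.\<close>
    have "(\<Sum>i<R. s i x * hder w 1 (g i) x) = 0" if x: "\<forall>i\<in>{..<R}. g i x = 0" for x w
    proof -
      have "hder w 1 Q x = (\<Sum>i<R. hder w 1 (s i * g i) x)" unfolding s(2) by (rule hder_sum_1[of _ m]) (simp add: polyf_times s(1) g)
      also have "\<dots> = (\<Sum>i<R. s i x * hder w 1 (g i) x)"
      proof (rule sum.cong[OF refl])
        fix i assume "i \<in> {..<R}"
        then have i: "i < R" by simp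
        show "hder w 1 (s i * g i) x = s i x * hder w 1 (g i) x"
          using hder_mult_1[OF s(1)[OF i] g[OF i], of w x] x i by simp
      qed
      finally have 1: "hder w 1 Q x = (\<Sum>i<R. s i x * hder w 1 (g i) x)" .
      have "hder w 1 (Q + P) x = hder w 1 Q x + hder w 1 P x" by (rule hder_add_1[OF pQ pth_comb_polyf[OF P]])
      moreover have "Q + P = a" by (rule ext) (simp add: Q_def)
      moreover have "hder w 1 a x = 0" using a(2) x unfolding deriv_vanish_def by blast
      ultimately show ?thesis using 1 pth_comb_hder[OF P, of w x] by simp
    qed
    then have "\<forall>i\<in>{..<R}. s i \<in> ideal m {..<R} g" using J[unfolded jacobian_indep_def, rule_format, of s] s(1) by blast
    then have "Q \<in> ideal_sq m {..<R} g" unfolding ideal_sq_def using s(2) by blast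
    moreover have "a v = P v + Q v" for v by (simp add: Q_def)
    ultimately show "\<exists>P Q. pth_comb m P \<and> Q \<in> ideal_sq m {..<R} g \<and> (\<forall>v. a v = P v + Q v)" using P by blast
  qed
qed

end

section \<open>From a weak differential to a weak form\<close>

context infinite_field
begin

text \<open>A family of \<open>N\<close> or more elements is dependent over the \<open>p\<close>-th
  powers, since the diagonal equation of degree \<open>p\<close> with these coefficients has a
  nontrivial zero. So a maximal independent family exists, and by maximality it spans.\<close>

lemma p_basis_ex: assumes "prime p" "p = CHAR('k)" "diag_solv p N"
  shows "\<exists>q eb. (\<forall>a :: 'k. \<exists>c. a = (\<Sum>b<q. eb b * c b ^ p)) \<and> (\<forall>c b. (\<Sum>b<(q::nat). eb b * c b ^ p) = 0 \<longrightarrow> b < q \<longrightarrow> c b = 0)"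
proof -
  define ind where "ind = (\<lambda>q (eb :: nat \<Rightarrow> 'k). \<forall>c b. (\<Sum>b<(q::nat). eb b * c b ^ p) = 0 \<longrightarrow> b < q \<longrightarrow> c b = 0)"
  have pp: "p > 0" using assms(1) prime_gt_0_nat by blast
  have lt: "q < N" if "ind q eb" for q eb
  proof (rule ccontr)
    assume "\<not> q < N"
    obtain l i where l: "i < N" "l i \<noteq> 0" "(\<Sum>i<N. eb i * l i ^ p) = 0" using assms(3) unfolding diag_solv_def by blast
    define c where "c = (\<lambda>i. if i < N then l i else 0)"
    have "(\<Sum>b<q. eb b * c b ^ p) = (\<Sum>b<N. eb b * l b ^ p)"
      by (rule sum.mono_neutral_cong_right) (use \<open>\<not> q < N\<close> pp in \<open>auto simp: c_def power_0_left\<close>)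
    then have "c i = 0" using that l(1,3) \<open>\<not> q < N\<close> unfolding ind_def by auto
    then show False using l by (simp add: c_def)
  qed
  have "ind 0 (\<lambda>_. 0)" by (simp add: ind_def)
  then have "\<exists>eb. ind 0 eb" by blast
  moreover have "\<forall>y. (\<exists>eb. ind y eb) \<longrightarrow> y < N" using lt by blast
  ultimately obtain q where "\<exists>eb. ind q eb" and mx: "\<And>y. \<exists>eb. ind y eb \<Longrightarrow> y \<le> q"
    using ex_has_greatest_nat[of "\<lambda>q. \<exists>eb. ind q eb" 0 "\<lambda>x. x" N] by blast
  then obtain eb where eb: "ind q eb" by blast
  have "\<exists>c. a = (\<Sum>b<q. eb b * c b ^ p)" for a
  proof -
    define eb' where "eb' = eb(q := a)"
    have "\<not> ind (Suc q) eb'" using mx[of "Suc q"] by auto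
    then obtain c b where c: "(\<Sum>b<Suc q. eb' b * c b ^ p) = 0" "b < Suc q" "c b \<noteq> 0" unfolding ind_def by blast
    have "(\<Sum>b<q. eb' b * c b ^ p) = (\<Sum>b<q. eb b * c b ^ p)" by (rule sum.cong) (auto simp: eb'_def)
    then have s: "(\<Sum>b<q. eb b * c b ^ p) + a * c q ^ p = 0" using c(1) by (simp add: eb'_def)
    have cq: "c q \<noteq> 0"
    proof
      assume "c q = 0"
      then have "(\<Sum>b<q. eb b * c b ^ p) = 0" using s pp by (simp add: power_0_left)
      then have "b < q \<Longrightarrow> c b = 0" using eb unfolding ind_def by blast
      then show False using c(2,3) \<open>c q = 0\<close> by (cases "b = q") auto
    qed
    have neg: "(- x) ^ p = - (x ^ p)" for x :: 'k using assms(1,2) minus_power_prime_CHAR by blast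
    have "a = - ((\<Sum>b<q. eb b * c b ^ p) / c q ^ p)" using s cq by (simp add: field_simps eq_neg_iff_add_eq_0 add.commute)
    also have "\<dots> = (\<Sum>b<q. eb b * (- (c b / c q)) ^ p)"
      unfolding sum_divide_distrib sum_negf[symmetric] by (rule sum.cong) (simp_all add: neg power_divide)
    finally show ?thesis by (intro exI[of _ "\<lambda>b. - (c b / c q)"])
  qed
  then show ?thesis using eb unfolding ind_def by blast
qed

lemma frame_map_lin: "frame_map x w k (a + scl t b) = frame_map x w k a + scl t (frame_map x w k b)"
proof (rule ext)
  fix i
  have *: "frame_map x w k z i = (\<Sum>j<k. z (2 * j) * x j i + z (2 * j + 1) * w j i)" for z
    unfolding frame_map_def sum_apply plus_fun_apply scl_apply ..
  have "frame_map x w k (a + scl t b) i = (\<Sum>j<k. (a (2 * j) * x j i + a (2 * j + 1) * w j i) + t * (b (2 * j) * x j i + b (2 * j + 1) * w j i))"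
    unfolding * by (rule sum.cong) (auto simp: algebra_simps)
  also have "\<dots> = frame_map x w k a i + t * frame_map x w k b i" unfolding sum.distrib sum_distrib_left[symmetric] * ..
  finally show "frame_map x w k (a + scl t b) i = (frame_map x w k a + scl t (frame_map x w k b)) i" by simp
qed

text \<open>Adjoining to \<open>V\<close> the coordinates of a frame makes the restrictions of the tuple to all
  intermediate coordinate subspaces strong.\<close>

lemma not_low_if_deriv_low_core:
  fixes Mb R :: nat and y :: "nat \<Rightarrow> 'k dform"
  assumes fr: "frobenius p q eb"
    and TTi1: "\<And>n (I :: nat set) d g. form_family n D I d g \<Longrightarrow> card I \<le> R \<Longrightarrow> strong_family n CC I d g \<Longrightarrow> dense_prime n I (g :: nat \<Rightarrow> (nat \<Rightarrow> 'k) \<Rightarrow> 'k)"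
    and TTi2: "\<And>n (I :: nat option set) d g. form_family n D I d g \<Longrightarrow> card I \<le> R + 1 \<Longrightarrow> strong_family n CC I d g \<Longrightarrow>
      dense_prime n I (g :: _ \<Rightarrow> (nat \<Rightarrow> 'k) \<Rightarrow> 'k) \<and> (\<forall>i\<in>I. g i \<notin> ideal n (I - {i}) g)"
    and Jc: "\<And>n (I :: nat set) d g. form_family n D I d g \<Longrightarrow> card I \<le> R \<Longrightarrow> strong_family n CC I d g \<Longrightarrow> jacobian_indep n I (g :: nat \<Rightarrow> (nat \<Rightarrow> 'k) \<Rightarrow> 'k)"
    and hs: "\<And>e n I \<tau> u F. 1 \<le> e \<Longrightarrow> e \<le> D \<Longrightarrow> I \<subseteq> {..<n} \<Longrightarrow> card I \<ge> Mb \<Longrightarrow> u \<noteq> (0::'k) \<Longrightarrow>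
    (\<forall>i\<in>I. \<forall>z t. F (z + scl t (unit_vec (\<tau> i))) = F z + t * (u * z i ^ (e - 1))) \<Longrightarrow> \<not> low n CC e (F :: _ \<Rightarrow> 'k)"
    and Mb: "Mb \<ge> 1" and y: "form_set n D (y ` {..<R})" and yinj: "inj_on y {..<R}" and ys: "\<And>i j. i \<le> j \<Longrightarrow> j < R \<Longrightarrow> fst (y i) \<le> fst (y j)"
    and fm: "frame (y ` {..<R}) (\<lambda>i. y (i div Mb)) (R * Mb) x w"
    and f: "polyf n f" and df: "\<And>v. (\<And>j. j < R \<Longrightarrow> snd (y j) v = 0) \<Longrightarrow> \<forall>w. hder w 1 f v = 0"
  shows "\<exists>P Q. frobenius.pth_comb p q eb n P \<and> Q \<in> ideal n {..<R} (\<lambda>j. snd (y j)) \<and> (\<forall>v. f v = P v + Q v)"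
proof -
  interpret frobenius K p q eb by (rule fr)
  define k where "k = R * Mb"
  define m where "m = 2 * k"
  define d where "d = (\<lambda>j. fst (y j))"
  define L where "L = frame_map x w k"
  \<comment> \<open>The first \<open>m\<close> coordinates run through the frame, the next
    \<open>n\<close> through the space itself. Restricted to the first \<open>m\<close> coordinates
    the forms live on the span of the frame; with all \<open>m + n\<close> they are pulled back
    along a map with a linear section.\<close>
  define Lt where "Lt = (\<lambda>z. L z + (\<lambda>i. if i < n then z (m + i) else 0))"
  define Bt where "Bt = (\<lambda>j z. snd (y j) (Lt z))"
  have yj: "1 \<le> d j" "d j \<le> D" "form n (d j) (snd (y j))" if "j < R" for j using y that by (auto simp: form_set_def d_def)
  have yeq: "y i = y j \<longleftrightarrow> i = j" if "i < R" "j < R" for i j using yinj that by (auto simp: inj_on_def)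
  have Lt_ap: "Lt z i = L z i + (if i < n then z (m + i) else 0)" for z i by (simp add: Lt_def)
  have lL: "linmap n (m + n) L" unfolding L_def by (rule linmap_frame_map) (simp add: m_def)
  have lLt: "linmap n (m + n) Lt" unfolding linmap_def
  proof (intro allI impI)
    fix i assume i: "i < n"
    have 1: "form (m + n) 1 (\<lambda>z. L z i)" using lL i by (simp add: linmap_def)
    have 2: "form (m + n) 1 (\<lambda>z :: nat \<Rightarrow> 'k. z (m + i))" unfolding form_def using i by (auto intro: polyf_var)
    have "(\<lambda>z. Lt z i) = (\<lambda>z. L z i) + (\<lambda>z. z (m + i))" by (rule ext) (simp add: Lt_ap i)
    then show "form (m + n) 1 (\<lambda>z. Lt z i)" using form_add[OF 1 2] by (simp only:)
  qed
  have Lrs: "L (trunc N z) = L z" if "m \<le> N" for N z unfolding L_def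
    by (rule frame_map_cong) (use that in \<open>simp add: trunc_def m_def\<close>)
  have Ltm: "Lt (trunc m z) = L z" for z
  proof (rule ext)
    fix i
    show "Lt (trunc m z) i = L z i" unfolding Lt_ap Lrs[OF order_refl] by (simp add: trunc_def)
  qed
  have hB: "form (m + n) (d j) (Bt j)" if "j < R" for j unfolding Bt_def by (rule linmap_form[OF lLt yj(3)[OF that]])
  have fB: "form_family N D {..<R} d (trunc_family Bt N)" for N unfolding form_family_def
    using yj(1,2) trunc_family_form[OF hB] by auto
  have Bm: "trunc_family Bt m j z = snd (y j) (L z)" for j z by (simp add: trunc_family_def Bt_def Ltm)
  have shift: "trunc_family Bt m j (s + scl t (unit_vec (2 * i + 1))) = trunc_family Bt m j s + (if j = i div Mb then t * s (2 * i) ^ (d j - 1) else 0)"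
    if "i < k" "j < R" "d j \<le> d (i div Mb)" for i j s t
  proof -
    have iR: "i div Mb < R" using that(1) by (simp add: k_def less_mult_imp_div_less)
    have mono: "fst (y (a div Mb)) \<le> fst (y (b div Mb))" if "a \<le> b" "b < R * Mb" for a b
      using ys[of "a div Mb" "b div Mb"] that by (simp add: div_le_mono less_mult_imp_div_less)
    have "snd (y j) (frame_map x w (R * Mb) (s + scl t (unit_vec (2 * i + 1)))) = snd (y j) (frame_map x w (R * Mb) s) +
      (if y j = y (i div Mb) then s (2 * i) ^ (fst (y (i div Mb)) - 1) * t else 0)"
      by (rule frame_shift[OF fm mono]) (use that in \<open>auto simp: k_def d_def\<close>)
    then show ?thesis unfolding Bm L_def k_def yeq[OF that(2) iR] by (auto simp: d_def mult.commute)
  qed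
  \<comment> \<open>The \<open>Mb\<close> blocks belonging to \<open>j0\<close> make the combination
    hyperbolic in the sense of \<open>hyperbolic_not_low\<close>. The term \<open>X\<close> does not
    involve the odd coordinates of the frame; it leaves room for a coordinate function adjoined to
    the family.\<close>
  have nlow: "\<not> low m CC e (\<lambda>z. (\<Sum>j\<in>{j\<in>{..<R}. d j = e}. u j * trunc_family Bt m j z) + X z)"
    if j0: "j0 < R" "d j0 = e" "u j0 \<noteq> 0" and X: "\<And>i z t. i < k \<Longrightarrow> X (z + scl t (unit_vec (2 * i + 1))) = X z" for e u j0 X
  proof -
    define I where "I = (\<lambda>i. 2 * i) ` {j0 * Mb..<j0 * Mb + Mb}"
    have ik: "i < k" "i div Mb = j0" if "i \<in> {j0 * Mb..<j0 * Mb + Mb}" for i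
    proof -
      have "(j0 + 1) * Mb \<le> R * Mb" using j0(1) by (intro mult_le_mono1) simp
      then show "i < k" using that by (simp add: k_def)
      show "i div Mb = j0" using that Mb by (intro div_nat_eqI) (auto simp: algebra_simps)
    qed
    show ?thesis
    proof (rule hs[of e I m "u j0" _ Suc])
      show "1 \<le> e" "e \<le> D" using yj[OF j0(1)] j0(2) by auto
      show "I \<subseteq> {..<m}" using ik by (auto simp: I_def m_def)
      have "inj_on (\<lambda>i::nat. 2 * i) {j0 * Mb..<j0 * Mb + Mb}" by (auto simp: inj_on_def)
      then show "Mb \<le> card I" unfolding I_def by (simp add: card_image)
      show "u j0 \<noteq> 0" by (rule j0(3))
      show "\<forall>l\<in>I. \<forall>z t. (\<Sum>j\<in>{j\<in>{..<R}. d j = e}. u j * trunc_family Bt m j (z + scl t (unit_vec (Suc l)))) + X (z + scl t (unit_vec (Suc l))) =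
        (\<Sum>j\<in>{j\<in>{..<R}. d j = e}. u j * trunc_family Bt m j z) + X z + t * (u j0 * z l ^ (e - 1))"
      proof (intro ballI allI)
        fix l z t assume "l \<in> I"
        then obtain i where i: "i \<in> {j0 * Mb..<j0 * Mb + Mb}" "l = 2 * i" by (auto simp: I_def)
        have ik: "i < k" "i div Mb = j0" using ik[OF i(1)] by auto
        have sl: "unit_vec (Suc l) = unit_vec (2 * i + 1)" by (simp add: i(2))
        have "(\<Sum>j\<in>{j\<in>{..<R}. d j = e}. u j * trunc_family Bt m j (z + scl t (unit_vec (2 * i + 1)))) =
          (\<Sum>j\<in>{j\<in>{..<R}. d j = e}. u j * trunc_family Bt m j z + (if j = j0 then t * (u j0 * z l ^ (e - 1)) else 0))"
        proof (rule sum.cong[OF refl])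
          fix j assume "j \<in> {j\<in>{..<R}. d j = e}"
          then have j: "j < R" "d j = e" by auto
          have "d j \<le> d (i div Mb)" using j(2) ik(2) j0(2) by simp
          from shift[OF ik(1) j(1) this, of z t]
          show "u j * trunc_family Bt m j (z + scl t (unit_vec (2 * i + 1))) = u j * trunc_family Bt m j z + (if j = j0 then t * (u j0 * z l ^ (e - 1)) else 0)"
            using j(2) by (simp only: ik(2) i(2)) (auto simp: algebra_simps)
        qed
        also have "\<dots> = (\<Sum>j\<in>{j\<in>{..<R}. d j = e}. u j * trunc_family Bt m j z) + t * (u j0 * z l ^ (e - 1))"
          unfolding sum.distrib using j0 by simp
        finally show "(\<Sum>j\<in>{j\<in>{..<R}. d j = e}. u j * trunc_family Bt m j (z + scl t (unit_vec (Suc l)))) + X (z + scl t (unit_vec (Suc l))) =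
        (\<Sum>j\<in>{j\<in>{..<R}. d j = e}. u j * trunc_family Bt m j z) + X z + t * (u j0 * z l ^ (e - 1))"
          unfolding sl X[OF ik(1)] by (simp only: ac_simps)
      qed
    qed
  qed
  have ist: "strong_family N CC {..<R} d (trunc_family Bt N)" if "m \<le> N" for N
    unfolding strong_family_def
  proof (intro allI impI notI)
    fix e and u :: "nat \<Rightarrow> 'k" assume ex: "\<exists>i\<in>{..<R}. d i = e \<and> u i \<noteq> 0"
      and lo: "low N CC e (\<Sum>i\<in>{i\<in>{..<R}. d i = e}. scl (u i) (trunc_family Bt N i))"
    obtain j0 where j0: "j0 < R" "d j0 = e" "u j0 \<noteq> 0" using ex by auto
    have "trunc_family Bt N j (trunc m z) = trunc_family Bt m j z" for j z using that by (simp add: trunc_family_def trunc_trunc min_def)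
    then have "(\<Sum>i\<in>{i\<in>{..<R}. d i = e}. scl (u i) (trunc_family Bt N i)) (trunc m z) = (\<Sum>j\<in>{j\<in>{..<R}. d j = e}. u j * trunc_family Bt m j z) + 0" for z
      by (simp only: sum_apply scl_apply add_0_right)
    then have "low m CC e (\<lambda>z. (\<Sum>j\<in>{j\<in>{..<R}. d j = e}. u j * trunc_family Bt m j z) + 0)"
      using low_pull[OF linmap_trunc[of N m] lo] by (simp only:)
    then show False using nlow[of j0 e u "\<lambda>_. 0", OF j0] by simp
  qed
  have PDN: "dense_prime N {..<R} (trunc_family Bt N)" and JN: "jacobian_indep N {..<R} (trunc_family Bt N)" if "m \<le> N" for N
    using TTi1[OF fB _ ist[OF that]] Jc[OF fB _ ist[OF that]] by auto
  \<comment> \<open>A coordinate in the ideal would be a linear combination of the linear members.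
    Beyond the frame it restricts to \<open>0\<close> on the first \<open>m\<close> coordinates, so
    strength there forces all coefficients to be \<open>0\<close>.\<close>
  have lnin: "coordfun N \<notin> ideal (Suc N) {..<R} (trunc_family Bt (Suc N))" if N: "m \<le> N" for N
  proof
    assume a: "coordfun N \<in> ideal (Suc N) {..<R} (trunc_family Bt (Suc N))"
    have h1: "form (Suc N) 1 (coordfun N)" using polyf_coordfun[of N "Suc N"] unfolding form_def by (simp add: coordfun_def)
    obtain r where r: "\<forall>i\<in>{..<R}. if d i \<le> 1 then form (Suc N) (1 - d i) (r i) else r i = 0" "coordfun N = (\<Sum>i\<in>{..<R}. r i * trunc_family Bt (Suc N) i)"
      using ideal_hom[OF a trunc_family_form[OF hB] h1] by auto
    define u where "u = (\<lambda>i. r i 0)"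
    have rv: "r i z = (if d i = 1 then u i else 0)" if "i < R" for i z
    proof (cases "d i = 1")
      case True
      then have "form (Suc N) 0 (r i)" using bspec[OF r(1), of i] that by simp
      from form_deg0[OF this] show ?thesis using True by (simp add: u_def)
    next
      case False
      then have "\<not> d i \<le> 1" using yj(1)[OF that] by simp
      then have "r i = 0" using r(1) that by auto
      then show ?thesis using False by simp
    qed
    have cr: "z N = (\<Sum>j\<in>{j\<in>{..<R}. d j = 1}. u j * trunc_family Bt (Suc N) j z)" for z
    proof -
      have "z N = (\<Sum>i<R. r i z * trunc_family Bt (Suc N) i z)" using fun_cong[OF r(2), of z] by (simp add: coordfun_def sum_apply)
      also have "\<dots> = (\<Sum>i<R. if d i = 1 then u i * trunc_family Bt (Suc N) i z else 0)" by (rule sum.cong) (auto simp: rv)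
      also have "\<dots> = (\<Sum>j\<in>{j\<in>{..<R}. d j = 1}. u j * trunc_family Bt (Suc N) j z)" by (subst sum.inter_filter) auto
      finally show ?thesis .
    qed
    have "u j = 0" if "j < R" "d j = 1" for j
    proof (rule ccontr)
      assume "u j \<noteq> 0"
      from nlow[of j 1 u "\<lambda>_. 0", OF that this] have nl: "\<not> low m CC 1 (\<lambda>z. (\<Sum>j\<in>{j\<in>{..<R}. d j = 1}. u j * trunc_family Bt m j z) + 0)" by simp
      have F0: "(\<lambda>z. (\<Sum>j\<in>{j\<in>{..<R}. d j = 1}. u j * trunc_family Bt m j z) + 0) = 0"
      proof (rule ext)
        fix z
        have "trunc_family Bt (Suc N) j (trunc m z) = trunc_family Bt m j z" for j using N by (simp add: trunc_family_def trunc_trunc min_def)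
        then show "(\<Sum>j\<in>{j\<in>{..<R}. d j = 1}. u j * trunc_family Bt m j z) + 0 = 0 z" using cr[of "trunc m z"] N by (simp add: trunc_def)
      qed
      show False using nl low_0 unfolding F0 by blast
    qed
    then have "(\<Sum>j\<in>{j\<in>{..<R}. d j = 1}. u j * trunc_family Bt (Suc N) j (unit_vec N)) = 0" by (intro sum.neutral) auto
    then show False using cr[of "unit_vec N"] by (simp add: unit_vec_def)
  qed
  \<comment> \<open>The first of the \<open>Mb\<close> blocks belonging to \<open>y j\<close>
    supplies the coordinates for \<open>base_claim\<close>; the others serve to make the restricted
    family strong.\<close>
  define sg where "sg = (\<lambda>j. 2 * (j * Mb))"
  define ta where "ta = (\<lambda>j. 2 * (j * Mb) + 1)"
  have jk: "j * Mb < k" if "j < R" for j using that Mb by (simp add: k_def)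
  \<comment> \<open>\<open>None\<close> stands for the coordinate \<open>sg j\<close>. The family
    enlarged by it is still strong, so its ideal is prime with dense points; this gives both the
    divisibility on the zero set and the fact that the coordinate lies outside the ideal of the
    family.\<close>
  define gT where "gT = (\<lambda>j t. case t of Some i \<Rightarrow> trunc_family Bt m i | None \<Rightarrow> coordfun (sg j))"
  define dT where "dT = (\<lambda>t. case t of Some i \<Rightarrow> d i | None \<Rightarrow> 1)"
  define T where "T = insert None (Some ` {..<R})"
  have opt: "dense_prime m T (gT j) \<and> gT j None \<notin> ideal m (T - {None}) (gT j)" if j: "j < R" for j
  proof -
    have hcomp: "form m 1 (coordfun (sg j))" using polyf_coordfun[of "sg j" m] jk[OF j] unfolding form_def by (simp add: coordfun_def sg_def m_def)
    have fT: "form_family m D T dT (gT j)" unfolding form_family_def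
    proof (intro conjI ballI)
      show "finite T" by (simp add: T_def)
      fix t assume "t \<in> T"
      then consider "t = None" | i where "i < R" "t = Some i" by (auto simp: T_def)
      then have "1 \<le> dT t \<and> dT t \<le> D \<and> form m (dT t) (gT j t)"
      proof cases
        case 1
        then show ?thesis using hcomp yj(1,2)[OF j] by (simp add: dT_def gT_def)
      next
        case 2
        then show ?thesis using fB[of m] by (auto simp: form_family_def dT_def gT_def)
      qed
      then show "1 \<le> dT t" "dT t \<le> D" "form m (dT t) (gT j t)" by auto
    qed
    have "card T \<le> R + 1" unfolding T_def using card_image_le[of "{..<R}" Some] card_insert_le_m1[of "R + 1" "Some ` {..<R}" None] by simp
    moreover have "strong_family m CC T dT (gT j)" unfolding strong_family_def
    proof (intro allI impI notI)
      fix e and u :: "nat option \<Rightarrow> 'k" assume ex: "\<exists>i\<in>T. dT i = e \<and> u i \<noteq> 0"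
        and lo: "low m CC e (\<Sum>i\<in>{i\<in>T. dT i = e}. scl (u i) (gT j i))"
      define X where "X = (\<lambda>z :: nat \<Rightarrow> 'k. if e = 1 then u None * z (sg j) else 0)"
      have eq: "(\<Sum>i\<in>{i\<in>T. dT i = e}. scl (u i) (gT j i)) = (\<lambda>z. (\<Sum>i\<in>{i\<in>{..<R}. d i = e}. u (Some i) * trunc_family Bt m i z) + X z)"
      proof (rule ext)
        fix z
        have "(\<Sum>i\<in>{i\<in>T. dT i = e}. scl (u i) (gT j i)) z = (\<Sum>i\<in>T. if dT i = e then u i * gT j i z else 0)"
          unfolding sum_apply scl_apply by (subst sum.inter_filter[symmetric]) (auto simp: T_def)
        also have "\<dots> = X z + (\<Sum>i\<in>Some ` {..<R}. if dT i = e then u i * gT j i z else 0)"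
          unfolding T_def by (subst sum.insert) (auto simp: X_def dT_def gT_def coordfun_def)
        also have "(\<Sum>i\<in>Some ` {..<R}. if dT i = e then u i * gT j i z else 0) = (\<Sum>i<R. if d i = e then u (Some i) * trunc_family Bt m i z else 0)"
          by (subst sum.reindex) (auto simp: dT_def gT_def intro!: sum.cong)
        also have "\<dots> = (\<Sum>i\<in>{i\<in>{..<R}. d i = e}. u (Some i) * trunc_family Bt m i z)" by (subst sum.inter_filter) auto
        finally show "(\<Sum>i\<in>{i\<in>T. dT i = e}. scl (u i) (gT j i)) z = (\<Sum>i\<in>{i\<in>{..<R}. d i = e}. u (Some i) * trunc_family Bt m i z) + X z"
          by (simp only: ac_simps)
      qed
      show False
      proof (cases "\<exists>i<R. d i = e \<and> u (Some i) \<noteq> 0")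
        case True
        then obtain j0 where j0: "j0 < R" "d j0 = e" "u (Some j0) \<noteq> 0" by blast
        have X: "X (z + scl t (unit_vec (2 * i + 1))) = X z" for i z t
        proof -
          have "2 * i + 1 \<noteq> sg j" unfolding sg_def by presburger
          then show ?thesis by (simp add: X_def unit_vec_def)
        qed
        show False using nlow[of j0 e "\<lambda>i. u (Some i)" X, OF j0 X] lo unfolding eq by blast
      next
        case False
        then have z: "(\<Sum>i\<in>{i\<in>{..<R}. d i = e}. u (Some i) * trunc_family Bt m i z) = 0" for z by (intro sum.neutral) auto
        have n: "e = 1" "u None \<noteq> 0" using ex False by (auto simp: T_def dT_def)
        have "low m CC e (\<lambda>z. 0 + X z)" using lo unfolding eq z .
        then have "low m CC 1 X" using n(1) by simp
        then have "X = 0" unfolding low_def by fastforce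
        then have "X (unit_vec (sg j)) = 0" by simp
        then show False using n by (simp add: X_def unit_vec_def)
      qed
    qed
    ultimately show ?thesis using TTi2[OF fT] by (auto simp: T_def)
  qed
  have base: "frobenius_reduces m {..<R} (trunc_family Bt m)"
  proof (rule base_claim[of R m "trunc_family Bt m" sg ta d])
    show "polyf m (trunc_family Bt m i)" if "i < R" for i using fB[of m] that form_polyf by (auto simp: form_family_def)
    show "sg j < m" "ta j < m" if "j < R" for j using jk[OF that] by (auto simp: sg_def ta_def m_def)
    show "sg i \<noteq> ta j" for i j unfolding sg_def ta_def by presburger
    show "inj_on ta {..<R}" using Mb by (auto simp: inj_on_def ta_def)
    show "trunc_family Bt m i (s + scl t (unit_vec (ta j))) = trunc_family Bt m i s + (if i = j then t * s (sg j) ^ (d j - 1) else 0)" if "j < R" "i \<le> j" for i j s t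
    proof -
      have "j * Mb div Mb = j" using Mb by simp
      then show ?thesis using shift[OF jk[OF that(1)], of i s t] that ys[OF that(2,1)] by (auto simp: sg_def ta_def d_def)
    qed
    show "dense_prime m {..<R} (trunc_family Bt m)" "jacobian_indep m {..<R} (trunc_family Bt m)" using PDN JN by auto
    have TS: "T - {None} = Some ` {..<R}" by (auto simp: T_def)
    have "ideal m (Some ` {..<R}) (gT j) = ideal m {..<R} (trunc_family Bt m)" for j
      using ideal_reindex[of Some "{..<R}" m "gT j"] by (simp add: gT_def)
    then show "coordfun (sg j) \<notin> ideal m {..<R} (trunc_family Bt m)" if "j < R" for j using opt[OF that] unfolding TS by (simp add: gT_def)
    show "\<exists>c. polyf m c \<and> (\<forall>x. (\<forall>i<R. trunc_family Bt m i x = 0) \<longrightarrow> u x = x (sg j) * c x)"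
      if j: "j < R" and u: "polyf m u" "\<And>x. \<forall>i<R. trunc_family Bt m i x = 0 \<Longrightarrow> x (sg j) = 0 \<Longrightarrow> u x = 0" for j u
    proof -
      have "u \<in> ideal m T (gT j)"
      proof (rule dense_prime_mem[OF opt[OF j, THEN conjunct1] u(1)])
        fix z assume z: "\<And>i. i \<in> T \<Longrightarrow> gT j i z = 0"
        have "\<forall>i<R. trunc_family Bt m i z = 0"
        proof (intro allI impI)
          fix i assume "i < R"
          then show "trunc_family Bt m i z = 0" using z[of "Some i"] by (simp add: T_def gT_def)
        qed
        moreover have "z (sg j) = 0" using z[of None] by (simp add: T_def gT_def coordfun_def)
        ultimately show "u z = 0" by (rule u(2))
      qed
      then obtain h r where h: "h \<in> ideal m (Some ` {..<R}) (gT j)" "polyf m r" "u = h + r * gT j None"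
        unfolding T_def by (subst (asm) ideal_insert) auto
      have "u x = x (sg j) * r x" if x: "\<forall>i<R. trunc_family Bt m i x = 0" for x
      proof -
        have "h x = 0" by (rule ideal_vanish[OF h(1)]) (use x in \<open>auto simp: gT_def\<close>)
        then show ?thesis by (simp add: h(3) gT_def coordfun_def mult.commute)
      qed
      then show ?thesis using h(2) by blast
    qed
  qed
  have "frobenius_reduces N {..<R} (trunc_family Bt N)" if "m \<le> N" for N
    using that
  proof (induction N rule: dec_induct)
    case base
    show ?case by (rule \<open>frobenius_reduces m {..<R} (trunc_family Bt m)\<close>)
  next
    case (step N)
    have "m \<le> Suc N" using step by simp
    show ?case
      by (rule climb_step[where d = d and M = "m + n", OF _ _ PDN[OF step(1)] PDN[OF \<open>m \<le> Suc N\<close>] JN[OF step(1)] lnin[OF step(1)] step.IH])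
         (auto intro: hB)
  qed
  then have C: "frobenius_reduces (m + n) {..<R} (trunc_family Bt (m + n))" by simp
  have Ltrs: "Lt (trunc (m + n) z) = Lt z" for z
  proof -
    have "L (trunc (m + n) z) = L z" by (rule Lrs) simp
    then show ?thesis unfolding Lt_def by (intro arg_cong2[where f = plus] ext) (auto simp: trunc_def)
  qed
  have Bmn: "trunc_family Bt (m + n) j z = snd (y j) (Lt z)" for j z by (simp only: trunc_family_def Bt_def Ltrs)
  define a where "a = (\<lambda>z. f (Lt z))"
  have pa: "polyf (m + n) a" unfolding a_def by (rule linmap_polyf[OF lLt f])
  have "deriv_vanish {..<R} (trunc_family Bt (m + n)) a" unfolding deriv_vanish_def
  proof (intro allI impI)
    fix z w assume z: "\<forall>i\<in>{..<R}. trunc_family Bt (m + n) i z = 0"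
    have "hder w 1 a z = hder (Lt w) 1 f (Lt z)"
    proof (rule hder_1_cong)
      fix t
      have "Lt (z + scl t w) = Lt z + scl t (Lt w)" by (rule ext) (simp add: Lt_ap L_def frame_map_lin algebra_simps)
      then show "a (z + scl t w) = f (Lt z + scl t (Lt w))" by (simp only: a_def)
    qed
    then show "hder w 1 a z = 0" using df[of "Lt z"] z unfolding Bmn by simp
  qed
  then obtain P Q where PQ: "pth_comb (m + n) P" "Q \<in> ideal_sq (m + n) {..<R} (trunc_family Bt (m + n))" "\<And>v. a v = P v + Q v"
    using C pa unfolding frobenius_reduces_def by blast
  \<comment> \<open>The section of \<open>Lt\<close>: with frame coordinates \<open>0\<close> the
    composite is the identity on the first \<open>n\<close> coordinates, which brings the
    decomposition of \<open>a\<close> back to \<open>f\<close>.\<close>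
  define E where "E = (\<lambda>(v :: nat \<Rightarrow> 'k) i. if i < m then 0 else v (i - m))"
  have lE: "linmap (m + n) n E" unfolding linmap_def
  proof (intro allI impI)
    fix i assume i: "i < m + n"
    show "form n 1 (\<lambda>z. E z i)"
    proof (cases "i < m")
      case True
      then have "(\<lambda>z. E z i) = (\<lambda>z. 0)" by (simp add: E_def)
      then show ?thesis by (simp add: form_def polyf_const)
    next
      case False
      then have "(\<lambda>z. E z i) = (\<lambda>z. z (i - m))" "i - m < n" using i by (auto simp: E_def)
      then show ?thesis by (simp add: form_def polyf_var)
    qed
  qed
  have LtE: "Lt (E v) = trunc n v" for v
  proof -
    have "L (E v) = L 0" unfolding L_def by (rule frame_map_cong) (simp add: E_def m_def)
    moreover have "L 0 = 0"
    proof (rule ext)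
      fix i
      have "frame_map x w k 0 i = (\<Sum>j<k. 0 * x j i + 0 * w j i)" unfolding frame_map_def sum_apply plus_fun_apply scl_apply zero_fun_apply ..
      then show "L 0 i = 0 i" by (simp add: L_def)
    qed
    ultimately show ?thesis by (intro ext) (simp add: Lt_ap E_def trunc_def)
  qed
  have fv: "f v = P (E v) + Q (E v)" for v
    using PQ(3)[of "E v"] trunc_polyf[OF f, of v] by (simp add: a_def LtE)
  have "pth_comb n (\<lambda>v. P (E v))"
  proof -
    obtain c where c: "\<forall>b<q. polyf (m + n) (c b)" "P = (\<lambda>v. \<Sum>b<q. eb b * c b v ^ p)" using PQ(1) unfolding pth_comb_def by blast
    then show ?thesis unfolding pth_comb_def by (intro exI[of _ "\<lambda>b v. c b (E v)"]) (auto intro: linmap_polyf[OF lE])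
  qed
  moreover have "(\<lambda>v. Q (E v)) \<in> ideal n {..<R} (\<lambda>j. snd (y j))"
  proof -
    have "polyf (m + n) (trunc_family Bt (m + n) i)" if "i \<in> {..<R}" for i using fB[of "m + n"] that form_polyf by (auto simp: form_family_def)
    then have "Q \<in> ideal (m + n) {..<R} (trunc_family Bt (m + n))" by (intro ideal_sq_ideal[OF PQ(2)]) auto
    from ideal_pull[OF this lE] have "(\<lambda>v. Q (E v)) \<in> ideal n {..<R} (\<lambda>i v. trunc_family Bt (m + n) i (E v))" .
    moreover have "ideal n {..<R} (\<lambda>i v. trunc_family Bt (m + n) i (E v)) = ideal n {..<R} (\<lambda>j. snd (y j))"
    proof (rule ideal_cong)
      fix i assume "i \<in> {..<R}"
      then have "snd (y i) (trunc n v) = snd (y i) v" for v using trunc_polyf[OF form_polyf[OF yj(3)]] by simp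
      then show "(\<lambda>v. trunc_family Bt (m + n) i (E v)) = snd (y i)" by (simp add: Bmn LtE)
    qed
    ultimately show ?thesis by simp
  qed
  ultimately show ?thesis using fv by blast
qed

text \<open>A low differential vanishes to second order on the common zeros of few forms in
  \<open>(x, w)\<close>. Restricting these forms to \<open>w = 0\<close> gives forms in
  \<open>x\<close>; at their common zeros the derivative of \<open>D_w f(x)\<close> in the
  \<open>w\<close>-directions vanishes, and by linearity in \<open>w\<close> this derivative is the
  differential of \<open>f\<close>. After regularization the core lemma decomposes \<open>f\<close>,
  and its component of degree \<open>d\<close> is low: at most \<open>q\<close> products from the
  \<open>p\<close>-th powers and at most \<open>B\<close> from the ideal.\<close>

lemma strong_deriv_if_zero_degree:
  assumes d: "1 \<le> d" "of_nat d = (0::'k)" and dense_fibres: "\<And>e. e < d \<Longrightarrow> dense_fibres e" and strong_deriv: "\<And>e. 1 \<le> e \<Longrightarrow> e < d \<Longrightarrow> strong_deriv e"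
    and diag: "\<And>e. 1 \<le> e \<Longrightarrow> \<exists>N. diag_solv e N"
  shows "strong_deriv d"
proof -
  define p where "p = CHAR('k)"
  have "CHAR('k) > 0" unfolding CHAR_pos_iff using d by (intro exI[of _ d]) auto
  then have p: "prime p" "p = CHAR('k)" unfolding p_def by (auto intro: prime_CHAR_semidom)
  have p2: "p \<ge> 2" using p(1) prime_ge_2_nat by blast
  obtain N0 where "diag_solv p N0" using diag[of p] p2 by auto
  from p_basis_ex[OF p this] obtain q and eb :: "nat \<Rightarrow> 'k" where qe: "\<forall>a. \<exists>c. a = (\<Sum>b<q. eb b * c b ^ p)"
    "\<forall>c b. (\<Sum>b<q. eb b * c b ^ p) = 0 \<longrightarrow> b < q \<longrightarrow> c b = 0" by (elim exE conjE)
  have fr: "frobenius p q eb"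
    by unfold_locales (use p qe in blast)+
  interpret fr: frobenius K p q eb by (rule fr)
  define D where "D = d - 1"
  have D: "D < d" using d(1) by (simp add: D_def)
  have CDD: "strong_deriv e" if "1 \<le> e" "e \<le> D" for e using strong_deriv[of e] that D by simp
  define A1 where "A1 = (\<lambda>R CC. \<forall>n (I :: nat set) d g. form_family n D I d g \<longrightarrow> card I \<le> R \<longrightarrow> strong_family n CC I d g \<longrightarrow> dense_prime n I (g :: nat \<Rightarrow> (nat \<Rightarrow> 'k) \<Rightarrow> 'k))"
  define A2 where "A2 = (\<lambda>R CC. \<forall>n (I :: nat option set) d g. form_family n D I d g \<longrightarrow> card I \<le> R + 1 \<longrightarrow> strong_family n CC I d g \<longrightarrow>
      dense_prime n I (g :: _ \<Rightarrow> (nat \<Rightarrow> 'k) \<Rightarrow> 'k) \<and> (\<forall>i\<in>I. g i \<notin> ideal n (I - {i}) g))"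
  define A3 where "A3 = (\<lambda>R CC. \<forall>n (I :: nat set) d g. form_family n D I d g \<longrightarrow> card I \<le> R \<longrightarrow> strong_family n CC I d g \<longrightarrow> jacobian_indep n I (g :: nat \<Rightarrow> (nat \<Rightarrow> 'k) \<Rightarrow> 'k))"
  define H where "H = (\<lambda>CC Mb. \<forall>e n I \<tau> u F. 1 \<le> e \<longrightarrow> e \<le> D \<longrightarrow> I \<subseteq> {..<n} \<longrightarrow> card I \<ge> Mb \<longrightarrow> u \<noteq> (0::'k) \<longrightarrow>
    (\<forall>i\<in>I. \<forall>z t. F (z + scl t (unit_vec (\<tau> i))) = F z + t * (u * z i ^ (e - 1))) \<longrightarrow> \<not> low n CC e (F :: _ \<Rightarrow> 'k))"
  define Fr where "Fr = (\<lambda>R k C. \<forall>n S b. form_set n D S \<longrightarrow> card S \<le> R \<longrightarrow> strong n C S \<longrightarrow> (\<forall>i<k. b i \<in> S) \<longrightarrow> (\<exists>x w. frame S b k x w))"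
  \<comment> \<open>For each number \<open>R\<close> of forms: \<open>CC\<close> is the strength
    needed by the statements on families, \<open>Mb\<close> the number of blocks per form that
    produces this strength, and \<open>Cf\<close> the strength needed for a frame of
    \<open>R * Mb\<close> blocks. They are kept as functions of \<open>R\<close> because the size of
    the regularized set is not known beforehand.\<close>
  have ex: "\<exists>CC Mb Cf. (A1 R CC \<and> A2 R CC \<and> A3 R CC) \<and> (1 \<le> Mb \<and> H CC Mb) \<and> Fr R (R * Mb) Cf" for R
  proof -
    obtain C1 where C1: "\<And>n (I :: nat set) d g. form_family n D I d g \<Longrightarrow> card I \<le> R \<Longrightarrow> strong_family n C1 I d g \<Longrightarrow>
      (\<forall>J\<subseteq>I. dense_prime n J (g :: nat \<Rightarrow> (nat \<Rightarrow> 'k) \<Rightarrow> 'k)) \<and> (\<forall>i\<in>I. g i \<notin> ideal n (I - {i}) g)" using dense_fibres_family[OF dense_fibres[OF D]] by blast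
    obtain C2 where C2: "\<And>n (I :: nat option set) d g. form_family n D I d g \<Longrightarrow> card I \<le> R + 1 \<Longrightarrow> strong_family n C2 I d g \<Longrightarrow>
      (\<forall>J\<subseteq>I. dense_prime n J (g :: nat option \<Rightarrow> (nat \<Rightarrow> 'k) \<Rightarrow> 'k)) \<and> (\<forall>i\<in>I. g i \<notin> ideal n (I - {i}) g)" using dense_fibres_family[OF dense_fibres[OF D]] by blast
    define J0 where "J0 = (\<lambda>C. \<forall>n (I :: nat set) d g q. form_family n D I d g \<longrightarrow> card I \<le> R \<longrightarrow> strong_family n C I d g \<longrightarrow> (\<forall>i\<in>I. polyf n (q i)) \<longrightarrow>
    (\<forall>x. (\<forall>i\<in>I. g i x = 0) \<longrightarrow> (\<forall>w. (\<Sum>i\<in>I. q i x * hder w 1 (g i) x) = 0)) \<longrightarrow> (\<forall>i\<in>I. q i \<in> ideal n I (g :: nat \<Rightarrow> (nat \<Rightarrow> 'k) \<Rightarrow> 'k)))"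
    have "\<exists>C. J0 C" unfolding J0_def by (rule jacobian_independence[OF dense_fibres[OF D]]) (rule CDD)
    then obtain C3 where "J0 C3" by blast
    note C3 = this[unfolded J0_def]
    define CC where "CC = C1 + C2 + C3"
    have le: "C1 \<le> CC" "C2 \<le> CC" "C3 \<le> CC" by (simp_all add: CC_def)
    have A: "A1 R CC" "A2 R CC"
    proof -
      show "A1 R CC" unfolding A1_def
      proof (intro allI impI)
        fix n and I :: "nat set" and d and g :: "nat \<Rightarrow> (nat \<Rightarrow> 'k) \<Rightarrow> 'k"
        assume a: "form_family n D I d g" "card I \<le> R" "strong_family n CC I d g"
        show "dense_prime n I g" using C1[OF a(1,2) strong_family_mono[OF a(3) le(1)]] by blast
      qed
      show "A2 R CC" unfolding A2_def
      proof (intro allI impI)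
        fix n and I :: "nat option set" and d and g :: "nat option \<Rightarrow> (nat \<Rightarrow> 'k) \<Rightarrow> 'k"
        assume a: "form_family n D I d g" "card I \<le> R + 1" "strong_family n CC I d g"
        show "dense_prime n I g \<and> (\<forall>i\<in>I. g i \<notin> ideal n (I - {i}) g)" using C2[OF a(1,2) strong_family_mono[OF a(3) le(2)]] by blast
      qed
    qed
    have A3: "A3 R CC" unfolding A3_def jacobian_indep_def
    proof (intro allI impI)
      fix n and I :: "nat set" and d g and r :: "nat \<Rightarrow> (nat \<Rightarrow> 'k) \<Rightarrow> 'k"
      assume a: "form_family n D I d g" "card I \<le> R" "strong_family n CC I d g" "\<forall>i\<in>I. polyf n (r i)"
        "\<forall>x. (\<forall>i\<in>I. g i x = 0) \<longrightarrow> (\<forall>w. (\<Sum>i\<in>I. r i x * hder w 1 (g i) x) = 0)"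
      show "\<forall>i\<in>I. r i \<in> ideal n I g" by (rule C3[rule_format, THEN ballI, OF a(1,2) strong_family_mono[OF a(3) le(3)]]) (use a(4,5) in auto)
    qed
    define HP where "HP = (\<lambda>e M. \<forall>n I \<tau> u F. I \<subseteq> {..<n} \<longrightarrow> card I > M \<longrightarrow> u \<noteq> (0::'k) \<longrightarrow>
    (\<forall>i\<in>I. \<forall>z t. F (z + scl t (unit_vec (\<tau> i))) = F z + t * (u * z i ^ (e - 1))) \<longrightarrow> \<not> low n CC e (F :: _ \<Rightarrow> 'k))"
    have "\<exists>M. HP e M" if "1 \<le> e" "e \<le> D" for e unfolding HP_def by (rule hyperbolic_not_low) (rule dense_fibres, use that D in simp)
    then obtain M where M: "\<And>e. 1 \<le> e \<Longrightarrow> e \<le> D \<Longrightarrow> HP e (M e)" by metis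
    define Mb where "Mb = (\<Sum>e\<le>D. M e) + 1"
    have "H CC Mb" unfolding H_def
    proof (intro allI impI)
      fix e n I \<tau> u and F :: "'k pfun"
      assume a: "1 \<le> e" "e \<le> D" "I \<subseteq> {..<n}" "card I \<ge> Mb" "u \<noteq> (0::'k)"
        "\<forall>i\<in>I. \<forall>z t. F (z + scl t (unit_vec (\<tau> i))) = F z + t * (u * z i ^ (e - 1))"
      have "M e \<le> (\<Sum>e\<le>D. M e)" by (rule member_le_sum) (use a in auto)
      then have "card I > M e" using a(4) by (simp add: Mb_def)
      then show "\<not> low n CC e F" by (rule M[OF a(1,2), unfolded HP_def, rule_format, OF a(3) _ a(5), of F \<tau>]) (use a(6) in blast)
    qed
    moreover have "1 \<le> Mb" by (simp add: Mb_def)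
    moreover have "\<exists>Cf. Fr R (R * Mb) Cf" unfolding Fr_def
      by (rule frame_ex) (use dense_fibres D in fastforce, rule CDD, assumption+, rule diag)
    ultimately show ?thesis using A A3 by blast
  qed
  define Pr where "Pr = (\<lambda>R t. (A1 R (fst t) \<and> A2 R (fst t) \<and> A3 R (fst t)) \<and> (1 \<le> fst (snd t) \<and> H (fst t) (fst (snd t))) \<and> Fr R (R * fst (snd t)) (snd (snd t)))"
  have "\<exists>t. Pr R t" for R
  proof -
    obtain CC Mb Cf where "(A1 R CC \<and> A2 R CC \<and> A3 R CC) \<and> (1 \<le> Mb \<and> H CC Mb) \<and> Fr R (R * Mb) Cf" using ex[of R] by blast
    then have "Pr R (CC, Mb, Cf)" unfolding Pr_def fst_conv snd_conv .
    then show ?thesis by blast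
  qed
  then obtain tt where tt: "\<And>R. Pr R (tt R)" by metis
  define CC where "CC = (\<lambda>R. fst (tt R))"
  define Mb where "Mb = (\<lambda>R. fst (snd (tt R)))"
  define Cf where "Cf = (\<lambda>R. snd (snd (tt R)))"
  have par: "\<And>R. A1 R (CC R)" "\<And>R. A2 R (CC R)" "\<And>R. A3 R (CC R)" "\<And>R. 1 \<le> Mb R" "\<And>R. H (CC R) (Mb R)" "\<And>R. Fr R (R * Mb R) (Cf R)"
    using tt unfolding Pr_def CC_def Mb_def Cf_def by blast+
  show ?thesis unfolding strong_deriv_def
  proof (rule allI)
    fix c
    obtain B where B: "\<And>n \<Phi>. form_set n D \<Phi> \<Longrightarrow> card \<Phi> \<le> 2 * c \<Longrightarrow> (\<exists>Q. form_set n D Q \<and> card Q \<le> B \<and> strong n (Cf (card Q)) Q \<and>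
      (\<forall>z. (\<forall>x\<in>Q. snd x z = (0::'k)) \<longrightarrow> (\<forall>\<phi>\<in>\<Phi>. snd \<phi> z = 0)))" using strong_common_zeros[of D "2 * c" Cf] by blast
    show "\<exists>C. \<forall>n f. form n d f \<longrightarrow> \<not> low n C d (f :: _ \<Rightarrow> 'k) \<longrightarrow> \<not> low (2 * n) c d (\<lambda>z. hder (\<lambda>i. z (i + n)) 1 f z)"
    proof (rule exI[of _ "q + B"], intro allI impI notI)
      fix n and f :: "'k pfun"
      assume f: "form n d f" "\<not> low n (q + B) d f" "low (2 * n) c d (\<lambda>z. hder (\<lambda>i. z (i + n)) 1 f z)"
      from low_zero_locus[OF f(3)] obtain \<Phi> where P: "form_set (2 * n) (d - 1) \<Phi>" "card \<Phi> \<le> 2 * c"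
        "\<And>z. (\<forall>\<phi>\<in>\<Phi>. snd \<phi> z = 0) \<Longrightarrow> \<forall>u. hder u 1 (\<lambda>z. hder (\<lambda>i. z (i + n)) 1 f z) z = 0" by blast
      define \<Phi>' where "\<Phi>' = (\<lambda>\<phi>. (fst \<phi>, \<lambda>x. snd \<phi> (trunc n x))) ` \<Phi>"
      have fin: "finite \<Phi>" using P(1) by (simp add: form_set_def)
      have w': "form_set n D \<Phi>'" unfolding form_set_def
      proof (intro conjI ballI)
        show "finite \<Phi>'" using fin by (simp add: \<Phi>'_def)
        fix x assume "x \<in> \<Phi>'"
        then obtain \<phi> where x: "\<phi> \<in> \<Phi>" "x = (fst \<phi>, \<lambda>x. snd \<phi> (trunc n x))" by (auto simp: \<Phi>'_def)
        have "form n (fst \<phi>) (\<lambda>x. snd \<phi> (trunc n x))" by (rule linmap_form[OF linmap_trunc, of "2 * n"]) (use P(1) x(1) in \<open>auto simp: form_set_def\<close>)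
        then show "1 \<le> fst x" "fst x \<le> D" "form n (fst x) (snd x)" using P(1) x by (auto simp: form_set_def D_def)
      qed
      have "card \<Phi>' \<le> 2 * c" using card_image_le[OF fin] P(2) unfolding \<Phi>'_def by (rule order.trans)
      from B[OF w' this] obtain S where S: "form_set n D S" "card S \<le> B" "strong n (Cf (card S)) S"
        "\<And>z. (\<forall>x\<in>S. snd x z = 0) \<Longrightarrow> (\<forall>\<phi>\<in>\<Phi>'. snd \<phi> z = 0)" by blast
      define R where "R = card S"
      have finS: "finite S" using S(1) by (simp add: form_set_def)
      obtain ys0 where ys0: "set ys0 = S" "distinct ys0" using finite_distinct_list[OF finS] by blast
      define ys where "ys = sort_key fst ys0"
      have ys: "set ys = S" "distinct ys" "length ys = R" "sorted (map fst ys)"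
        using ys0 distinct_card[OF ys0(2)] by (auto simp: ys_def R_def)
      define y where "y = (\<lambda>i. ys ! i)"
      have yS: "y ` {..<R} = S"
      proof
        show "y ` {..<R} \<subseteq> S" using ys(1,3) by (auto simp: y_def)
        show "S \<subseteq> y ` {..<R}"
        proof
          fix z assume "z \<in> S"
          then obtain i where "i < R" "ys ! i = z" using ys(1,3) by (metis in_set_conv_nth)
          then show "z \<in> y ` {..<R}" by (auto simp: y_def)
        qed
      qed
      have yinj: "inj_on y {..<R}" using ys(2,3) by (auto simp: y_def inj_on_def nth_eq_iff_index_eq)
      have ysort: "fst (y i) \<le> fst (y j)" if "i \<le> j" "j < R" for i j
        using sorted_nth_mono[OF ys(4), of i j] that ys(3) by (simp add: y_def)
      have "\<forall>i<R * Mb R. y (i div Mb R) \<in> S" using yS by (auto simp: less_mult_imp_div_less)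
      then obtain x w where fm: "frame S (\<lambda>i. y (i div Mb R)) (R * Mb R) x w"
        using par(6)[of R, unfolded Fr_def, rule_format, OF S(1) _ S(3)[folded R_def], of "\<lambda>i. y (i div Mb R)"] by (auto simp: R_def)
      have df: "\<forall>w. hder w 1 f v = 0" if v: "\<And>j. j < R \<Longrightarrow> snd (y j) v = 0" for v
      proof
        fix w
        have "\<forall>x\<in>S. snd x v = 0" using v unfolding yS[symmetric] by auto
        then have "\<forall>\<phi>\<in>\<Phi>. snd \<phi> (trunc n v) = 0" using S(4)[of v] by (auto simp: \<Phi>'_def)
        from P(3)[OF this] have 0: "hder u 1 (\<lambda>z. hder (\<lambda>i. z (i + n)) 1 f z) (trunc n v) = 0" for u by blast
        define u where "u = (\<lambda>i. if i < n then 0 else w (i - n) :: 'k)"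
        have "hder u 1 (\<lambda>z. hder (\<lambda>i. z (i + n)) 1 f z) (trunc n v) = hder w 1 f v"
        proof (rule hder_1_linear)
          fix t
          have s: "(\<lambda>i. (trunc n v + scl t u) (i + n)) = scl t w" by (rule ext) (simp add: trunc_def u_def)
          have s0: "(\<lambda>i. trunc n v (i + n)) = scl 0 w" by (rule ext) (simp add: trunc_def)
          have c: "hder w 1 f (trunc n v + scl t u) = hder w 1 f v" "hder w 1 f (trunc n v) = hder w 1 f v"
            by (rule polyf_cong_coords[OF polyf_hder[OF form_polyf[OF f(1)]]]; simp add: trunc_def u_def)+
          show "hder (\<lambda>i. (trunc n v + scl t u) (i + n)) 1 f (trunc n v + scl t u) = hder (\<lambda>i. trunc n v (i + n)) 1 f (trunc n v) + t * hder w 1 f v"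
            unfolding s s0 hder_scale_dir[OF form_polyf[OF f(1)]] c by simp
        qed
        then show "hder w 1 f v = 0" using 0 by simp
      qed
      have "\<exists>P Q. frobenius.pth_comb p q eb n P \<and> Q \<in> ideal n {..<R} (\<lambda>j. snd (y j)) \<and> (\<forall>v. f v = P v + Q v)"
      proof (rule not_low_if_deriv_low_core[OF fr, where Mb = "Mb R" and CC = "CC R" and D = D and y = y])
        show "dense_prime n I g" if "form_family n D I d g" "card I \<le> R" "strong_family n (CC R) I d g" for n d and I :: "nat set" and g :: "nat \<Rightarrow> (nat \<Rightarrow> 'k) \<Rightarrow> 'k"
          using par(1)[of R] that unfolding A1_def by blast
        show "dense_prime n I g \<and> (\<forall>i\<in>I. g i \<notin> ideal n (I - {i}) g)" if "form_family n D I d g" "card I \<le> R + 1" "strong_family n (CC R) I d g"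
          for n d and I :: "nat option set" and g :: "nat option \<Rightarrow> (nat \<Rightarrow> 'k) \<Rightarrow> 'k"
          using par(2)[of R] that unfolding A2_def by blast
        show "jacobian_indep n I g" if "form_family n D I d g" "card I \<le> R" "strong_family n (CC R) I d g" for n d and I :: "nat set" and g :: "nat \<Rightarrow> (nat \<Rightarrow> 'k) \<Rightarrow> 'k"
          using par(3)[of R] that unfolding A3_def by blast
        show "\<not> low n (CC R) e F" if "1 \<le> e" "e \<le> D" "I \<subseteq> {..<n}" "Mb R \<le> card I" "u \<noteq> 0"
          "\<forall>i\<in>I. \<forall>z t. F (z + scl t (unit_vec (\<tau> i))) = F z + t * (u * z i ^ (e - 1))" for e n I \<tau> u and F :: "'k pfun"
          by (rule par(5)[of R, unfolded H_def, rule_format, OF that(1-5), of F \<tau>]) (use that(6) in blast)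
        show "1 \<le> Mb R" by (rule par(4))
        show "form_set n D (y ` {..<R})" "frame (y ` {..<R}) (\<lambda>i. y (i div Mb R)) (R * Mb R) x w" unfolding yS by (rule S(1), rule fm)
        show "inj_on y {..<R}" by (rule yinj)
        show "fst (y i) \<le> fst (y j)" if "i \<le> j" "j < R" for i j by (rule ysort[OF that])
        show "polyf n f" by (rule form_polyf[OF f(1)])
        show "\<forall>w. hder w 1 f v = 0" if "\<And>j. j < R \<Longrightarrow> snd (y j) v = 0" for v by (rule df[OF that])
      qed
      then obtain P Q where PQ: "fr.pth_comb n P" "Q \<in> ideal n {..<R} (\<lambda>j. snd (y j))" "\<And>v. f v = P v + Q v" by blast
      have yh: "1 \<le> fst (y j)" "fst (y j) \<le> D" "form n (fst (y j)) (snd (y j))" if "j \<in> {..<R}" for j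
        using S(1) yS that by (auto simp: form_set_def)
      have pQ: "polyf n Q" by (rule ideal_polyf[OF PQ(2)]) (rule form_polyf[OF yh(3)])
      have fe: "f = P + Q" by (rule ext) (simp add: PQ(3))
      have "f = hcomp d f" using hcomp_of_form[OF f(1), of d] by simp
      also have "\<dots> = hcomp d P + hcomp d Q" unfolding fe by (rule hcomp_add[OF fr.pth_comb_polyf[OF PQ(1)] pQ])
      finally have fs: "f = hcomp d P + hcomp d Q" .
      have "hcomp d Q \<in> ideal n {..<R} (\<lambda>j. snd (y j))" by (rule ideal_hcomp[OF PQ(2), of "\<lambda>j. fst (y j)"]) (rule yh(3))
      then have "low n (card {..<R}) d (hcomp d Q)"
        by (rule low_of_ideal[where d = "\<lambda>j. fst (y j)"]) (use yh D hcomp_form[OF pQ] in force)+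
      then have lQ: "low n B d (hcomp d Q)" by (rule low_mono) (use S(2) in \<open>simp add: R_def\<close>)
      have lP: "low n q d (hcomp d P)"
      proof -
        obtain c where c: "\<forall>b<q. form n (d div p) (c b)" "hcomp d P = (\<lambda>v. if p dvd d then \<Sum>b<q. eb b * c b v ^ p else 0)"
          using fr.pth_comb_hcomp[OF PQ(1)] by blast
        have pd: "p dvd d" using d(2) unfolding of_nat_eq_0_iff_char_dvd p_def .
        then obtain l where "d = p * l" by (elim dvdE)
        then have dp: "1 \<le> d div p" "d = d div p * p" using d(1) p2 by (cases l; simp)+
        \<comment> \<open>Each \<open>p\<close>-th power splits as \<open>c * c^(p-1)\<close>, two
          factors of positive degree since \<open>p\<close> is at least 2.\<close>
        have eq: "hcomp d P = (\<Sum>b<q. scl (eb b) (c b) * c b ^ (p - 1))"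
        proof (rule ext)
          fix v
          have "c b v ^ p = c b v * c b v ^ (p - 1)" for b using p2 by (cases p) auto
          then show "hcomp d P v = (\<Sum>b<q. scl (eb b) (c b) * c b ^ (p - 1)) v"
            unfolding c(2) using pd by (simp add: sum_apply power_apply mult.assoc)
        qed
        have "low n 1 d (scl (eb b) (c b) * c b ^ (p - 1))" if "b \<in> {..<q}" for b
        proof (rule low_single)
          have cb: "form n (d div p) (c b)" using c(1) that by simp
          show "form n (d div p) (scl (eb b) (c b))" by (rule form_cmul[OF cb])
          show "form n (d div p * (p - 1)) (c b ^ (p - 1))" by (rule form_power[OF cb])
          show "1 \<le> d div p" by (rule dp(1))
          show "1 \<le> d div p * (p - 1)" using dp(1) p2 by simp
          have "d div p + d div p * (p - 1) = d div p * p" using p2 by (cases p) auto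
          then show "d div p + d div p * (p - 1) = d" using dp(2) by simp
        qed
        then have "low n (card {..<q}) d (\<Sum>b<q. scl (eb b) (c b) * c b ^ (p - 1))" by (intro low_sum) auto
        then show ?thesis unfolding eq by simp
      qed
      have "low n (q + B) d f" using low_add[OF lP lQ] unfolding fs[symmetric] .
      then show False using f(2) by simp
    qed
  qed
qed

lemma strong_deriv_step:
  assumes "1 \<le> d" "\<And>e. e < d \<Longrightarrow> dense_fibres e" "\<And>e. 1 \<le> e \<Longrightarrow> e < d \<Longrightarrow> strong_deriv e" "\<And>e. 1 \<le> e \<Longrightarrow> \<exists>N. diag_solv e N"
  shows "strong_deriv d"
proof (cases "of_nat d = (0::'k)")
  case True
  show ?thesis by (rule strong_deriv_if_zero_degree[OF assms(1) True assms(2-4)])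
next
  case False
  then show ?thesis by (rule strong_deriv_if_nonzero_degree)
qed

section \<open>Generic fibres\<close>

text \<open>The forms behave as a regular sequence. If the leading parts of \<open>u'\<close> and
  \<open>q * fibre_eq x g\<close> cancel, the leading part of \<open>q\<close> times
  \<open>g\<close> lies in the ideal of the earlier forms; that ideal is prime and does not contain
  \<open>g\<close>, so the leading part of \<open>q\<close> lies in it and the degree of
  \<open>q\<close> can be lowered. \<open>f1\<close> is added last, so primality is asked only of
  subsets without \<open>f1\<close>, which is what the induction on the number of forms of top
  degree can supply.\<close>

lemma top_form:
  assumes T: "form_set n d T" and dense_prime: "\<And>U. U \<subseteq> T - {f1} \<Longrightarrow> dense_prime n U snd" and nin: "\<And>x. x \<in> T \<Longrightarrow> (snd x :: _ \<Rightarrow> 'k) \<notin> ideal n (T - {x}) snd"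
    and u: "u \<in> ideal n T (fibre_eq x)" "\<And>e. e > D \<Longrightarrow> hcomp e u = 0"
  shows "hcomp D u \<in> ideal n T snd"
proof -
  define TF where "TF = (\<lambda>T. \<forall>u D. u \<in> ideal n T (fibre_eq x) \<longrightarrow> (\<forall>e>D. hcomp e u = 0) \<longrightarrow> hcomp D u \<in> ideal n T snd)"
  have fin: "finite T" using T by (simp add: form_set_def)
  have hT: "1 \<le> fst y" "form n (fst y) (snd y)" if "y \<in> T" for y using T that by (auto simp: form_set_def)
  have pg: "polyf n (fibre_eq x y)" if "y \<in> T" for y by (rule polyf_fibre_eq[OF T that])
  have step: "TF (insert g U)" if U: "U \<subseteq> T - {f1}" "g \<in> T" "g \<notin> U" and TFU: "TF U" for g U
  proof -
    have finU: "finite U" using U(1) fin finite_subset by blast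
    have UT: "U \<subseteq> T" using U(1) by blast
    have PDU: "dense_prime n U snd" by (rule dense_prime[OF U(1)])
    have gn: "snd g \<notin> ideal n U snd"
    proof
      assume "snd g \<in> ideal n U snd"
      moreover have "ideal n U snd \<subseteq> ideal n (T - {g}) snd" by (rule ideal_mono) (use fin UT U(3) in auto)
      ultimately show False using nin[OF U(2)] by blast
    qed
    define d where "d = fst g"
    have d1: "1 \<le> d" and hg: "form n d (snd g)" using hT[OF U(2)] by (auto simp: d_def)
    have gg: "q * fibre_eq x g = q * snd g - scl (x g) q" for q by (rule ext) (simp add: fibre_eq_def algebra_simps)
    have hcq: "hcomp e (q * fibre_eq x g) = (if d \<le> e then hcomp (e - d) q * snd g else 0) - scl (x g) (hcomp e q)" if "polyf n q" for e q
    proof -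
      have s: "hcomp e (scl (x g) q) = scl (x g) (hcomp e q)"
      proof -
        have "scl (x g) q = q * (\<lambda>_. x g)" "form n 0 (\<lambda>_. x g)" by (auto simp: fun_eq_iff form_def polyf_const)
        then have "hcomp e (scl (x g) q) = hcomp (e - 0) q * (\<lambda>_. x g)" using hcomp_mult_form[OF that, of 0 "\<lambda>_. x g" e] by simp
        then show ?thesis by (auto simp: fun_eq_iff)
      qed
      have "hcomp e (q * fibre_eq x g) = hcomp e (q * snd g) - hcomp e (scl (x g) q)" unfolding gg
        by (rule hcomp_diff[of n]) (intro polyf_times that form_polyf[OF hg] polyf_scl)+
      then show ?thesis unfolding s hcomp_mult_form[OF that hg] .
    qed
    have main: "hcomp D u \<in> ideal n (insert g U) snd" if "u = u' + q * fibre_eq x g" "u' \<in> ideal n U (fibre_eq x)" "polyf n q" "\<And>e. e \<ge> E \<Longrightarrow> hcomp e q = 0"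
      "\<And>e. e > D \<Longrightarrow> hcomp e u = 0" for u u' q D E
      using that
    proof (induction E arbitrary: u' q)
      case 0
      obtain D0 where "q = (\<Sum>j\<le>D0. hcomp j q)" using hcomp_expand[OF 0(3)] by blast
      also have "\<dots> = 0" by (rule sum.neutral, rule ballI, rule 0(4), simp)
      finally have "u = u'" using 0(1) by simp
      then have "hcomp D u \<in> ideal n U snd" using TFU 0(2,5) unfolding TF_def by blast
      then show ?case using ideal_mono[of "insert g U" U n snd] finU by blast
    next
      case (Suc E)
      have pu': "polyf n u'" by (rule ideal_polyf[OF Suc.prems(2)]) (use pg UT in blast)
      have pq: "polyf n q" by (rule Suc.prems(3))
      have sp: "hcomp e u = hcomp e u' + ((if d \<le> e then hcomp (e - d) q * snd g else 0) - scl (x g) (hcomp e q))" for e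
        unfolding Suc.prems(1) hcq[OF pq, symmetric] by (rule hcomp_add[OF pu']) (intro polyf_times pq pg U(2))
      have sp0: "hcomp e u = hcomp e u' + (if d \<le> e then hcomp (e - d) q * snd g else 0)" if "e > E" for e
      proof -
        have "hcomp e q = 0" by (rule Suc.prems(4)) (use that in simp)
        then show ?thesis unfolding sp by (rule_tac ext) simp
      qed
      have top0: "hcomp e u = hcomp e u'" if "e > E + d" for e
      proof -
        have "hcomp (e - d) q = 0" by (rule Suc.prems(4)) (use that in simp)
        then show ?thesis using sp0[of e] that by (rule_tac ext) simp
      qed
      show ?case
      proof (cases "E + d \<le> D")
        case True
        have "hcomp e u' = 0" if "e > D" for e
        proof -
          have "hcomp e u = hcomp e u'" by (rule top0) (use True that in simp)
          with Suc.prems(5)[OF that] show ?thesis by (simp only:)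
        qed
        then have 1: "hcomp D u' \<in> ideal n U snd" using TFU Suc.prems(2) unfolding TF_def by blast
        have "D > E" using True d1 by simp
        then have "hcomp D u = hcomp D u' + hcomp (D - d) q * snd g" using sp0 True by simp
        then show ?thesis using ideal_insert[OF finU U(3), of "hcomp D u" n snd] 1 polyf_hcomp[OF pq] by blast
      next
        case False
        define T0 where "T0 = E + d"
        have "hcomp e u' = 0" if "e > T0" for e
        proof -
          have 1: "hcomp e u = hcomp e u'" by (rule top0) (use that in \<open>simp add: T0_def\<close>)
          have "hcomp e u = 0" by (rule Suc.prems(5)) (use that False in \<open>simp add: T0_def\<close>)
          with 1 show ?thesis by (simp only:)
        qed
        then have 1: "hcomp T0 u' \<in> ideal n U snd" using TFU Suc.prems(2) unfolding TF_def by blast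
        have "hcomp T0 u = 0" by (rule Suc.prems(5)) (use False in \<open>simp add: T0_def\<close>)
        then have "0 = hcomp T0 u' + hcomp E q * snd g" using sp0[of T0] d1 by (simp add: T0_def)
        then have "hcomp E q * snd g = - hcomp T0 u'" by (simp only: eq_neg_iff_add_eq_0 add.commute)
        then have "hcomp E q * snd g \<in> ideal n U snd" using ideal_neg[OF 1] by simp
        then have hE: "hcomp E q \<in> ideal n U snd" using dense_prime_prime[OF PDU polyf_hcomp[OF pq] form_polyf[OF hg]] gn by blast
        have hU: "form n (fst y) (snd y)" if "y \<in> U" for y using hT UT that by blast
        obtain r where r: "\<forall>y\<in>U. if fst y \<le> E then form n (E - fst y) (r y) else r y = 0" "hcomp E q = (\<Sum>y\<in>U. r y * snd y)"
          using ideal_hom[OF hE hU hcomp_form[OF pq]] by blast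
        have pr: "polyf n (r y)" if "y \<in> U" for y using bspec[OF r(1) that] by (cases "fst y \<le> E") (auto intro: form_polyf polyf_0)
        \<comment> \<open>\<open>r'\<close> lies in the fibre ideal of \<open>U\<close> and has the
          same leading part as \<open>q\<close>. Thus \<open>q - r'\<close> has smaller degree, and
          \<open>r'\<close> times the new equation is absorbed into \<open>u'\<close>.\<close>
        define r' where "r' = (\<Sum>y\<in>U. r y * fibre_eq x y)"
        have r'I: "r' \<in> ideal n U (fibre_eq x)" unfolding r'_def ideal_def using pr by blast
        have prg: "polyf n (r y * fibre_eq x y)" if "y \<in> U" for y
          by (rule polyf_times[OF pr[OF that] pg]) (use that UT in blast)
        have pr': "polyf n r'" unfolding r'_def by (rule polyf_Sum) (rule prg)
        have hr': "hcomp e r' = (if e = E then hcomp E q else 0)" if "e \<ge> E" for e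
        proof -
          have "hcomp e r' = (\<Sum>y\<in>U. hcomp e (r y * fibre_eq x y))" unfolding r'_def
            by (rule hcomp_sum[of _ n]) (rule prg)
          also have "\<dots> = (\<Sum>y\<in>U. if e = E then r y * snd y else 0)"
          proof (rule sum.cong[OF refl])
            fix y assume y: "y \<in> U"
            have y1: "1 \<le> fst y" using hT UT y by blast
            show "hcomp e (r y * fibre_eq x y) = (if e = E then r y * snd y else 0)"
            proof (cases "fst y \<le> E")
              case True
              then have hr: "form n (E - fst y) (r y)" using bspec[OF r(1) y] by simp
              have ry: "form n E (r y * snd y)" using form_mult[OF hr hU[OF y]] True by simp
              have sr: "form n (E - fst y) (scl (x y) (r y))" by (rule form_cmul[OF hr])
              have "r y * fibre_eq x y = r y * snd y - scl (x y) (r y)" by (rule ext) (simp add: fibre_eq_def algebra_simps)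
              then have "hcomp e (r y * fibre_eq x y) = hcomp e (r y * snd y) - hcomp e (scl (x y) (r y))"
                using hcomp_diff[OF form_polyf[OF ry] form_polyf[OF sr], of e] by simp
              moreover have "hcomp e (scl (x y) (r y)) = 0" unfolding hcomp_of_form[OF sr] using True y1 that by auto
              ultimately show ?thesis unfolding hcomp_of_form[OF ry] by (rule_tac ext) simp
            next
              case False
              then have "r y = 0" using bspec[OF r(1) y] by simp
              moreover have "(0 :: (nat \<Rightarrow> 'k) \<Rightarrow> 'k) * h = 0" for h by (rule ext) simp
              ultimately show ?thesis by (simp only: hcomp_0 if_cancel)
            qed
          qed
          also have "\<dots> = (if e = E then hcomp E q else 0)" by (cases "e = E") (simp_all add: r(2))
          finally show ?thesis .
        qed
        define q' where "q' = q - r'"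
        have pq': "polyf n q'" unfolding q'_def by (rule polyf_diff[OF pq pr'])
        have lt: "hcomp e q' = 0" if "e \<ge> E" for e
        proof -
          have "hcomp e q' = hcomp e q - hcomp e r'" unfolding q'_def by (rule hcomp_diff[OF pq pr'])
          then show ?thesis using hr'[OF that] Suc.prems(4)[of e] that by (cases "e = E") auto
        qed
        have ue: "u = (u' + fibre_eq x g * r') + q' * fibre_eq x g" unfolding Suc.prems(1) q'_def by (rule ext) (simp add: algebra_simps)
        have "u' + fibre_eq x g * r' \<in> ideal n U (fibre_eq x)" by (rule ideal_add[OF Suc.prems(2) ideal_mult[OF pg[OF U(2)] r'I]])
        from Suc.IH[OF ue this pq' lt Suc.prems(5)] show ?thesis .
      qed
    qed
    show ?thesis unfolding TF_def
    proof (intro allI impI)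
      fix u D assume a: "u \<in> ideal n (insert g U) (fibre_eq x)" "\<forall>e>D. hcomp e u = 0"
      obtain u' q where uq: "u' \<in> ideal n U (fibre_eq x)" "polyf n q" "u = u' + q * fibre_eq x g" using a(1) ideal_insert[OF finU U(3)] by blast
      obtain E where E: "\<forall>j>E. hcomp j q = 0" using hcomp_expand[OF uq(2)] by blast
      show "hcomp D u \<in> ideal n (insert g U) snd" by (rule main[OF uq(3,1,2), of "Suc E"]) (use E a(2) in auto)
    qed
  qed
  have TFU: "TF U" if "U \<subseteq> T - {f1}" for U
  proof -
    have "finite U" using that fin finite_subset by blast
    then show ?thesis using that
    proof (induction U rule: finite_induct)
      case empty
      show ?case unfolding TF_def
      proof (intro allI impI)
        fix u D assume "u \<in> ideal n {} (fibre_eq x)"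
        then have "u = 0" unfolding ideal_def sum.empty by blast
        then show "hcomp D u \<in> ideal n {} snd" using ideal_zero by (simp only: hcomp_0)
      qed
    next
      case (insert g U)
      show ?case by (rule step) (use insert in auto)
    qed
  qed
  have "TF T"
  proof (cases "f1 \<in> T")
    case True
    have "TF (insert f1 (T - {f1}))" by (rule step[OF order_refl True _ TFU[OF order_refl]]) simp
    then show ?thesis using True by (simp add: insert_absorb)
  next
    case False
    then show ?thesis using TFU[of T] by simp
  qed
  then show ?thesis using u unfolding TF_def by blast
qed

section \<open>Normal forms modulo the fibres of a strong tuple\<close>

lemma complement_ex:
  assumes J: "fs.subspace J" and H: "fs.subspace H" "J \<subseteq> H"
  shows "\<exists>C. fs.subspace C \<and> C \<subseteq> H \<and> J \<inter> C = {0} \<and> (\<forall>h\<in>H. \<exists>j\<in>J. \<exists>c\<in>C. h = j + (c :: 'a \<Rightarrow> 'k))"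
proof -
  obtain B0 where B0: "B0 \<subseteq> J" "fs.independent B0" "J \<subseteq> fs.span B0"
    using fs.maximal_independent_subset[of J] by blast
  obtain B where B: "B0 \<subseteq> B" "B \<subseteq> H" "fs.independent B" "H \<subseteq> fs.span B"
    using fs.maximal_independent_subset_extend[of B0 H] B0 H(2) by blast
  define C where "C = fs.span (B - B0)"
  have sB0: "fs.span B0 = J" using fs.span_minimal[OF B0(1) J] B0(3) by blast
  have "B - B0 \<subseteq> H" using B(2) by blast
  then have CH: "C \<subseteq> H" unfolding C_def by (rule fs.span_minimal[OF _ H(1)])
  have sub: "fs.subspace C" unfolding C_def by (rule fs.subspace_span)
  have "h = 0" if h: "h \<in> J" "h \<in> C" for h
  proof -
    have 1: "fs.representation B h = fs.representation B0 h"
      by (rule fs.representation_extend[OF B(3) _ B(1)]) (use h sB0 in blast)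
    have 2: "fs.representation B h = fs.representation (B - B0) h"
      by (rule fs.representation_extend[OF B(3)]) (use h in \<open>auto simp only: C_def\<close>)
    have "fs.representation B h b = 0" for b
    proof (cases "b \<in> B0")
      case True
      then show ?thesis unfolding 2 using fs.representation_ne_zero[of "B - B0" h b] by auto
    next
      case False
      then show ?thesis unfolding 1 using fs.representation_ne_zero[of B0 h b] by auto
    qed
    moreover have hB: "h \<in> fs.span B" using h(1) H(2) B(4) by blast
    ultimately show "h = 0" using fs.sum_nonzero_representation_eq[OF B(3) hB] by simp
  qed
  moreover have "0 \<in> J" "0 \<in> C" using fs.subspace_0 J sub by blast+
  ultimately have int: "J \<inter> C = {0}" by blast
  have dec: "\<exists>j\<in>J. \<exists>c\<in>C. h = j + c" if h: "h \<in> H" for h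
  proof -
    have "B = B0 \<union> (B - B0)" using B(1) by blast
    then have "h \<in> fs.span (B0 \<union> (B - B0))" using h B(4) by auto
    then show ?thesis unfolding fs.span_Un sB0 C_def by blast
  qed
  show ?thesis using sub CH int dec by blast
qed

text \<open>Reducing \<open>a\<close> modulo the graded complement \<open>C\<close> gives a \<open>C\<close>-valued polynomial in the values of the
  forms in \<open>G - S\<close>; it vanishes at a value exactly if \<open>a\<close> lies in the ideal of the corresponding fibre.\<close>

lemma generic_fibre:
  assumes G: "form_set n d G" and S: "S \<subseteq> G"
    and TF: "\<And>x u D. u \<in> ideal n G (fibre_eq x) \<Longrightarrow> (\<And>e. e > D \<Longrightarrow> hcomp e u = 0) \<Longrightarrow> hcomp D u \<in> ideal n G snd"
    and a: "polyf n a" "a \<notin> ideal n S (fibre_eq c)"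
  shows "\<exists>\<rho>. polyf n \<rho> \<and> \<rho> \<noteq> (0 :: _ \<Rightarrow> 'k) \<and> (\<forall>v. \<rho> v \<noteq> 0 \<longrightarrow> a \<notin> ideal n G (fibre_eq (\<lambda>g. if g \<in> S then c g else snd g v))) \<and>
    (\<forall>v v'. (\<forall>g\<in>G-S. snd g v = snd g v') \<longrightarrow> \<rho> v = \<rho> v')"
proof -
  have fin: "finite G" using G by (simp add: form_set_def)
  have hG: "1 \<le> fst g" "form n (fst g) (snd g)" if "g \<in> G" for g using G that by (auto simp: form_set_def)
  have pgen: "polyf n (fibre_eq x g)" if "g \<in> G" for x g by (rule polyf_fibre_eq[OF G that])
  define H where "H = (\<lambda>e. {f :: (nat \<Rightarrow> 'k) \<Rightarrow> 'k. form n e f})"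
  define J where "J = (\<lambda>e. ideal n G snd \<inter> H e)"
  have sH: "fs.subspace (H e)" for e unfolding fs.subspace_def H_def using form_0 form_add form_cmul by blast
  have sI: "fs.subspace (ideal n G snd)" unfolding fs.subspace_def using ideal_zero ideal_add ideal_scl by blast
  have sJ: "fs.subspace (J e)" for e unfolding J_def by (rule fs.subspace_inter[OF sI sH])
  have "\<exists>C. fs.subspace C \<and> C \<subseteq> H e \<and> J e \<inter> C = {0} \<and> (\<forall>h\<in>H e. \<exists>j\<in>J e. \<exists>c\<in>C. h = j + c)" for e
    by (rule complement_ex[OF sJ sH]) (simp add: J_def)
  then obtain Ce where Ce: "\<And>e. fs.subspace (Ce e)" "\<And>e. Ce e \<subseteq> H e" "\<And>e. J e \<inter> Ce e = {0}"
    "\<And>e h. h \<in> H e \<Longrightarrow> \<exists>j\<in>J e. \<exists>c\<in>Ce e. h = j + c" by metis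
  \<comment> \<open>Normal forms: in every degree the component lies in a fixed complement of the
    homogeneous part of the ideal of \<open>G\<close>.\<close>
  define C where "C = {u. polyf n u \<and> (\<forall>e. hcomp e u \<in> Ce e)}"
  have C0: "0 \<in> C" unfolding C_def using fs.subspace_0[OF Ce(1)] by (simp add: hcomp_0 polyf_0)
  have Cadd: "u + v \<in> C" if "u \<in> C" "v \<in> C" for u v
  proof -
    have u: "polyf n u" "hcomp e u \<in> Ce e" and v: "polyf n v" "hcomp e v \<in> Ce e" for e using that by (auto simp: C_def)
    have "hcomp e (u + v) \<in> Ce e" for e unfolding hcomp_add[OF u(1) v(1)] by (rule fs.subspace_add[OF Ce(1) u(2) v(2)])
    then show ?thesis unfolding C_def using polyf_plus[OF u(1) v(1)] by blast
  qed
  have hcs: "hcomp e (scl k u) = scl k (hcomp e u)" if "polyf n u" for k e and u :: "'k pfun"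
  proof -
    have "scl k u = u * (\<lambda>_. k)" "form n 0 (\<lambda>_. k)" by (auto simp: fun_eq_iff form_def polyf_const)
    then have "hcomp e (scl k u) = hcomp (e - 0) u * (\<lambda>_. k)" using hcomp_mult_form[OF that, of 0 "\<lambda>_. k" e] by simp
    then show ?thesis by (auto simp: fun_eq_iff)
  qed
  have Cscl: "scl k u \<in> C" if "u \<in> C" for k u
  proof -
    have u: "polyf n u" "hcomp e u \<in> Ce e" for e using that by (auto simp: C_def)
    have "hcomp e (scl k u) \<in> Ce e" for e unfolding hcs[OF u(1)] by (rule fs.subspace_scale[OF Ce(1) u(2)])
    then show ?thesis unfolding C_def using polyf_scl[OF u(1)] by blast
  qed
  have Csum: "(\<Sum>i\<in>A. f i) \<in> C" if "\<And>i. i \<in> A \<Longrightarrow> f i \<in> C" for f :: "'i \<Rightarrow> _" and A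
    using that by (induction A rule: infinite_finite_induct) (auto intro: C0 Cadd)
  \<comment> \<open>The top component of an element of any fibre ideal lies in the ideal of the
    forms by \<open>TF\<close>; for a normal form it lies in the complement as well, so it is
    \<open>0\<close>. Hence normal forms are unique on each fibre.\<close>
  have Ksep: "u = 0" if u: "u \<in> C" "u \<in> ideal n G (fibre_eq x)" for u x
  proof (rule ccontr)
    assume nz: "u \<noteq> 0"
    have pu: "polyf n u" using u(1) by (simp add: C_def)
    obtain D0 where D0: "u = (\<Sum>j\<le>D0. hcomp j u)" "\<And>j. j > D0 \<Longrightarrow> hcomp j u = 0" using hcomp_expand[OF pu] by blast
    have ne: "\<exists>j. hcomp j u \<noteq> 0" using D0(1) nz by (metis sum.neutral)
    have "\<forall>j. hcomp j u \<noteq> 0 \<longrightarrow> j \<le> D0" using D0(2) not_le by blast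
    with ne obtain D where D: "hcomp D u \<noteq> 0" "\<And>j. hcomp j u \<noteq> 0 \<Longrightarrow> j \<le> D"
      using GreatestI_nat[of "\<lambda>j. hcomp j u \<noteq> 0"] Greatest_le_nat[of "\<lambda>j. hcomp j u \<noteq> 0"] by blast
    have "hcomp D u \<in> ideal n G snd" by (rule TF[OF u(2)]) (use D(2) in fastforce)
    then have "hcomp D u \<in> J D" using hcomp_form[OF pu] by (simp add: J_def H_def)
    moreover have "hcomp D u \<in> Ce D" using u(1) by (simp add: C_def)
    ultimately show False using Ce(3)[of D] D(1) by blast
  qed
  define xx where "xx = (\<lambda>X g. if g \<in> S then c g else X g)"
  define ev where "ev = (\<lambda>v (g :: 'k dform). snd g v)"
  \<comment> \<open>\<open>A X\<close> is the normal form of \<open>a\<close> on the fibre with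
    value \<open>c\<close> on \<open>S\<close> and \<open>X\<close> outside. By the third clause,
    inserting the values at \<open>v\<close> itself changes \<open>a\<close> only by the ideal of
    the fibre of \<open>S\<close>; so if \<open>a\<close> is outside that ideal, \<open>A\<close>
    does not vanish identically.\<close>
  define Rep where "Rep = (\<lambda>a A. (\<forall>X. A X \<in> C) \<and> (\<forall>X. a - A X \<in> ideal n G (fibre_eq (xx X))) \<and>
    a - (\<lambda>v. A (ev v) v) \<in> ideal n S (fibre_eq c) \<and> (\<forall>v'. polyf n (\<lambda>v. A (ev v) v')) \<and>
    (\<forall>X X'. (\<forall>g\<in>G-S. X g = X' g) \<longrightarrow> A X = A X'))"
  have Rep0: "Rep 0 (\<lambda>X. 0)"
  proof -
    have "(0 :: (nat \<Rightarrow> 'k) \<Rightarrow> 'k) - 0 = 0" "(0 :: (nat \<Rightarrow> 'k) \<Rightarrow> 'k) - (\<lambda>v. 0 v) = 0" "(\<lambda>v :: nat \<Rightarrow> 'k. (0 :: (nat \<Rightarrow> 'k) \<Rightarrow> 'k) v') = (\<lambda>_. 0)" for v'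
      by (rule ext, simp)+
    then show ?thesis unfolding Rep_def using C0 ideal_zero polyf_const by metis
  qed
  have Rep_sum: "Rep (\<Sum>i\<in>I. f i) (\<lambda>X. \<Sum>i\<in>I. A i X)" if "\<And>i. i \<in> I \<Longrightarrow> Rep (f i) (A i)" for I :: "nat set" and f A
    unfolding Rep_def
  proof (intro conjI allI impI)
    fix X
    show "(\<Sum>i\<in>I. A i X) \<in> C" by (rule Csum) (use that in \<open>simp add: Rep_def\<close>)
    show "(\<Sum>i\<in>I. f i) - (\<Sum>i\<in>I. A i X) \<in> ideal n G (fibre_eq (xx X))"
      unfolding sum_subtractf[symmetric] by (rule ideal_sum) (use that in \<open>unfold Rep_def, blast\<close>)
  next
    have "(\<Sum>i\<in>I. f i) - (\<lambda>v. (\<Sum>i\<in>I. A i (ev v)) v) = (\<Sum>i\<in>I. f i - (\<lambda>v. A i (ev v) v))"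
      by (rule ext) (simp only: sum_apply fun_diff_def sum_subtractf)
    also have "\<dots> \<in> ideal n S (fibre_eq c)" by (rule ideal_sum) (use that in \<open>unfold Rep_def, blast\<close>)
    finally show "(\<Sum>i\<in>I. f i) - (\<lambda>v. (\<Sum>i\<in>I. A i (ev v)) v) \<in> ideal n S (fibre_eq c)" .
  next
    fix v'
    show "polyf n (\<lambda>v. (\<Sum>i\<in>I. A i (ev v)) v')" unfolding sum_apply by (rule polyf_sum) (use that in \<open>unfold Rep_def, blast\<close>)
  next
    fix X X' :: "'k dform \<Rightarrow> 'k" assume XX: "\<forall>g\<in>G-S. X g = X' g"
    show "(\<Sum>i\<in>I. A i X) = (\<Sum>i\<in>I. A i X')"
    proof (rule sum.cong[OF refl])
      fix i assume "i \<in> I"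
      from that[OF this] show "A i X = A i X'" using XX unfolding Rep_def by blast
    qed
  qed
  have hom: "\<exists>A. Rep a A" if "form n e a" for e a
    using that
  proof (induction e arbitrary: a rule: less_induct)
    case (less e)
    have "a \<in> H e" using less.prems by (simp add: H_def)
    then obtain j c0 where jc: "j \<in> J e" "c0 \<in> Ce e" "a = j + c0" using Ce(4) by blast
    have h0: "form n e c0" using Ce(2) jc(2) by (auto simp: H_def)
    have "j \<in> ideal n G snd" "form n e j" using jc(1) by (auto simp: J_def H_def)
    from ideal_hom[OF this(1) hG(2) this(2)] obtain q where q: "\<forall>g\<in>G. if fst g \<le> e then form n (e - fst g) (q g) else q g = 0"
      "j = (\<Sum>g\<in>G. q g * snd g)" by blast
    have "\<exists>A. Rep (q g) A" if g: "g \<in> G" for g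
    proof (cases "fst g \<le> e")
      case True
      then have "form n (e - fst g) (q g)" "e - fst g < e" using bspec[OF q(1) g] hG(1)[OF g] by auto
      then show ?thesis using less.IH by blast
    next
      case False
      then show ?thesis using bspec[OF q(1) g] Rep0 by auto
    qed
    then obtain A where A: "\<And>g. g \<in> G \<Longrightarrow> Rep (q g) (A g)" by metis
    have A1: "A g X \<in> C" "q g - A g X \<in> ideal n G (fibre_eq (xx X))" "q g - (\<lambda>v. A g (ev v) v) \<in> ideal n S (fibre_eq c)" "polyf n (\<lambda>v. A g (ev v) v')"
        "\<forall>g\<in>G-S. X g = X' g \<Longrightarrow> A g X = A g X'"
      if "g \<in> G" for g X X' v' using A[OF that] unfolding Rep_def by blast+
    have pq: "polyf n (q g)" if "g \<in> G" for g using bspec[OF q(1) that] by (cases "fst g \<le> e") (auto intro: form_polyf polyf_0)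
    have c0C: "c0 \<in> C" unfolding C_def
    proof (intro CollectI conjI allI)
      fix e'
      show "hcomp e' c0 \<in> Ce e'" unfolding hcomp_of_form[OF h0] using jc(2) fs.subspace_0[OF Ce(1)] by (cases "e' = e") simp_all
    qed (rule form_polyf[OF h0])
    \<comment> \<open>Modulo a fibre, \<open>snd g\<close> is replaced by its prescribed value; the
      coefficients \<open>q g\<close> have smaller degree than \<open>a\<close>, so their normal
      forms are available by induction.\<close>
    define A' where "A' = (\<lambda>X. c0 + (\<Sum>g\<in>G. scl (xx X g) (A g X)))"
    have "Rep a A'" unfolding Rep_def
    proof (intro conjI allI impI)
      fix X
      show "A' X \<in> C" unfolding A'_def by (intro Cadd c0C Csum Cscl A1(1))
      have "a - A' X = (\<Sum>g\<in>G. q g * fibre_eq (xx X) g + scl (xx X g) (q g - A g X))"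
      proof (rule ext)
        fix v
        have "(a - A' X) v = (\<Sum>g\<in>G. q g v * snd g v) - (\<Sum>g\<in>G. xx X g * A g X v)"
          unfolding jc(3) q(2) A'_def by (simp only: fun_diff_def plus_fun_apply sum_apply times_fun_apply scl_apply) simp
        also have "\<dots> = (\<Sum>g\<in>G. q g v * fibre_eq (xx X) g v + xx X g * (q g v - A g X v))"
          unfolding sum_subtractf[symmetric] by (rule sum.cong) (simp_all add: fibre_eq_def algebra_simps)
        finally show "(a - A' X) v = (\<Sum>g\<in>G. q g * fibre_eq (xx X) g + scl (xx X g) (q g - A g X)) v"
          by (simp only: fun_diff_def plus_fun_apply sum_apply times_fun_apply scl_apply)
      qed
      also have "\<dots> \<in> ideal n G (fibre_eq (xx X))"
        by (intro ideal_sum ideal_add ideal_mult ideal_scl pq ideal_fibre_eq fin A1(2))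
      finally show "a - A' X \<in> ideal n G (fibre_eq (xx X))" .
    next
      have "a - (\<lambda>v. A' (ev v) v) = (\<Sum>g\<in>G. if g \<in> S then q g * fibre_eq c g + scl (c g) (q g - (\<lambda>v. A g (ev v) v)) else snd g * (q g - (\<lambda>v. A g (ev v) v)))"
      proof (rule ext)
        fix v
        have "(a - (\<lambda>v. A' (ev v) v)) v = (\<Sum>g\<in>G. q g v * snd g v) - (\<Sum>g\<in>G. xx (ev v) g * A g (ev v) v)"
          unfolding jc(3) q(2) A'_def by (simp only: fun_diff_def plus_fun_apply sum_apply times_fun_apply scl_apply) simp
        also have "\<dots> = (\<Sum>g\<in>G. (if g \<in> S then q g * fibre_eq c g + scl (c g) (q g - (\<lambda>v. A g (ev v) v)) else snd g * (q g - (\<lambda>v. A g (ev v) v))) v)"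
          unfolding sum_subtractf[symmetric] by (rule sum.cong) (simp_all add: fibre_eq_def xx_def ev_def algebra_simps)
        finally show "(a - (\<lambda>v. A' (ev v) v)) v = (\<Sum>g\<in>G. if g \<in> S then q g * fibre_eq c g + scl (c g) (q g - (\<lambda>v. A g (ev v) v)) else snd g * (q g - (\<lambda>v. A g (ev v) v))) v"
          by (simp only: sum_apply)
      qed
      also have "\<dots> \<in> ideal n S (fibre_eq c)"
      proof (rule ideal_sum)
        fix g assume g: "g \<in> G"
        have "finite S" using S fin finite_subset by blast
        then show "(if g \<in> S then q g * fibre_eq c g + scl (c g) (q g - (\<lambda>v. A g (ev v) v)) else snd g * (q g - (\<lambda>v. A g (ev v) v))) \<in> ideal n S (fibre_eq c)"
          using ideal_add[OF ideal_mult[OF pq[OF g] ideal_fibre_eq[of S g "fibre_eq c" n]] ideal_scl[OF A1(3)[OF g]]] ideal_mult[OF form_polyf[OF hG(2)[OF g]] A1(3)[OF g]]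
          by (cases "g \<in> S") (simp_all only: if_True if_False)
      qed
      finally show "a - (\<lambda>v. A' (ev v) v) \<in> ideal n S (fibre_eq c)" .
    next
      fix v'
      have "(\<lambda>v. A' (ev v) v') = (\<lambda>v. c0 v' + (\<Sum>g\<in>G. xx (ev v) g * A g (ev v) v'))"
        unfolding A'_def by (simp only: plus_fun_apply sum_apply scl_apply)
      moreover have "polyf n (\<lambda>v. c0 v' + (\<Sum>g\<in>G. xx (ev v) g * A g (ev v) v'))"
      proof (intro polyf_add polyf_const polyf_sum polyf_mult A1(4))
        fix g assume g: "g \<in> G"
        show "polyf n (\<lambda>v. xx (ev v) g)" using form_polyf[OF hG(2)[OF g]] polyf_const[of n "c g"] by (cases "g \<in> S") (simp_all add: xx_def ev_def)
      qed
      ultimately show "polyf n (\<lambda>v. A' (ev v) v')" by (simp only:)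
    next
      fix X X' :: "'k dform \<Rightarrow> 'k" assume XX: "\<forall>g\<in>G-S. X g = X' g"
      have "(\<Sum>g\<in>G. scl (xx X g) (A g X)) = (\<Sum>g\<in>G. scl (xx X' g) (A g X'))"
      proof (rule sum.cong[OF refl])
        fix g assume g: "g \<in> G"
        have "xx X g = xx X' g" using XX g by (auto simp: xx_def)
        then show "scl (xx X g) (A g X) = scl (xx X' g) (A g X')" using A1(5)[OF g XX] by (simp only:)
      qed
      then show "A' X = A' X'" by (simp only: A'_def)
    qed
    then show ?case by blast
  qed
  obtain D where D: "a = (\<Sum>j\<le>D. hcomp j a)" using hcomp_expand[OF a(1)] by blast
  have "\<exists>A. Rep (hcomp j a) A" for j by (rule hom[OF hcomp_form[OF a(1)]])
  then obtain Aj where "\<And>j. Rep (hcomp j a) (Aj j)" by metis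
  then have "Rep (\<Sum>j\<le>D. hcomp j a) (\<lambda>X. \<Sum>j\<le>D. Aj j X)" by (intro Rep_sum)
  then have "Rep a (\<lambda>X. \<Sum>j\<le>D. Aj j X)" unfolding D[symmetric] .
  then obtain A where "Rep a A" by blast
  then have A: "\<And>X. A X \<in> C" "\<And>X. a - A X \<in> ideal n G (fibre_eq (xx X))" "a - (\<lambda>v. A (ev v) v) \<in> ideal n S (fibre_eq c)" "\<And>v'. polyf n (\<lambda>v. A (ev v) v')"
    "\<And>X X'. \<forall>g\<in>G-S. X g = X' g \<Longrightarrow> A X = A X'"
    unfolding Rep_def by blast+
  have "\<exists>va. A (ev va) va \<noteq> 0"
  proof (rule ccontr)
    assume "\<nexists>va. A (ev va) va \<noteq> 0"
    then have "a - (\<lambda>v. A (ev v) v) = a" by (intro ext) (simp add: fun_diff_def)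
    then show False using A(3) a(2) by simp
  qed
  then obtain va where va: "A (ev va) va \<noteq> 0" by blast
  \<comment> \<open>\<open>v\<close> enters only through the values of the forms, while the
    resulting normal form is evaluated at the fixed point \<open>va\<close>.\<close>
  define \<rho> where "\<rho> = (\<lambda>v. A (ev v) va)"
  have "\<rho> va \<noteq> 0" using va by (simp add: \<rho>_def)
  then have nz: "\<rho> \<noteq> 0" by (metis zero_fun_apply)
  have p\<rho>: "polyf n \<rho>" unfolding \<rho>_def by (rule A(4))
  have "a \<notin> ideal n G (fibre_eq (\<lambda>g. if g \<in> S then c g else snd g v))" if v: "\<rho> v \<noteq> 0" for v
  proof
    assume "a \<in> ideal n G (fibre_eq (\<lambda>g. if g \<in> S then c g else snd g v))"
    then have "a \<in> ideal n G (fibre_eq (xx (ev v)))" by (simp only: xx_def ev_def)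
    from ideal_diff[OF this A(2)] have "a - (a - A (ev v)) \<in> ideal n G (fibre_eq (xx (ev v)))" .
    moreover have "a - (a - A (ev v)) = A (ev v)" by (rule ext) simp
    ultimately have "A (ev v) = 0" using Ksep[OF A(1)] by simp
    then show False using v by (simp add: \<rho>_def)
  qed
  moreover have "\<rho> v = \<rho> v'" if "\<forall>g\<in>G-S. snd g v = snd g v'" for v v'
    using A(5)[of "ev v" "ev v'"] that by (simp add: \<rho>_def ev_def)
  ultimately show ?thesis using p\<rho> nz by blast
qed

section \<open>The induction on the degree\<close>

lemma frame_value:
  assumes fm: "frame S (\<lambda>_. f1) M x w" and S: "form_set n d S" and f1: "f1 \<in> S" "fst f1 = d" and y: "y \<in> S"
  shows "snd y (frame_map x w M s) = (if fst y = d then (\<Sum>c<M. s (2 * c) ^ d * snd y (x c)) else 0) +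
    (if y = f1 then (\<Sum>c<M. s (2 * c) ^ (d - 1) * s (2 * c + 1)) else 0)"
proof -
  have "snd y (frame_map x w k s) = (if fst y = d then (\<Sum>c<k. s (2 * c) ^ d * snd y (x c)) else 0) +
    (if y = f1 then (\<Sum>c<k. s (2 * c) ^ (d - 1) * s (2 * c + 1)) else 0)" if "k \<le> M" for k
    using that
  proof (induction k)
    case 0
    have 1: "frame_map x w 0 s = 0" by (simp only: frame_map_def lessThan_0 sum.empty)
    have 2: "snd y 0 = 0" using form_at_0[of n "fst y" "snd y"] S y by (auto simp: form_set_def)
    show ?case unfolding 1 2 by simp
  next
    case (Suc k)
    have "block {y\<in>S. fst y \<le> fst f1} (fst f1) f1 (x ` {..<k} \<union> w ` {..<k}) (x k) (w k)" using fm Suc.prems by (simp add: frame_def)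
    moreover have "y \<in> {y\<in>S. fst y \<le> fst f1}" using y S f1 by (auto simp: form_set_def)
    ultimately have 1: "snd y (frame_map x w k s + (scl (s (2 * k)) (x k) + scl (s (2 * k + 1)) (w k))) = snd y (frame_map x w k s) +
      (if fst y = fst f1 then s (2 * k) ^ fst f1 * snd y (x k) else 0) + (if y = f1 then s (2 * k) ^ (fst f1 - 1) * s (2 * k + 1) else 0)"
      using frame_map_span unfolding block_def by blast
    have 2: "snd y (frame_map x w k s) = (if fst y = d then (\<Sum>c<k. s (2 * c) ^ d * snd y (x c)) else 0) +
      (if y = f1 then (\<Sum>c<k. s (2 * c) ^ (d - 1) * s (2 * c + 1)) else 0)" by (rule Suc.IH) (use Suc.prems in simp)
    show ?case unfolding frame_map_Suc 1[unfolded f1(2)] 2 sum.lessThan_Suc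
      by (cases "fst y = d"; cases "y = f1") (simp_all add: algebra_simps)
  qed
  from this[of M] show ?thesis by simp
qed

text \<open>Parametrize \<open>x'\<close> and \<open>w'\<close> by coordinates \<open>z\<close> on
  the frame. Expanding at \<open>v0\<close>, the mixed terms between \<open>v0\<close> and the frame
  are boundedly many forms in \<open>z\<close> of degree below \<open>d\<close>, while the desired
  slope has leading coefficient \<open>h z\<close> with \<open>h\<close> hyperbolic of degree
  \<open>d\<close>, hence not low. So \<open>nonvanishing_point\<close> gives a \<open>z\<close>
  where the unwanted mixed terms vanish and \<open>h\<close> does not.\<close>

lemma shift_ex:
  assumes "dense_fibres (d - 1)" "1 \<le> d"
  shows "\<exists>M. \<forall>n S f1 x w v0. form_set n d S \<longrightarrow> card S \<le> N \<longrightarrow> f1 \<in> S \<longrightarrow> fst f1 = d \<longrightarrow> frame S (\<lambda>_. f1) M x w \<longrightarrow>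
    (\<exists>x' w' pH. w' \<in> fs.span (w ` {..<M}) \<and> pH \<noteq> (0 :: 'k poly) \<and>
      (\<forall>y\<in>S. \<forall>\<tau> \<rho>. snd y (v0 + (scl \<tau> x' + scl \<rho> w')) = snd y (v0 + (scl \<tau> x' + scl 0 w')) + (if y = f1 then \<rho> * poly pH \<tau> else 0)) \<and>
      (\<forall>y\<in>S. fst y < d \<longrightarrow> (\<forall>\<tau>. snd y (v0 + (scl \<tau> x' + scl 0 w')) = snd y v0)))"
proof -
  \<comment> \<open>A bound for the triples of a member, an order from 1 to \<open>d\<close> and an
    exponent from 0 to \<open>d\<close>.\<close>
  define N' where "N' = N * (d * (d + 1))"
  obtain B where nonvanishing_point: "\<And>n \<Phi> g e. form_set n (d - 1) \<Phi> \<Longrightarrow> card \<Phi> \<le> N' \<Longrightarrow> d - 1 < e \<Longrightarrow> form n e g \<Longrightarrow> \<not> low n B e (g :: _ \<Rightarrow> 'k) \<Longrightarrow>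
    (\<exists>z. (\<forall>\<phi>\<in>\<Phi>. snd \<phi> z = 0) \<and> g z \<noteq> 0)" using nonvanishing_point[OF assms(1)] by blast
  define HS where "HS = (\<lambda>M. \<forall>n I \<tau> u F. I \<subseteq> {..<n} \<longrightarrow> card I > M \<longrightarrow> u \<noteq> (0::'k) \<longrightarrow>
    (\<forall>i\<in>I. \<forall>z t. F (z + scl t (unit_vec (\<tau> i))) = F z + t * (u * z i ^ (d - 1))) \<longrightarrow> \<not> low n B d (F :: _ \<Rightarrow> 'k))"
  have "\<exists>M. HS M" unfolding HS_def by (rule hyperbolic_not_low[OF assms(1)])
  then obtain M0 where "HS M0" by blast
  note HS = this[unfolded HS_def, rule_format]
  define M where "M = Suc M0"
  show ?thesis
  proof (rule exI[of _ M], intro allI impI)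
    fix n and S :: "'k dform set" and f1 x w v0
    assume a: "form_set n d S" "card S \<le> N" "f1 \<in> S" "fst f1 = d" "frame S (\<lambda>_. f1) M x w"
    have finS: "finite S" using a(1) by (simp add: form_set_def)
    have hS: "1 \<le> fst y" "fst y \<le> d" "form n (fst y) (snd y)" if "y \<in> S" for y using a(1) that by (auto simp: form_set_def)
    define X where "X = (\<lambda>z. frame_map x w M (\<lambda>i. if even i then z i else 0))"
    define W where "W = (\<lambda>z. frame_map x w M (\<lambda>i. if even i then 0 else z i))"
    have comb: "scl \<tau> (X z) + scl \<rho> (W z) = frame_map x w M (\<lambda>i. if even i then \<tau> * z i else \<rho> * z i)" for \<tau> \<rho> z
    proof (rule ext)
      fix i
      have *: "frame_map x w M s i = (\<Sum>j<M. s (2 * j) * x j i + s (2 * j + 1) * w j i)" for s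
        unfolding frame_map_def sum_apply plus_fun_apply scl_apply ..
      show "(scl \<tau> (X z) + scl \<rho> (W z)) i = frame_map x w M (\<lambda>i. if even i then \<tau> * z i else \<rho> * z i) i"
        unfolding plus_fun_apply scl_apply X_def W_def * by (simp add: sum_distrib_left sum.distrib mult.assoc)
    qed
    have lF: "linmap n (2 * M) (frame_map x w M)" by (rule linmap_frame_map) simp
    have lX: "linmap n (2 * M) X" and lW: "linmap n (2 * M) W"
    proof -
      have le: "linmap (2 * M) (2 * M) (\<lambda>(z :: nat \<Rightarrow> 'k) i. if even i then z i else 0)"
        unfolding linmap_def form_def
      proof (intro allI impI conjI)
        fix i assume "i < 2 * M"
        then show "polyf (2 * M) (\<lambda>z :: nat \<Rightarrow> 'k. if even i then z i else 0)" by (cases "even i") (simp_all add: polyf_var polyf_const)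
      qed simp
      have lo: "linmap (2 * M) (2 * M) (\<lambda>(z :: nat \<Rightarrow> 'k) i. if even i then 0 else z i)"
        unfolding linmap_def form_def
      proof (intro allI impI conjI)
        fix i assume "i < 2 * M"
        then show "polyf (2 * M) (\<lambda>z :: nat \<Rightarrow> 'k. if even i then 0 else z i)" by (cases "even i") (simp_all add: polyf_var polyf_const)
      qed simp
      show "linmap n (2 * M) X" unfolding linmap_def X_def
      proof (intro allI impI)
        fix i assume "i < n"
        then have "form (2 * M) 1 (\<lambda>z. frame_map x w M z i)" using lF by (simp only: linmap_def)
        from linmap_form[OF le this] show "form (2 * M) 1 (\<lambda>z. frame_map x w M (\<lambda>i. if even i then z i else 0) i)" .
      qed
      show "linmap n (2 * M) W" unfolding linmap_def W_def
      proof (intro allI impI)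
        fix i assume "i < n"
        then have "form (2 * M) 1 (\<lambda>z. frame_map x w M z i)" using lF by (simp only: linmap_def)
        from linmap_form[OF lo this] show "form (2 * M) 1 (\<lambda>z. frame_map x w M (\<lambda>i. if even i then 0 else z i) i)" .
      qed
    qed
    define h where "h = (\<lambda>z :: nat \<Rightarrow> 'k. \<Sum>c<M. z (2 * c) ^ (d - 1) * z (2 * c + 1))"
    define P where "P = (\<lambda>(y :: 'k dform) (z :: nat \<Rightarrow> 'k). if fst y = d then (\<Sum>c<M. z (2 * c) ^ d * snd y (x c)) else 0)"
    have val: "snd y (scl \<tau> (X z) + scl \<rho> (W z)) = \<tau> ^ d * P y z + (if y = f1 then \<tau> ^ (d - 1) * \<rho> * h z else 0)" if "y \<in> S" for y \<tau> \<rho> z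
      unfolding comb frame_value[OF a(5,1,3,4) that]
      by (simp add: P_def h_def power_mult_distrib sum_distrib_left ac_simps)
    have hh: "form (2 * M) d h" unfolding form_def
    proof (intro conjI allI)
      show "polyf (2 * M) h" unfolding h_def by (intro polyf_sum polyf_mult polyf_pow polyf_var) simp_all
      fix c :: 'k and z :: "nat \<Rightarrow> 'k"
      have cd: "c ^ d = c ^ (d - 1) * c" using assms(2) by (cases d) simp_all
      show "h (scl c z) = c ^ d * h z" unfolding h_def sum_distrib_left
        by (rule sum.cong[OF refl]) (simp only: scl_apply power_mult_distrib cd ac_simps)
    qed
    have nl: "\<not> low (2 * M) B d h"
    proof (rule HS[of "(\<lambda>c. 2 * c) ` {..<M}" "2 * M" 1 h Suc])
      show "(\<lambda>c. 2 * c) ` {..<M} \<subseteq> {..<2 * M}" by auto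
      have "inj_on (\<lambda>c :: nat. 2 * c) {..<M}" by (auto simp: inj_on_def)
      then show "M0 < card ((\<lambda>c. 2 * c) ` {..<M})" by (simp add: card_image M_def)
      show "(1::'k) \<noteq> 0" by simp
      fix i z t assume "i \<in> (\<lambda>c. 2 * c) ` {..<M}"
      then obtain c0 where c0: "c0 < M" "i = 2 * c0" by auto
      have "h (z + scl t (unit_vec (Suc i))) = (\<Sum>c<M. z (2 * c) ^ (d - 1) * z (2 * c + 1) + (if c = c0 then t * z (2 * c) ^ (d - 1) else 0))"
        unfolding h_def
      proof (rule sum.cong[OF refl])
        fix c
        have "2 * c \<noteq> Suc i" "2 * c + 1 = Suc i \<longleftrightarrow> c = c0" unfolding c0(2) by presburger+
        then show "(z + scl t (unit_vec (Suc i))) (2 * c) ^ (d - 1) * (z + scl t (unit_vec (Suc i))) (2 * c + 1) =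
          z (2 * c) ^ (d - 1) * z (2 * c + 1) + (if c = c0 then t * z (2 * c) ^ (d - 1) else 0)"
          by (simp add: unit_vec_def algebra_simps)
      qed
      also have "\<dots> = h z + t * (1 * z i ^ (d - 1))" unfolding sum.distrib h_def using c0 by simp
      finally show "h (z + scl t (unit_vec (Suc i))) = h z + t * (1 * z i ^ (d - 1))" .
    qed
    define Kc where "Kc = (\<lambda>(y :: 'k dform) a j z. hder (W z) j (hder v0 a (snd y)) (X z))"
    \<comment> \<open>The mixed terms to be removed: all of them for members of degree below
      \<open>d\<close>, those containing \<open>\<rho>\<close> for members of degree
      \<open>d\<close>, except that for \<open>f1\<close> terms linear in \<open>\<rho>\<close> may
      stay and become part of the slope.\<close>
    define I where "I = {(y, a, j). y \<in> S \<and> 1 \<le> a \<and> a < fst y \<and> j \<le> d \<and> (y = f1 \<longrightarrow> 2 \<le> j) \<and> (fst y = d \<longrightarrow> 1 \<le> j)}"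
    define \<Phi> where "\<Phi> = (\<lambda>(y, a, j). (fst y - a, Kc y a j)) ` I"
    have Isub: "I \<subseteq> S \<times> {1..<d+1} \<times> {..d}" using hS by (force simp: I_def)
    have finI: "finite I" by (rule finite_subset[OF Isub]) (use finS in auto)
    have "card \<Phi> \<le> card I" unfolding \<Phi>_def by (rule card_image_le[OF finI])
    also have "\<dots> \<le> card (S \<times> {1..<d+1} \<times> {..d})" by (rule card_mono[OF _ Isub]) (use finS in auto)
    also have "\<dots> = card S * (d * (d + 1))" by (simp add: card_cartesian_product)
    also have "\<dots> \<le> N'" unfolding N'_def by (rule mult_le_mono1[OF a(2)])
    finally have c\<Phi>: "card \<Phi> \<le> N'" .
    have hv: "form n (fst y - a) (hder v0 a (snd y))" if "y \<in> S" "a \<le> fst y" for y a by (rule hder_form(1)[OF hS(3)[OF that(1)] that(2)])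
    have w\<Phi>: "form_set (2 * M) (d - 1) \<Phi>" unfolding form_set_def
    proof (intro conjI ballI)
      show "finite \<Phi>" unfolding \<Phi>_def using finI by simp
      fix q assume "q \<in> \<Phi>"
      then obtain y a j where q: "y \<in> S" "1 \<le> a" "a < fst y" "q = (fst y - a, Kc y a j)" by (auto simp: \<Phi>_def I_def)
      have "form (2 * M) (fst y - a) (Kc y a j)" unfolding Kc_def by (rule form_bi[OF lX lW hv]) (use q in auto)
      then show "1 \<le> fst q" "fst q \<le> d - 1" "form (2 * M) (fst q) (snd q)" using q hS(2)[OF q(1)] by auto
    qed
    obtain z where z: "\<forall>\<phi>\<in>\<Phi>. snd \<phi> z = 0" "h z \<noteq> 0" using nonvanishing_point[OF w\<Phi> c\<Phi> _ hh nl] assms(2) by auto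
    have K0: "Kc y a j z = 0" if "(y, a, j) \<in> I" for y a j
    proof -
      have "(fst y - a, Kc y a j) \<in> \<Phi>" unfolding \<Phi>_def by (rule image_eqI[OF _ that]) simp
      then show ?thesis using z(1) by fastforce
    qed
    have exp: "snd y (v0 + (scl \<tau> (X z) + scl \<rho> (W z))) = snd y (scl \<tau> (X z) + scl \<rho> (W z)) + snd y v0 +
      (\<Sum>a\<in>{1..<fst y}. \<Sum>j\<le>fst y - a. \<tau> ^ (fst y - a - j) * \<rho> ^ j * Kc y a j z)" if y: "y \<in> S" for y \<tau> \<rho>
    proof -
      define e where "e = fst y"
      have e1: "1 \<le> e" and he: "form n e (snd y)" using hS[OF y] by (auto simp: e_def)
      have top: "hder v0 e (snd y) \<zeta> = snd y v0" for \<zeta>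
      proof -
        have h0: "form n 0 (hder v0 e (snd y))" using hv[OF y, of e] by (simp add: e_def)
        have "snd y (v0 + 0) = (\<Sum>a\<le>e. hder v0 a (snd y) 0)" by (rule hder_shift[OF he])
        also have "\<dots> = (\<Sum>a\<in>{e}. hder v0 a (snd y) 0)"
        proof (rule sum.mono_neutral_right)
          show "\<forall>i\<in>{..e} - {e}. hder v0 i (snd y) 0 = 0"
          proof
            fix i assume "i \<in> {..e} - {e}"
            then have "form n (e - i) (hder v0 i (snd y))" "e - i > 0" using hv[OF y, of i] by (auto simp: e_def)
            then show "hder v0 i (snd y) 0 = 0" by (rule form_at_0)
          qed
        qed auto
        finally have "hder v0 e (snd y) 0 = snd y v0" by (simp only: add_0_right sum.insert sum.empty finite.emptyI empty_iff simp_thms)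
        then show ?thesis using form_deg0[OF h0, of \<zeta>] by simp
      qed
      let ?\<zeta> = "scl \<tau> (X z) + scl \<rho> (W z)"
      have "snd y (v0 + ?\<zeta>) = (\<Sum>a\<le>e. hder v0 a (snd y) ?\<zeta>)" by (rule hder_shift[OF he])
      also have "{..e} = insert 0 (insert e {1..<e})" using e1 by auto
      also have "(\<Sum>a\<in>insert 0 (insert e {1..<e}). hder v0 a (snd y) ?\<zeta>) = snd y ?\<zeta> + (snd y v0 + (\<Sum>a\<in>{1..<e}. hder v0 a (snd y) ?\<zeta>))"
        using e1 by (subst sum.insert, simp, simp, subst sum.insert) (simp_all only: top hder_0[OF form_polyf[OF he]] finite_atLeastLessThan atLeastLessThan_iff less_irrefl simp_thms not_False_eq_True)
      also have "(\<Sum>a\<in>{1..<e}. hder v0 a (snd y) ?\<zeta>) = (\<Sum>a\<in>{1..<e}. \<Sum>j\<le>e - a. \<tau> ^ (e - a - j) * \<rho> ^ j * Kc y a j z)"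
      proof (rule sum.cong[OF refl])
        fix a assume "a \<in> {1..<e}"
        then have "form n (e - a) (hder v0 a (snd y))" using hv[OF y, of a] by (simp add: e_def)
        from hder_biexp[OF this] show "hder v0 a (snd y) ?\<zeta> = (\<Sum>j\<le>e - a. \<tau> ^ (e - a - j) * \<rho> ^ j * Kc y a j z)" unfolding Kc_def .
      qed
      finally show ?thesis by (simp only: e_def add.assoc)
    qed
    \<comment> \<open>The mixed terms contribute to the slope only powers of \<open>\<tau>\<close>
      below \<open>d - 1\<close>, so \<open>h z\<close> is its coefficient in degree
      \<open>d - 1\<close>.\<close>
    define pH where "pH = monom (h z) (d - 1) + (\<Sum>a\<in>{1..<d}. monom (Kc f1 a 1 z) (d - a - 1))"
    have inner: "(\<Sum>j\<le>e - a. \<tau> ^ (e - a - j) * \<rho> ^ j * Kc y a j z) = \<tau> ^ (e - a) * Kc y a 0 z + (if y = f1 then \<tau> ^ (e - a - 1) * \<rho> * Kc y a 1 z else 0)"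
      if y: "y \<in> S" "e = fst y" "1 \<le> a" "a < e" for y a e \<tau> \<rho>
    proof -
      have ed: "e \<le> d" using hS(2)[OF y(1)] y(2) by simp
      have "(\<Sum>j\<le>e - a. \<tau> ^ (e - a - j) * \<rho> ^ j * Kc y a j z) = (\<Sum>j\<in>{0,1}. \<tau> ^ (e - a - j) * \<rho> ^ j * Kc y a j z)"
      proof (rule sum.mono_neutral_right)
        show "{0, 1} \<subseteq> {..e - a}" using y by auto
        show "\<forall>j\<in>{..e - a} - {0, 1}. \<tau> ^ (e - a - j) * \<rho> ^ j * Kc y a j z = 0"
        proof
          fix j assume j: "j \<in> {..e - a} - {0, 1}"
          have "(y, a, j) \<in> I" unfolding I_def using y j ed by auto
          from K0[OF this] show "\<tau> ^ (e - a - j) * \<rho> ^ j * Kc y a j z = 0" by simp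
        qed
      qed simp
      also have "\<dots> = \<tau> ^ (e - a) * Kc y a 0 z + \<tau> ^ (e - a - 1) * \<rho> * Kc y a 1 z" by simp
      finally have eq: "(\<Sum>j\<le>e - a. \<tau> ^ (e - a - j) * \<rho> ^ j * Kc y a j z) = \<tau> ^ (e - a) * Kc y a 0 z + \<tau> ^ (e - a - 1) * \<rho> * Kc y a 1 z" .
      show ?thesis
      proof (cases "y = f1")
        case True
        then show ?thesis using eq by simp
      next
        case False
        have "(y, a, 1) \<in> I" unfolding I_def using y False ed assms(2) by auto
        from K0[OF this] show ?thesis using eq False by simp
      qed
    qed
    have main: "snd y (v0 + (scl \<tau> (X z) + scl \<rho> (W z))) = snd y (v0 + (scl \<tau> (X z) + scl 0 (W z))) + (if y = f1 then \<rho> * poly pH \<tau> else 0)"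
      if y: "y \<in> S" for y \<tau> \<rho>
    proof -
      define A where "A = (\<lambda>\<rho>. \<Sum>a\<in>{1..<fst y}. \<Sum>j\<le>fst y - a. \<tau> ^ (fst y - a - j) * \<rho> ^ j * Kc y a j z)"
      have A: "A \<rho> = (\<Sum>a\<in>{1..<fst y}. \<tau> ^ (fst y - a) * Kc y a 0 z) + (if y = f1 then \<rho> * (\<Sum>a\<in>{1..<d}. Kc f1 a 1 z * \<tau> ^ (d - a - 1)) else 0)" for \<rho>
      proof -
        have "A \<rho> = (\<Sum>a\<in>{1..<fst y}. \<tau> ^ (fst y - a) * Kc y a 0 z + (if y = f1 then \<tau> ^ (fst y - a - 1) * \<rho> * Kc y a 1 z else 0))"
          unfolding A_def by (rule sum.cong[OF refl]) (rule inner[OF y refl], auto)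
        then show ?thesis using a(4) by (cases "y = f1") (simp_all add: sum.distrib sum_distrib_left ac_simps)
      qed
      have Av: "(\<Sum>a\<in>{1..<fst y}. \<Sum>j\<le>fst y - a. \<tau> ^ (fst y - a - j) * \<rho> ^ j * Kc y a j z) = A \<rho>" for \<rho> by (simp only: A_def)
      show ?thesis unfolding exp[OF y] val[OF y] Av A
        by (cases "y = f1") (simp_all add: pH_def poly_monom poly_sum algebra_simps)
    qed
    have lowv: "snd y (v0 + (scl \<tau> (X z) + scl 0 (W z))) = snd y v0" if y: "y \<in> S" "fst y < d" for y \<tau>
    proof -
      have "y \<noteq> f1" using y a(4) by auto
      have "(\<Sum>a\<in>{1..<fst y}. \<Sum>j\<le>fst y - a. \<tau> ^ (fst y - a - j) * 0 ^ j * Kc y a j z) = 0"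
      proof (intro sum.neutral ballI)
        fix a j assume aj: "a \<in> {1..<fst y}" "j \<in> {..fst y - a}"
        have "(y, a, j) \<in> I" unfolding I_def using y aj \<open>y \<noteq> f1\<close> by auto
        from K0[OF this] show "\<tau> ^ (fst y - a - j) * 0 ^ j * Kc y a j z = 0" by simp
      qed
      then show ?thesis unfolding exp[OF y(1)] val[OF y(1)] using y(2) \<open>y \<noteq> f1\<close> by (simp add: P_def)
    qed
    have "coeff pH (d - 1) = h z + (\<Sum>a\<in>{1..<d}. if d - a - 1 = d - 1 then Kc f1 a 1 z else 0)" by (simp only: pH_def coeff_sum coeff_add coeff_monom refl if_True)
    also have "(\<Sum>a\<in>{1..<d}. if d - a - 1 = d - 1 then Kc f1 a 1 z else 0) = 0" by (rule sum.neutral) auto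
    finally have "coeff pH (d - 1) \<noteq> 0" using z(2) by simp
    then have "pH \<noteq> 0" by auto
    moreover have "W z \<in> fs.span (w ` {..<M})"
    proof -
      have "W z = (\<Sum>i<M. scl (z (2 * i + 1)) (w i))" unfolding W_def frame_map_def
        by (rule sum.cong[OF refl]) (rule ext, simp)
      also have "\<dots> \<in> fs.span (w ` {..<M})" by (rule fs.span_sum, rule fs.span_scale, rule fs.span_base, rule imageI)
      finally show ?thesis .
    qed
    ultimately show "\<exists>x' w' pH. w' \<in> fs.span (w ` {..<M}) \<and> pH \<noteq> (0 :: 'k poly) \<and>
      (\<forall>y\<in>S. \<forall>\<tau> \<rho>. snd y (v0 + (scl \<tau> x' + scl \<rho> w')) = snd y (v0 + (scl \<tau> x' + scl 0 w')) + (if y = f1 then \<rho> * poly pH \<tau> else 0)) \<and>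
      (\<forall>y\<in>S. fst y < d \<longrightarrow> (\<forall>\<tau>. snd y (v0 + (scl \<tau> x' + scl 0 w')) = snd y v0))"
      using main lowv by (intro exI[of _ "X z"] exI[of _ "W z"] exI[of _ pH] conjI ballI allI impI) assumption+
  qed
qed

section \<open>Solving for the last form of top degree\<close>

lemma hder_at_shift: assumes "polyf n (a :: _ \<Rightarrow> 'k)"
  shows "\<exists>D h. (\<forall>j. polyf n (h j)) \<and> (\<forall>v t. a (v + scl t w) = a v + t * (\<Sum>j<D. t ^ j * h j v))"
proof -
  obtain D where D: "\<And>v t. a (v + scl t w) = (\<Sum>j\<le>D. hder w j a v * t ^ j)" using hder_expand0[OF assms, of w] by blast
  have "a (v + scl t w) = a v + t * (\<Sum>j<D. t ^ j * hder w (Suc j) a v)" for v t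
    unfolding D sum.atMost_shift using hder_0[OF assms, of w] by (simp add: sum_distrib_left ac_simps)
  then show ?thesis using polyf_hder[OF assms] by (intro exI[of _ D] exI[of _ "\<lambda>j. hder w (Suc j) a"]) blast
qed

text \<open>Moving a point of the fibre along \<open>w\<close> until the last equation holds.\<close>

lemma solve_last:
  assumes fin: "finite G" and f1: "f1 \<in> G" and pg: "\<And>g. g \<in> G \<Longrightarrow> polyf n (snd g)" and a: "polyf n a" "a \<notin> ideal n G (fibre_eq x)" and \<eta>: "\<eta> \<noteq> (0::'k)"
  shows "\<exists>a'. polyf n a' \<and> a' \<notin> ideal n (G - {f1}) (fibre_eq x) \<and> (\<forall>v. a' v = a (v + scl ((x f1 - snd f1 v) / \<eta>) w))"
proof -
  obtain D h where h: "\<And>j. polyf n (h j)" "\<And>v t. a (v + scl t w) = a v + t * (\<Sum>j<D. t ^ j * h j v)" using hder_at_shift[OF a(1), of w] by blast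
  define \<theta> where "\<theta> = (\<lambda>v. (x f1 - snd f1 v) * inverse \<eta>)"
  have p\<theta>: "polyf n \<theta>" unfolding \<theta>_def by (intro polyf_mult polyf_minus polyf_const pg f1)
  define r where "r = (\<lambda>v. inverse \<eta> * (\<Sum>j<D. \<theta> v ^ j * h j v))"
  have pr: "polyf n r" unfolding r_def by (intro polyf_mult polyf_const polyf_sum polyf_pow p\<theta> h(1))
  define a' where "a' = (\<lambda>v. a (v + scl (\<theta> v) w))"
  have a': "a' v = a v + \<theta> v * (\<Sum>j<D. \<theta> v ^ j * h j v)" for v unfolding a'_def by (rule h(2))
  have pa': "polyf n a'"
  proof -
    have "a' = (\<lambda>v. a v + \<theta> v * (\<Sum>j<D. \<theta> v ^ j * h j v))" using a' by blast
    moreover have "polyf n (\<lambda>v. a v + \<theta> v * (\<Sum>j<D. \<theta> v ^ j * h j v))" by (intro polyf_add a(1) polyf_mult p\<theta> polyf_sum polyf_pow h(1))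
    ultimately show ?thesis by simp
  qed
  have "a' \<notin> ideal n (G - {f1}) (fibre_eq x)"
  proof
    assume "a' \<in> ideal n (G - {f1}) (fibre_eq x)"
    then have "a' \<in> ideal n G (fibre_eq x)" using ideal_mono[of G "G - {f1}" n "fibre_eq x"] fin by blast
    moreover have "r * fibre_eq x f1 \<in> ideal n G (fibre_eq x)" by (rule ideal_mult[OF pr ideal_fibre_eq[OF fin f1]])
    ultimately have "a' + r * fibre_eq x f1 \<in> ideal n G (fibre_eq x)" by (rule ideal_add)
    moreover have "a' + r * fibre_eq x f1 = a"
    proof (rule ext)
      fix v
      show "(a' + r * fibre_eq x f1) v = a v" using a'[of v] by (simp add: r_def fibre_eq_def \<theta>_def algebra_simps)
    qed
    ultimately show False using a(2) by simp
  qed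
  moreover have "a' v = a (v + scl ((x f1 - snd f1 v) / \<eta>) w)" for v by (simp only: a'_def \<theta>_def divide_inverse)
  ultimately show ?thesis using pa' by blast
qed

text \<open>Induction on the number of members of degree \<open>d\<close>. Removing
  \<open>f1\<close> from the enlarged tuple \<open>G\<close> leaves fewer of them, so the fibres of
  \<open>G - {f1}\<close> are under control; it remains to correct the value of \<open>f1\<close> at
  a point \<open>v\<close> of such a fibre. The direction \<open>w'\<close> is found at another
  point, before \<open>v\<close> is known. All members of \<open>G\<close> of degree below
  \<open>d\<close> agree at the two points, and they determine the increments along the span of the
  frame vectors; so at \<open>v\<close> too the shift along \<open>w'\<close> changes
  \<open>f1\<close> with nonzero slope and leaves the rest of \<open>S\<close> fixed.\<close>

lemma dense_fibres_step:
  assumes d1: "1 \<le> d" and dense_fibres: "\<And>e. e < d \<Longrightarrow> dense_fibres e" and strong_deriv: "\<And>e. 1 \<le> e \<Longrightarrow> e \<le> d \<Longrightarrow> strong_deriv e"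
    and diag: "\<And>e. 1 \<le> e \<Longrightarrow> \<exists>N. diag_solv e N"
  shows "dense_fibres d"
proof -
  have TT1: "dense_fibres (d - 1)" using dense_fibres d1 by simp
  define TQ where "TQ = (\<lambda>r N K. \<forall>n S (c :: _ \<Rightarrow> 'k). card S \<le> N \<longrightarrow> form_set n d S \<longrightarrow> card {x\<in>S. fst x = d} \<le> r \<longrightarrow> strong n K S \<longrightarrow> dense_prime n S (fibre_eq c))"
  have "\<exists>C. \<forall>N. TQ r N (C N)" for r
  proof (induction r)
    case 0
    obtain C where C: "\<And>N n S (c :: _ \<Rightarrow> 'k). card S \<le> N \<Longrightarrow> form_set n (d - 1) S \<Longrightarrow> strong n (C N) S \<Longrightarrow> dense_prime n S (fibre_eq c)"
      using TT1 unfolding dense_fibres_def by blast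
    show ?case
    proof (rule exI[of _ C], rule allI, unfold TQ_def, intro allI impI)
      fix N n and S :: "'k dform set" and c :: "_ \<Rightarrow> 'k"
      assume a: "card S \<le> N" "form_set n d S" "card {x\<in>S. fst x = d} \<le> 0" "strong n (C N) S"
      have "finite {x\<in>S. fst x = d}" using a(2) by (simp add: form_set_def)
      then have e: "{x\<in>S. fst x = d} = {}" using a(3) by simp
      have "form_set n (d - 1) S" unfolding form_set_def
      proof (intro conjI ballI)
        show "finite S" using a(2) by (simp add: form_set_def)
        fix x assume x: "x \<in> S"
        then have "fst x \<noteq> d" using e by blast
        moreover have "1 \<le> fst x" "fst x \<le> d" "form n (fst x) (snd x)" using a(2) x by (auto simp: form_set_def)
        ultimately show "1 \<le> fst x" "fst x \<le> d - 1" "form n (fst x) (snd x)" by auto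
      qed
      then show "dense_prime n S (fibre_eq c)" using C a(1,4) by blast
    qed
  next
    case (Suc r)
    then obtain C where "\<And>N. TQ r N (C N)" by blast
    note C = this[unfolded TQ_def, rule_format]
    have "\<exists>K. TQ (Suc r) N K" for N
    proof -
      define SH where "SH = (\<lambda>M. \<forall>n S f1 x w v0. form_set n d S \<longrightarrow> card S \<le> N \<longrightarrow> f1 \<in> S \<longrightarrow> fst f1 = d \<longrightarrow> frame S (\<lambda>_. f1) M x w \<longrightarrow>
    (\<exists>x' w' pH. w' \<in> fs.span (w ` {..<M}) \<and> pH \<noteq> (0 :: 'k poly) \<and>
      (\<forall>y\<in>S. \<forall>\<tau> \<rho>. snd y (v0 + (scl \<tau> x' + scl \<rho> w')) = snd y (v0 + (scl \<tau> x' + scl 0 w')) + (if y = f1 then \<rho> * poly pH \<tau> else 0)) \<and>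
      (\<forall>y\<in>S. fst y < d \<longrightarrow> (\<forall>\<tau>. snd y (v0 + (scl \<tau> x' + scl 0 w')) = snd y v0))))"
      have "\<exists>M. SH M" unfolding SH_def by (rule shift_ex[OF TT1 d1])
      then obtain M where "SH M" by blast
      note SH = this[unfolded SH_def, rule_format]
      define FR where "FR = (\<lambda>Cf. \<forall>n S b. form_set n d S \<longrightarrow> card S \<le> N \<longrightarrow> strong n Cf S \<longrightarrow> (\<forall>i<M. b i \<in> S) \<longrightarrow> (\<exists>x w. frame S b M x w))"
      have "\<exists>Cf. FR Cf" unfolding FR_def by (rule frame_ex[OF dense_fibres strong_deriv diag])
      then obtain Cf where "FR Cf" by blast
      note FR = this[unfolded FR_def, rule_format]
      define P where "P = (\<lambda>e' B. \<forall>n U f. finite U \<longrightarrow> card U \<le> M \<longrightarrow> form n e' (f :: _ \<Rightarrow> 'k) \<longrightarrow>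
        (\<exists>\<Psi>. form_set n (e' - 1) \<Psi> \<and> card \<Psi> \<le> B \<and>
          (\<forall>u\<in>fs.span U. \<forall>v w. (\<forall>\<psi>\<in>\<Psi>. snd \<psi> v = snd \<psi> w) \<longrightarrow> f (v + u) - f v = f (w + u) - f w)))"
      have "\<exists>B. P e' B" for e' unfolding P_def by (rule polarize)
      then obtain Bp where Bp: "\<And>e'. P e' (Bp e')" by metis
      define Bm where "Bm = (\<Sum>e'\<le>d. Bp e')"
      \<comment> \<open>\<open>C m\<close> controls the fibres of tuples with fewer members of
        degree \<open>d\<close>; the summand \<open>m\<close> is for
        \<open>strong_notin\<close>.\<close>
      define Kf where "Kf = (\<lambda>m. C m + m)"
      obtain CR BR where R: "regularizes Kf (d - 1) N (N * Bm) CR BR" using regularize by blast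
      note CR = R[unfolded regularizes_def, rule_format]
      show ?thesis
      proof (rule exI[of _ "C N + Cf + CR"], unfold TQ_def, intro allI impI)
        fix n and S :: "'k dform set" and c :: "_ \<Rightarrow> 'k"
        assume a: "card S \<le> N" "form_set n d S" "card {x\<in>S. fst x = d} \<le> Suc r" "strong n (C N + Cf + CR) S"
        have st: "strong n (C N) S" "strong n Cf S" "strong n CR S" using strong_mono[OF a(4)] by auto
        have finS: "finite S" using a(2) by (simp add: form_set_def)
        have hS: "1 \<le> fst y" "fst y \<le> d" "form n (fst y) (snd y)" if "y \<in> S" for y using a(2) that by (auto simp: form_set_def)
        show "dense_prime n S (fibre_eq c)"
        proof (cases "card {x\<in>S. fst x = d} \<le> r")
          case True
          then show ?thesis using C[OF a(1,2) _ st(1)] by blast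
        next
          case False
          have "{x\<in>S. fst x = d} \<noteq> {}"
          proof
            assume e: "{x\<in>S. fst x = d} = {}"
            show False using False unfolding e by simp
          qed
          then obtain f1 where f1: "f1 \<in> S" "fst f1 = d" by blast
          obtain x w where fm: "frame S (\<lambda>_. f1) M x w" using FR[OF a(2,1) st(2), of "\<lambda>_. f1"] f1(1) by blast
          define U where "U = w ` {..<M}"
          have U: "finite U" "card U \<le> M" using card_image_le[of "{..<M}" w] by (auto simp: U_def)
          have "\<forall>y. \<exists>\<Psi>. y \<in> S \<longrightarrow> form_set n (fst y - 1) \<Psi> \<and> card \<Psi> \<le> Bp (fst y) \<and>
            (\<forall>u\<in>fs.span U. \<forall>v w. (\<forall>\<psi>\<in>\<Psi>. snd \<psi> v = snd \<psi> w) \<longrightarrow> snd y (v + u) - snd y v = snd y (w + u) - snd y w)"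
            using Bp[unfolded P_def, rule_format, OF U hS(3)] by blast
          then obtain \<Psi> where Ps: "\<And>y. y \<in> S \<Longrightarrow> form_set n (fst y - 1) (\<Psi> y)" "\<And>y. y \<in> S \<Longrightarrow> card (\<Psi> y) \<le> Bp (fst y)"
            "\<And>y u v w. y \<in> S \<Longrightarrow> u\<in>fs.span U \<Longrightarrow> (\<forall>\<psi>\<in>\<Psi> y. snd \<psi> v = snd \<psi> w) \<Longrightarrow> snd y (v + u) - snd y v = snd y (w + u) - snd y w"
            by metis
          define PS where "PS = (\<Union>y\<in>S. \<Psi> y)"
          have wPS: "form_set n (d - 1) PS"
          proof -
            have "form_set n (d - 1) (\<Psi> y)" if "y \<in> S" for y by (rule form_set_mono[OF Ps(1)[OF that]]) (use hS(2)[OF that] in simp)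
            then show ?thesis using finS unfolding PS_def form_set_def by blast
          qed
          have "card PS \<le> (\<Sum>y\<in>S. card (\<Psi> y))" unfolding PS_def by (rule card_UN_le[OF finS])
          also have "\<dots> \<le> (\<Sum>y\<in>S. Bm)"
          proof (rule sum_mono)
            fix y assume y: "y \<in> S"
            have "Bp (fst y) \<le> Bm" unfolding Bm_def using hS(2)[OF y] by (intro member_le_sum) auto
            then show "card (\<Psi> y) \<le> Bm" using Ps(2)[OF y] by simp
          qed
          also have "\<dots> \<le> N * Bm" using a(1) by simp
          finally have cPS: "card PS \<le> N * Bm" .
          obtain Q where Q: "form_set n (d - 1) Q" "strong n (Kf (card (S \<union> Q))) (S \<union> Q)" "\<And>\<psi>. \<psi> \<in> PS \<Longrightarrow> determined (d - 1) (S \<union> Q) (snd \<psi>)"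
            using CR[OF a(2,1) st(3) wPS cPS] by blast
          define G where "G = S \<union> Q"
          have wG: "form_set n d G" unfolding G_def by (rule form_set_Un[OF a(2)]) (rule form_set_mono[OF Q(1)], simp)
          have finG: "finite G" using wG by (simp add: form_set_def)
          have pG: "polyf n (snd g)" if "g \<in> G" for g using wG that form_polyf by (auto simp: form_set_def)
          have sG: "strong n (C (card G)) G" "strong n (card G) G" using strong_mono[OF Q(2)[folded G_def]] by (auto simp: Kf_def)
          have f1G: "f1 \<in> G" using f1(1) by (simp add: G_def)
          \<comment> \<open>The adjoined forms have degree below \<open>d\<close>, so without
            \<open>f1\<close> at most \<open>r\<close> members of degree \<open>d\<close> remain and
            the induction hypothesis applies to every fibre.\<close>
          have PDU: "dense_prime n V (fibre_eq y)" if V: "V \<subseteq> G - {f1}" for V and y :: "_ \<Rightarrow> 'k"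
          proof (rule C[of V "card G"])
            have VG: "V \<subseteq> G" using V by blast
            show "card V \<le> card G" by (rule card_mono[OF finG VG])
            show "form_set n d V" by (rule form_set_subset[OF wG VG])
            show "strong n (C (card G)) V" by (rule strong_subset[OF sG(1) VG finG])
            have "{x\<in>V. fst x = d} \<subseteq> {x\<in>S. fst x = d} - {f1}"
              using V Q(1) d1 by (fastforce simp: G_def form_set_def)
            then have "card {x\<in>V. fst x = d} \<le> card ({x\<in>S. fst x = d} - {f1})" by (rule card_mono[rotated]) (use finS in auto)
            also have "\<dots> \<le> r" using a(3) f1 finS by (subst card_Diff_singleton) auto
            finally show "card {x\<in>V. fst x = d} \<le> r" .
          qed
          have PD0: "dense_prime n V snd" if "V \<subseteq> G - {f1}" for V using PDU[OF that, of "\<lambda>_. 0"] by (simp only: fibre_eq_0)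
          have nin: "snd g \<notin> ideal n (G - {g}) snd" if "g \<in> G" for g by (rule strong_notin[OF wG sG(2) that order_refl])
          have TF: "hcomp D u \<in> ideal n G snd" if "u \<in> ideal n G (fibre_eq y)" "\<And>e. e > D \<Longrightarrow> hcomp e u = 0" for y u D
            by (rule top_form[OF wG PD0 nin that])
          have SG: "S \<subseteq> G" by (simp add: G_def)
          show ?thesis unfolding dense_prime_def
          proof (intro allI impI)
            fix a b :: "'k pfun" assume ab: "polyf n a" "polyf n b" "a \<notin> ideal n S (fibre_eq c)" "b \<notin> ideal n S (fibre_eq c)"
            define xv where "xv = (\<lambda>v g. if g \<in> S then c g else snd g (v :: nat \<Rightarrow> 'k))"
            \<comment> \<open>\<open>\<rho>\<close> depends only on the values of the adjoined
              forms, so its nonvanishing can be carried from one point to another with the same such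
              values.\<close>
            have gf: "\<exists>\<rho>. polyf n \<rho> \<and> \<rho> \<noteq> 0 \<and> (\<forall>v. \<rho> v \<noteq> 0 \<longrightarrow> h \<notin> ideal n G (fibre_eq (xv v))) \<and>
              (\<forall>v v'. (\<forall>g\<in>G-S. snd g v = snd g v') \<longrightarrow> \<rho> v = \<rho> v')" if h: "polyf n h" "h \<notin> ideal n S (fibre_eq c)" for h
              unfolding xv_def by (rule generic_fibre[OF wG SG _ h]) (rule TF)
            obtain \<rho> where \<rho>: "polyf n \<rho>" "\<rho> \<noteq> 0" "\<And>v. \<rho> v \<noteq> 0 \<Longrightarrow> a \<notin> ideal n G (fibre_eq (xv v))" "\<And>v v'. (\<forall>g\<in>G-S. snd g v = snd g v') \<Longrightarrow> \<rho> v = \<rho> v'"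
              using gf[OF ab(1,3)] by blast
            obtain \<rho>' where \<rho>': "polyf n \<rho>'" "\<rho>' \<noteq> 0" "\<And>v. \<rho>' v \<noteq> 0 \<Longrightarrow> b \<notin> ideal n G (fibre_eq (xv v))" "\<And>v v'. (\<forall>g\<in>G-S. snd g v = snd g v') \<Longrightarrow> \<rho>' v = \<rho>' v'"
              using gf[OF ab(2,4)] by blast
            obtain vs where vs: "\<rho> vs \<noteq> 0" "\<rho>' vs \<noteq> 0" using polyf_eq_0_near[OF \<rho>(1) \<rho>'(1) \<rho>(2) \<rho>'(2)] by blast
            \<comment> \<open>If the ideal were the unit ideal it would contain \<open>a\<close>;
              hence the fibre of \<open>G - {f1}\<close> over the values at \<open>vs\<close> has a
              rational point \<open>v0\<close>.\<close>
            have one: "1 \<notin> ideal n (G - {f1}) (fibre_eq (xv vs))"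
            proof
              assume "1 \<in> ideal n (G - {f1}) (fibre_eq (xv vs))"
              then have "1 \<in> ideal n G (fibre_eq (xv vs))" using ideal_mono[of G "G - {f1}" n "fibre_eq (xv vs)"] finG by blast
              from ideal_mult[OF ab(1) this] have "a \<in> ideal n G (fibre_eq (xv vs))" by (simp only: mult_1_right)
              then show False using \<rho>(3)[OF vs(1)] by blast
            qed
            obtain v0 where v0: "\<forall>g\<in>G-{f1}. fibre_eq (xv vs) g v0 = 0"
              using PDU[OF order_refl, of "xv vs"] polyf_1[of n] one unfolding dense_prime_def by blast
            have v0S: "snd g v0 = c g" if "g \<in> S" "g \<noteq> f1" for g using bspec[OF v0, of g] that by (simp add: fibre_eq_def xv_def G_def)
            have v0Q: "snd g v0 = snd g vs" if "g \<in> G - S" for g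
            proof -
              have "g \<noteq> f1" using that f1(1) by blast
              then show ?thesis using bspec[OF v0, of g] that by (simp add: fibre_eq_def xv_def)
            qed
            have \<rho>0: "\<rho> v0 \<noteq> 0" "\<rho>' v0 \<noteq> 0" using \<rho>(4)[of v0 vs] \<rho>'(4)[of v0 vs] v0Q vs by auto
            from SH[OF a(2,1) f1 fm, of v0] obtain x' w' pH where sh: "w' \<in> fs.span U" "pH \<noteq> 0"
              "\<forall>y\<in>S. \<forall>\<tau> \<rho>. snd y (v0 + (scl \<tau> x' + scl \<rho> w')) = snd y (v0 + (scl \<tau> x' + scl 0 w')) + (if y = f1 then \<rho> * poly pH \<tau> else 0)"
              "\<forall>y\<in>S. fst y < d \<longrightarrow> (\<forall>\<tau>. snd y (v0 + (scl \<tau> x' + scl 0 w')) = snd y v0)" unfolding U_def by blast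
            have line: "\<exists>q. q \<noteq> 0 \<and> (\<forall>t. h (v0 + scl t x') = poly q t)" if lh: "polyf n h" "h v0 \<noteq> 0" for h :: "'k pfun"
            proof -
              obtain q where q: "\<And>t. h (v0 + scl t x') = poly q t" using tpolyf_line[OF lh(1), of x'] unfolding tpolyf_def by metis
              have "v0 + scl 0 x' = v0" by (rule ext) simp
              then have "poly q 0 \<noteq> 0" using q[of 0] lh(2) by simp
              then have "q \<noteq> 0" by auto
              then show ?thesis using q by blast
            qed
            obtain q1 where q1: "q1 \<noteq> 0" "\<And>t. \<rho> (v0 + scl t x') = poly q1 t" using line[OF \<rho>(1) \<rho>0(1)] by blast
            obtain q2 where q2: "q2 \<noteq> 0" "\<And>t. \<rho>' (v0 + scl t x') = poly q2 t" using line[OF \<rho>'(1) \<rho>0(2)] by blast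
            \<comment> \<open>One parameter \<open>\<tau>\<close> has to keep \<open>\<rho>\<close>
              and \<open>\<rho>'\<close> nonzero and to make the slope of \<open>f1\<close>
              nonzero.\<close>
            have "q1 * q2 * pH \<noteq> 0" using q1(1) q2(1) sh(2) by simp
            then obtain \<tau> where "poly (q1 * q2 * pH) \<tau> \<noteq> 0" using poly_nonzero_avoid[of _ "{}"] by blast
            then have \<tau>: "poly q1 \<tau> \<noteq> 0" "poly q2 \<tau> \<noteq> 0" "poly pH \<tau> \<noteq> 0" by auto
            define v1 where "v1 = v0 + scl \<tau> x'"
            define \<eta> where "\<eta> = poly pH \<tau>"
            have e1: "v0 + (scl \<tau> x' + scl 0 w') = v1" unfolding v1_def by (rule ext) simp
            have e2: "v0 + (scl \<tau> x' + scl t w') = v1 + scl t w'" for t unfolding v1_def by (simp only: add.assoc)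
            have \<eta>: "\<eta> \<noteq> 0" using \<tau>(3) by (simp add: \<eta>_def)
            have mv: "snd y (v1 + scl t w') - snd y v1 = (if y = f1 then t * \<eta> else 0)" if "y \<in> S" for y t
              using bspec[OF sh(3) that, rule_format, of \<tau> t] unfolding e1 e2 \<eta>_def by simp
            have lowS: "snd y v1 = c y" if "y \<in> S" "fst y < d" for y
            proof -
              have "y \<noteq> f1" using that f1(2) by auto
              then show ?thesis using bspec[OF sh(4) that(1), rule_format, OF that(2), of \<tau>] v0S[OF that(1)] unfolding e1 by simp
            qed
            have na: "a \<notin> ideal n G (fibre_eq (xv v1))" by (rule \<rho>(3)) (use q1(2)[of \<tau>] \<tau>(1) in \<open>simp add: v1_def\<close>)
            have nb: "b \<notin> ideal n G (fibre_eq (xv v1))" by (rule \<rho>'(3)) (use q2(2)[of \<tau>] \<tau>(2) in \<open>simp add: v1_def\<close>)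
            obtain a' where a': "polyf n a'" "a' \<notin> ideal n (G - {f1}) (fibre_eq (xv v1))" "\<And>v. a' v = a (v + scl ((xv v1 f1 - snd f1 v) / \<eta>) w')"
              using solve_last[OF finG f1G pG ab(1) na \<eta>, of w'] by blast
            obtain b' where b': "polyf n b'" "b' \<notin> ideal n (G - {f1}) (fibre_eq (xv v1))" "\<And>v. b' v = b (v + scl ((xv v1 f1 - snd f1 v) / \<eta>) w')"
              using solve_last[OF finG f1G pG ab(2) nb \<eta>, of w'] by blast
            obtain v where v: "\<forall>g\<in>G-{f1}. fibre_eq (xv v1) g v = 0" "a' v \<noteq> 0" "b' v \<noteq> 0"
              using PDU[OF order_refl, of "xv v1"] a'(1,2) b'(1,2) unfolding dense_prime_def by blast
            have vS: "snd g v = c g" if "g \<in> S" "g \<noteq> f1" for g using bspec[OF v(1), of g] that by (simp add: fibre_eq_def xv_def G_def)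
            have vQ: "snd g v = snd g v1" if "g \<in> G - S" for g
            proof -
              have "g \<noteq> f1" using that f1(1) by blast
              then show ?thesis using bspec[OF v(1), of g] that by (simp add: fibre_eq_def xv_def)
            qed
            \<comment> \<open>The polarizing forms are determined by members of degree below
              \<open>d\<close>. Those in \<open>S\<close> take the prescribed value at both points,
              the adjoined ones have their value at \<open>v1\<close> imposed on \<open>v\<close>;
              members of \<open>S\<close> of degree \<open>d\<close> may differ.\<close>
            have agree: "snd \<psi> v = snd \<psi> v1" if "\<psi> \<in> PS" for \<psi>
            proof -
              have "snd g v = snd g v1" if g: "g \<in> S \<union> Q" "fst g \<le> d - 1" for g
              proof (cases "g \<in> S")
                case True
                have "fst g < d" using g(2) d1 by simp
                moreover have "g \<noteq> f1" using f1(2) \<open>fst g < d\<close> by auto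
                ultimately show ?thesis using vS[OF True] lowS[OF True] by simp
              next
                case False
                then show ?thesis using vQ g(1) by (simp add: G_def)
              qed
              then show ?thesis using Q(3)[OF that] unfolding determined_def by blast
            qed
            define \<theta> where "\<theta> = (xv v1 f1 - snd f1 v) / \<eta>"
            have "scl \<theta> w' \<in> fs.span U" by (rule fs.span_scale[OF sh(1)])
            \<comment> \<open>Equal polarizations give equal increments, so the increment computed
              at \<open>v1\<close> is valid at \<open>v\<close>.\<close>
            have sv: "snd y (v + scl \<theta> w') - snd y v = (if y = f1 then \<theta> * \<eta> else 0)" if y: "y \<in> S" for y
            proof -
              have "\<forall>\<psi>\<in>\<Psi> y. snd \<psi> v = snd \<psi> v1" using agree y unfolding PS_def by blast
              from Ps(3)[OF y \<open>scl \<theta> w' \<in> fs.span U\<close> this] show ?thesis unfolding mv[OF y] .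
            qed
            have "fibre_eq c g (v + scl \<theta> w') = 0" if g: "g \<in> S" for g
            proof (cases "g = f1")
              case True
              have "snd f1 (v + scl \<theta> w') = snd f1 v + \<theta> * \<eta>" using sv[OF f1(1)] by (simp add: algebra_simps)
              also have "\<dots> = c f1" using \<eta> f1(1) by (simp add: \<theta>_def xv_def)
              finally show ?thesis using True by (simp add: fibre_eq_def)
            next
              case False
              then show ?thesis using sv[OF g] vS[OF g] by (simp add: fibre_eq_def)
            qed
            then show "\<exists>z. (\<forall>i\<in>S. fibre_eq c i z = 0) \<and> a z \<noteq> 0 \<and> b z \<noteq> 0"
              using v(2,3) a'(3)[of v] b'(3)[of v] unfolding \<theta>_def by (intro exI[of _ "v + scl \<theta> w'"]) (simp add: \<theta>_def)
          qed
        qed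
      qed
    qed
    then show ?case by metis
  qed
  then obtain C where "\<And>r N. TQ r N (C r N)" by metis
  note C = this[unfolded TQ_def, rule_format]
  show ?thesis unfolding dense_fibres_def
  proof (rule exI[of _ "\<lambda>N. C N N"], intro allI impI)
    fix N n and S :: "'k dform set" and c :: "_ \<Rightarrow> 'k"
    assume a: "card S \<le> N" "form_set n d S" "strong n (C N N) S"
    have "finite S" using a(2) by (simp add: form_set_def)
    then have "card {x\<in>S. fst x = d} \<le> card S" by (intro card_mono) auto
    then show "dense_prime n S (fibre_eq c)" using C[OF a(1,2) _ a(3)] a(1) by simp
  qed
qed

text \<open>In degree \<open>d\<close> the differential is treated before the fibres:
  \<open>strong_deriv d\<close> uses both statements below \<open>d\<close> only, and
  \<open>dense_fibres d\<close> uses \<open>strong_deriv d\<close>.\<close>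

lemma dense_fibres_and_strong_deriv: assumes diag: "\<And>e. 1 \<le> e \<Longrightarrow> \<exists>N. diag_solv e N"
  shows "dense_fibres d \<and> (1 \<le> d \<longrightarrow> strong_deriv d)"
proof (induction d rule: less_induct)
  case (less d)
  show ?case
  proof (cases "d = 0")
    case True
    then show ?thesis using dense_fibres_0 by simp
  next
    case False
    then have d1: "1 \<le> d" by simp
    have dense_fibres: "dense_fibres e" if "e < d" for e using less that by blast
    have strong_deriv: "strong_deriv e" if "1 \<le> e" "e < d" for e using less that by blast
    have CDd: "strong_deriv d" by (rule strong_deriv_step[OF d1 dense_fibres strong_deriv diag])
    have CD': "strong_deriv e" if "1 \<le> e" "e \<le> d" for e using strong_deriv CDd that by (cases "e = d") auto
    show ?thesis using dense_fibres_step[OF d1 dense_fibres CD' diag] CDd by blast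
  qed
qed

end

section \<open>From polynomials to polynomial functions\<close>

definition mon_eval :: "(nat \<Rightarrow>\<^sub>0 nat) \<Rightarrow> (nat \<Rightarrow> 'k::comm_ring_1) \<Rightarrow> 'k" where
  "mon_eval m x = (\<Prod>i\<in>Poly_Mapping.keys m. x i ^ Poly_Mapping.lookup m i)"

lemma mon_eval_super: "finite A \<Longrightarrow> Poly_Mapping.keys m \<subseteq> A \<Longrightarrow> mon_eval m x = (\<Prod>i\<in>A. x i ^ Poly_Mapping.lookup m i)"
  unfolding mon_eval_def by (rule prod.mono_neutral_left) (auto simp: in_keys_iff)

lemma mon_eval_add: "mon_eval (k + l) x = mon_eval k x * mon_eval l x"
proof -
  let ?A = "Poly_Mapping.keys k \<union> Poly_Mapping.keys l"
  have "mon_eval (k + l) x = (\<Prod>i\<in>?A. x i ^ Poly_Mapping.lookup (k + l) i)" by (rule mon_eval_super) (auto simp: keys_add)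
  also have "\<dots> = (\<Prod>i\<in>?A. x i ^ Poly_Mapping.lookup k i) * (\<Prod>i\<in>?A. x i ^ Poly_Mapping.lookup l i)"
    by (simp add: lookup_add power_add prod.distrib)
  also have "\<dots> = mon_eval k x * mon_eval l x" by (subst (1 2) mon_eval_super[of ?A]) auto
  finally show ?thesis .
qed

lemma mon_eval_mult: "mon_eval m (\<lambda>i. x i * y i) = mon_eval m x * mon_eval m y"
  by (simp add: mon_eval_def power_mult_distrib prod.distrib)

lemma mon_eval_scl: "mon_eval m (scl c x) = c ^ mdeg m * mon_eval m x"
  by (simp add: mon_eval_def mdeg_def power_mult_distrib prod.distrib power_sum)

lemma eval_mpoly_mon: "eval_mpoly p x = (\<Sum>m\<in>Poly_Mapping.keys p. Poly_Mapping.lookup p m * mon_eval m x)"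
  by (simp add: eval_mpoly_def mon_eval_def)

lemma eval_0: "eval_mpoly 0 x = 0"
  by (simp add: eval_mpoly_def)

lemma eval_add: "eval_mpoly (p + q) x = eval_mpoly p x + eval_mpoly q x"
  unfolding eval_mpoly_mon
  by (rule setsum_keys_plus_distrib[where f = "\<lambda>m a. a * mon_eval m x"]) (auto simp: distrib_right)

lemma eval_sum: "eval_mpoly (\<Sum>i\<in>I. f i) x = (\<Sum>i\<in>I. eval_mpoly (f i) x)"
  by (induction I rule: infinite_finite_induct) (auto simp: eval_0 eval_add)

lemma eval_single: "eval_mpoly (Poly_Mapping.single m a) x = a * mon_eval m x"
  by (simp add: eval_mpoly_mon)

lemma mpoly_expand: "p = (\<Sum>m\<in>Poly_Mapping.keys p. Poly_Mapping.single m (Poly_Mapping.lookup p m))"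
proof (rule poly_mapping_eqI)
  fix k
  have "Poly_Mapping.lookup (\<Sum>m\<in>Poly_Mapping.keys p. Poly_Mapping.single m (Poly_Mapping.lookup p m)) k
    = (\<Sum>m\<in>Poly_Mapping.keys p. if m = k then Poly_Mapping.lookup p k else 0)"
    unfolding lookup_sum by (rule sum.cong) (auto simp: lookup_single when_def)
  also have "\<dots> = Poly_Mapping.lookup p k" by (simp add: in_keys_iff)
  finally show "Poly_Mapping.lookup p k = Poly_Mapping.lookup (\<Sum>m\<in>Poly_Mapping.keys p. Poly_Mapping.single m (Poly_Mapping.lookup p m)) k" ..
qed

lemma eval_mult: "eval_mpoly (p * q) x = eval_mpoly p x * eval_mpoly q x"
proof -
  have "p * q = (\<Sum>k\<in>Poly_Mapping.keys p. \<Sum>l\<in>Poly_Mapping.keys q. Poly_Mapping.single (k + l) (Poly_Mapping.lookup p k * Poly_Mapping.lookup q l))"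
    by (subst mpoly_expand[of p], subst mpoly_expand[of q]) (simp add: sum_product mult_single)
  then show ?thesis unfolding eval_mpoly_mon[of p] eval_mpoly_mon[of q] sum_product
    by (simp only: eval_sum eval_single mon_eval_add) (simp only: ac_simps)
qed

lemma eval_const: "eval_mpoly (const_mpoly c) x = c"
  by (simp add: const_mpoly_def eval_single mon_eval_def)

lemma vars_add: "vars_in n p \<Longrightarrow> vars_in n q \<Longrightarrow> vars_in n (p + q)"
  unfolding vars_in_def using keys_add[of p q] by blast

lemma vars_mult: "vars_in n p \<Longrightarrow> vars_in n q \<Longrightarrow> vars_in n (p * q)"
  unfolding vars_in_def
proof (intro ballI)
  fix m i assume a: "\<forall>m\<in>Poly_Mapping.keys p. \<forall>i\<in>Poly_Mapping.keys m. i < n" "\<forall>m\<in>Poly_Mapping.keys q. \<forall>i\<in>Poly_Mapping.keys m. i < n"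
    and m: "m \<in> Poly_Mapping.keys (p * q)" and i: "i \<in> Poly_Mapping.keys m"
  from m obtain k l where "k \<in> Poly_Mapping.keys p" "l \<in> Poly_Mapping.keys q" "m = k + l" using keys_mult[of p q] by blast
  then show "i < n" using i a keys_add[of k l] by blast
qed

lemma vars_const: "vars_in n (const_mpoly c)"
  by (simp add: vars_in_def const_mpoly_def)

lemma polyf_eval: "vars_in n p \<Longrightarrow> polyf n (eval_mpoly p)"
proof -
  assume "vars_in n p"
  then have "polyf n (\<lambda>x. \<Sum>m\<in>Poly_Mapping.keys p. Poly_Mapping.lookup p m * mon_eval m x)"
    unfolding mon_eval_def by (intro polyf_sum polyf_mult polyf_const polyf_prod polyf_pow polyf_var) (auto simp: vars_in_def)
  moreover have "eval_mpoly p = (\<lambda>x. \<Sum>m\<in>Poly_Mapping.keys p. Poly_Mapping.lookup p m * mon_eval m x)" by (rule ext) (rule eval_mpoly_mon)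
  ultimately show ?thesis by simp
qed

lemma form_eval: "vars_in n p \<Longrightarrow> homogeneous d p \<Longrightarrow> form n d (eval_mpoly p)"
  unfolding form_def
proof (intro conjI allI polyf_eval)
  fix c v assume h: "homogeneous d p"
  have "eval_mpoly p (scl c v) = (\<Sum>m\<in>Poly_Mapping.keys p. c ^ d * (Poly_Mapping.lookup p m * mon_eval m v))"
    unfolding eval_mpoly_mon by (rule sum.cong) (use h in \<open>auto simp: mon_eval_scl homogeneous_def\<close>)
  then show "eval_mpoly p (scl c v) = c ^ d * eval_mpoly p v" by (simp add: sum_distrib_left eval_mpoly_mon)
qed

lemma eval_ex: "polyf n f \<Longrightarrow> \<exists>p. vars_in n p \<and> eval_mpoly p = f"
proof (induction rule: polyf.induct)
  case (polyf_const c)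
  show ?case by (rule exI[of _ "const_mpoly c"]) (simp add: vars_const eval_const fun_eq_iff)
next
  case (polyf_var i)
  have "vars_in n (Poly_Mapping.single (Poly_Mapping.single i 1) 1)" using polyf_var by (simp add: vars_in_def)
  moreover have "eval_mpoly (Poly_Mapping.single (Poly_Mapping.single i 1) 1) = (\<lambda>v. v i)"
    by (rule ext) (simp add: eval_single mon_eval_def)
  ultimately show ?case by blast
next
  case (polyf_add f g)
  then obtain p q where "vars_in n p" "eval_mpoly p = f" "vars_in n q" "eval_mpoly q = g" by blast
  then show ?case by (intro exI[of _ "p + q"]) (auto simp: vars_add eval_add fun_eq_iff)
next
  case (polyf_mult f g)
  then obtain p q where "vars_in n p" "eval_mpoly p = f" "vars_in n q" "eval_mpoly q = g" by blast
  then show ?case by (intro exI[of _ "p * q"]) (auto simp: vars_mult eval_mult fun_eq_iff)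
qed

section \<open>Polynomials are determined by their values\<close>

context infinite_field
begin

lemma pow_neq: assumes "a \<noteq> b" shows "\<exists>t :: 'k. t ^ a \<noteq> t ^ b"
proof (rule ccontr)
  assume "\<nexists>t :: 'k. t ^ a \<noteq> t ^ b"
  then have "poly (monom 1 a :: 'k poly) t = poly (monom 1 b) t" for t by (simp add: poly_monom)
  then have "monom (1::'k) a = monom 1 b" by (rule poly_eq_by_values)
  then have "coeff (monom (1::'k) a) a = coeff (monom 1 b) a" by simp
  then show False using assms by simp
qed

text \<open>Monomials are pairwise distinct multiplicative characters, hence linearly independent (Dedekind).\<close>

lemma mon_eval_indep: "finite A \<Longrightarrow> (\<And>x. (\<Sum>m\<in>A. c m * mon_eval m x) = (0::'k)) \<Longrightarrow> m \<in> A \<Longrightarrow> c m = 0"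
proof (induction A arbitrary: c m rule: finite_induct)
  case (insert m0 A)
  have one: "mon_eval m (\<lambda>_. 1 :: 'k) = 1" for m by (simp add: mon_eval_def)
  have A0: "c m = 0" if m: "m \<in> A" for m
  proof -
    have "m \<noteq> m0" using m insert by blast
    then obtain i where i: "Poly_Mapping.lookup m i \<noteq> Poly_Mapping.lookup m0 i" by (metis poly_mapping_eqI)
    obtain t :: 'k where t: "t ^ Poly_Mapping.lookup m i \<noteq> t ^ Poly_Mapping.lookup m0 i" using pow_neq[OF i] by blast
    define y where "y = (\<lambda>j. if j = i then t else 1)"
    have my: "mon_eval m y = t ^ Poly_Mapping.lookup m i" for m
    proof -
      have "mon_eval m y = (\<Prod>j\<in>insert i (Poly_Mapping.keys m). y j ^ Poly_Mapping.lookup m j)" by (rule mon_eval_super) auto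
      also have "\<dots> = (\<Prod>j\<in>{i}. y j ^ Poly_Mapping.lookup m j)" by (rule prod.mono_neutral_right) (auto simp: y_def)
      finally show ?thesis by (simp add: y_def)
    qed
    have "(\<Sum>m\<in>A. (c m * (mon_eval m y - mon_eval m0 y)) * mon_eval m x) = 0" for x
    proof -
      have 1: "(\<Sum>m\<in>insert m0 A. c m * mon_eval m (\<lambda>i. y i * x i)) = 0" "(\<Sum>m\<in>insert m0 A. c m * mon_eval m x) = 0" by (rule insert.prems(1))+
      have "(\<Sum>m\<in>A. (c m * (mon_eval m y - mon_eval m0 y)) * mon_eval m x) = (\<Sum>m\<in>insert m0 A. c m * (mon_eval m y * mon_eval m x) - mon_eval m0 y * (c m * mon_eval m x))"
        unfolding sum.insert[OF insert.hyps] by (simp add: algebra_simps)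
      also have "\<dots> = (\<Sum>m\<in>insert m0 A. c m * (mon_eval m y * mon_eval m x)) - mon_eval m0 y * (\<Sum>m\<in>insert m0 A. c m * mon_eval m x)"
        unfolding sum_subtractf sum_distrib_left ..
      also have "\<dots> = 0" using 1 unfolding mon_eval_mult by (simp only: mult_zero_right diff_zero)
      finally show ?thesis .
    qed
    from insert.IH[OF this m] have "c m * (mon_eval m y - mon_eval m0 y) = 0" .
    then show ?thesis using t by (simp add: my)
  qed
  have "(\<Sum>m\<in>insert m0 A. c m * mon_eval m (\<lambda>_. 1)) = 0" by (rule insert.prems(1))
  moreover have "(\<Sum>m\<in>A. c m * mon_eval m (\<lambda>_. 1)) = 0" by (rule sum.neutral) (simp add: A0)
  ultimately have "c m0 = 0" unfolding sum.insert[OF insert.hyps] by (simp add: one)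
  then show ?case using A0 insert.prems(2) by blast
qed simp

text \<open>This justifies arguing with functions: decompositions and ideal memberships found
  pointwise lift to polynomials.\<close>

lemma eval_inj: assumes "eval_mpoly p = eval_mpoly (q :: 'k mpoly)" shows "p = q"
proof (rule poly_mapping_eqI)
  fix m
  let ?A = "Poly_Mapping.keys p \<union> Poly_Mapping.keys q"
  define c where "c = (\<lambda>m. Poly_Mapping.lookup p m - Poly_Mapping.lookup q m)"
  have e: "eval_mpoly r x = (\<Sum>m\<in>?A. Poly_Mapping.lookup r m * mon_eval m x)" if "Poly_Mapping.keys r \<subseteq> ?A" for r x
    unfolding eval_mpoly_mon by (rule sum.mono_neutral_left) (use that in \<open>auto simp: in_keys_iff\<close>)
  have "(\<Sum>m\<in>?A. c m * mon_eval m x) = 0" for x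
    using fun_cong[OF assms, of x] e[of p x] e[of q x] by (simp add: c_def left_diff_distrib sum_subtractf)
  from mon_eval_indep[OF _ this, of m] have "m \<in> ?A \<Longrightarrow> c m = 0" by simp
  then show "Poly_Mapping.lookup p m = Poly_Mapping.lookup q m" by (cases "m \<in> ?A") (auto simp: c_def in_keys_iff)
qed

text \<open>The part of degree \<open>d\<close> of any polynomial representing \<open>f\<close>
  represents the degree \<open>d\<close> component of the function, which is \<open>f\<close>
  itself.\<close>

lemma form_eval_ex: assumes "form n d f" shows "\<exists>p :: 'k mpoly. vars_in n p \<and> homogeneous d p \<and> eval_mpoly p = f"
proof -
  obtain p :: "'k mpoly" where p: "vars_in n p" "eval_mpoly p = f" using eval_ex[OF form_polyf[OF assms]] by blast
  define pd where "pd = (\<lambda>e. \<Sum>m\<in>{m\<in>Poly_Mapping.keys p. mdeg m = e}. Poly_Mapping.single m (Poly_Mapping.lookup p m))"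
  have kd: "Poly_Mapping.keys (pd d) \<subseteq> {m\<in>Poly_Mapping.keys p. mdeg m = d}"
    unfolding pd_def by (rule order.trans[OF keys_sum]) auto
  have ev: "eval_mpoly (pd e) v = (\<Sum>m\<in>{m\<in>Poly_Mapping.keys p. mdeg m = e}. Poly_Mapping.lookup p m * mon_eval m v)" for e v
    unfolding pd_def eval_sum eval_single ..
  define D where "D = (\<Sum>m\<in>Poly_Mapping.keys p. mdeg m)"
  have mD: "mdeg m \<le> D" if "m \<in> Poly_Mapping.keys p" for m unfolding D_def by (rule member_le_sum) (use that in auto)
  have "f (scl t v) = (\<Sum>e\<le>D. eval_mpoly (pd e) v * t ^ e)" for t v
  proof -
    have "f (scl t v) = (\<Sum>m\<in>Poly_Mapping.keys p. t ^ mdeg m * (Poly_Mapping.lookup p m * mon_eval m v))"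
      unfolding p(2)[symmetric] eval_mpoly_mon mon_eval_scl by (simp add: ac_simps)
    also have "\<dots> = (\<Sum>e\<le>D. \<Sum>m\<in>{m\<in>Poly_Mapping.keys p. mdeg m = e}. t ^ mdeg m * (Poly_Mapping.lookup p m * mon_eval m v))"
      by (rule sum.group[symmetric]) (use mD in auto)
    also have "\<dots> = (\<Sum>e\<le>D. eval_mpoly (pd e) v * t ^ e)"
      unfolding ev sum_distrib_right by (intro sum.cong refl) (auto simp: ac_simps)
    finally show ?thesis .
  qed
  from tcoeff_sum[OF this, of _ d] have "hcomp d f v = (if d \<le> D then eval_mpoly (pd d) v else 0)" for v unfolding hcomp_def .
  moreover have "eval_mpoly (pd d) v = 0" if "\<not> d \<le> D" for v unfolding ev by (rule sum.neutral) (use mD that in auto)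
  ultimately have "hcomp d f = eval_mpoly (pd d)" by (auto simp: fun_eq_iff)
  then have "eval_mpoly (pd d) = f" using hcomp_of_form[OF assms, of d] by simp
  moreover have "homogeneous d (pd d)" using kd by (auto simp: homogeneous_def)
  moreover have "vars_in n (pd d)" using kd p(1) by (auto simp: vars_in_def)
  ultimately show ?thesis by blast
qed

text \<open>The factors are lifted to homogeneous polynomials, and the identity of functions becomes
  one of polynomials. Positivity of \<open>a i\<close> makes both degrees smaller than
  \<open>e\<close>, as \<open>strength_decomp\<close> requires.\<close>

lemma low_strength:
  assumes "low n C e (eval_mpoly F)" shows "strength n e (F :: 'k mpoly) \<le> enat C"
proof -
  obtain s g h a where s: "s \<le> C" and
    gh: "\<And>i. i < s \<Longrightarrow> 1 \<le> a i \<and> a i < e \<and> form n (a i) (g i) \<and> form n (e - a i) (h i)" "eval_mpoly F = (\<Sum>i<(s::nat). g i * h i)"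
    using assms unfolding low_def by blast
  have "\<forall>i. \<exists>p :: 'k mpoly. i < s \<longrightarrow> vars_in n p \<and> homogeneous (a i) p \<and> eval_mpoly p = g i" using gh(1) form_eval_ex by blast
  then obtain G where G: "\<And>i. i < s \<Longrightarrow> vars_in n (G i) \<and> homogeneous (a i) (G i :: 'k mpoly) \<and> eval_mpoly (G i) = g i" by metis
  have "\<forall>i. \<exists>p :: 'k mpoly. i < s \<longrightarrow> vars_in n p \<and> homogeneous (e - a i) p \<and> eval_mpoly p = h i" using gh(1) form_eval_ex by blast
  then obtain H where H: "\<And>i. i < s \<Longrightarrow> vars_in n (H i) \<and> homogeneous (e - a i) (H i :: 'k mpoly) \<and> eval_mpoly (H i) = h i" by metis
  have "F = (\<Sum>i<s. G i * H i)"
  proof (rule eval_inj, rule ext)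
    fix x
    show "eval_mpoly F x = eval_mpoly (\<Sum>i<s. G i * H i) x"
      unfolding gh(2) eval_sum eval_mult sum_apply times_fun_apply by (rule sum.cong) (simp_all add: G H)
  qed
  moreover have "\<forall>i<s. a i < e \<and> e - a i < e \<and> homogeneous (a i) (G i) \<and> homogeneous (e - a i) (H i) \<and> vars_in n (G i) \<and> vars_in n (H i)"
  proof (intro allI impI)
    fix i assume i: "i < s"
    have "1 \<le> a i" "a i < e" using gh(1)[OF i] by auto
    then show "a i < e \<and> e - a i < e \<and> homogeneous (a i) (G i) \<and> homogeneous (e - a i) (H i) \<and> vars_in n (G i) \<and> vars_in n (H i)"
      using G[OF i] H[OF i] by simp
  qed
  ultimately have d: "strength_decomp n e F s" unfolding strength_decomp_def
    by (rule_tac exI[of _ G], rule_tac exI[of _ H], rule_tac exI[of _ a], rule_tac exI[of _ "\<lambda>i. e - a i"], intro conjI)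
  then have "strength n e F = enat (LEAST s. strength_decomp n e F s)" unfolding strength_def by (rule_tac if_P) (rule exI)
  also have "\<dots> \<le> enat s" using Least_le[of "strength_decomp n e F", OF d] by simp
  also have "\<dots> \<le> enat C" using s by simp
  finally show ?thesis .
qed

text \<open>A low combination would bound the tuple strength by \<open>C\<close>, so the evaluated
  forms are a strong family. Its zero fibre has dense rational points in the sense of ideal
  membership, which gives the radical condition with exponent 1.\<close>

lemma dense_if_strong:
  assumes dense_fibres: "dense_fibres D" and ds: "\<And>i. i < length ds \<Longrightarrow> 1 \<le> ds ! i \<and> ds ! i \<le> D"
  shows "\<exists>C::nat. \<forall>(n::nat) (fs::'k mpoly list).
           length fs = length ds \<longrightarrow>
           (\<forall>i<length ds. homogeneous (ds!i) (fs!i) \<and> vars_in n (fs!i)) \<longrightarrow>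
           tuple_strength n ds fs > enat C \<longrightarrow>
           kpoints_dense n fs"
proof -
  define Q where "Q = (\<lambda>C. \<forall>n (I :: nat set) d (g :: nat \<Rightarrow> (nat \<Rightarrow> 'k) \<Rightarrow> 'k). form_family n D I d g \<longrightarrow> card I \<le> length ds \<longrightarrow> strong_family n C I d g \<longrightarrow>
    (\<forall>J\<subseteq>I. dense_prime n J g) \<and> (\<forall>i\<in>I. g i \<notin> ideal n (I - {i}) g))"
  have "\<exists>C. Q C" unfolding Q_def by (rule dense_fibres_family[OF dense_fibres])
  then obtain C where "Q C" by blast
  note C = this[unfolded Q_def, rule_format, THEN conjunct1, rule_format]
  show ?thesis
  proof (rule exI[of _ C], intro allI impI)
    fix n and fs :: "'k mpoly list"
    assume len: "length fs = length ds" and hom: "\<forall>i<length ds. homogeneous (ds!i) (fs!i) \<and> vars_in n (fs!i)"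
      and str: "tuple_strength n ds fs > enat C"
    define I where "I = {..<length ds}"
    define g where "g = (\<lambda>i. eval_mpoly (fs ! i))"
    have F: "form_family n D I ((!) ds) g" unfolding form_family_def
    proof (intro conjI ballI)
      fix i assume "i \<in> I"
      then have i: "i < length ds" by (simp add: I_def)
      show "1 \<le> ds ! i" "ds ! i \<le> D" using ds[OF i] by auto
      show "form n (ds ! i) (g i)" unfolding g_def using hom i by (intro form_eval) auto
    qed (simp add: I_def)
    have S: "strong_family n C I ((!) ds) g" unfolding strong_family_def
    proof (intro allI impI notI)
      fix e and u :: "nat \<Rightarrow> 'k"
      assume ne: "\<exists>i\<in>I. ds ! i = e \<and> u i \<noteq> 0" and low: "low n C e (\<Sum>i\<in>{i\<in>I. ds ! i = e}. scl (u i) (g i))"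
      let ?F = "\<Sum>i\<in>{i. i < length ds \<and> ds!i = e}. const_mpoly (u i) * fs!i"
      have "(\<Sum>i\<in>{i\<in>I. ds ! i = e}. scl (u i) (g i)) = eval_mpoly ?F"
        by (rule ext) (simp add: sum_apply eval_sum eval_mult eval_const g_def I_def)
      with low have "strength n e ?F \<le> enat C" by (intro low_strength) simp
      moreover have "tuple_strength n ds fs \<le> strength n e ?F" unfolding tuple_strength_def
        by (rule Inf_lower) (use ne in \<open>auto simp: I_def\<close>)
      ultimately show False using str by (meson leD order_trans)
    qed
    have dense_prime: "dense_prime n I g" by (rule C[OF F _ S order_refl]) (simp add: I_def)
    show "kpoints_dense n fs" unfolding kpoints_dense_def
    proof (intro allI impI)
      fix h assume h: "vars_in n h" "\<forall>x\<in>kpoints n fs. eval_mpoly h x = 0"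
      have pg: "polyf n (g i)" if "i \<in> I" for i using that hom polyf_eval by (auto simp: g_def I_def)
      have "eval_mpoly h \<in> ideal n I g"
      proof (rule dense_prime_mem[OF dense_prime polyf_eval[OF h(1)]])
        fix z assume z: "\<And>i. i \<in> I \<Longrightarrow> g i z = 0"
        \<comment> \<open>Members of \<open>kpoints\<close> have zero coordinates from
          \<open>n\<close> on, whereas zeros provided by \<open>dense_prime\<close> are arbitrary
          there; truncation changes no value.\<close>
        have "trunc n z \<in> kpoints n fs" unfolding kpoints_def
        proof (intro CollectI conjI allI impI ballI)
          fix f assume "f \<in> set fs"
          then obtain i where i: "i \<in> I" "f = fs ! i" using len by (auto simp: in_set_conv_nth I_def)
          then show "eval_mpoly f (trunc n z) = 0" using trunc_polyf[OF pg[OF i(1)], of z] z by (simp add: g_def)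
        qed (simp add: trunc_def)
        then show "eval_mpoly h z = 0" using h(2) trunc_polyf[OF polyf_eval[OF h(1)], of z] by simp
      qed
      then obtain q where q: "\<And>i. i \<in> I \<Longrightarrow> polyf n (q i)" "eval_mpoly h = (\<Sum>i\<in>I. q i * g i)" unfolding ideal_def by blast
      have "\<forall>i. \<exists>p :: 'k mpoly. i \<in> I \<longrightarrow> vars_in n p \<and> eval_mpoly p = q i" using q(1) eval_ex by blast
      then obtain p :: "nat \<Rightarrow> 'k mpoly" where p: "\<And>i. i \<in> I \<Longrightarrow> vars_in n (p i) \<and> eval_mpoly (p i) = q i" by metis
      have "eval_mpoly h = eval_mpoly (\<Sum>i\<in>I. p i * fs ! i)"
      proof (rule ext)
        fix x
        have "eval_mpoly h x = (\<Sum>i\<in>I. q i x * g i x)" unfolding q(2) by (simp add: sum_apply)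
        also have "\<dots> = eval_mpoly (\<Sum>i\<in>I. p i * fs ! i) x" unfolding eval_sum eval_mult by (rule sum.cong) (use p in \<open>auto simp: g_def\<close>)
        finally show "eval_mpoly h x = eval_mpoly (\<Sum>i\<in>I. p i * fs ! i) x" .
      qed
      then have "h = (\<Sum>i\<in>I. p i * fs ! i)" by (rule eval_inj)
      then show "\<exists>m::nat. \<exists>q::nat \<Rightarrow> 'k mpoly. (\<forall>j<length fs. vars_in n (q j)) \<and> h ^ m = (\<Sum>j<length fs. q j * fs!j)"
        using p len by (intro exI[of _ 1] exI[of _ p]) (simp add: I_def)
    qed
  qed
qed

end

theorem theorem1p4:
  fixes ds :: "nat list"
  assumes "infinite (UNIV :: 'k::field set)"
    and "brauer_field TYPE('k)"
    and "multi_degree ds"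
  shows "\<exists>C::nat. \<forall>(n::nat) (fs::'k mpoly list).
           length fs = length ds \<longrightarrow>
           (\<forall>i<length ds. homogeneous (ds!i) (fs!i) \<and> vars_in n (fs!i)) \<longrightarrow>
           tuple_strength n ds fs > enat C \<longrightarrow>
           kpoints_dense n fs"
proof -
  interpret infinite_field "TYPE('k)" by unfold_locales (rule assms(1))
  have diag: "\<exists>N. diag_solv e N" if e: "1 \<le> e" for e
  proof -
    obtain N where N: "\<forall>n>N. \<forall>a::nat \<Rightarrow> 'k. \<exists>x. (\<exists>i<n. x i \<noteq> 0) \<and> (\<Sum>i<n. a i * x i ^ e) = 0"
      using assms(2)[unfolded brauer_field_def, rule_format, OF e] by blast
    \<comment> \<open>The Brauer condition holds for every number of variables above
      \<open>N\<close>; \<open>Suc N\<close> is the least of them.\<close>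
    show ?thesis unfolding diag_solv_def by (rule exI[of _ "Suc N"]) (use N in blast)
  qed
  show ?thesis
  \<comment> \<open>The sum of the degrees is a common upper bound for them.\<close>
  proof (rule dense_if_strong[OF dense_fibres_and_strong_deriv[OF diag, THEN conjunct1, of "sum_list ds"]])
    fix i assume "i < length ds"
    then have "ds ! i \<in> set ds" by simp
    then show "1 \<le> ds ! i \<and> ds ! i \<le> sum_list ds"
      using assms(3) member_le_sum_list by (auto simp: multi_degree_def)
  qed
qed

end
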